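(* Assume (A1), (A2) and (B1) (defined in the context). Then the weak solution $u^\varepsilon$ of the microscopic problem satisfies, with a constant $C>0$ independent of $\varepsilon$, $$\|u_L^\varepsilon\|_{L^\infty(0,T;L^2(\Omega_L^\varepsilon))}+\|u_R^\varepsilon\|_{L^\infty(0,T;L^2(\Omega_R^\varepsilon))}+\frac1{\sqrt\varepsilon}\|u_M^\varepsilon\|_{L^\infty(0,T;L^2(\Omega_M^\varepsilon))}\le C,$$ $$\Big\|\frac{\partial u_L^\varepsilon}{\partial t}\Big\|_{L^\infty(0,T;L^2(\Omega_L^\varepsilon))}+\Big\|\frac{\partial u_R^\varepsilon}{\partial t}\Big\|_{L^\infty(0,T;L^2(\Omega_R^\varepsilon))}+\frac1{\sqrt\varepsilon}\Big\|\frac{\partial u_M^\varepsilon}{\partial t}\Big\|_{L^\infty(0,T;L^2(\Omega_M^\varepsilon))}\le C,$$ $$\|\nabla u_L^\varepsilon\|_{L^\infty(0,T;L^2(\Omega_L^\varepsilon))}+\|\nabla u_R^\varepsilon\|_{L^\infty(0,T;L^2(\Omega_R^\varepsilon))}+\frac1{\sqrt\varepsilon}\|\nabla u_M^\varepsilon\|_{L^\infty(0,T;L^2(\Omega_M^\varepsilon))}\le C.$$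
   Context: **Geometry.** Let $\ell,h,T>0$. The parameter $\varepsilon>0$ ranges over small numbers with $h=N\varepsilon$, $N\in\mathbb N$. Put $\Omega=(-\ell,\ell)\times(0,h)$, $\Omega_L^\varepsilon=(-\ell,-\varepsilon/2)\times(0,h)$, $\Omega_M^\varepsilon=(-\varepsilon/2,\varepsilon/2)\times(0,h)$, $\Omega_R^\varepsilon=(\varepsilon/2,\ell)\times(0,h)$, $\Omega_L=(-\ell,0)\times(0,h)$, $\Sigma=\{0\}\times(0,h)$ (identified with $(0,h)$), $Y=(-\tfrac12,\tfrac12)\times(0,1)$, $\mathcal T=Z=(0,1)$. For $g$ on $\Omega$, $g_L^\varepsilon,g_M^\varepsilon,g_R^\varepsilon$ denote restrictions to $\Omega_L^\varepsilon,\Omega_M^\varepsilon,\Omega_R^\varepsilon$. $H^1_\sharp(\Omega)$: periodic $H^1$ functions on $\Omega$ (i.e. $\Omega$ identified with a torus). **(A1)** $D_L,D_R,\rho_L,\rho_R>0$ are constants; $\rho_M^\varepsilon(t,x)=\rho_M(t,x_2,\frac t\varepsilon,\frac x\varepsilon,\frac{x_2}{\varepsilon^2})$, $D_M^\varepsilon(t,x)=D_M(t,x_2,\frac t\varepsilon,\frac x\varepsilon,\frac{x_2}{\varepsilon^2})$ with scalar $\rho_M,D_M\in W^{1,\infty}((0,T)\times\Sigma\times\mathcal T\times Y\times Z)$ (variables $(t,x_2,\tau,y,z)$) periodic in $\tau,y_2,z$, and there are positive constants with $\rho_{min}\le\rho_M^\varepsilon\le\rho_{max}$, $D_{min}\le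 D_M^\varepsilon\le D_{max}$. **(A2)** $v_1\in C_c^2(\Omega_L)$, $v_2\in C_c^1(\Omega_L)$, $f_L\in C_c^2((0,T)\times\Omega_L)$, and $\varepsilon$ is so small that these are supported in $\Omega_L^\varepsilon$, resp. $(0,T)\times\Omega_L^\varepsilon$ ($v_1,v_2,f_L$ are extended by zero). **(B1)** The coefficients do not depend on the fast time variable: $\rho_M^\varepsilon(t,x)=\rho_M(t,x_2,\frac x\varepsilon,\frac{x_2}{\varepsilon^2})$ and $D_M^\varepsilon(t,x)=D_M(t,x_2,\frac x\varepsilon,\frac{x_2}{\varepsilon^2})$. **Microscopic problem.** Let $\hat\rho^\varepsilon=\rho_L,\frac1\varepsilon\rho_M^\varepsilon,\rho_R$ and $\hat D^\varepsilon=D_L,\frac1\varepsilon D_M^\varepsilon,D_R$ in $\Omega_L^\varepsilon,\Omega_M^\varepsilon,\Omega_R^\varepsilon$ respectively. The weak solution $u^\varepsilon$ is the (unique) function $u^\varepsilon\in L^2(0,T;H^1_\sharp(\Omega))$ with $\partial_tu^\varepsilon\in L^2(0,T;L^2(\Omega))$, $u^\varepsilon(0)=v_1$, and $$-\int_0^T\!\!\int_\Omega\hat\rho^\varepsilon\partial_tu^\varepsilon\partial_t\phi+\int_0^T\!\!\int_\Omega\hat D^\varepsilon\nabla u^\varepsilon\cdot\nabla\phi=\int_0^T\!\!\int_\Omega f_L\phi+\int_\Omega\rho_Lv_2\phi(0)$$ for all $\phi\in L^2(0,T;H^1_\sharp(\Omega))$ with $\partial_t\phi\in L^2(0,T;L^2(\Omega))$,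 $\phi(T)=0$. *)

theory Defs
  imports "HOL-Analysis.Analysis" "HOL-Probability.Essential_Supremum"
begin

section \<open>Classical function spaces\<close>

text \<open>\<open>Ck k S f\<close>: \<open>f\<close> is \<open>k\<close> times continuously differentiable on \<open>S\<close>. It is meant for open \<open>S\<close>.\<close>

primrec Ck :: "nat \<Rightarrow> 'a::euclidean_space set \<Rightarrow> ('a \<Rightarrow> real) \<Rightarrow> bool" where
  "Ck 0 S f \<longleftrightarrow> continuous_on S f"
| "Ck (Suc k) S f \<longleftrightarrow>
     (\<forall>x\<in>S. f differentiable (at x)) \<and>
     (\<forall>b\<in>Basis. Ck k S (\<lambda>x. frechet_derivative f (at x) b))"

definition supp :: "('a::euclidean_space \<Rightarrow> real) \<Rightarrow> 'a set" where
  "supp f = closure {x. f x \<noteq> 0}"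

text \<open>Functions on \<open>S\<close> with compact support in \<open>S\<close>, already extended by zero to the whole space
  (the support is taken in the whole space).\<close>

definition Ck_compact :: "nat \<Rightarrow> 'a::euclidean_space set \<Rightarrow> ('a \<Rightarrow> real) \<Rightarrow> bool" where
  "Ck_compact k S f \<longleftrightarrow> Ck k S f \<and> compact (supp f) \<and> supp f \<subseteq> S"

definition test_functions :: "'a::euclidean_space set \<Rightarrow> ('a \<Rightarrow> real) set" where
  "test_functions S = {\<theta>. \<forall>k. Ck_compact k S \<theta>}"


section \<open>Lebesgue and Sobolev spaces\<close>

text \<open>Elements of Lebesgue and Sobolev spaces are represented by Borel functions; every notion
  below is invariant under changing the representative on a null set. Norms take values in
  \<^typ>\<open>ennreal\<close>, so that they are infinite, not \<open>0\<close>, where the integral diverges.\<close>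

definition L2norm :: "'a::euclidean_space set \<Rightarrow> ('a \<Rightarrow> 'b::euclidean_space) \<Rightarrow> ennreal" where
  "L2norm S g =
     (let I = (\<integral>\<^sup>+x\<in>S. ennreal ((norm (g x))\<^sup>2) \<partial>lborel)
      in if I = \<infinity> then \<infinity> else ennreal (sqrt (enn2real I)))"

definition L2_on :: "'a::euclidean_space set \<Rightarrow> ('a \<Rightarrow> 'b::euclidean_space) \<Rightarrow> bool" where
  "L2_on S g \<longleftrightarrow> set_borel_measurable lborel S g \<and> L2norm S g < \<infinity>"

definition Linf_on :: "'a::euclidean_space set \<Rightarrow> ('a \<Rightarrow> real) \<Rightarrow> bool" where
  "Linf_on S g \<longleftrightarrow> set_borel_measurable lborel S g \<and> (\<exists>B. AE x\<in>S in lborel. \<bar>g x\<bar> \<le> B)"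

definition locally_integrable_on :: "'a::euclidean_space set \<Rightarrow> ('a \<Rightarrow> real) \<Rightarrow> bool" where
  "locally_integrable_on S g \<longleftrightarrow> (\<forall>K. compact K \<and> K \<subseteq> S \<longrightarrow> set_integrable lborel K g)"

text \<open>On the open set \<open>S\<close>, \<open>g\<close> is the weak partial derivative of \<open>f\<close> in the direction \<open>b\<close>.\<close>

definition has_weak_pderiv ::
    "'a::euclidean_space set \<Rightarrow> 'a \<Rightarrow> ('a \<Rightarrow> real) \<Rightarrow> ('a \<Rightarrow> real) \<Rightarrow> bool" where
  "has_weak_pderiv S b f g \<longleftrightarrow>
     locally_integrable_on S f \<and> locally_integrable_on S g \<and>
     (\<forall>\<theta>\<in>test_functions S.
        (LINT x:S|lborel. f x * frechet_derivative \<theta> (at x) b) = - (LINT x:S|lborel. g x * \<theta> x))"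

definition W1inf_on :: "'a::euclidean_space set \<Rightarrow> ('a \<Rightarrow> real) \<Rightarrow> bool" where
  "W1inf_on S f \<longleftrightarrow> Linf_on S f \<and> (\<forall>b\<in>Basis. \<exists>g. Linf_on S g \<and> has_weak_pderiv S b f g)"


section \<open>Geometry\<close>

definition Omega :: "real \<Rightarrow> real \<Rightarrow> (real \<times> real) set" where
  "Omega l h = {-l<..<l} \<times> {0<..<h}"

definition Omega_L0 :: "real \<Rightarrow> real \<Rightarrow> (real \<times> real) set" where
  "Omega_L0 l h = {-l<..<0} \<times> {0<..<h}"

definition Omega_L :: "real \<Rightarrow> real \<Rightarrow> real \<Rightarrow> (real \<times> real) set" where
  "Omega_L l h \<epsilon> = {-l<..<-\<epsilon>/2} \<times> {0<..<h}"

definition Omega_M :: "real \<Rightarrow> real \<Rightarrow> (real \<times> real) set" where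
  "Omega_M h \<epsilon> = {-\<epsilon>/2<..<\<epsilon>/2} \<times> {0<..<h}"

definition Omega_R :: "real \<Rightarrow> real \<Rightarrow> real \<Rightarrow> (real \<times> real) set" where
  "Omega_R l h \<epsilon> = {\<epsilon>/2<..<l} \<times> {0<..<h}"

text \<open>The range of the parameter \<open>\<epsilon>\<close>, with an upper bound \<open>\<epsilon>0\<close> expressing smallness. The condition
  \<open>\<epsilon> < 2 * l\<close> says that the layer lies inside \<open>Omega l h\<close>.\<close>

definition eps_range :: "real \<Rightarrow> real \<Rightarrow> real \<Rightarrow> real set" where
  "eps_range l h \<epsilon>0 = {\<epsilon>. 0 < \<epsilon> \<and> \<epsilon> \<le> \<epsilon>0 \<and> \<epsilon> < 2 * l \<and> (\<exists>N::nat. h = real N * \<epsilon>)}"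


section \<open>Periodic Sobolev functions and Bochner spaces\<close>

definition smooth_periodic :: "real \<Rightarrow> real \<Rightarrow> (real \<times> real \<Rightarrow> real) set" where
  "smooth_periodic l h =
     {\<psi>. (\<forall>k. Ck k UNIV \<psi>) \<and> (\<forall>x1 x2. \<psi> (x1 + 2 * l, x2) = \<psi> (x1, x2) \<and> \<psi> (x1, x2 + h) = \<psi> (x1, x2))}"

text \<open>\<open>g\<close> lies in the periodic space \<open>H\<^sup>1\<close> over \<open>Omega l h\<close> and has gradient \<open>G\<close>: testing against all
  smooth periodic functions makes \<open>G\<close> the weak gradient on the torus, so traces on opposite
  sides of the rectangle agree.\<close>

definition has_periodic_gradient ::
    "real \<Rightarrow> real \<Rightarrow> (real \<times> real \<Rightarrow> real) \<Rightarrow> (real \<times> real \<Rightarrow> real \<times> real) \<Rightarrow> bool" where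
  "has_periodic_gradient l h g G \<longleftrightarrow>
     L2_on (Omega l h) g \<and> L2_on (Omega l h) G \<and>
     (\<forall>\<psi>\<in>smooth_periodic l h. \<forall>b\<in>Basis.
        (LINT x:Omega l h|lborel. g x * frechet_derivative \<psi> (at x) b) =
        - (LINT x:Omega l h|lborel. (G x \<bullet> b) * \<psi> x))"

text \<open>\<open>L\<^sup>2(0,T;L\<^sup>2(S))\<close>, identified with \<open>L\<^sup>2\<close> of the space-time cylinder.\<close>

definition L2_L2 :: "real \<Rightarrow> (real \<times> real) set \<Rightarrow> (real \<Rightarrow> real \<times> real \<Rightarrow> 'b::euclidean_space) \<Rightarrow> bool" where
  "L2_L2 T S u \<longleftrightarrow> L2_on ({0<..<T} \<times> S) (\<lambda>(t, x). u t x)"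

text \<open>\<open>u \<in> L\<^sup>2(0,T;H\<^sup>1)\<close> (periodic \<open>H\<^sup>1\<close>) with spatial gradient \<open>Gu\<close>.\<close>

definition L2_H1_periodic ::
    "real \<Rightarrow> real \<Rightarrow> real \<Rightarrow> (real \<Rightarrow> real \<times> real \<Rightarrow> real) \<Rightarrow> (real \<Rightarrow> real \<times> real \<Rightarrow> real \<times> real) \<Rightarrow> bool" where
  "L2_H1_periodic l h T u Gu \<longleftrightarrow>
     L2_L2 T (Omega l h) u \<and> L2_L2 T (Omega l h) Gu \<and>
     (AE t\<in>{0<..<T} in lborel. has_periodic_gradient l h (u t) (Gu t))"

text \<open>\<open>u\<close> has the weak time derivative \<open>ut \<in> L\<^sup>2(0,T;L\<^sup>2(S))\<close>; \<open>(1, 0)\<close> is the time direction.\<close>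

definition has_time_derivative ::
    "real \<Rightarrow> (real \<times> real) set \<Rightarrow> (real \<Rightarrow> real \<times> real \<Rightarrow> real) \<Rightarrow> (real \<Rightarrow> real \<times> real \<Rightarrow> real) \<Rightarrow> bool" where
  "has_time_derivative T S u ut \<longleftrightarrow>
     L2_L2 T S ut \<and>
     has_weak_pderiv ({0<..<T} \<times> S) (1, 0) (\<lambda>(t, x). u t x) (\<lambda>(t, x). ut t x)"

text \<open>\<open>u(s) = g\<close> in \<open>L\<^sup>2(S)\<close>, where \<open>u(s)\<close> is the value at time \<open>s\<close> of the representative of \<open>u\<close>
  in \<open>C([0,T];L\<^sup>2(S))\<close>.\<close>

definition has_time_trace ::
    "real \<Rightarrow> (real \<times> real) set \<Rightarrow> (real \<Rightarrow> real \<times> real \<Rightarrow> real) \<Rightarrow> real \<Rightarrow> (real \<times> real \<Rightarrow> real) \<Rightarrow> bool" where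
  "has_time_trace T S u s g \<longleftrightarrow>
     L2_on S g \<and>
     (\<exists>v. (AE t\<in>{0<..<T} in lborel. AE x\<in>S in lborel. v t x = u t x) \<and>
          (\<forall>t\<in>{0..T}. L2_on S (v t)) \<and>
          (\<forall>t\<in>{0..T}. ((\<lambda>r. L2norm S (\<lambda>x. v r x - v t x)) \<longlongrightarrow> 0) (at t within {0..T})) \<and>
          (AE x\<in>S in lborel. v s x = g x))"

definition LinfL2norm ::
    "real \<Rightarrow> (real \<times> real) set \<Rightarrow> (real \<Rightarrow> real \<times> real \<Rightarrow> 'b::euclidean_space) \<Rightarrow> ennreal" where
  "LinfL2norm T S u = esssup (restrict_space lborel {0<..<T}) (\<lambda>t. L2norm S (u t))"


section \<open>Oscillating coefficients\<close>

text \<open>Arguments \<open>(t, x2, \<tau>, y, z)\<close>.\<close>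

type_synonym coefficient = "real \<times> real \<times> real \<times> (real \<times> real) \<times> real \<Rightarrow> real"

definition coeff_cell :: "real \<Rightarrow> real \<Rightarrow> (real \<times> real \<times> real \<times> (real \<times> real) \<times> real) set" where
  "coeff_cell h T =
     {0<..<T} \<times> {0<..<h} \<times> {0<..<1} \<times> ({-1/2<..<1/2} \<times> {0<..<1}) \<times> {0<..<1}"

text \<open>The cell extended periodically in \<open>\<tau>\<close>, \<open>y2\<close> and \<open>z\<close>.\<close>

definition coeff_domain :: "real \<Rightarrow> real \<Rightarrow> (real \<times> real \<times> real \<times> (real \<times> real) \<times> real) set" where
  "coeff_domain h T =
     {0<..<T} \<times> {0<..<h} \<times> UNIV \<times> ({-1/2<..<1/2} \<times> UNIV) \<times> UNIV"

definition coeff_periodic :: "real \<Rightarrow> real \<Rightarrow> coefficient \<Rightarrow> bool" where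
  "coeff_periodic h T c \<longleftrightarrow>
     (\<forall>t x2 \<tau> y1 y2 z. (t, x2, \<tau>, (y1, y2), z) \<in> coeff_domain h T \<longrightarrow>
        c (t, x2, \<tau> + 1, (y1, y2), z) = c (t, x2, \<tau>, (y1, y2), z) \<and>
        c (t, x2, \<tau>, (y1, y2 + 1), z) = c (t, x2, \<tau>, (y1, y2), z) \<and>
        c (t, x2, \<tau>, (y1, y2), z + 1) = c (t, x2, \<tau>, (y1, y2), z))"

text \<open>Composing with \<open>(t, x) \<mapsto> (t, x2, t/\<epsilon>, x/\<epsilon>, x2/\<epsilon>\<^sup>2)\<close> evaluates the coefficient on a null set.
  Hence \<open>c\<close> is taken to be the continuous representative of its \<open>W\<^sup>1\<^sup>,\<^sup>\<infinity>\<close> class.\<close>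

definition W1inf_periodic_coeff :: "real \<Rightarrow> real \<Rightarrow> coefficient \<Rightarrow> bool" where
  "W1inf_periodic_coeff h T c \<longleftrightarrow>
     W1inf_on (coeff_cell h T) c \<and> coeff_periodic h T c \<and> continuous_on (coeff_domain h T) c"

definition osc :: "real \<Rightarrow> coefficient \<Rightarrow> real \<Rightarrow> real \<times> real \<Rightarrow> real" where
  "osc \<epsilon> c t x = c (t, snd x, t / \<epsilon>, x /\<^sub>R \<epsilon>, snd x / \<epsilon>\<^sup>2)"

text \<open>The two interfaces are a null set. They are assigned to the outer parts because \<open>cM\<close> is only
  controlled (hence only measurable) on \<^const>\<open>coeff_domain\<close>, where \<open>y1\<close> is in the open interval.\<close>

definition micro_coeff ::
    "real \<Rightarrow> real \<Rightarrow> coefficient \<Rightarrow> real \<Rightarrow> real \<Rightarrow> real \<times> real \<Rightarrow> real" where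
  "micro_coeff \<epsilon> cL cM cR t x =
     (if fst x \<le> - \<epsilon> / 2 then cL else if fst x < \<epsilon> / 2 then osc \<epsilon> cM t x / \<epsilon> else cR)"


section \<open>Assumptions and the microscopic problem\<close>

definition uniformly_bounded_coeff :: "real \<Rightarrow> real \<Rightarrow> real \<Rightarrow> real \<Rightarrow> coefficient \<Rightarrow> bool" where
  "uniformly_bounded_coeff l h T \<epsilon>0 c \<longleftrightarrow>
     (\<exists>cmin cmax. 0 < cmin \<and> 0 < cmax \<and>
        (\<forall>\<epsilon>\<in>eps_range l h \<epsilon>0. \<forall>t\<in>{0<..<T}. \<forall>x\<in>Omega_M h \<epsilon>. cmin \<le> osc \<epsilon> c t x \<and> osc \<epsilon> c t x \<le> cmax))"

definition assumption_A1 ::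
    "real \<Rightarrow> real \<Rightarrow> real \<Rightarrow> real \<Rightarrow> real \<Rightarrow> real \<Rightarrow> real \<Rightarrow> real \<Rightarrow> coefficient \<Rightarrow> coefficient \<Rightarrow> bool" where
  "assumption_A1 l h T \<epsilon>0 \<rho>L \<rho>R DL DR \<rho>M DM \<longleftrightarrow>
     0 < DL \<and> 0 < DR \<and> 0 < \<rho>L \<and> 0 < \<rho>R \<and>
     W1inf_periodic_coeff h T \<rho>M \<and> W1inf_periodic_coeff h T DM \<and>
     uniformly_bounded_coeff l h T \<epsilon>0 \<rho>M \<and> uniformly_bounded_coeff l h T \<epsilon>0 DM"

definition assumption_A2 ::
    "real \<Rightarrow> real \<Rightarrow> real \<Rightarrow> real \<Rightarrow> (real \<times> real \<Rightarrow> real) \<Rightarrow> (real \<times> real \<Rightarrow> real) \<Rightarrow>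
     (real \<times> real \<times> real \<Rightarrow> real) \<Rightarrow> bool" where
  "assumption_A2 l h T \<epsilon>0 v1 v2 fL \<longleftrightarrow>
     Ck_compact 2 (Omega_L0 l h) v1 \<and> Ck_compact 1 (Omega_L0 l h) v2 \<and>
     Ck_compact 2 ({0<..<T} \<times> Omega_L0 l h) fL \<and>
     (\<forall>\<epsilon>\<in>eps_range l h \<epsilon>0.
        supp v1 \<subseteq> Omega_L l h \<epsilon> \<and> supp v2 \<subseteq> Omega_L l h \<epsilon> \<and> supp fL \<subseteq> {0<..<T} \<times> Omega_L l h \<epsilon>)"

definition no_fast_time :: "real \<Rightarrow> real \<Rightarrow> coefficient \<Rightarrow> bool" where
  "no_fast_time h T c \<longleftrightarrow>
     (\<forall>t x2 \<tau> \<tau>' y z. (t, x2, \<tau>, y, z) \<in> coeff_domain h T \<longrightarrow> c (t, x2, \<tau>, y, z) = c (t, x2, \<tau>', y, z))"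

definition assumption_B1 :: "real \<Rightarrow> real \<Rightarrow> coefficient \<Rightarrow> coefficient \<Rightarrow> bool" where
  "assumption_B1 h T \<rho>M DM \<longleftrightarrow> no_fast_time h T \<rho>M \<and> no_fast_time h T DM"

text \<open>\<open>u\<close> is a weak solution, with weak time derivative \<open>ut\<close> and weak spatial gradient \<open>Gu\<close>
  (both determined by \<open>u\<close> almost everywhere). For a test function \<open>\<phi>\<close>, its weak time derivative
  is \<open>\<phi>t\<close>, its gradient is \<open>G\<phi>\<close> and its value at time \<open>0\<close> is \<open>\<phi>0\<close>.\<close>

definition weak_solution ::
    "real \<Rightarrow> real \<Rightarrow> real \<Rightarrow> real \<Rightarrow> real \<Rightarrow> real \<Rightarrow> real \<Rightarrow> coefficient \<Rightarrow> coefficient \<Rightarrow>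
     (real \<times> real \<Rightarrow> real) \<Rightarrow> (real \<times> real \<Rightarrow> real) \<Rightarrow> (real \<times> real \<times> real \<Rightarrow> real) \<Rightarrow> real \<Rightarrow>
     (real \<Rightarrow> real \<times> real \<Rightarrow> real) \<Rightarrow> (real \<Rightarrow> real \<times> real \<Rightarrow> real) \<Rightarrow>
     (real \<Rightarrow> real \<times> real \<Rightarrow> real \<times> real) \<Rightarrow> bool" where
  "weak_solution l h T \<rho>L \<rho>R DL DR \<rho>M DM v1 v2 fL \<epsilon> u ut Gu \<longleftrightarrow>
     L2_H1_periodic l h T u Gu \<and>
     has_time_derivative T (Omega l h) u ut \<and>
     has_time_trace T (Omega l h) u 0 v1 \<and>
     (\<forall>\<phi> \<phi>t G\<phi> \<phi>0.
        L2_H1_periodic l h T \<phi> G\<phi> \<and>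
        has_time_derivative T (Omega l h) \<phi> \<phi>t \<and>
        has_time_trace T (Omega l h) \<phi> T (\<lambda>x. 0) \<and>
        has_time_trace T (Omega l h) \<phi> 0 \<phi>0 \<longrightarrow>
        - (LINT t:{0<..<T}|lborel. LINT x:Omega l h|lborel.
             micro_coeff \<epsilon> \<rho>L \<rho>M \<rho>R t x * ut t x * \<phi>t t x)
        + (LINT t:{0<..<T}|lborel. LINT x:Omega l h|lborel.
             micro_coeff \<epsilon> DL DM DR t x * (Gu t x \<bullet> G\<phi> t x))
        = (LINT t:{0<..<T}|lborel. LINT x:Omega l h|lborel. fL (t, x) * \<phi> t x)
        + (LINT x:Omega l h|lborel. \<rho>L * v2 x * \<phi>0 x))"

text \<open>The sum of the three norms in the estimates, with weight \<open>1/sqrt \<epsilon>\<close> on the layer.\<close>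

definition scaled_norm ::
    "real \<Rightarrow> real \<Rightarrow> real \<Rightarrow> real \<Rightarrow> (real \<Rightarrow> real \<times> real \<Rightarrow> 'b::euclidean_space) \<Rightarrow> ennreal" where
  "scaled_norm l h T \<epsilon> g =
     LinfL2norm T (Omega_L l h \<epsilon>) g + LinfL2norm T (Omega_R l h \<epsilon>) g
     + ennreal (1 / sqrt \<epsilon>) * LinfL2norm T (Omega_M h \<epsilon>) g"

end

theory Submission
  imports Defs
begin

text \<open>
  Formally one tests the equation with the time derivative of the solution. As that derivative is only
  square-integrable, the test function is \<open>\<zeta>(t) (u(t + d) - u(t - d)) / (2 d)\<close> with a cut-off \<open>\<zeta>\<close> vanishing
  near \<open>T\<close>, where \<open>u\<close> is continued to negative times by \<open>v1 + t v2\<close>. For any symmetric term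
  \<open>m f (f(t + d) - f(t - d)) / (2 d)\<close> a shift in time moves the difference onto \<open>\<zeta> m\<close>, so that
  no second derivatives occur, and the limit \<open>d \<rightarrow> 0\<close> gives
  \<open>- \<integral> \<zeta>' e - K \<integral> \<zeta> e \<le> 2 \<integral> \<zeta> fL \<partial>\<^sub>t u + \<zeta>(0) (initial data)\<close> for the energy density
  \<open>e = \<rho> (\<partial>\<^sub>t u)\<^sup>2 + D (\<nabla>u)\<^sup>2\<close>. Since the coefficients do not oscillate in time, their time derivative is at most \<open>K\<close> times
  themselves, uniformly in \<open>\<epsilon>\<close>. Given \<open>g \<ge> 0\<close>, a weight with \<open>- \<zeta>' - (K + 1) \<zeta> \<ge> c g\<close> and
  \<open>\<zeta>(0) = \<integral> g\<close> absorbs the other terms and leaves \<open>c \<integral> g e \<le> C \<integral> g\<close>; as \<open>g\<close> is arbitrary,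
  the energy is bounded at almost every time. In the layer \<open>\<rho>\<close> and \<open>D\<close> are at least a constant over \<open>\<epsilon>\<close>,
  which produces the factor \<open>1 / sqrt \<epsilon>\<close>. The bound of \<open>u\<close> itself follows by integrating \<open>\<partial>\<^sub>t u\<close> in time.
\<close>

section \<open>Translation continuity\<close>

text \<open>The obstacle is the initial time: no trace of \<open>ut\<close> or \<open>Gu\<close> at
  0 is at hand, and the shift in time leaves boundary terms over the slab (0, d). The continuation
  by \<open>v1 + t v2\<close> is chosen so that one factor of each slab term is explicit data. In
  the kinetic term the unknown half cancels against the initial term of the weak formulation, whose
  test function at time 0 averages over (-d, d). In the gradient term the unknown factor is
  integrated by parts in space onto second derivatives of \<open>v1\<close>; this is where two
  derivatives of \<open>v1\<close> enter, and it leaves - \<integral> v1 \<Delta>v1, the Dirichlet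
  energy of \<open>v1\<close>. Both computations use that the data live in the left part, where the
  coefficients are constant; the same fact makes the bounds of source and initial energy independent
  of \<epsilon>. Uniformity of \<open>K\<close> comes from comparing an increment of a layer
  coefficient with the coefficient itself: both carry the factor 1/\<epsilon>. Weak gradients are
  defined through smooth periodic test functions, while the derivatives of \<open>v1\<close> are
  only C1 with compact support, so that identity has to be extended by smoothing on the
  torus.\<close>

lemma tendsto_0_of_abs_le:
  fixes a b :: "nat \<Rightarrow> real"
  assumes "\<And>n. \<bar>a n\<bar> \<le> b n" "b \<longlonglongrightarrow> 0"
  shows "a \<longlonglongrightarrow> 0"
  by (rule Lim_null_comparison[OF always_eventually assms(2)]) (use assms(1) in simp)

lemma lborel_distr_translate:
  fixes c :: "'a::euclidean_space"
  shows "distr lborel lborel (\<lambda>x. x + c) = lborel"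
proof -
  have "distr lborel lborel (\<lambda>x. x + c) = distr lborel borel ((+) c)"
    by (intro distr_cong) (auto simp: add.commute)
  then show ?thesis by (simp add: lborel_distr_plus)
qed

lemma integrable_translate:
  fixes f :: "'a::euclidean_space \<Rightarrow> real"
  assumes "integrable lborel f"
  shows "integrable lborel (\<lambda>x. f (x + c))"
  using integrable_distr[of "\<lambda>x. x + c" lborel lborel f] assms
  by (simp add: lborel_distr_translate)

lemma integral_translate:
  fixes f :: "'a::euclidean_space \<Rightarrow> real"
  assumes [measurable]: "f \<in> borel_measurable lborel"
  shows "(LINT x|lborel. f (x + c)) = (LINT x|lborel. f x)"
  using integral_distr[of "\<lambda>x. x + c" lborel lborel f]
  by (simp add: lborel_distr_translate)

lemma AE_translate:
  fixes c :: "'a::euclidean_space"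
  assumes "AE x in lborel. P x"
  shows "AE x in lborel. P (x + c)"
  using AE_distrD[of "\<lambda>x. x + c" lborel lborel P] assms
  unfolding lborel_distr_translate by simp

text \<open>Outer regularity reduces the claim to open sets of finite measure. For an open set the
  points lost by a translation converge pointwise to none, and translation invariance makes the
  measure gained equal to the measure lost.\<close>

lemma translation_continuous_indicator:
  fixes A :: "'a::euclidean_space set" and c :: "nat \<Rightarrow> 'a"
  assumes [measurable]: "A \<in> sets borel" and fin: "emeasure lborel A < \<infinity>" and c: "c \<longlonglongrightarrow> 0"
  shows "(\<lambda>n. LINT x|lborel. \<bar>indicat_real A (x + c n) - indicat_real A x\<bar>) \<longlonglongrightarrow> 0"
proof (rule LIMSEQ_I)
  fix e :: real assume e: "0 < e"
  obtain U where U: "open U" "A \<subseteq> U" "emeasure lborel (U - A) < ennreal (e/4)"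
    using outer_regular_lborel[of A "e/4"] e assms(1) by auto
  have [measurable]: "U \<in> sets borel" using U(1) by simp
  have UA: "U = A \<union> (U - A)" using U(2) by auto
  have "emeasure lborel U \<le> emeasure lborel A + emeasure lborel (U - A)"
    by (subst UA, rule emeasure_subadditive) auto
  also have "\<dots> < \<infinity>" using fin order_less_trans[OF U(3), of top] by simp
  finally have Ufin: "emeasure lborel U < \<infinity>" .
  have DAfin: "emeasure lborel (U - A) < \<infinity>" using order_less_trans[OF U(3), of top] by simp
  have iA: "integrable lborel (indicat_real A)" and iU: "integrable lborel (indicat_real U)"
    and iUA: "integrable lborel (indicat_real (U - A))"
    using fin Ufin DAfin by (auto simp: integrable_indicator_iff)
  let ?d = "\<lambda>n x. indicat_real U (x + c n) - indicat_real U x"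
  \<comment> \<open>Only the lost part \<open>?p\<close> is followed: a point of \<open>U\<close>
    stays in \<open>U\<close> under small translations, while a boundary point outside
    \<open>U\<close> may enter it for infinitely many n.\<close>
  let ?p = "\<lambda>n x. max 0 (indicat_real U x - indicat_real U (x + c n))"
  have ip: "integrable lborel (?p n)" for n
    by (rule Bochner_Integration.integrable_bound[OF iU]) (auto simp: indicator_def)
  have p0: "(\<lambda>n. LINT x|lborel. ?p n x) \<longlonglongrightarrow> (LINT x|(lborel::'a measure). 0)"
  proof (rule integral_dominated_convergence[where w="indicat_real U"])
    show "AE x in lborel. (\<lambda>n. ?p n x) \<longlonglongrightarrow> 0"
    proof (rule AE_I2)
      fix x :: 'a
      show "(\<lambda>n. ?p n x) \<longlonglongrightarrow> 0"
      proof (cases "x \<in> U")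
        case True
        have "(\<lambda>n. x + c n) \<longlonglongrightarrow> x" using tendsto_add[OF tendsto_const c, of x] by simp
        then have "\<forall>\<^sub>F n in sequentially. x + c n \<in> U"
          using topological_tendstoD[OF _ U(1) True] by blast
        then show ?thesis
          by (intro tendsto_eventually) (auto elim!: eventually_mono simp: True)
      qed simp
    qed
  qed (use iU in \<open>auto simp: indicator_def\<close>)
  \<comment> \<open>\<bar>d\<bar> = d + 2 max 0 (- d), and \<open>?d n\<close> has integral 0 by
    translation invariance.\<close>
  have eqU: "(LINT x|lborel. \<bar>?d n x\<bar>) = 2 * (LINT x|lborel. ?p n x)" for n
  proof -
    have "(LINT x|lborel. \<bar>?d n x\<bar>) = (LINT x|lborel. (indicat_real U (x + c n) - indicat_real U x) + 2 * ?p n x)"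
      by (intro Bochner_Integration.integral_cong) (auto simp: indicator_def)
    also have "\<dots> = ((LINT x|lborel. indicat_real U (x + c n)) - (LINT x|lborel. indicat_real U x)) + 2 * (LINT x|lborel. ?p n x)"
      using ip[of n] iU integrable_translate[OF iU, of "c n"] by simp
    also have "\<dots> = 2 * (LINT x|lborel. ?p n x)"
      using integral_translate[of "indicat_real U" "c n"] by simp
    finally show ?thesis .
  qed
  have "(\<lambda>n. LINT x|lborel. \<bar>?d n x\<bar>) \<longlonglongrightarrow> 0"
    unfolding eqU using tendsto_mult_left[OF p0, of 2] by simp
  from LIMSEQ_D[OF this, of "e/2"] e obtain N where N: "\<And>n. n \<ge> N \<Longrightarrow> (LINT x|lborel. \<bar>?d n x\<bar>) < e/2"
    by auto
  have mUA: "(LINT x|lborel. indicat_real (U - A) x) < e/4"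
    using U(3) e DAfin by (simp add: emeasure_eq_ennreal_measure ennreal_less_iff)
  have "(LINT x|lborel. \<bar>indicat_real A (x + c n) - indicat_real A x\<bar>) < e" if "n \<ge> N" for n
  proof -
    have "(LINT x|lborel. \<bar>indicat_real A (x + c n) - indicat_real A x\<bar>) \<le>
       (LINT x|lborel. \<bar>?d n x\<bar> + (indicat_real (U - A) (x + c n) + indicat_real (U - A) x))"
    proof (rule integral_mono)
      show "integrable lborel (\<lambda>x. \<bar>indicat_real A (x + c n) - indicat_real A x\<bar>)"
        using iA integrable_translate[OF iA, of "c n"] by (intro integrable_abs Bochner_Integration.integrable_diff)
      show "integrable lborel (\<lambda>x. \<bar>?d n x\<bar> + (indicat_real (U - A) (x + c n) + indicat_real (U - A) x))"
        using iU integrable_translate[OF iU, of "c n"] iUA integrable_translate[OF iUA, of "c n"]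
        by (intro integrable_abs Bochner_Integration.integrable_diff Bochner_Integration.integrable_add)
    qed (use U(2) in \<open>auto simp: indicator_def\<close>)
    also have "\<dots> = (LINT x|lborel. \<bar>?d n x\<bar>) + ((LINT x|lborel. indicat_real (U - A) (x + c n))
        + (LINT x|lborel. indicat_real (U - A) x))"
      using iU iUA integrable_translate[OF iU, of "c n"] integrable_translate[OF iUA, of "c n"] by simp
    also have "(LINT x|lborel. indicat_real (U - A) (x + c n)) = (LINT x|lborel. indicat_real (U - A) x)"
      by (rule integral_translate) simp
    also have "(LINT x|lborel. \<bar>?d n x\<bar>) + ((LINT x|lborel. indicat_real (U - A) x) + (LINT x|lborel. indicat_real (U - A) x)) < e"
      using N[OF that] mUA by linarith
    finally show ?thesis .
  qed
  then show "\<exists>no. \<forall>n\<ge>no. norm ((LINT x|lborel. \<bar>indicat_real A (x + c n) - indicat_real A x\<bar>) - 0) < e"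
    by auto
qed

text \<open>Density argument along \<open>integrable_induct\<close>: indicators are the previous
  lemma, sums follow from the triangle inequality, and limits from comparison with one good
  approximant.\<close>

lemma translation_continuous_L1:
  fixes f :: "'a::euclidean_space \<Rightarrow> real" and c :: "nat \<Rightarrow> 'a"
  assumes "integrable lborel f" and c: "c \<longlonglongrightarrow> 0"
  shows "(\<lambda>n. LINT x|lborel. \<bar>f (x + c n) - f x\<bar>) \<longlonglongrightarrow> 0"
  using assms(1)
proof (induct rule: integrable_induct)
  case (base A k)
  have "(LINT x|lborel. \<bar>indicat_real A (x + c n) *\<^sub>R k - indicat_real A x *\<^sub>R k\<bar>)
     = (LINT x|lborel. \<bar>indicat_real A (x + c n) - indicat_real A x\<bar> * \<bar>k\<bar>)" for n
    by (intro Bochner_Integration.integral_cong) (auto simp: indicator_def)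
  then show ?case
    using tendsto_mult_right[OF translation_continuous_indicator[of A c], of "\<bar>k\<bar>"] base c by simp
next
  case (add f g)
  have "norm (LINT x|lborel. \<bar>(f (x + c n) + g (x + c n)) - (f x + g x)\<bar>)
     \<le> (LINT x|lborel. \<bar>f (x + c n) - f x\<bar>) + (LINT x|lborel. \<bar>g (x + c n) - g x\<bar>)" for n
  proof -
    have "(LINT x|lborel. \<bar>(f (x + c n) + g (x + c n)) - (f x + g x)\<bar>)
     \<le> (LINT x|lborel. \<bar>f (x + c n) - f x\<bar> + \<bar>g (x + c n) - g x\<bar>)"
      using add(1,3) by (intro integral_mono integrable_abs Bochner_Integration.integrable_add
            Bochner_Integration.integrable_diff integrable_translate) auto
    then show ?thesis
      using add(1,3) integrable_translate[OF add(1), of "c n"] integrable_translate[OF add(3), of "c n"] by simp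
  qed
  then show ?case
    using tendsto_add[OF add(2,4)] by (auto intro!: tendsto_0_of_abs_le[where b="\<lambda>n. (LINT x|lborel. \<bar>f (x + c n) - f x\<bar>) + (LINT x|lborel. \<bar>g (x + c n) - g x\<bar>)"])
next
  case (lim f s)
  have "(\<lambda>i. LINT x|lborel. \<bar>s i x - f x\<bar>) \<longlonglongrightarrow> (LINT x|(lborel::'a measure). 0)"
  \<comment> \<open>The approximants of \<open>integrable_induct\<close> satisfy \<bar>s i x\<bar>
    \<le> 2 \<bar>f x\<bar>, hence the majorant 3 \<bar>f x\<bar>.\<close>
  proof (rule integral_dominated_convergence[where w="\<lambda>x. 3 * \<bar>f x\<bar>"])
    show "AE x in lborel. (\<lambda>i. \<bar>s i x - f x\<bar>) \<longlonglongrightarrow> 0"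
      using lim(3) by (intro AE_I2 tendsto_rabs_zero LIM_zero) simp
    show "AE x in lborel. norm \<bar>s i x - f x\<bar> \<le> 3 * \<bar>f x\<bar>" for i
    proof (rule AE_I2)
      fix x :: 'a
      show "norm \<bar>s i x - f x\<bar> \<le> 3 * \<bar>f x\<bar>" using lim(4)[of x i] by simp
    qed
    show "(\<lambda>x. \<bar>s i x - f x\<bar>) \<in> borel_measurable lborel" for i
      using lim(1)[of i] lim(5) by measurable
    show "integrable lborel (\<lambda>x. 3 * \<bar>f x\<bar>)" using lim(5) by simp
  qed simp
  then have s0: "(\<lambda>i. LINT x|lborel. \<bar>s i x - f x\<bar>) \<longlonglongrightarrow> 0" by simp
  show ?case
  proof (rule LIMSEQ_I)
    fix e :: real assume e: "0 < e"
    obtain i where i: "(LINT x|lborel. \<bar>s i x - f x\<bar>) < e/4"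
      using LIMSEQ_D[OF s0, of "e/4"] e by auto
    obtain N where N: "\<And>n. n \<ge> N \<Longrightarrow> (LINT x|lborel. \<bar>s i (x + c n) - s i x\<bar>) < e/2"
      using LIMSEQ_D[OF lim(2)[of i], of "e/2"] e by auto
    have isf: "integrable lborel (\<lambda>x. \<bar>s i x - f x\<bar>)" using lim(1)[of i] lim(5) by simp
    have "(LINT x|lborel. \<bar>f (x + c n) - f x\<bar>) < e" if "n \<ge> N" for n
    proof -
      have tr: "integrable lborel (\<lambda>x. f (x + c n))" "integrable lborel (\<lambda>x. s i (x + c n))"
        using integrable_translate[OF lim(5)] integrable_translate[OF lim(1)[of i]] by auto
      \<comment> \<open>The two outer terms of the triangle inequality coincide by translation
        invariance, so the budget is e/4 + e/2 + e/4.\<close>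
      have "(LINT x|lborel. \<bar>f (x + c n) - f x\<bar>) \<le>
         (LINT x|lborel. \<bar>s i (x + c n) - s i x\<bar> + (\<bar>s i (x + c n) - f (x + c n)\<bar> + \<bar>s i x - f x\<bar>))"
        using lim(1)[of i] lim(5) tr by (intro integral_mono) auto
      also have "\<dots> = (LINT x|lborel. \<bar>s i (x + c n) - s i x\<bar>) +
         ((LINT x|lborel. \<bar>s i (x + c n) - f (x + c n)\<bar>) + (LINT x|lborel. \<bar>s i x - f x\<bar>))"
        using lim(1)[of i] lim(5) tr by simp
      also have "(LINT x|lborel. \<bar>s i (x + c n) - f (x + c n)\<bar>) = (LINT x|lborel. \<bar>s i x - f x\<bar>)"
        using integral_translate[of "\<lambda>x. \<bar>s i x - f x\<bar>" "c n"] isf by (simp add: borel_measurable_integrable)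
      finally show ?thesis using N[OF that] i by linarith
    qed
    then show "\<exists>no. \<forall>n\<ge>no. norm ((LINT x|lborel. \<bar>f (x + c n) - f x\<bar>) - 0) < e"
      by auto
  qed
qed

text \<open>Reduction to L1: for nonnegative numbers
  \<open>(x - y)\<^sup>2 \<le> \<bar>x\<^sup>2 - y\<^sup>2\<bar>\<close>, and this is applied to the
  positive and negative parts of \<open>f\<close>, whose squares are integrable.\<close>

lemma translation_continuous_L2:
  fixes f :: "'a::euclidean_space \<Rightarrow> real" and c :: "nat \<Rightarrow> 'a"
  assumes [measurable]: "f \<in> borel_measurable lborel" and f: "integrable lborel (\<lambda>x. (f x)\<^sup>2)"
    and c: "c \<longlonglongrightarrow> 0"
  shows "(\<lambda>n. LINT x|lborel. (f (x + c n) - f x)\<^sup>2) \<longlonglongrightarrow> 0"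
proof -
  let ?p = "\<lambda>x. (max 0 (f x))\<^sup>2" and ?m = "\<lambda>x. (max 0 (- f x))\<^sup>2"
  have i: "integrable lborel ?p" "integrable lborel ?m"
    by (rule Bochner_Integration.integrable_bound[OF f]; auto simp: max_def)+
  have key: "(a - b)\<^sup>2 \<le> 2 * \<bar>(max 0 a)\<^sup>2 - (max 0 b)\<^sup>2\<bar> + 2 * \<bar>(max 0 (-a))\<^sup>2 - (max 0 (-b))\<^sup>2\<bar>" for a b :: real
  proof -
    have sq: "(x - y)\<^sup>2 \<le> \<bar>x\<^sup>2 - y\<^sup>2\<bar>" if "0 \<le> x" "0 \<le> y" for x y :: real
    proof -
      have "\<bar>x - y\<bar> * \<bar>x - y\<bar> \<le> \<bar>x - y\<bar> * (x + y)" using that by (intro mult_left_mono) auto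
      also have "\<dots> = \<bar>x\<^sup>2 - y\<^sup>2\<bar>" using that by (simp add: power2_eq_square abs_mult square_diff_square_factored mult.commute)
      finally show ?thesis by (simp add: power2_eq_square abs_mult_self_eq)
    qed
    have "(a - b)\<^sup>2 = ((max 0 a - max 0 b) + (- (max 0 (-a) - max 0 (-b))))\<^sup>2"
      by (rule arg_cong[where f="\<lambda>x. x\<^sup>2"]) (auto simp: max_def)
    also have "\<dots> \<le> 2 * (max 0 a - max 0 b)\<^sup>2 + 2 * (max 0 (-a) - max 0 (-b))\<^sup>2"
      using sum_squares_bound[of "max 0 a - max 0 b" "- (max 0 (-a) - max 0 (-b))"]
      unfolding power2_sum by (simp add: power2_commute)
    also have "\<dots> \<le> 2 * \<bar>(max 0 a)\<^sup>2 - (max 0 b)\<^sup>2\<bar> + 2 * \<bar>(max 0 (-a))\<^sup>2 - (max 0 (-b))\<^sup>2\<bar>"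
      using sq[of "max 0 a" "max 0 b"] sq[of "max 0 (-a)" "max 0 (-b)"] by simp
    finally show ?thesis .
  qed
  have "norm (LINT x|lborel. (f (x + c n) - f x)\<^sup>2) \<le>
     2 * (LINT x|lborel. \<bar>?p (x + c n) - ?p x\<bar>) + 2 * (LINT x|lborel. \<bar>?m (x + c n) - ?m x\<bar>)" for n
  proof -
    note tr = i[THEN integrable_translate, of "c n"]
    have "(LINT x|lborel. (f (x + c n) - f x)\<^sup>2) \<le>
      (LINT x|lborel. 2 * \<bar>?p (x + c n) - ?p x\<bar> + 2 * \<bar>?m (x + c n) - ?m x\<bar>)"
      using i tr by (intro integral_mono' key) auto
    then show ?thesis using i tr by simp
  qed
  moreover have "(\<lambda>n. 2 * (LINT x|lborel. \<bar>?p (x + c n) - ?p x\<bar>) + 2 * (LINT x|lborel. \<bar>?m (x + c n) - ?m x\<bar>)) \<longlonglongrightarrow> 2 * 0 + 2 * 0"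
    using i c by (intro tendsto_intros translation_continuous_L1)
  ultimately show ?thesis
    by (metis (no_types, lifting) tendsto_0_of_abs_le add_0 mult_zero_right real_norm_def)
qed

section \<open>Smooth functions with compact support\<close>

lemma frechet_derivative_eqI: "(f has_derivative D) (at x) \<Longrightarrow> frechet_derivative f (at x) b = D b"
  by (metis frechet_derivative_at)

lemma frechet_derivative_cong_open:
  assumes "open S" "x \<in> S" "\<And>y. y \<in> S \<Longrightarrow> f y = g y"
  shows "frechet_derivative f (at x) = frechet_derivative g (at x)"
proof -
  have "(f has_derivative D) (at x) \<longleftrightarrow> (g has_derivative D) (at x)" for D
    using has_derivative_transform_within_open[of f D x UNIV S g]
      has_derivative_transform_within_open[of g D x UNIV S f] assms by auto
  then show ?thesis unfolding frechet_derivative_def by simp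
qed

lemma Ck_cong:
  assumes "open S" "\<And>x. x \<in> S \<Longrightarrow> f x = g x"
  shows "Ck k S f \<longleftrightarrow> Ck k S g"
  using assms(2)
proof (induction k arbitrary: f g)
  case 0
  then show ?case by (auto cong: continuous_on_cong)
next
  case (Suc k)
  have "f differentiable at x \<longleftrightarrow> g differentiable at x" if "x \<in> S" for x
    unfolding differentiable_def
    using has_derivative_transform_within_open[of f _ x UNIV S g]
      has_derivative_transform_within_open[of g _ x UNIV S f] assms(1) that Suc.prems by auto
  moreover have "Ck k S (\<lambda>x. frechet_derivative f (at x) b) \<longleftrightarrow> Ck k S (\<lambda>x. frechet_derivative g (at x) b)" for b
    using frechet_derivative_cong_open[OF assms(1) _ Suc.prems] by (intro Suc.IH) auto
  ultimately show ?case by auto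
qed

text \<open>Any derivative \<open>D\<close> may be supplied in place of
  \<open>frechet_derivative\<close>, so that the closure properties below become applications of the
  usual differentiation rules.\<close>

lemma Ck_SucI:
  assumes "open S" "\<And>x. x \<in> S \<Longrightarrow> (f has_derivative D x) (at x)"
    and "\<And>b. b \<in> Basis \<Longrightarrow> Ck k S (\<lambda>x. D x b)"
  shows "Ck (Suc k) S f"
proof -
  have "Ck k S (\<lambda>x. frechet_derivative f (at x) b)" if "b \<in> Basis" for b
    using Ck_cong[OF assms(1), of "\<lambda>x. frechet_derivative f (at x) b" "\<lambda>x. D x b" k]
      assms(3)[OF that] frechet_derivative_eqI[OF assms(2)] by auto
  then show ?thesis using assms(2) by (auto simp: differentiable_def)
qed

lemma Ck_Suc_has_derivative:
  "Ck (Suc k) S f \<Longrightarrow> x \<in> S \<Longrightarrow> (f has_derivative frechet_derivative f (at x)) (at x)"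
  by (simp add: frechet_derivative_works)

lemma Ck_SucD: "Ck (Suc k) S f \<Longrightarrow> Ck k S f"
proof (induction k arbitrary: f)
  case 0
  then show ?case
    by (auto intro!: differentiable_imp_continuous_on differentiable_at_imp_differentiable_on)
next
  case (Suc k)
  then show ?case by (metis Ck.simps(2))
qed

lemma Ck_le: "Ck k S f \<Longrightarrow> j \<le> k \<Longrightarrow> Ck j S f"
  by (induction k) (auto simp del: Ck.simps simp: le_Suc_eq dest: Ck_SucD)

lemma Ck_const: "Ck k S (\<lambda>x. c)"
  by (induction k arbitrary: c) auto

lemma Ck_add:
  assumes "open S"
  shows "Ck k S f \<Longrightarrow> Ck k S g \<Longrightarrow> Ck k S (\<lambda>x. f x + g x)"
proof (induction k arbitrary: f g)
  case (Suc k)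
  show ?case
  proof (rule Ck_SucI[OF assms])
    show "((\<lambda>x. f x + g x) has_derivative (\<lambda>h. frechet_derivative f (at x) h + frechet_derivative g (at x) h)) (at x)"
      if "x \<in> S" for x
      using has_derivative_add Ck_Suc_has_derivative[OF _ that] Suc.prems by blast
    show "Ck k S (\<lambda>x. frechet_derivative f (at x) b + frechet_derivative g (at x) b)" if "b \<in> Basis" for b
      by (rule Suc.IH; use Suc.prems that in simp)
  qed
qed (auto intro: continuous_on_add)

lemma Ck_mult:
  assumes "open S"
  shows "Ck k S f \<Longrightarrow> Ck k S g \<Longrightarrow> Ck k S (\<lambda>x. f x * g x)"
proof (induction k arbitrary: f g)
  case (Suc k)
  show ?case
  proof (rule Ck_SucI[OF assms])
    show "((\<lambda>x. f x * g x) has_derivative (\<lambda>h. f x * frechet_derivative g (at x) h + frechet_derivative f (at x) h * g x)) (at x)"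
      if "x \<in> S" for x
      using has_derivative_mult Ck_Suc_has_derivative[OF _ that] Suc.prems by blast
    have "Ck k S f" "Ck k S g" using Suc.prems by (auto dest: Ck_SucD simp del: Ck.simps)
    then show "Ck k S (\<lambda>x. f x * frechet_derivative g (at x) b + frechet_derivative f (at x) b * g x)" if "b \<in> Basis" for b
      using Suc.prems that by (intro Ck_add[OF assms] Suc.IH) simp_all
  qed
qed (auto intro: continuous_on_mult)

lemma Ck_diff:
  assumes "open S" "Ck k S f" "Ck k S g"
  shows "Ck k S (\<lambda>x. f x - g x)"
  using Ck_add[OF assms(1,2) Ck_mult[OF assms(1) Ck_const[of _ _ "-1"] assms(3)]] by simp

lemma Ck_prod:
  assumes "open S" "finite I" "\<And>i. i \<in> I \<Longrightarrow> Ck k S (f i)"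
  shows "Ck k S (\<lambda>x. \<Prod>i\<in>I. f i x)"
  using assms(2,3)
proof (induction I)
  case (insert i I)
  then have "Ck k S (\<lambda>x. f i x * (\<Prod>i\<in>I. f i x))" by (intro Ck_mult[OF assms(1)]) auto
  with insert show ?case by simp
qed (simp add: Ck_const)

lemma Ck_bounded_linear:
  assumes "bounded_linear (f :: 'a::euclidean_space \<Rightarrow> real)"
  shows "Ck k UNIV f"
proof (cases k)
  case 0
  then show ?thesis by (simp add: assms linear_continuous_on)
next
  case (Suc j)
  show ?thesis unfolding Suc
    by (rule Ck_SucI[OF open_UNIV bounded_linear_imp_has_derivative[OF assms] Ck_const])
qed

lemma Ck_real_Suc:
  fixes f :: "real \<Rightarrow> real"
  assumes "\<And>x. (f has_real_derivative f' x) (at x)" "Ck k UNIV f'"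
  shows "Ck (Suc k) UNIV f"
  by (rule Ck_SucI[of _ _ "\<lambda>x h. f' x * h"])
    (use assms in \<open>auto simp: has_field_derivative_def\<close>)

lemma Ck_compose:
  assumes "open S"
  shows "Ck k UNIV (f :: real \<Rightarrow> real) \<Longrightarrow> Ck k S g \<Longrightarrow> Ck k S (\<lambda>x. f (g x))"
proof (induction k arbitrary: f g)
  case 0
  then show ?case by (auto intro: continuous_on_compose2)
next
  case (Suc k)
  \<comment> \<open>In one dimension the derivative is multiplication by its value at 1. The chain
    rule thereby becomes a product, to which the induction hypothesis and \<open>Ck_mult\<close>
    apply.\<close>
  let ?f' = "\<lambda>y. frechet_derivative f (at y) 1"
  have f': "(f has_derivative (\<lambda>h. ?f' y * h)) (at y)" for y
  proof -
    have "(f has_derivative frechet_derivative f (at y)) (at y)"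
      using Ck_Suc_has_derivative[OF Suc.prems(1)] by simp
    moreover have "frechet_derivative f (at y) = (\<lambda>h. ?f' y * h)"
    proof
      fix h
      show "frechet_derivative f (at y) h = ?f' y * h"
        using linear_scale[OF has_derivative_linear[OF calculation], of h 1] by (simp add: mult.commute)
    qed
    ultimately show ?thesis by metis
  qed
  show ?case
  proof (rule Ck_SucI[OF assms])
    show "((\<lambda>x. f (g x)) has_derivative (\<lambda>h. ?f' (g x) * frechet_derivative g (at x) h)) (at x)" if "x \<in> S" for x
      using diff_chain_at[OF Ck_Suc_has_derivative[OF Suc.prems(2) that] f'[of "g x"]]
      by (simp add: o_def)
    show "Ck k S (\<lambda>x. ?f' (g x) * frechet_derivative g (at x) b)" if "b \<in> Basis" for b
      using Suc.prems(1) Ck_SucD[OF Suc.prems(2)] Suc.prems(2) that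
      by (intro Ck_mult[OF assms, OF Suc.IH[of ?f' g]]) simp_all
  qed
qed

section \<open>Supports and extension by zero\<close>

lemma supp_superset: "f x \<noteq> 0 \<Longrightarrow> x \<in> supp f"
  unfolding supp_def by (rule subsetD[OF closure_subset]) simp

lemma closed_supp: "closed (supp f)"
  by (simp add: supp_def)

lemma supp_subsetI: "closed K \<Longrightarrow> (\<And>x. f x \<noteq> 0 \<Longrightarrow> x \<in> K) \<Longrightarrow> supp f \<subseteq> K"
  unfolding supp_def by (rule closure_minimal) auto

lemma compact_suppI: "compact K \<Longrightarrow> (\<And>x. f x \<noteq> 0 \<Longrightarrow> x \<in> K) \<Longrightarrow> compact (supp f)"
  using supp_subsetI[of K f] compact_imp_closed[of K] compact_Int_closed[of K "supp f"] closed_supp[of f]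
  by (simp add: Int_absorb1)

lemma Ck_subset: "Ck k S f \<Longrightarrow> S' \<subseteq> S \<Longrightarrow> Ck k S' f"
  by (induction k arbitrary: f) (auto intro: continuous_on_subset)

lemma Ck_zero: "open S \<Longrightarrow> (\<And>x. x \<in> S \<Longrightarrow> f x = 0) \<Longrightarrow> Ck k S f"
  using Ck_cong[of S f "\<lambda>x. 0" k] Ck_const by auto

lemma Ck_Un:
  assumes "open S" "open S'"
  shows "Ck k S f \<Longrightarrow> Ck k S' f \<Longrightarrow> Ck k (S \<union> S') f"
  using assms by (induction k arbitrary: f) (auto intro!: continuous_on_open_Un)

text \<open>\<open>S\<close> and the complement of the support are open and cover the space, the
  function vanishes on the second set, and regularity is a local property.\<close>

lemma Ck_compact_UNIV:
  assumes "open S" "Ck_compact k S f"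
  shows "Ck k UNIV f"
proof -
  have "Ck k (- supp f) f"
    using supp_superset[of f] closed_supp[of f] by (intro Ck_zero) auto
  then have "Ck k (S \<union> - supp f) f"
    using assms closed_supp[of f] by (intro Ck_Un) (auto simp: Ck_compact_def)
  moreover have "S \<union> - supp f = UNIV" using assms by (auto simp: Ck_compact_def)
  ultimately show ?thesis by simp
qed

lemma frechet_derivative_outside_supp:
  assumes "x \<notin> supp f"
  shows "frechet_derivative f (at x) b = 0"
proof -
  have "frechet_derivative f (at x) = frechet_derivative (\<lambda>x. 0) (at x)"
    using assms supp_superset[of f] closed_supp[of f]
    by (intro frechet_derivative_cong_open[of "- supp f"]) auto
  then show ?thesis by simp
qed

lemma supp_frechet_derivative: "supp (\<lambda>x. frechet_derivative f (at x) b) \<subseteq> supp f"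
  by (rule supp_subsetI[OF closed_supp]) (use frechet_derivative_outside_supp in blast)

lemma Ck_compact_SucD:
  assumes "Ck_compact (Suc k) S f" "b \<in> Basis"
  shows "Ck_compact k S (\<lambda>x. frechet_derivative f (at x) b)"
proof -
  note s = supp_frechet_derivative[of f b]
  have "compact (supp (\<lambda>x. frechet_derivative f (at x) b))"
    using assms s compact_Int_closed[of "supp f" "supp (\<lambda>x. frechet_derivative f (at x) b)"]
    by (auto simp: Ck_compact_def supp_def Int_absorb1)
  then show ?thesis using assms s by (auto simp: Ck_compact_def)
qed

section \<open>A smooth function that is flat at the origin\<close>

definition flat :: "real \<Rightarrow> real" where
  "flat z = (if 0 < z then exp (- (1 / z)) else 0)"

text \<open>The derivatives of \<open>flat\<close> are polynomials in 1/z times exp (- 1/z). This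
  class is closed under differentiation, which lets the induction in \<open>Ck_flat\<close> go
  through.\<close>

definition flat_poly :: "real poly \<Rightarrow> real \<Rightarrow> real" where
  "flat_poly p z = (if 0 < z then poly p (1 / z) * exp (- (1 / z)) else 0)"

lemma poly_exp_decay: "((\<lambda>x. poly p x * exp (- x)) \<longlongrightarrow> (0::real)) at_top"
proof -
  have "((\<lambda>x. \<Sum>i\<le>degree p. coeff p i * (x ^ i / exp x)) \<longlongrightarrow> (\<Sum>i\<le>degree p. coeff p i * 0)) at_top"
    by (intro tendsto_intros tendsto_power_div_exp_0)
  then show ?thesis by (simp add: poly_altdef sum_distrib_right exp_minus divide_inverse mult.assoc)
qed

text \<open>For z > 0 the derivative of p (1/z) exp (- 1/z) is (p - p') (1/z) exp (- 1/z) / z^2; the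
  polynomial \<open>[:0, 0, 1:]\<close> is the factor X^2 in the variable X = 1/z.\<close>

lemma flat_poly_deriv:
  "(flat_poly p has_real_derivative flat_poly ([:0, 0, 1:] * (p - pderiv p)) z) (at z)"
proof (cases z "0 :: real" rule: linorder_cases)
  case less
  then have "((\<lambda>z. 0) has_real_derivative flat_poly ([:0, 0, 1:] * (p - pderiv p)) z) (at z)"
    by (simp add: flat_poly_def)
  then show ?thesis
    by (rule has_field_derivative_transform_within_open[of _ _ _ "{..<0}"]) (use less in \<open>auto simp: flat_poly_def\<close>)
next
  case greater
  have "((\<lambda>z. poly p (1 / z) * exp (- (1 / z))) has_real_derivative flat_poly ([:0, 0, 1:] * (p - pderiv p)) z) (at z)"
  proof -
    have i: "((\<lambda>z. 1 / z) has_real_derivative - (1 / z\<^sup>2)) (at z)"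
      using greater by (auto intro!: derivative_eq_intros simp: power2_eq_square)
    have e: "((\<lambda>z. exp (- (1 / z))) has_real_derivative exp (- (1 / z)) * - (- (1 / z\<^sup>2))) (at z)"
      by (rule DERIV_chain2[OF DERIV_exp DERIV_minus[OF i]])
    have "((\<lambda>z. poly p (1 / z)) has_real_derivative poly (pderiv p) (1 / z) * - (1 / z\<^sup>2)) (at z)"
      by (rule DERIV_chain2[OF poly_DERIV i])
    from DERIV_mult[OF this e] show ?thesis
      by (rule DERIV_cong) (use greater in \<open>simp add: flat_poly_def field_simps power2_eq_square\<close>)
  qed
  then show ?thesis
    by (rule has_field_derivative_transform_within_open[of _ _ _ "{0<..}"]) (use greater in \<open>auto simp: flat_poly_def\<close>)
next
  case equal
  have r: "((\<lambda>h. flat_poly p h / h) \<longlongrightarrow> 0) (at_right 0)"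
  proof -
    \<comment> \<open>At the origin the difference quotient with h = 1/x is x p(x) exp (- x), and
      \<open>pCons 0 p\<close> is the polynomial x p(x).\<close>
    have "((\<lambda>h. poly (pCons 0 p) (inverse h) * exp (- inverse h)) \<longlongrightarrow> (0::real)) (at_right 0)"
      by (rule filterlim_compose[OF poly_exp_decay filterlim_inverse_at_top_right])
    then show ?thesis
      by (rule Lim_transform_eventually)
        (auto simp: eventually_at_right_field flat_poly_def divide_simps inverse_eq_divide intro!: exI[of _ 1])
  qed
  have l: "((\<lambda>h. flat_poly p h / h) \<longlongrightarrow> 0) (at_left 0)"
    by (rule tendsto_eventually) (auto simp: eventually_at_left_field flat_poly_def intro!: exI[of _ "-1"])
  have "((\<lambda>h. flat_poly p h / h) \<longlongrightarrow> 0) (at 0)"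
    using l r by (simp add: filterlim_split_at)
  then show ?thesis
    unfolding equal DERIV_def by (simp add: flat_poly_def)
qed

lemma Ck_flat: "Ck k UNIV flat"
proof -
  have "Ck k UNIV (flat_poly p)" for p
  proof (induction k arbitrary: p)
    case 0
    then show ?case using flat_poly_deriv[of p]
      by (auto intro!: continuous_at_imp_continuous_on DERIV_isCont)
  next
    case (Suc k)
    show ?case by (rule Ck_real_Suc[OF flat_poly_deriv Suc.IH])
  qed
  moreover have "flat = flat_poly 1" by (auto simp: flat_def flat_poly_def fun_eq_iff)
  ultimately show ?thesis by metis
qed

lemma flat_bounds: "0 \<le> flat z" "flat z \<le> 1" "flat z = 0 \<longleftrightarrow> z \<le> 0"
  by (auto simp: flat_def)

text \<open>The shift by -1 is lost in the limit, but makes the approximants vanish for z \<le> 1/n;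
  products of them therefore have compact support inside an open box.\<close>

lemma flat_tendsto: "(\<lambda>n. flat (real n * z - 1)) \<longlonglongrightarrow> (if 0 < z then 1 else 0)"
proof (cases "0 < z")
  case True
  have i: "filterlim (\<lambda>n. z * real n - 1) at_top sequentially"
    using True
    by (auto intro!: filterlim_tendsto_add_at_top[OF tendsto_const, of _ _ "-1", simplified]
        filterlim_tendsto_pos_mult_at_top[OF tendsto_const _ filterlim_real_sequentially])
  have "(\<lambda>n. exp (- inverse (z * real n - 1))) \<longlonglongrightarrow> exp (- 0)"
    by (intro tendsto_exp tendsto_minus tendsto_inverse_0_at_top i)
  moreover have "\<forall>\<^sub>F n in sequentially. exp (- inverse (z * real n - 1)) = flat (real n * z - 1)"
    using filterlim_at_top_dense[THEN iffD1, OF i, rule_format, of 0]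
    by eventually_elim (auto simp: flat_def field_simps)
  ultimately show ?thesis using Lim_transform_eventually True by fastforce
next
  case False
  then have "real n * z \<le> 0" for n by (simp add: mult_nonneg_nonpos)
  then have "flat (real n * z - 1) = 0" for n using flat_bounds(3)[of "real n * z - 1"] by (smt (verit))
  then show ?thesis using False by simp
qed

section \<open>Smooth approximation of indicators of boxes\<close>

definition box_bump :: "nat \<Rightarrow> 'a::euclidean_space \<Rightarrow> 'a \<Rightarrow> 'a \<Rightarrow> real" where
  "box_bump n a b x = (\<Prod>i\<in>Basis. flat (real n * (x \<bullet> i - a \<bullet> i) - 1) * flat (real n * (b \<bullet> i - x \<bullet> i) - 1))"

lemma Ck_box_bump: "Ck k UNIV (box_bump n a b)"
proof -
  have l: "Ck k UNIV (\<lambda>x :: 'a. x \<bullet> i)" for i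
    by (rule Ck_bounded_linear[OF bounded_linear_inner_left])
  show ?thesis
    unfolding box_bump_def
    by (intro Ck_prod Ck_mult Ck_compose[OF _ Ck_flat] Ck_diff Ck_const l open_UNIV finite_Basis)
qed

lemma box_bump_bounds: "0 \<le> box_bump n a b x" "box_bump n a b x \<le> 1"
  unfolding box_bump_def
  by (auto intro!: prod_nonneg prod_le_1 mult_nonneg_nonneg mult_le_one simp: flat_bounds)

lemma box_bump_nonzero:
  assumes "box_bump n a b x \<noteq> 0"
  shows "x \<in> cbox (a + (1 / real n) *\<^sub>R One) (b - (1 / real n) *\<^sub>R One)" "0 < n"
proof -
  have *: "0 < real n * (x \<bullet> i - a \<bullet> i) - 1" "0 < real n * (b \<bullet> i - x \<bullet> i) - 1" if "i \<in> Basis" for i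
    using assms that unfolding box_bump_def by (auto simp: flat_bounds not_le)
  show n: "0 < n" using *(1)[OF SOME_Basis] by (cases n) auto
  show "x \<in> cbox (a + (1 / real n) *\<^sub>R One) (b - (1 / real n) *\<^sub>R One)"
    unfolding mem_box using * n by (auto simp: inner_add_left inner_diff_left field_simps less_imp_le)
qed

lemma shrunk_cbox_subset: "0 < n \<Longrightarrow> cbox (a + (1 / real n) *\<^sub>R One) (b - (1 / real n) *\<^sub>R One) \<subseteq> box a b"
  unfolding subset_iff mem_box by (auto simp: inner_add_left inner_diff_left algebra_simps) (smt (verit) divide_pos_pos of_nat_0_less_iff)+

lemma box_bump_eq_0: "x \<notin> box a b \<Longrightarrow> box_bump n a b x = 0"
  using box_bump_nonzero[of n a b x] shrunk_cbox_subset[of n a b] by blast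

lemma box_bump_tendsto: "(\<lambda>n. box_bump n a b x) \<longlonglongrightarrow> indicat_real (box a b) x"
proof -
  have "(\<lambda>n. box_bump n a b x) \<longlonglongrightarrow>
    (\<Prod>i\<in>Basis. (if 0 < x \<bullet> i - a \<bullet> i then 1 else 0) * (if 0 < b \<bullet> i - x \<bullet> i then 1 else 0))"
    unfolding box_bump_def by (intro tendsto_prod tendsto_mult flat_tendsto)
  moreover have "(\<Prod>i\<in>Basis. (if 0 < x \<bullet> i - a \<bullet> i then 1 else 0) * (if 0 < b \<bullet> i - x \<bullet> i then 1 else 0))
     = indicat_real (box a b) x"
  proof (cases "x \<in> box a b")
    case True
    then show ?thesis by (simp add: mem_box)
  next
    case False
    then obtain i where "i \<in> Basis" "\<not> (a \<bullet> i < x \<bullet> i \<and> x \<bullet> i < b \<bullet> i)" by (auto simp: mem_box)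
    then show ?thesis using False by (subst prod_zero) auto
  qed
  ultimately show ?thesis by simp
qed

lemma box_bump_supp:
  "compact (supp (box_bump n a b))" "supp (box_bump n a b) \<subseteq> box a b"
proof -
  have "compact (supp (box_bump n a b)) \<and> supp (box_bump n a b) \<subseteq> box a b"
  \<comment> \<open>For n = 0 the term \<open>1 / real n\<close> is 0 and does not shrink the box;
    there the function is identically zero because \<open>flat (-1)\<close> is 0.\<close>
  proof (cases "n = 0")
    case True
    then have "box_bump n a b = (\<lambda>x. 0)" using box_bump_nonzero(2)[of n a b] by auto
    then show ?thesis by (simp add: supp_def)
  next
    case False
    then show ?thesis
      using compact_suppI[OF compact_cbox box_bump_nonzero(1)] shrunk_cbox_subset[of n a b]
        supp_subsetI[OF closed_cbox box_bump_nonzero(1)] by blast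
  qed
  then show "compact (supp (box_bump n a b))" "supp (box_bump n a b) \<subseteq> box a b" by auto
qed

section \<open>Square-integrable functions\<close>

lemma continuous_compact_supp_bound:
  assumes "continuous_on UNIV f" "compact (supp f)"
  shows "\<exists>B\<ge>0. \<forall>x. \<bar>f x\<bar> \<le> B"
proof -
  have "bounded (f ` supp f)"
    using assms by (intro compact_imp_bounded compact_continuous_image) (auto intro: continuous_on_subset)
  then obtain B where B: "\<And>x. x \<in> supp f \<Longrightarrow> \<bar>f x\<bar> \<le> B" unfolding bounded_iff by auto
  have "\<bar>f x\<bar> \<le> max 0 B" for x
    using B[of x] supp_superset[of f x] by (cases "f x = 0") auto
  then show ?thesis by (intro exI[of _ "max 0 B"]) simp
qed

lemma continuous_compact_supp_integrable:
  assumes "continuous_on UNIV f" "compact (supp f)"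
  shows "integrable lborel f"
proof -
  have "integrable lborel (\<lambda>x. indicator (supp f) x *\<^sub>R f x)"
    using assms by (intro borel_integrable_compact) (auto intro: continuous_on_subset)
  moreover have "(\<lambda>x. indicator (supp f) x *\<^sub>R f x) = f"
    using supp_superset[of f] by (auto simp: indicator_def fun_eq_iff)
  ultimately show ?thesis by metis
qed

text \<open>The difference quotients of \<open>g\<close> have integral zero by translation invariance.\<close>

lemma integral_partial_derivative_zero:
  fixes g :: "'a::euclidean_space \<Rightarrow> real"
  assumes g: "Ck 1 UNIV g" and K: "compact (supp g)" and b: "b \<in> Basis"
  shows "(LINT x|lborel. frechet_derivative g (at x) b) = 0"
proof -
  let ?D = "\<lambda>x. frechet_derivative g (at x) b"
  have gC: "continuous_on UNIV g" using Ck_SucD[of 0 UNIV g] g by simp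
  have DC: "continuous_on UNIV ?D" using g b by simp
  have DK: "compact (supp ?D)"
    using K supp_frechet_derivative[of g b] compact_Int_closed[of "supp g" "supp ?D"] closed_supp[of ?D]
    by (simp add: Int_absorb1)
  obtain B where B: "0 \<le> B" "\<And>x. \<bar>?D x\<bar> \<le> B"
    using continuous_compact_supp_bound[OF DC DK] by blast
  obtain R where R: "\<And>x. x \<in> supp g \<Longrightarrow> norm x \<le> R"
    using compact_imp_bounded[OF K] unfolding bounded_iff by auto
  have gi: "integrable lborel g" by (rule continuous_compact_supp_integrable[OF gC K])
  have line: "((\<lambda>r. g (x + r *\<^sub>R b)) has_real_derivative ?D (x + r *\<^sub>R b)) (at r)" for x r
  proof -
    have gd: "(g has_derivative frechet_derivative g (at (x + r *\<^sub>R b))) (at (x + r *\<^sub>R b))"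
      using Ck_Suc_has_derivative[of 0 UNIV g] g by simp
    have "((\<lambda>r. x + r *\<^sub>R b) has_derivative (\<lambda>h. h *\<^sub>R b)) (at r)"
      by (auto intro!: derivative_eq_intros)
    from diff_chain_at[OF this gd] show ?thesis
      using linear_scale[OF has_derivative_linear[OF gd]]
      by (simp add: o_def has_field_derivative_def mult.commute[of _ "?D _"])
  qed
  define s where "s n = 1 / real (Suc n)" for n
  have s: "0 < s n" "s n \<le> 1" for n by (auto simp: s_def divide_simps)
  have s0: "s \<longlonglongrightarrow> 0" unfolding s_def using LIMSEQ_inverse_real_of_nat by (simp add: inverse_eq_divide)
  define q where "q n x = (g (x + s n *\<^sub>R b) - g x) / s n" for n x
  have "(\<lambda>n. LINT x|lborel. q n x) \<longlonglongrightarrow> (LINT x|lborel. ?D x)"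
  proof (rule integral_dominated_convergence[where w="\<lambda>x. B * indicator (cball 0 (R + 1)) x"])
    show "?D \<in> borel_measurable lborel" using DC borel_measurable_continuous_onI by simp
    show "q n \<in> borel_measurable lborel" for n
      unfolding q_def using gi integrable_translate[OF gi, of "s n *\<^sub>R b"] by simp
    \<comment> \<open>The support lies in the ball of radius R and the steps have length at most 1,
      so the quotients live in the ball of radius R + 1; there the mean value theorem bounds them by
      the supremum B of the partial derivative.\<close>
    show "integrable lborel (\<lambda>x::'a. B * indicator (cball 0 (R + 1)) x :: real)"
      using emeasure_bounded_finite[of "cball (0::'a) (R+1)"] by (simp add: integrable_indicator_iff)
    show "AE x in lborel. (\<lambda>n. q n x) \<longlonglongrightarrow> ?D x"
    proof (rule AE_I2)
      fix x :: 'a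
      have "((\<lambda>h. (g (x + h *\<^sub>R b) - g x) / h) \<longlongrightarrow> ?D x) (at 0)"
        using line[of x 0] unfolding DERIV_def by simp
      moreover have "filterlim s (at 0) sequentially"
        using s0 s(1) by (auto simp: filterlim_at less_imp_neq[THEN not_sym] intro!: always_eventually)
      ultimately show "(\<lambda>n. q n x) \<longlonglongrightarrow> ?D x"
        unfolding q_def by (rule filterlim_compose)
    qed
    show "AE x in lborel. norm (q n x) \<le> B * indicator (cball 0 (R + 1)) x" for n
    proof (rule AE_I2)
      fix x :: 'a
      show "norm (q n x) \<le> B * indicator (cball 0 (R + 1)) x"
      proof (cases "norm x \<le> R + 1")
        case True
        obtain z where z: "g (x + s n *\<^sub>R b) - g (x + 0 *\<^sub>R b) = (s n - 0) * ?D (x + z *\<^sub>R b)"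
          using MVT2[OF s(1)[of n], of "\<lambda>r. g (x + r *\<^sub>R b)" "\<lambda>r. ?D (x + r *\<^sub>R b)"] line by blast
        then have "q n x = ?D (x + z *\<^sub>R b)" using s(1)[of n] by (simp add: q_def)
        then show ?thesis using True B(2) by simp
      next
        case False
        have "norm x \<le> norm (x + s n *\<^sub>R b) + norm (s n *\<^sub>R b)"
          by (metis add_diff_cancel_right' norm_triangle_ineq4)
        moreover have "norm (s n *\<^sub>R b) \<le> 1" using s[of n] b by simp
        ultimately have "norm (x + s n *\<^sub>R b) > R" using False by simp
        then have "g (x + s n *\<^sub>R b) = 0" using R[of "x + s n *\<^sub>R b"] supp_superset[of g "x + s n *\<^sub>R b"] by force
        moreover have "g x = 0" using R[of x] supp_superset[of g x] False by force
        ultimately show ?thesis using False by (simp add: q_def)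
      qed
    qed
  qed
  moreover have "(LINT x|lborel. q n x) = 0" for n
    unfolding q_def using gi integrable_translate[OF gi, of "s n *\<^sub>R b"] integral_translate[of g "s n *\<^sub>R b"]
    by (simp add: borel_measurable_integrable)
  ultimately have "(\<lambda>n::nat. 0) \<longlonglongrightarrow> (LINT x|lborel. ?D x)" by simp
  then show ?thesis by (simp add: LIMSEQ_const_iff)
qed

text \<open>L2 over the whole space. Functions on a subset enter after multiplication with its
  indicator, so that translations in time never leave the domain of definition.\<close>

definition square_integrable :: "('a::euclidean_space \<Rightarrow> real) \<Rightarrow> bool" where
  "square_integrable f \<longleftrightarrow> f \<in> borel_measurable lborel \<and> integrable lborel (\<lambda>x. (f x)\<^sup>2)"

section \<open>Inequalities and limits in L2\<close>

lemma square_integrableD: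
  assumes "square_integrable f"
  shows "f \<in> borel_measurable lborel" "f \<in> borel_measurable borel" "integrable lborel (\<lambda>x. (f x)\<^sup>2)"
  using assms by (auto simp: square_integrable_def)

lemma square_integrable_bound:
  assumes "square_integrable g" "f \<in> borel_measurable lborel" "\<And>x. \<bar>f x\<bar> \<le> \<bar>g x\<bar>"
  shows "square_integrable f"
  unfolding square_integrable_def
  using assms(2,3)
  by (auto intro!: Bochner_Integration.integrable_bound[OF square_integrableD(3)[OF assms(1)]] AE_I2 simp: abs_le_square_iff)

lemma square_integrable_cmult: "square_integrable f \<Longrightarrow> square_integrable (\<lambda>x. c * f x)"
  by (auto simp: square_integrable_def power_mult_distrib)

lemma square_integrable_bounded_mult:
  assumes "square_integrable f" "q \<in> borel_measurable lborel" "\<And>x. \<bar>q x\<bar> \<le> B"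
  shows "square_integrable (\<lambda>x. q x * f x)"
proof (rule square_integrable_bound)
  show "square_integrable (\<lambda>x. B * f x)" using assms(1) by (rule square_integrable_cmult)
  show "(\<lambda>x. q x * f x) \<in> borel_measurable lborel" using assms(2) square_integrableD(1)[OF assms(1)] by simp
  show "\<bar>q x * f x\<bar> \<le> \<bar>B * f x\<bar>" for x
    using assms(3)[of x] by (auto simp: abs_mult intro!: mult_right_mono)
qed

lemma square_integrable_add:
  assumes "square_integrable f" "square_integrable g"
  shows "square_integrable (\<lambda>x. f x + g x)"
proof -
  have "integrable lborel (\<lambda>x. 2 * (f x)\<^sup>2 + 2 * (g x)\<^sup>2)"
    using assms by (simp add: square_integrable_def)
  then have "integrable lborel (\<lambda>x. (f x + g x)\<^sup>2)"
  proof (rule Bochner_Integration.integrable_bound)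
    show "AE x in lborel. norm ((f x + g x)\<^sup>2) \<le> norm (2 * (f x)\<^sup>2 + 2 * (g x)\<^sup>2)"
    proof (rule AE_I2)
      fix x show "norm ((f x + g x)\<^sup>2) \<le> norm (2 * (f x)\<^sup>2 + 2 * (g x)\<^sup>2)"
        using sum_squares_bound[of "f x" "g x"] by (simp add: power2_sum[symmetric]) (simp add: power2_sum)
    qed
  qed (use assms in \<open>auto simp: square_integrable_def\<close>)
  then show ?thesis using assms by (auto simp: square_integrable_def)
qed

lemma square_integrable_diff:
  "square_integrable f \<Longrightarrow> square_integrable g \<Longrightarrow> square_integrable (\<lambda>x. f x - g x)"
  using square_integrable_add[of f "\<lambda>x. (-1) * g x"] square_integrable_cmult[of g "-1"] by simp

lemma square_integrable_translate:
  "square_integrable f \<Longrightarrow> square_integrable (\<lambda>x. f (x + c))"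
  unfolding square_integrable_def using integrable_translate[of "\<lambda>x. (f x)\<^sup>2" c] by auto

lemma integral_square_translate:
  "square_integrable f \<Longrightarrow> (LINT x|lborel. (f (x + c))\<^sup>2) = (LINT x|lborel. (f x)\<^sup>2)"
  by (rule integral_translate[of "\<lambda>x. (f x)\<^sup>2" c]) (auto simp: square_integrable_def)

lemma square_integrable_mult:
  assumes "square_integrable f" "square_integrable g"
  shows "integrable lborel (\<lambda>x. f x * g x)"
proof (rule Bochner_Integration.integrable_bound)
  show "integrable lborel (\<lambda>x. (f x)\<^sup>2 + (g x)\<^sup>2)" using assms by (simp add: square_integrable_def)
  show "AE x in lborel. norm (f x * g x) \<le> norm ((f x)\<^sup>2 + (g x)\<^sup>2)"
  proof (rule AE_I2)
    fix x show "norm (f x * g x) \<le> norm ((f x)\<^sup>2 + (g x)\<^sup>2)"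
      using sum_squares_bound[of "\<bar>f x\<bar>" "\<bar>g x\<bar>"] zero_le_power2[of "f x"] zero_le_power2[of "g x"]
        mult_nonneg_nonneg[of "\<bar>f x\<bar>" "\<bar>g x\<bar>"]
      by (simp only: abs_mult real_norm_def power2_abs)
  qed
qed (use assms in \<open>auto simp: square_integrable_def\<close>)

text \<open>The quadratic form
  \<open>\<integral> (s \<bar>f\<bar> - r \<bar>g\<bar>)\<^sup>2\<close> is nonnegative; its value
  at s = \<integral> g^2 and r = \<integral> \<bar>f g\<bar> is the inequality multiplied by
  \<integral> g^2.\<close>

lemma Cauchy_Schwarz_integral:
  assumes "square_integrable f" "square_integrable g"
  shows "(LINT x|lborel. \<bar>f x * g x\<bar>)\<^sup>2 \<le> (LINT x|lborel. (f x)\<^sup>2) * (LINT x|lborel. (g x)\<^sup>2)"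
proof -
  let ?A = "LINT x|lborel. (f x)\<^sup>2" and ?B = "LINT x|lborel. (g x)\<^sup>2" and ?I = "LINT x|lborel. \<bar>f x * g x\<bar>"
  have i: "integrable lborel (\<lambda>x. \<bar>f x * g x\<bar>)" "integrable lborel (\<lambda>x. (f x)\<^sup>2)" "integrable lborel (\<lambda>x. (g x)\<^sup>2)"
    using square_integrable_mult[OF assms] assms by (auto simp: square_integrable_def)
  have q: "0 \<le> s\<^sup>2 * ?A - 2 * s * r * ?I + r\<^sup>2 * ?B" for s r
  proof -
    have "0 \<le> (LINT x|lborel. (s * \<bar>f x\<bar> - r * \<bar>g x\<bar>)\<^sup>2)" by simp
    also have "\<dots> = (LINT x|lborel. s\<^sup>2 * (f x)\<^sup>2 - 2 * s * r * \<bar>f x * g x\<bar> + r\<^sup>2 * (g x)\<^sup>2)"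
      by (intro Bochner_Integration.integral_cong refl) (simp add: power2_diff power_mult_distrib abs_mult)
    also have "\<dots> = s\<^sup>2 * ?A - 2 * s * r * ?I + r\<^sup>2 * ?B" using i by simp
    finally show ?thesis .
  qed
  show ?thesis
  proof (cases "?B = 0")
    case True
    have I0: "0 \<le> ?I" by simp
    have "?I = 0"
    proof (rule ccontr)
      assume "?I \<noteq> 0"
      then have "?I > 0" using I0 by linarith
      \<comment> \<open>With \<integral> g^2 = 0 the form is affine in r, and this choice of r would
        make it equal to -1.\<close>
      then have "?A < 2 * ((?A + 1) / (2 * ?I)) * ?I" by simp
      then show False using q[of 1 "(?A + 1) / (2 * ?I)"] True by simp
    qed
    then show ?thesis using True by simp
  next
    case False
    then have B: "?B > 0" using integral_nonneg_AE[of "\<lambda>x. (g x)\<^sup>2" lborel] by (simp add: less_le)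
    have "0 \<le> ?B * (?B * ?A - ?I\<^sup>2)"
      using q[of ?B ?I] by (simp add: algebra_simps power2_eq_square)
    then show ?thesis using B by (simp add: zero_le_mult_iff mult.commute)
  qed
qed

text \<open>By Cauchy-Schwarz; the second factor may vary with n as long as its norm stays
  bounded.\<close>

lemma L2_convergence_mult_fixed:
  assumes f: "\<And>n. square_integrable (f n)" "(\<lambda>n. LINT x|lborel. (f n x)\<^sup>2) \<longlonglongrightarrow> 0"
    and g: "\<And>n. square_integrable (g n)" "\<And>n. (LINT x|lborel. (g n x)\<^sup>2) \<le> C"
  shows "(\<lambda>n. LINT x|lborel. \<bar>f n x * g n x\<bar>) \<longlonglongrightarrow> 0"
proof (rule tendsto_0_of_abs_le)
  show "\<bar>LINT x|lborel. \<bar>f n x * g n x\<bar>\<bar> \<le> sqrt ((LINT x|lborel. (f n x)\<^sup>2) * C)" for n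
  proof -
    have "(LINT x|lborel. \<bar>f n x * g n x\<bar>)\<^sup>2 \<le> (LINT x|lborel. (f n x)\<^sup>2) * (LINT x|lborel. (g n x)\<^sup>2)"
      by (rule Cauchy_Schwarz_integral[OF f(1) g(1)])
    also have "\<dots> \<le> (LINT x|lborel. (f n x)\<^sup>2) * C" using g(2) by (intro mult_left_mono) auto
    finally show ?thesis by (simp add: real_le_rsqrt)
  qed
  show "(\<lambda>n. sqrt ((LINT x|lborel. (f n x)\<^sup>2) * C)) \<longlonglongrightarrow> 0"
    using tendsto_real_sqrt[OF tendsto_mult_right[OF f(2), of C]] by simp
qed

text \<open>Strong times strong convergence in L2, with weights that are bounded and converge
  pointwise. The difference from F G splits into three products containing a null sequence, handled
  by Cauchy-Schwarz; the change of the weight in front of F G is handled by dominated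
  convergence.\<close>

lemma L2_convergence_product:
  fixes q :: "'a::euclidean_space \<Rightarrow> real"
  assumes f: "\<And>n. square_integrable (f n)" "square_integrable F" "(\<lambda>n. LINT x|lborel. (f n x - F x)\<^sup>2) \<longlonglongrightarrow> 0"
    and g: "\<And>n. square_integrable (g n)" "square_integrable G" "(\<lambda>n. LINT x|lborel. (g n x - G x)\<^sup>2) \<longlonglongrightarrow> 0"
    and q: "\<And>n. qn n \<in> borel_measurable lborel" "\<And>n x. \<bar>qn n x\<bar> \<le> B" "q \<in> borel_measurable lborel"
      "\<And>x. (\<lambda>n. qn n x) \<longlonglongrightarrow> q x"
  shows "(\<lambda>n. LINT x|lborel. qn n x * (f n x * g n x)) \<longlonglongrightarrow> (LINT x|lborel. q x * (F x * G x))"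
proof -
  have B0: "0 \<le> B" using q(2)[of 0 undefined] by simp
  have qB: "\<bar>q x\<bar> \<le> B" for x
    by (rule tendsto_upperbound[OF tendsto_rabs[OF q(4)]]) (use q(2) in auto)
  have df: "square_integrable (\<lambda>x. f n x - F x)" and dg: "square_integrable (\<lambda>x. g n x - G x)" for n
    using f g by (auto intro: square_integrable_diff)
  note int = square_integrable_mult[OF df dg] square_integrable_mult[OF df g(2)] square_integrable_mult[OF dg f(2)]
    square_integrable_mult[OF f(1) g(1)] square_integrable_mult[OF f(2) g(2)]
  have bint: "integrable lborel (\<lambda>x. qn n x * h x)" if "integrable lborel h" for h n
    by (rule Bochner_Integration.integrable_bound[of _ "\<lambda>x. B * h x"])
      (use that q(1,2) B0 in \<open>auto simp: abs_mult mult_right_mono\<close>)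
  have Dcon: "(\<lambda>n. LINT x|lborel. qn n x * (F x * G x)) \<longlonglongrightarrow> (LINT x|lborel. q x * (F x * G x))"
  proof (rule integral_dominated_convergence[where w="\<lambda>x. B * \<bar>F x * G x\<bar>"])
    show "AE x in lborel. norm (qn n x * (F x * G x)) \<le> B * \<bar>F x * G x\<bar>" for n
      using q(2) by (auto simp: abs_mult intro!: mult_right_mono)
    show "AE x in lborel. (\<lambda>n. qn n x * (F x * G x)) \<longlonglongrightarrow> q x * (F x * G x)"
      using q(4) by (auto intro!: tendsto_mult_right)
    show "integrable lborel (\<lambda>x. B * \<bar>F x * G x\<bar>)" using int by simp
  qed (use q f g in \<open>auto simp: square_integrable_def\<close>)
  let ?E = "\<lambda>n. (LINT x|lborel. \<bar>(f n x - F x) * (g n x - G x)\<bar>) + (LINT x|lborel. \<bar>(f n x - F x) * G x\<bar>)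
     + (LINT x|lborel. \<bar>(g n x - G x) * F x\<bar>)"
  obtain Cg where Cg: "\<And>n. (LINT x|lborel. (g n x - G x)\<^sup>2) \<le> Cg"
    using Bseq_eq_bounded convergent_imp_Bseq[OF convergentI[OF g(3)]] unfolding Bseq_def
    by (metis abs_le_D1 real_norm_def)
  have E: "?E \<longlonglongrightarrow> 0 + 0 + 0"
    by (intro tendsto_add L2_convergence_mult_fixed[where C=Cg] L2_convergence_mult_fixed[where C="LINT x|lborel. (G x)\<^sup>2"]
       L2_convergence_mult_fixed[where C="LINT x|lborel. (F x)\<^sup>2"] df dg f(2,3) g(2,3) Cg order_refl)
  have le: "\<bar>(LINT x|lborel. qn n x * (f n x * g n x)) - (LINT x|lborel. qn n x * (F x * G x))\<bar> \<le> B * ?E n" for n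
  proof -
    have "\<bar>(LINT x|lborel. qn n x * (f n x * g n x)) - (LINT x|lborel. qn n x * (F x * G x))\<bar>
      = \<bar>LINT x|lborel. qn n x * (f n x * g n x) - qn n x * (F x * G x)\<bar>"
      using bint[OF int(4)] bint[OF int(5)] by simp
    also have "\<dots> \<le> (LINT x|lborel. \<bar>qn n x * (f n x * g n x) - qn n x * (F x * G x)\<bar>)"
      by (rule integral_abs_bound)
    also have "\<dots> \<le> (LINT x|lborel. B * (\<bar>(f n x - F x) * (g n x - G x)\<bar> + \<bar>(f n x - F x) * G x\<bar> + \<bar>(g n x - G x) * F x\<bar>))"
    proof (rule integral_mono)
      fix x
      have "qn n x * (f n x * g n x) - qn n x * (F x * G x) =
        qn n x * ((f n x - F x) * (g n x - G x) + (f n x - F x) * G x + (g n x - G x) * F x)"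
        by (simp add: algebra_simps)
      also have "\<bar>\<dots>\<bar> \<le> B * (\<bar>(f n x - F x) * (g n x - G x)\<bar> + \<bar>(f n x - F x) * G x\<bar> + \<bar>(g n x - G x) * F x\<bar>)"
        unfolding abs_mult[of "qn n x"] using q(2)[of n x] by (intro mult_mono) auto
      finally show "\<bar>qn n x * (f n x * g n x) - qn n x * (F x * G x)\<bar> \<le> \<dots>" .
    next
      show "integrable lborel (\<lambda>x. \<bar>qn n x * (f n x * g n x) - qn n x * (F x * G x)\<bar>)"
        by (intro integrable_abs Bochner_Integration.integrable_diff bint[OF int(4)] bint[OF int(5)])
      show "integrable lborel (\<lambda>x. B * (\<bar>(f n x - F x) * (g n x - G x)\<bar> + \<bar>(f n x - F x) * G x\<bar> + \<bar>(g n x - G x) * F x\<bar>))"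
        by (intro integrable_mult_right integrable_abs Bochner_Integration.integrable_add int(1-3))
    qed
    also have "\<dots> = B * ?E n"
      using int(1)[of n n] int(2)[of n] int(3)[of n] by simp
    finally show ?thesis .
  qed
  have "(\<lambda>n. (LINT x|lborel. qn n x * (f n x * g n x)) - (LINT x|lborel. qn n x * (F x * G x))) \<longlonglongrightarrow> 0"
    by (rule tendsto_0_of_abs_le[OF le]) (use tendsto_mult_left[OF E, of B] in simp)
  from tendsto_add[OF this Dcon] show ?thesis by simp
qed

text \<open>The positive and the negative part of \<open>f\<close> are densities of two measures
  that agree on boxes, an intersection-stable generator of the Borel sets. Hence the measures agree,
  and then the densities almost everywhere.\<close>

lemma AE_zero_if_box_integrals_zero:
  fixes f :: "'a::euclidean_space \<Rightarrow> real"
  assumes f: "integrable lborel f" and z: "\<And>a b. (LINT x|lborel. indicator (box a b) x * f x) = 0"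
  shows "AE x in lborel. f x = 0"
proof -
  let ?p = "\<lambda>x. max 0 (f x)" and ?m = "\<lambda>x. max 0 (- f x)"
  have i: "integrable lborel ?p" "integrable lborel ?m" using f by auto
  have ii: "integrable lborel (\<lambda>x. indicator A x * ?p x)" "integrable lborel (\<lambda>x. indicator A x * ?m x)"
    if "A \<in> sets borel" for A
    using integrable_mult_indicator[OF _ i(1), of A] integrable_mult_indicator[OF _ i(2), of A] that by auto
  have em: "emeasure (density lborel (\<lambda>x. ennreal (h x))) A = ennreal (LINT x|lborel. indicator A x * h x)"
    if "A \<in> sets borel" "integrable lborel (\<lambda>x. indicator A x * h x)" "\<And>x. 0 \<le> h x" "h \<in> borel_measurable lborel" for h A
  proof -
    have "emeasure (density lborel (\<lambda>x. ennreal (h x))) A = (\<integral>\<^sup>+x. ennreal (indicator A x * h x) \<partial>lborel)"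
      using that by (subst emeasure_density) (auto intro!: nn_integral_cong simp: indicator_def)
    also have "\<dots> = ennreal (LINT x|lborel. indicator A x * h x)"
      using that by (intro nn_integral_eq_integral) auto
    finally show ?thesis .
  qed
  have pm: "(LINT x|lborel. indicator (box a b) x * ?p x) = (LINT x|lborel. indicator (box a b) x * ?m x)" for a b :: 'a
  proof -
    have "0 = (LINT x|lborel. indicator (box a b) x * ?p x - indicator (box a b) x * ?m x)"
      by (subst z[of a b, symmetric], intro Bochner_Integration.integral_cong) (auto simp: max_def)
    then show ?thesis using ii[of "box a b"] by simp
  qed
  have eq: "density lborel (\<lambda>x. ennreal (?p x)) = density lborel (\<lambda>x. ennreal (?m x))"
  proof (rule measure_eqI_generator_eq[where E="range (\<lambda>(a, b). box a b::'a set)" and \<Omega>=UNIV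
        and A="\<lambda>n. box (- real n *\<^sub>R One) (real n *\<^sub>R One)"])
    show "Int_stable (range (\<lambda>(a, b). box a b::'a set))" by (auto simp: Int_stable_def box_Int_box)
    show "sets (density lborel (\<lambda>x. ennreal (?p x))) = sigma_sets UNIV (range (\<lambda>(a, b). box a b::'a set))"
      "sets (density lborel (\<lambda>x. ennreal (?m x))) = sigma_sets UNIV (range (\<lambda>(a, b). box a b::'a set))"
      by (simp_all add: borel_eq_box)
    show "(\<Union>n. box (- real n *\<^sub>R One) (real n *\<^sub>R One)) = (UNIV :: 'a set)"
      using UN_box_eq_UNIV by simp
    show "emeasure (density lborel (\<lambda>x. ennreal (?p x))) X = emeasure (density lborel (\<lambda>x. ennreal (?m x))) X"
      if "X \<in> range (\<lambda>(a, b). box a b::'a set)" for X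
      using that pm i em[of _ ?p] em[of _ ?m] ii by auto
    show "emeasure (density lborel (\<lambda>x. ennreal (?p x))) (box (- real n *\<^sub>R One) (real n *\<^sub>R One)) \<noteq> \<infinity>" for n
      using i em[of _ ?p] ii by simp
  qed auto
  have "AE x in lborel. ?p x = ?m x"
  proof (rule density_unique_real[OF i])
    fix A :: "'a set" assume "A \<in> sets lborel"
    then have A: "A \<in> sets borel" by simp
    have "ennreal (LINT x|lborel. indicator A x * ?p x) = ennreal (LINT x|lborel. indicator A x * ?m x)"
      using em[OF A, of ?p] em[OF A, of ?m] ii[OF A] i eq by simp
    then show "set_lebesgue_integral lborel A ?p = set_lebesgue_integral lborel A ?m"
      by (simp add: set_lebesgue_integral_def)
  qed
  then show ?thesis by eventually_elim (auto simp: max_def split: if_splits)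
qed

text \<open>Substitute for a trace at time 0: the mass of an integrable function in a vanishing slab
  tends to 0, although its mean over the slab need not converge. The remainders at the initial time
  are all brought into this form.\<close>

lemma thin_slab_integral_tendsto_0:
  fixes F :: "real \<times> 'a::euclidean_space \<Rightarrow> real"
  assumes F: "integrable lborel F" and d: "\<delta> \<longlonglongrightarrow> 0"
  shows "(\<lambda>n. LINT z|lborel. indicator {0<..<\<delta> n} (fst z) * \<bar>F z\<bar>) \<longlonglongrightarrow> 0"
proof -
  have "(\<lambda>n. LINT z|lborel. indicator {0<..<\<delta> n} (fst z) * \<bar>F z\<bar>) \<longlonglongrightarrow> (LINT z|(lborel :: (real \<times> 'a) measure). 0)"
  proof (rule integral_dominated_convergence[where w="\<lambda>z. \<bar>F z\<bar>"])
    show "AE z in lborel. (\<lambda>n. indicator {0<..<\<delta> n} (fst z) * \<bar>F z\<bar>) \<longlonglongrightarrow> 0"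
    proof (rule AE_I2)
      fix z :: "real \<times> 'a"
      show "(\<lambda>n. indicator {0<..<\<delta> n} (fst z) * \<bar>F z\<bar>) \<longlonglongrightarrow> 0"
      proof (cases "0 < fst z")
        case True
        have "\<forall>\<^sub>F n in sequentially. \<delta> n < fst z" using order_tendstoD(2)[OF d True] .
        then show ?thesis by (intro tendsto_eventually) (auto elim!: eventually_mono)
      qed simp
    qed
    show "(\<lambda>z. indicator {0<..<\<delta> n} (fst z) * \<bar>F z\<bar>) \<in> borel_measurable lborel" for n
      using F by (auto simp: borel_prod[symmetric] intro!: borel_measurable_times borel_measurable_indicator'
          dest!: borel_measurable_integrable)
  qed (use F in \<open>auto simp: indicator_def\<close>)
  then show ?thesis by simp
qed

section \<open>Primitives in time\<close>

lemma lborel_pair_integral: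
  fixes F :: "'a::euclidean_space \<times> 'b::euclidean_space \<Rightarrow> real"
  assumes "integrable lborel F"
  shows "(LINT z|lborel. F z) = (LINT x|lborel. LINT y|lborel. F (x, y))"
    and "(LINT z|lborel. F z) = (LINT y|lborel. LINT x|lborel. F (x, y))"
    and "AE x in lborel. integrable lborel (\<lambda>y. F (x, y))"
    and "AE y in lborel. integrable lborel (\<lambda>x. F (x, y))"
    and "integrable lborel (\<lambda>x. LINT y|lborel. F (x, y))"
    and "integrable lborel (\<lambda>y. LINT x|lborel. F (x, y))"
proof -
  have i: "integrable (lborel \<Otimes>\<^sub>M lborel) (case_prod (\<lambda>x y. F (x, y)))"
    using assms by (simp add: lborel_prod)
  show "(LINT z|lborel. F z) = (LINT x|lborel. LINT y|lborel. F (x, y))"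
    using lborel_pair.integral_fst[OF i] by (simp add: lborel_prod)
  show "(LINT z|lborel. F z) = (LINT y|lborel. LINT x|lborel. F (x, y))"
    using lborel_pair.integral_snd[OF i] by (simp add: lborel_prod)
  show "AE x in lborel. integrable lborel (\<lambda>y. F (x, y))"
    using lborel_pair.AE_integrable_fst[OF i] by simp
  show "AE y in lborel. integrable lborel (\<lambda>x. F (x, y))"
    using lborel_pair.AE_integrable_snd[OF i] by simp
  show "integrable lborel (\<lambda>x. LINT y|lborel. F (x, y))"
    using lborel_pair.integrable_fst[OF i] by simp
  show "integrable lborel (\<lambda>y. LINT x|lborel. F (x, y))"
    using lborel_pair.integrable_snd[OF i] by simp
qed

lemma lborel_swap:
  "distr lborel lborel (\<lambda>(x, y). (y, x)) = (lborel :: ('a::euclidean_space \<times> 'b::euclidean_space) measure)"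
  using lborel_pair.distr_pair_swap[where 'a='a and 'b='b] unfolding lborel_prod by simp

text \<open>The second conclusion is the first one for the swapped product, which is again Lebesgue
  measure.\<close>

lemma AE_lborel_pair:
  fixes P :: "'a::euclidean_space \<times> 'b::euclidean_space \<Rightarrow> bool"
  assumes "AE z in lborel. P z"
  shows "AE x in lborel. AE y in lborel. P (x, y)" "AE y in lborel. AE x in lborel. P (x, y)"
proof -
  show "AE x in lborel. AE y in lborel. P (x, y)"
    by (rule lborel_pair.AE_pair[of P, unfolded lborel_prod, OF assms])
  have "AE z in distr lborel lborel (\<lambda>(x, y). (y, x)). P z"
    using assms unfolding lborel_swap .
  then have "AE z in (lborel :: ('b \<times> 'a) measure). P (snd z, fst z)"
    by (auto dest!: AE_distrD[rotated] simp: case_prod_beta borel_prod[symmetric])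
  then show "AE y in lborel. AE x in lborel. P (x, y)"
    using lborel_pair.AE_pair[of "\<lambda>z. P (snd z, fst z)", unfolded lborel_prod] by simp
qed

lemma AE_lborel_fst:
  assumes "AE x in lborel. P (x :: 'a::euclidean_space)"
  shows "AE z in (lborel :: ('a \<times> 'b::euclidean_space) measure). P (fst z)"
proof -
  obtain N where N: "{x. \<not> P x} \<subseteq> N" "N \<in> null_sets lborel"
    using assms by (auto elim!: AE_E simp: null_sets_def)
  have "N \<times> (UNIV :: 'b set) \<in> null_sets (lborel \<Otimes>\<^sub>M lborel)"
    using N(2) by (auto simp: null_sets_def lborel.emeasure_pair_measure_Times)
  then show ?thesis using N(1) by (intro AE_I'[of "N \<times> UNIV"]) (auto simp: lborel_prod)
qed

lemma AE_lborel_snd: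
  assumes "AE y in lborel. P (y :: 'b::euclidean_space)"
  shows "AE z in (lborel :: ('a::euclidean_space \<times> 'b) measure). P (snd z)"
proof -
  obtain N where N: "{x. \<not> P x} \<subseteq> N" "N \<in> null_sets lborel"
    using assms by (auto elim!: AE_E simp: null_sets_def)
  have "(UNIV :: 'a set) \<times> N \<in> null_sets (lborel \<Otimes>\<^sub>M lborel)"
    using N(2) by (auto simp: null_sets_def lborel.emeasure_pair_measure_Times)
  then show ?thesis using N(1) by (intro AE_I'[of "UNIV \<times> N"]) (auto simp: lborel_prod)
qed

lemma borel_measurable_prod_comp:
  fixes f :: "'a::euclidean_space \<times> 'b::euclidean_space \<Rightarrow> real"
  assumes "f \<in> borel_measurable lborel" "g \<in> borel_measurable M" "h \<in> borel_measurable M"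
  shows "(\<lambda>x. f (g x, h x)) \<in> borel_measurable M"
  using measurable_compose[OF measurable_Pair[OF assms(2,3)], of f borel] assms(1)
  by (simp add: borel_prod)

lemma borel_measurable_fst_snd:
  "(fst :: 'a::euclidean_space \<times> 'b::euclidean_space \<Rightarrow> 'a) \<in> borel_measurable lborel"
  "(snd :: 'a::euclidean_space \<times> 'b::euclidean_space \<Rightarrow> 'b) \<in> borel_measurable lborel"
  by (simp_all add: borel_prod[symmetric])

lemma integrable_product:
  fixes u :: "'a::euclidean_space \<Rightarrow> real" and v :: "'b::euclidean_space \<Rightarrow> real"
  assumes u: "integrable lborel u" and v: "integrable lborel v"
  shows "integrable lborel (\<lambda>z. u (fst z) * v (snd z))"
proof -
  have [measurable]: "u \<in> borel_measurable borel" "v \<in> borel_measurable borel"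
    using u v by (auto dest: borel_measurable_integrable)
  have "integrable (lborel \<Otimes>\<^sub>M lborel) (\<lambda>z. u (fst z) * v (snd z))"
  proof (rule lborel_pair.Fubini_integrable)
    show "(\<lambda>z. u (fst z) * v (snd z)) \<in> borel_measurable (lborel \<Otimes>\<^sub>M lborel)" by measurable
    show "integrable lborel (\<lambda>x. LINT y|lborel. norm (u (fst (x, y)) * v (snd (x, y))))"
      using u by (simp add: abs_mult)
    show "AE x in lborel. integrable lborel (\<lambda>y. u (fst (x, y)) * v (snd (x, y)))"
      using v by simp
  qed
  then show ?thesis by (simp add: lborel_prod)
qed

text \<open>Integration by parts against the primitive of a merely integrable function, obtained by
  exchanging the integrals over the triangle 0 < s < t < T.\<close>

lemma integral_primitive_mult:
  fixes g :: "real \<Rightarrow> real"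
  assumes g: "integrable lborel g" and T: "0 \<le> T"
    and A: "\<And>t. (A has_real_derivative A' t) (at t)" "continuous_on UNIV A'"
  shows "(LINT t|lborel. indicator {0<..<T} t * (A' t * (LINT s|lborel. indicator {0<..<t} s * g s)))
    = (LINT s|lborel. indicator {0<..<T} s * (g s * (A T - A s)))"
proof -
  have [measurable]: "g \<in> borel_measurable borel" "A' \<in> borel_measurable borel"
    using g A(2) by (auto dest: borel_measurable_integrable borel_measurable_continuous_onI)
  have "bounded (A' ` {0..T})"
    using A(2) by (intro compact_imp_bounded compact_continuous_image) (auto intro: continuous_on_subset)
  then obtain B where B: "\<And>t. t \<in> {0..T} \<Longrightarrow> \<bar>A' t\<bar> \<le> B"
    unfolding bounded_iff by (metis image_eqI real_norm_def)
  let ?F = "\<lambda>z :: real \<times> real. indicator {0<..<T} (fst z) * (A' (fst z) * (indicator {0<..<fst z} (snd z) * g (snd z)))"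
  have m: "?F \<in> borel_measurable (lborel \<Otimes>\<^sub>M lborel)"
  proof -
    have "(\<lambda>z. if 0 < fst z \<and> fst z < T \<and> 0 < snd z \<and> snd z < fst z then A' (fst z) * g (snd z) else 0)
      \<in> borel_measurable (borel \<Otimes>\<^sub>M borel)"
      by measurable
    also have "(\<lambda>z. if 0 < fst z \<and> fst z < T \<and> 0 < snd z \<and> snd z < fst z then A' (fst z) * g (snd z) else 0) = ?F"
      by (auto simp: fun_eq_iff indicator_def)
    finally show ?thesis by (simp cong: measurable_cong_sets sets_pair_measure_cong)
  qed
  have i: "integrable lborel ?F"
  proof (rule Bochner_Integration.integrable_bound)
    show "integrable lborel (\<lambda>z :: real \<times> real. (B * indicator {0<..<T} (fst z)) * g (snd z))"
      by (rule integrable_product) (use g T in \<open>auto simp: integrable_indicator_iff\<close>)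
    show "?F \<in> borel_measurable lborel" using m by (simp add: lborel_prod)
    show "AE z in lborel. norm (?F z) \<le> norm (B * indicator {0<..<T} (fst z) * g (snd z))"
    proof (rule AE_I2)
      fix z :: "real \<times> real"
      show "norm (?F z) \<le> norm (B * indicator {0<..<T} (fst z) * g (snd z))"
        using B[of "fst z"] by (auto simp: indicator_def abs_mult intro!: mult_right_mono)
    qed
  qed
  have "(LINT t|lborel. indicator {0<..<T} t * (A' t * (LINT s|lborel. indicator {0<..<t} s * g s)))
     = (LINT t|lborel. LINT s|lborel. ?F (t, s))" by simp
  also have "\<dots> = (LINT s|lborel. LINT t|lborel. ?F (t, s))"
    using lborel_pair_integral(1,2)[OF i] by simp
  also have "\<dots> = (LINT s|lborel. indicator {0<..<T} s * (g s * (A T - A s)))"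
  proof (intro Bochner_Integration.integral_cong refl)
    fix s :: real
    show "(LINT t|lborel. ?F (t, s)) = indicator {0<..<T} s * (g s * (A T - A s))"
    proof (cases "0 < s \<and> s < T")
      case True
      have "(LINT t|lborel. ?F (t, s)) = (LINT t|lborel. g s * (indicator {s..T} t * A' t))"
      proof (rule integral_cong_AE)
        show "AE t in lborel. ?F (t, s) = g s * (indicator {s..T} t * A' t)"
          using AE_lborel_singleton[of s] AE_lborel_singleton[of T]
          by eventually_elim (use True in \<open>auto simp: indicator_def\<close>)
        show "(\<lambda>t. ?F (t, s)) \<in> borel_measurable lborel"
          using measurable_compose[OF _ m, of "\<lambda>t. (t, s)" lborel] by simp
      qed measurable
      also have "\<dots> = g s * (LINT t|lborel. indicator {s..T} t * A' t)" by simp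
      also have "(LINT t|lborel. indicator {s..T} t * A' t) = A T - A s"
        using integral_FTC_Icc_real[of s T A A'] A True
        by (simp add: continuous_at_imp_continuous_on set_lebesgue_integral_def continuous_on_eq_continuous_at mult.commute)
      finally show ?thesis using True by simp
    next
      case False
      then have "(\<lambda>t. ?F (t, s)) = (\<lambda>t. 0)" by (auto simp: indicator_def fun_eq_iff)
      then have "(LINT t|lborel. ?F (t, s)) = 0" by simp
      then show ?thesis using False by simp
    qed
  qed
  finally show ?thesis .
qed

text \<open>The open interval is empty at nonpositive times, so the primitive is 0 there.\<close>

definition primitive0 :: "(real \<times> 'b::euclidean_space \<Rightarrow> real) \<Rightarrow> real \<times> 'b \<Rightarrow> real" where
  "primitive0 g z = (LINT s|lborel. indicator {0<..<fst z} s * g (s, snd z))"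

text \<open>A parameter integral with a moving interval: the indicator is rewritten as a condition
  on all variables at once, which exhibits joint measurability of the integrand.\<close>

lemma primitive0_measurable:
  assumes "g \<in> borel_measurable lborel"
  shows "primitive0 g \<in> borel_measurable lborel"
proof -
  have g: "g \<in> borel_measurable (borel \<Otimes>\<^sub>M borel)" using assms by (simp add: borel_prod)
  have [measurable]: "(\<lambda>p. g (snd p, snd (fst p))) \<in> borel_measurable ((borel \<Otimes>\<^sub>M borel) \<Otimes>\<^sub>M borel)"
    by (rule measurable_compose[OF _ g]) measurable
  have "(\<lambda>p. (if 0 < snd p \<and> snd p < fst (fst p) then g (snd p, snd (fst p)) else 0))
     \<in> borel_measurable (((borel \<Otimes>\<^sub>M borel) \<Otimes>\<^sub>M borel) :: ((real \<times> 'a) \<times> real) measure)"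
    by measurable
  also have "(\<lambda>p. (if 0 < snd p \<and> snd p < fst (fst p) then g (snd p, snd (fst p)) else 0))
     = (\<lambda>(z, s). indicator {0<..<fst z} s * g (s, snd z))"
    by (auto simp: fun_eq_iff indicator_def)
  finally have "(\<lambda>(z, s). indicator {0<..<fst z} s * g (s, snd z)) \<in> borel_measurable (lborel \<Otimes>\<^sub>M lborel)"
    by (simp only: borel_prod lborel_prod) simp
  then have "(\<lambda>z. LINT s|lborel. indicator {0<..<fst z} s * g (s, snd z)) \<in> borel_measurable lborel"
    by (rule lborel.borel_measurable_lebesgue_integral)
  then show ?thesis unfolding primitive0_def[abs_def] .
qed

lemma primitive0_bound:
  assumes "integrable lborel (\<lambda>s. g (s, q))"
  shows "\<bar>primitive0 g (t, q)\<bar> \<le> (LINT s|lborel. \<bar>g (s, q)\<bar>)"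
proof -
  have "\<bar>primitive0 g (t, q)\<bar> \<le> (LINT s|lborel. \<bar>indicator {0<..<t} s * g (s, q)\<bar>)"
    unfolding primitive0_def by simp
  also have "\<dots> \<le> (LINT s|lborel. \<bar>g (s, q)\<bar>)"
    by (rule integral_mono) (use assms integrable_mult_indicator[OF _ assms, of "{0<..<t}"] in \<open>auto simp: indicator_def\<close>)
  finally show ?thesis .
qed

text \<open>On almost every line in time the primitive is bounded by the total mass of the line,
  which is integrable in space by Fubini; the cut-off supplies integrability in time.\<close>

lemma primitive0_integrable:
  fixes g :: "real \<times> 'b::euclidean_space \<Rightarrow> real"
  assumes g: "integrable lborel g"
  shows "integrable lborel (\<lambda>z. indicator {0<..<T} (fst z) * primitive0 g z)"
proof -
  have gm: "g \<in> borel_measurable lborel" using g by (rule borel_measurable_integrable)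
  have ga: "integrable lborel (\<lambda>z. \<bar>g z\<bar>)" using g by simp
  have fin: "integrable lborel (\<lambda>t. indicator {0<..<T} t :: real)"
    using emeasure_bounded_finite[of "{0<..<T}"] by (simp add: integrable_indicator_iff)
  note sl = lborel_pair_integral(4)[OF g]
  show ?thesis
  proof (rule Bochner_Integration.integrable_bound[OF integrable_product[OF fin lborel_pair_integral(6)[OF ga]]])
    show "(\<lambda>z. indicator {0<..<T} (fst z) * primitive0 g z) \<in> borel_measurable lborel"
      using primitive0_measurable[OF gm] measurable_compose[OF borel_measurable_fst_snd(1), of "indicat_real {0<..<T}" borel]
      by (intro borel_measurable_times) auto
    have "AE z in (lborel :: (real \<times> 'b) measure). integrable lborel (\<lambda>s. g (s, snd z))"
      by (rule AE_lborel_snd[OF sl])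
    then show "AE z in lborel. norm (indicator {0<..<T} (fst z) * primitive0 g z)
       \<le> norm (indicator {0<..<T} (fst z) * (LINT x|lborel. \<bar>g (x, snd z)\<bar>))"
    proof eventually_elim
      case (elim z)
      show ?case using primitive0_bound[OF elim, of "fst z"] by (auto simp: abs_mult indicator_def)
    qed
  qed
qed

lemma borel_measurable_indicator_fst:
  "S \<in> sets borel \<Longrightarrow> (\<lambda>z :: 'a::euclidean_space \<times> 'b::euclidean_space. indicat_real S (fst z)) \<in> borel_measurable lborel"
  using measurable_compose[OF borel_measurable_fst_snd(1), of "indicat_real S" borel] by simp

lemma borel_measurable_indicator_snd:
  "S \<in> sets borel \<Longrightarrow> (\<lambda>z :: 'a::euclidean_space \<times> 'b::euclidean_space. indicat_real S (snd z)) \<in> borel_measurable lborel"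
  using measurable_compose[OF borel_measurable_fst_snd(2), of "indicat_real S" borel] by simp

lemma box_Pair: "box (a, c) (b, d) = box a b \<times> box c d"
  by (auto simp: box_def Basis_prod_def ball_Un)

lemma continuous_primitive_exists:
  fixes f :: "real \<Rightarrow> real"
  assumes "continuous_on UNIV f"
  shows "\<exists>F. F 0 = 0 \<and> (\<forall>t. (F has_real_derivative f t) (at t))"
proof -
  \<comment> \<open>The oriented interval integral also covers negative t.\<close>
  define F where "F t = (LBINT y=ereal 0..ereal t. f y)" for t
  have "(F has_real_derivative f t) (at t)" for t
  proof -
    have "((\<lambda>u. LBINT y=ereal 0..ereal u. f y) has_vector_derivative f t) (at t within {- \<bar>t\<bar> - 1..\<bar>t\<bar> + 1})"
      using assms by (intro interval_integral_FTC2) (auto intro: continuous_on_subset)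
    moreover have "at t within {- \<bar>t\<bar> - 1..\<bar>t\<bar> + 1} = at t"
      by (rule at_within_interior) (simp add: abs_if)
    ultimately show ?thesis
      unfolding F_def[abs_def] by (simp add: has_real_derivative_iff_has_vector_derivative)
  qed
  moreover have "F 0 = 0" by (simp add: F_def)
  ultimately show ?thesis by blast
qed

section \<open>Product test functions and functions with a weak time derivative\<close>

lemma Ck_box_bump_snd: "Ck k UNIV (\<lambda>z :: 'a::euclidean_space \<times> 'b::euclidean_space. box_bump n a b (snd z))"
proof -
  have l: "Ck k UNIV (\<lambda>z :: 'a \<times> 'b. snd z \<bullet> i)" for i
    by (rule Ck_bounded_linear[OF bounded_linear_compose[OF bounded_linear_inner_left bounded_linear_snd]])
  show ?thesis
    unfolding box_bump_def
    by (intro Ck_prod Ck_mult Ck_compose[OF _ Ck_flat] Ck_diff Ck_const l open_UNIV finite_Basis)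
qed

lemma product_test_function:
  fixes a b :: "'b::euclidean_space" and A :: "real \<Rightarrow> real"
  assumes A: "\<And>k. Ck k UNIV A" "compact K" "K \<subseteq> {0<..<T}" "\<And>t. t \<notin> K \<Longrightarrow> A t = (0::real)"
    and cd: "box c d \<subseteq> box a b"
  shows "(\<lambda>z. A (fst z) * box_bump n c d (snd z)) \<in> test_functions ({0<..<T} \<times> box a b)"
proof -
  have Ck: "Ck k UNIV (\<lambda>z :: real \<times> 'b. A (fst z) * box_bump n c d (snd z))" for k
    by (intro Ck_mult open_UNIV Ck_box_bump_snd Ck_compose[OF open_UNIV A(1)] Ck_bounded_linear bounded_linear_fst)
  let ?L = "K \<times> supp (box_bump n c d)"
  have L: "compact ?L" "?L \<subseteq> {0<..<T} \<times> box a b"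
    using A(2,3) box_bump_supp[of n c d] cd by (auto intro: compact_Times)
  have nz: "z \<in> ?L" if "A (fst z) * box_bump n c d (snd z) \<noteq> 0" for z
    using that A(4)[of "fst z"] supp_superset[of "box_bump n c d" "snd z"] by (auto simp: mem_Times_iff)
  have s: "compact (supp (\<lambda>z. A (fst z) * box_bump n c d (snd z)))"
    using compact_suppI[OF L(1) nz] .
  have "supp (\<lambda>z. A (fst z) * box_bump n c d (snd z)) \<subseteq> ?L"
    using supp_subsetI[OF compact_imp_closed[OF L(1)] nz] .
  with s L(2) Ck_subset[OF Ck subset_UNIV] show ?thesis
    unfolding test_functions_def Ck_compact_def by blast
qed

lemma product_time_derivative:
  fixes c d :: "'b::euclidean_space"
  assumes "(A has_real_derivative A') (at (fst z))"
  shows "frechet_derivative (\<lambda>z. A (fst z) * box_bump n c d (snd z)) (at z) (1, 0) = A' * box_bump n c d (snd z)"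
proof -
  obtain D where D: "(box_bump n c d has_derivative D) (at (snd z))"
    using Ck_Suc_has_derivative[of 0 UNIV "box_bump n c d" "snd z"] Ck_box_bump by blast
  have "((\<lambda>z. A (fst z)) has_derivative (\<lambda>h. A' * fst h)) (at z)"
    using diff_chain_at[OF bounded_linear_imp_has_derivative[OF bounded_linear_fst], of A "(*) A'" z]
      assms by (simp add: has_field_derivative_def o_def)
  moreover have "((\<lambda>z. box_bump n c d (snd z)) has_derivative (\<lambda>h. D (snd h))) (at z)"
    using diff_chain_at[OF bounded_linear_imp_has_derivative[OF bounded_linear_snd] D] by (simp add: o_def)
  ultimately have "((\<lambda>z. A (fst z) * box_bump n c d (snd z)) has_derivative
     (\<lambda>h. A (fst z) * D (snd h) + A' * fst h * box_bump n c d (snd z))) (at z)"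
    by (rule has_derivative_mult)
  from frechet_derivative_eqI[OF this, of "(1, 0)"] show ?thesis
    using linear_0[OF has_derivative_linear[OF D]] by simp
qed

lemma integrable_bounded_mult:
  fixes F :: "'a::euclidean_space \<Rightarrow> real"
  assumes "integrable lborel F" "q \<in> borel_measurable lborel" "\<And>z. \<bar>q z\<bar> \<le> B"
  shows "integrable lborel (\<lambda>z. q z * F z)"
proof (rule Bochner_Integration.integrable_bound)
  show "integrable lborel (\<lambda>z. B * F z)" using assms(1) by simp
  have "\<bar>q z\<bar> \<le> \<bar>B\<bar>" for z using assms(3)[of z] by simp
  then show "AE z in lborel. norm (q z * F z) \<le> norm (B * F z)"
    by (auto simp: abs_mult intro!: mult_right_mono)
qed (use assms(1,2) in \<open>auto dest: borel_measurable_integrable\<close>)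

lemma box_bump_integrable: "integrable lborel (box_bump n a b)"
  by (rule continuous_compact_supp_integrable[OF _ box_bump_supp(1)]) (use Ck_box_bump[of 0] in simp)

lemma box_bump_measurable: "box_bump n a b \<in> borel_measurable lborel"
  by (rule borel_measurable_integrable[OF box_bump_integrable])

lemma indicator_box_integrable: "integrable lborel (indicat_real (box a b))"
  using emeasure_bounded_finite[OF bounded_box[of a b]] by (simp add: integrable_indicator_iff)

lemma box_bump_integral_tendsto:
  "(\<lambda>n. LINT x|lborel. box_bump n a b x) \<longlonglongrightarrow> (LINT x|lborel. indicat_real (box a b) x)"
proof (rule integral_dominated_convergence[where w="indicat_real (box a b)"])
  show "AE x in lborel. norm (box_bump n a b x) \<le> indicat_real (box a b) x" for n
    using box_bump_bounds[of n a b] box_bump_eq_0[of _ a b n] by (auto simp: indicator_def)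
  show "box_bump n a b \<in> borel_measurable lborel" for n by (rule box_bump_measurable)
qed (auto simp: box_bump_tendsto indicator_box_integrable)

text \<open>A version of the du Bois-Reymond lemma in the time variable.\<close>

lemma weak_time_derivative_primitive:
  fixes f g :: "real \<times> 'b::euclidean_space \<Rightarrow> real"
  assumes T: "0 < T" and Q: "Q = {0<..<T} \<times> box a b"
    and fi: "integrable lborel f" and gi: "integrable lborel g"
    and f0: "\<And>z. z \<notin> Q \<Longrightarrow> f z = 0" and g0: "\<And>z. z \<notin> Q \<Longrightarrow> g z = 0"
    and test: "\<And>\<theta>. \<theta> \<in> test_functions Q \<Longrightarrow>
      (LINT z|lborel. f z * frechet_derivative \<theta> (at z) (1, 0)) = - (LINT z|lborel. g z * \<theta> z)"
  shows "\<exists>p. p \<in> borel_measurable lborel \<and> (AE z in lborel. z \<in> Q \<longrightarrow> f z = p (snd z) + primitive0 g z)"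
proof -
  \<comment> \<open>\<open>P\<close> is the primitive of \<open>g\<close>, \<open>F = f - P\<close>
    should be independent of time, \<open>p\<close> is its mean over (0, T), and \<open>H\<close> is
    the deviation of \<open>F\<close> from this mean. The goal is that \<open>H\<close> vanishes
    almost everywhere.\<close>
  define P where "P z = indicator {0<..<T} (fst z) * primitive0 g z" for z
  have Pi: "integrable lborel P" unfolding P_def by (rule primitive0_integrable[OF gi])
  define F where "F z = f z - P z" for z
  have Fi: "integrable lborel F" unfolding F_def using fi Pi by simp
  define p where "p q = (1 / T) * (LINT t|lborel. F (t, q))" for q
  have pi: "integrable lborel p"
    unfolding p_def using lborel_pair_integral(6)[OF Fi] by simp
  define H where "H z = F z - indicator {0<..<T} (fst z) * p (snd z)" for z
  have indT: "integrable lborel (indicat_real {0<..<T})" using indicator_box_integrable[of 0 T] by simp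
  have ip: "integrable lborel (\<lambda>z. indicator {0<..<T} (fst z) * p (snd z))"
    by (rule integrable_product[OF indT pi])
  have Hi: "integrable lborel H" unfolding H_def using Fi ip by simp
  have F0: "F z = 0" if "z \<notin> Q" for z
  proof (cases "fst z \<in> {0<..<T}")
    case True
    then have "snd z \<notin> box a b" using that Q by (auto simp: mem_Times_iff)
    then have "g (s, snd z) = 0" for s using g0[of "(s, snd z)"] Q by auto
    then show ?thesis using f0[OF that] by (simp add: F_def P_def primitive0_def)
  qed (use f0[OF that] in \<open>simp add: F_def P_def\<close>)
  have p0: "p q = 0" if "q \<notin> box a b" for q
  proof -
    have "F (t, q) = 0" for t by (rule F0) (use that Q in auto)
    then show ?thesis by (simp add: p_def)
  qed
  have H0: "H z = 0" if "z \<notin> Q" for z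
    using F0[OF that] p0[of "snd z"] that Q by (auto simp: H_def indicator_def mem_Times_iff)
  \<comment> \<open>\<open>f\<close> and \<open>P\<close> have the same weak time derivative
    \<open>g\<close>, so \<open>F\<close> is orthogonal to the time derivatives of product test
    functions.\<close>
  have step1: "(LINT z|lborel. (A' (fst z) * box_bump n c d (snd z)) * F z) = 0"
    if A: "\<And>k. Ck k UNIV A'" "\<And>t. (A has_real_derivative A' t) (at t)"
      and K: "compact K" "K \<subseteq> {0<..<T}" "\<And>t. t \<notin> K \<Longrightarrow> A t = 0" "\<And>t. t \<notin> K \<Longrightarrow> A' t = 0"
      and cd: "box c d \<subseteq> box a b" for A A' K n c d
  proof -
    have AC: "Ck k UNIV A" for k
      using Ck_real_Suc[OF A(2,1)] Ck_SucD by blast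
    have c: "continuous_on UNIV A" "continuous_on UNIV A'" using AC[of 0] A(1)[of 0] by auto
    have "compact (supp A)" "compact (supp A')" using compact_suppI[OF K(1)] K(3,4) by auto
    then obtain B B' where B: "\<And>t. \<bar>A t\<bar> \<le> B" "\<And>t. \<bar>A' t\<bar> \<le> B'"
      using continuous_compact_supp_bound c by metis
    have m: "A \<in> borel_measurable borel" "A' \<in> borel_measurable borel"
      using c by (auto intro: borel_measurable_continuous_onI)
    have bm: "box_bump n c d \<in> borel_measurable borel" using box_bump_measurable[of n c d] by simp
    have mz: "(\<lambda>z :: real \<times> 'b. h (fst z) * box_bump n c d (snd z)) \<in> borel_measurable lborel"
      if "h \<in> borel_measurable borel" for h :: "real \<Rightarrow> real"
      by (intro borel_measurable_times measurable_compose[OF borel_measurable_fst_snd(1) that]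
         measurable_compose[OF borel_measurable_fst_snd(2) bm])
    have bz: "\<bar>h * box_bump n c d x\<bar> \<le> C" if "\<bar>h\<bar> \<le> C" for h C x
      using mult_mono[OF that, of "box_bump n c d x" 1] box_bump_bounds[where n=n and a=c and b=d and x=x] that by (simp add: abs_mult)
    have int: "integrable lborel (\<lambda>z. (h (fst z) * box_bump n c d (snd z)) * G z)"
      if "integrable lborel G" "h \<in> borel_measurable borel" "\<And>t. \<bar>h t\<bar> \<le> C" for G :: "real \<times> 'b \<Rightarrow> real" and h C
      by (rule integrable_bounded_mult[OF that(1) mz[OF that(2)] bz[OF that(3)]])
    have AT: "A T = 0" by (rule K(3)) (use K(2) in auto)
    have "(LINT z|lborel. (A' (fst z) * box_bump n c d (snd z)) * f z) = - (LINT z|lborel. (A (fst z) * box_bump n c d (snd z)) * g z)"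
    proof -
      have "(\<lambda>z. A (fst z) * box_bump n c d (snd z)) \<in> test_functions Q"
        unfolding Q by (rule product_test_function[OF AC K(1-3) cd])
      from test[OF this] show ?thesis
        unfolding product_time_derivative[OF A(2)] by (simp add: mult.commute)
    qed
    also have "\<dots> = (LINT z|lborel. (A' (fst z) * box_bump n c d (snd z)) * P z)"
    proof -
      have i1: "integrable lborel (\<lambda>z. (A' (fst z) * box_bump n c d (snd z)) * P z)" by (rule int[OF Pi m(2) B(2)])
      have i2: "integrable lborel (\<lambda>z. (A (fst z) * box_bump n c d (snd z)) * g z)" by (rule int[OF gi m(1) B(1)])
      have "(LINT z|lborel. (A' (fst z) * box_bump n c d (snd z)) * P z)
        = (LINT q|lborel. LINT t|lborel. (A' t * box_bump n c d q) * P (t, q))"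
        using lborel_pair_integral(2)[OF i1] by simp
      also have "\<dots> = (LINT q|lborel. - (LINT t|lborel. (A t * box_bump n c d q) * g (t, q)))"
      proof (rule integral_cong_AE)
        show "(\<lambda>q. LINT t|lborel. (A' t * box_bump n c d q) * P (t, q)) \<in> borel_measurable lborel"
          using borel_measurable_integrable[OF lborel_pair_integral(6)[OF i1]] by simp
        show "(\<lambda>q. - (LINT t|lborel. (A t * box_bump n c d q) * g (t, q))) \<in> borel_measurable lborel"
          using borel_measurable_integrable[OF lborel_pair_integral(6)[OF i2]] by simp
        show "AE q in lborel. (LINT t|lborel. (A' t * box_bump n c d q) * P (t, q))
           = - (LINT t|lborel. (A t * box_bump n c d q) * g (t, q))"
          using lborel_pair_integral(4)[OF gi]
        proof eventually_elim
          case (elim q)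
          have "(LINT t|lborel. (A' t * box_bump n c d q) * P (t, q))
             = (LINT t|lborel. box_bump n c d q * (indicator {0<..<T} t * (A' t * (LINT s|lborel. indicator {0<..<t} s * g (s, q)))))"
            by (intro Bochner_Integration.integral_cong refl) (simp add: P_def primitive0_def)
          also have "\<dots> = box_bump n c d q * (LINT t|lborel. indicator {0<..<T} t * (A' t * (LINT s|lborel. indicator {0<..<t} s * g (s, q))))"
            by simp
          also have "\<dots> = box_bump n c d q * (LINT s|lborel. indicator {0<..<T} s * (g (s, q) * (A T - A s)))"
            using integral_primitive_mult[OF elim less_imp_le[OF T] A(2) c(2)] by simp
          also have "\<dots> = (LINT s|lborel. box_bump n c d q * (indicator {0<..<T} s * (g (s, q) * (A T - A s))))"
            by simp
          also have "\<dots> = (LINT t|lborel. - ((A t * box_bump n c d q) * g (t, q)))"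
          proof (intro Bochner_Integration.integral_cong refl)
            fix t
            show "box_bump n c d q * (indicator {0<..<T} t * (g (t, q) * (A T - A t))) = - ((A t * box_bump n c d q) * g (t, q))"
              using AT g0[of "(t, q)"] Q by (auto simp: indicator_def)
          qed
          finally show ?case by simp
        qed
      qed
      also have "\<dots> = - (LINT z|lborel. (A (fst z) * box_bump n c d (snd z)) * g z)"
        using lborel_pair_integral(2)[OF i2] by simp
      finally show ?thesis by simp
    qed
    finally have "(LINT z|lborel. (A' (fst z) * box_bump n c d (snd z)) * f z)
      = (LINT z|lborel. (A' (fst z) * box_bump n c d (snd z)) * P z)" .
    then show ?thesis
      unfolding F_def using int[OF fi m(2) B(2)] int[OF Pi m(2) B(2)] by (simp add: right_diff_distrib)
  qed
  \<comment> \<open>The indicator of a time interval minus its mean over (0, T) is approximated by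
    admissible derivatives \<open>A'\<close>. Testing \<open>F\<close> with this difference amounts
    to testing \<open>H\<close> with the indicator.\<close>
  have step2: "(LINT z|lborel. indicator (box (\<alpha>, c) (\<beta>, d)) z * H z) = 0"
    if ab: "0 \<le> \<alpha>" "\<alpha> < \<beta>" "\<beta> \<le> T" and cd: "box c d \<subseteq> box a b" for \<alpha> \<beta> c d
  proof -
    \<comment> \<open>Chosen so that \<open>A' n\<close> has integral 0, which makes its primitive
      vanish at both ends of (0, T).\<close>
    define \<kappa> where "\<kappa> n = (LINT x|lborel. box_bump n \<alpha> \<beta> x) / (LINT x|lborel. box_bump n 0 T x)" for n
    have k: "\<kappa> \<longlonglongrightarrow> (\<beta> - \<alpha>) / T"
      unfolding \<kappa>_def
      using tendsto_divide[OF box_bump_integral_tendsto[of \<alpha> \<beta>] box_bump_integral_tendsto[of 0 T]] T ab by simp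
    obtain C where C: "\<And>n. \<bar>\<kappa> n\<bar> \<le> C"
      using convergent_imp_Bseq[OF convergentI[OF k]] unfolding Bseq_def by auto
    define A' where "A' n t = box_bump n \<alpha> \<beta> t - \<kappa> n * box_bump n 0 T t" for n t
    have A'lim: "(\<lambda>n. A' n t) \<longlonglongrightarrow> indicator {\<alpha><..<\<beta>} t - (\<beta> - \<alpha>) / T * indicator {0<..<T} t" for t
      unfolding A'_def
      using tendsto_diff[OF box_bump_tendsto[of \<alpha> \<beta> t] tendsto_mult[OF k box_bump_tendsto[of 0 T t]]] by simp
    have A'b: "\<bar>A' n t\<bar> \<le> 1 + C" for n t
    proof -
      have "\<bar>A' n t\<bar> \<le> \<bar>box_bump n \<alpha> \<beta> t\<bar> + \<bar>\<kappa> n\<bar> * \<bar>box_bump n 0 T t\<bar>"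
        unfolding A'_def by (metis abs_mult abs_triangle_ineq4)
      also have "\<dots> \<le> 1 + C * 1"
        using C[of n] box_bump_bounds[of n \<alpha> \<beta> t] box_bump_bounds[of n 0 T t] by (intro add_mono mult_mono) auto
      finally show ?thesis by simp
    qed
    have Ck': "Ck k UNIV (A' n)" for n k
      unfolding A'_def by (intro Ck_diff Ck_mult Ck_const Ck_box_bump open_UNIV)
    have A'm: "A' n \<in> borel_measurable borel" for n
      using Ck'[of 0 n] by (auto intro: borel_measurable_continuous_onI)
    have z: "(LINT z|lborel. (A' n (fst z) * box_bump n c d (snd z)) * F z) = 0"
      if n: "0 < (LINT x|lborel. box_bump n 0 T x)" "0 < n" for n
    proof -
      obtain A where A: "A 0 = 0" "\<And>t. (A has_real_derivative A' n t) (at t)"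
        using continuous_primitive_exists[of "A' n"] Ck'[of 0 n] by auto
      have A'0: "A' n t = 0" if "t \<notin> {1 / real n .. T - 1 / real n}" for t
      proof -
        have "box_bump n \<alpha> \<beta> t = 0" "box_bump n 0 T t = 0"
          using that ab box_bump_nonzero(1)[of n \<alpha> \<beta> t] box_bump_nonzero(1)[of n 0 T t] by fastforce+
        then show ?thesis by (simp add: A'_def)
      qed
      have "(LINT x|lborel. A' n x) = 0"
      proof -
        have "(LINT x|lborel. A' n x) = (LINT x|lborel. box_bump n \<alpha> \<beta> x) - \<kappa> n * (LINT x|lborel. box_bump n 0 T x)"
          unfolding A'_def using box_bump_integrable[of n \<alpha> \<beta>] box_bump_integrable[of n 0 T] by simp
        then show ?thesis using n by (simp add: \<kappa>_def)
      qed
      moreover have "(LINT x|lborel. A' n x) = (LINT x|lborel. A' n x * indicator {0..T} x)"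
      proof (intro Bochner_Integration.integral_cong refl)
        fix t show "A' n t = A' n t * indicator {0..T} t"
        proof (cases "t \<in> {0..T}")
          case False
          moreover have "0 < 1 / real n" using n by simp
          ultimately have "t \<notin> {1 / real n .. T - 1 / real n}" unfolding atLeastAtMost_iff by linarith
          then show ?thesis using A'0 by simp
        qed simp
      qed
      moreover have "(LINT x|lborel. A' n x * indicator {0..T} x) = A T - A 0"
        using T A(2) Ck'[of 0 n]
        by (intro integral_FTC_Icc_real) (auto intro: continuous_on_interior simp: continuous_on_eq_continuous_at)
      ultimately have AT: "A T = 0" using A(1) by simp
      \<comment> \<open>\<open>A\<close> is constant where \<open>A'\<close> vanishes, with the
        value \<open>A 0 = 0\<close> on the left and \<open>A T = 0\<close> on the right.\<close>
      have A0: "A t = 0" if "t \<notin> {1 / real n .. T - 1 / real n}" for t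
      proof -
        have c: "continuous_on S A" for S using A(2) by (auto intro!: continuous_at_imp_continuous_on DERIV_isCont)
        have "t < 1 / real n \<or> t > T - 1 / real n" using that by (auto simp: not_le)
        then consider "t < 1 / real n" | "t > T - 1 / real n" by blast
        then show ?thesis
        proof cases
          case 1
          have "A t = A 0"
            by (rule DERIV_isconst3[of "min t 0 - 1" "1 / real n"]) (use 1 n A(2) A'0 in \<open>auto, metis A'0 atLeastAtMost_iff not_le\<close>)
          then show ?thesis using A(1) by simp
        next
          case 2
          have "A t = A T"
            by (rule DERIV_isconst3[of "T - 1 / real n" "max t T + 1"]) (use 2 n A(2) A'0 in \<open>auto, metis A'0 atLeastAtMost_iff not_le\<close>)
          then show ?thesis using AT by simp
        qed
      qed
      have "0 < 1 / real n" using n by simp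
      then have "{1 / real n .. T - 1 / real n} \<subseteq> {0<..<T}" 
        by (intro subsetI) (simp only: atLeastAtMost_iff greaterThanLessThan_iff, linarith)
      then show ?thesis
        by (intro step1[of "A' n" A "{1 / real n .. T - 1 / real n}"]) (use Ck' A(2) A'0 A0 n cd in simp_all)
    qed
    let ?X = "\<lambda>z. (indicator {\<alpha><..<\<beta>} (fst z) - (\<beta> - \<alpha>) / T * indicator {0<..<T} (fst z)) * indicator (box c d) (snd z) * F z"
    have "(\<lambda>n. LINT z|lborel. (A' n (fst z) * box_bump n c d (snd z)) * F z) \<longlonglongrightarrow> (LINT z|lborel. ?X z)"
    proof (rule integral_dominated_convergence[where w="\<lambda>z. (1 + C) * \<bar>F z\<bar>"])
      show "integrable lborel (\<lambda>z. (1 + C) * \<bar>F z\<bar>)" using Fi by simp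
      have bm: "box_bump n c d \<in> borel_measurable borel" for n using box_bump_measurable[of n c d] by simp
      show "(\<lambda>z. (A' n (fst z) * box_bump n c d (snd z)) * F z) \<in> borel_measurable lborel" for n
        by (intro borel_measurable_times measurable_compose[OF borel_measurable_fst_snd(1) A'm]
         measurable_compose[OF borel_measurable_fst_snd(2) bm] borel_measurable_integrable[OF Fi])
      show "?X \<in> borel_measurable lborel"
        by (intro borel_measurable_times borel_measurable_diff borel_measurable_const borel_measurable_integrable[OF Fi]
          borel_measurable_indicator_fst borel_measurable_indicator_snd) auto
      show "AE z in lborel. (\<lambda>n. (A' n (fst z) * box_bump n c d (snd z)) * F z) \<longlonglongrightarrow> ?X z"
        by (intro AE_I2 tendsto_mult A'lim box_bump_tendsto tendsto_const)
      show "AE z in lborel. norm ((A' n (fst z) * box_bump n c d (snd z)) * F z) \<le> (1 + C) * \<bar>F z\<bar>" for n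
      proof (rule AE_I2)
        fix z
        have "\<bar>A' n (fst z)\<bar> * \<bar>box_bump n c d (snd z)\<bar> \<le> (1 + C) * 1"
          using A'b[of n "fst z"] box_bump_bounds[of n c d "snd z"] by (intro mult_mono) auto
        then show "norm ((A' n (fst z) * box_bump n c d (snd z)) * F z) \<le> (1 + C) * \<bar>F z\<bar>"
          by (simp add: abs_mult mult_right_mono)
      qed
    qed
    moreover have "\<forall>\<^sub>F n in sequentially. (LINT z|lborel. (A' n (fst z) * box_bump n c d (snd z)) * F z) = 0"
    proof -
      have "\<forall>\<^sub>F n in sequentially. 0 < (LINT x|lborel. box_bump n 0 T x)"
        using order_tendstoD(1)[OF box_bump_integral_tendsto[of 0 T], of 0] T by simp
      then show ?thesis using eventually_gt_at_top[of 0] by eventually_elim (rule z)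
    qed
    ultimately have X: "(LINT z|lborel. ?X z) = 0"
      by (rule LIMSEQ_unique[OF _ tendsto_eventually])
    have mc: "indicat_real (box c d) \<in> borel_measurable lborel" by simp
    have ipc: "integrable lborel (\<lambda>q. indicator (box c d) q * p q)"
      using integrable_mult_indicator[OF _ pi, of "box c d"] by simp
    let ?Y = "\<lambda>z. indicator {\<alpha><..<\<beta>} (fst z) * (indicator (box c d) (snd z) * p (snd z))"
    let ?W = "\<lambda>z. indicator (box c d) (snd z) * F z"
    have Wi: "integrable lborel ?W"
      by (rule integrable_bounded_mult[OF Fi borel_measurable_indicator_snd, where B=1]) auto
    have Wi2: "integrable lborel (\<lambda>z. indicator {\<alpha>'<..<\<beta>'} (fst z) * ?W z)" for \<alpha>' \<beta>'
      by (rule integrable_bounded_mult[OF Wi borel_measurable_indicator_fst, where B=1]) auto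
    have indab: "integrable lborel (indicat_real {\<alpha><..<\<beta>})" using indicator_box_integrable[of \<alpha> \<beta>] by simp
    have Yi: "integrable lborel ?Y"
      by (rule integrable_product[OF indab ipc])
    \<comment> \<open>The integral of \<open>p\<close> over the box, unfolded through the definition
      of \<open>p\<close> as a mean in time, is up to sign the second term of
      \<open>?X\<close>.\<close>
    have "(LINT z|lborel. ?Y z) = (LINT q|lborel. LINT t|lborel. indicator {\<alpha><..<\<beta>} t * (indicator (box c d) q * p q))"
      using lborel_pair_integral(2)[OF Yi] by simp
    also have "\<dots> = (LINT q|lborel. (\<beta> - \<alpha>) * (indicator (box c d) q * p q))"
      using ab by (intro Bochner_Integration.integral_cong refl) simp
    also have "\<dots> = (LINT q|lborel. (\<beta> - \<alpha>) / T * (LINT t|lborel. ?W (t, q)))"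
      by (intro Bochner_Integration.integral_cong refl) (simp add: p_def)
    also have "\<dots> = (\<beta> - \<alpha>) / T * (LINT z|lborel. ?W z)"
      using lborel_pair_integral(2)[OF Wi] by simp
    also have "(LINT z|lborel. ?W z) = (LINT z|lborel. indicator {0<..<T} (fst z) * ?W z)"
      by (intro Bochner_Integration.integral_cong refl) (use F0 Q in \<open>auto simp: indicator_def mem_Times_iff\<close>)
    finally have Y: "(LINT z|lborel. ?Y z) = (\<beta> - \<alpha>) / T * (LINT z|lborel. indicator {0<..<T} (fst z) * ?W z)" .
    have "(LINT z|lborel. indicator (box (\<alpha>, c) (\<beta>, d)) z * H z)
       = (LINT z|lborel. indicator {\<alpha><..<\<beta>} (fst z) * ?W z - ?Y z)"
    proof (intro Bochner_Integration.integral_cong refl)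
      fix z :: "real \<times> 'b"
      have "z \<in> box (\<alpha>, c) (\<beta>, d) \<longleftrightarrow> fst z \<in> {\<alpha><..<\<beta>} \<and> snd z \<in> box c d"
        by (cases z) (simp add: box_Pair)
      then show "indicator (box (\<alpha>, c) (\<beta>, d)) z * H z = indicator {\<alpha><..<\<beta>} (fst z) * ?W z - ?Y z"
        using ab by (auto simp: H_def indicator_def)
    qed
    also have "\<dots> = (LINT z|lborel. indicator {\<alpha><..<\<beta>} (fst z) * ?W z) - (LINT z|lborel. ?Y z)"
      using Wi2 Yi by simp
    also have "\<dots> = (LINT z|lborel. indicator {\<alpha><..<\<beta>} (fst z) * ?W z - (\<beta> - \<alpha>) / T * (indicator {0<..<T} (fst z) * ?W z))"
      unfolding Y using Wi2[of \<alpha> \<beta>] Wi2[of 0 T] by simp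
    also have "\<dots> = (LINT z|lborel. ?X z)"
      by (intro Bochner_Integration.integral_cong refl) (simp add: algebra_simps)
    finally show ?thesis using X by simp
  qed
  have "(LINT z|lborel. indicator (box u v) z * H z) = 0" for u v
  proof -
    \<comment> \<open>\<open>Q\<close> is itself a box and \<open>H\<close> vanishes outside it, so
      an arbitrary box may be cut down to one inside \<open>Q\<close>.\<close>
    have Qb: "Q = box (0, a) (T, b)" by (simp add: Q box_Pair)
    obtain u' v' where uv: "box u v \<inter> Q = box u' v'"
      unfolding Qb box_Int_box by blast
    obtain \<alpha> c where u': "u' = (\<alpha>, c)" by (cases u')
    obtain \<beta> d where v': "v' = (\<beta>, d)" by (cases v')
    have i: "box u v \<inter> Q = box (\<alpha>, c) (\<beta>, d)" using uv unfolding u' v' .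
    have eq: "(LINT z|lborel. indicator (box u v) z * H z) = (LINT z|lborel. indicator (box (\<alpha>, c) (\<beta>, d)) z * H z)"
      unfolding i[symmetric] by (intro Bochner_Integration.integral_cong refl) (use H0 in \<open>auto simp: indicator_def\<close>)
    show ?thesis
    proof (cases "box (\<alpha>, c) (\<beta>, d) = {}")
      case True
      then show ?thesis unfolding eq by simp
    next
      case False
      have "{\<alpha><..<\<beta>} \<times> box c d \<subseteq> {0<..<T} \<times> box a b" using i Q by (auto simp: box_Pair)
      moreover have "{\<alpha><..<\<beta>} \<noteq> {}" "box c d \<noteq> {}" using False by (auto simp: box_Pair)
      ultimately have "{\<alpha><..<\<beta>} \<subseteq> {0<..<T}" "\<alpha> < \<beta>" "box c d \<subseteq> box a b" by (auto simp: times_subset_iff)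
      then show ?thesis unfolding eq
        by (intro step2) (auto simp: greaterThanLessThan_subseteq_greaterThanLessThan)
    qed
  qed
  then have "AE z in lborel. H z = 0" by (rule AE_zero_if_box_integrals_zero[OF Hi])
  then have "AE z in lborel. z \<in> Q \<longrightarrow> f z = p (snd z) + primitive0 g z"
    by eventually_elim (auto simp: H_def F_def P_def Q)
  then show ?thesis using borel_measurable_integrable[OF pi] by blast
qed

section \<open>Periodic weak gradients\<close>

lemma L2norm_finite_iff:
  "L2norm S g < \<infinity> \<longleftrightarrow> (\<integral>\<^sup>+x\<in>S. ennreal ((norm (g x))\<^sup>2) \<partial>lborel) < \<infinity>"
  by (simp add: L2norm_def Let_def top.not_eq_extremum)

lemma L2norm_le:
  assumes "(\<integral>\<^sup>+x\<in>S. ennreal ((norm (g x))\<^sup>2) \<partial>lborel) \<le> ennreal C" "0 \<le> C"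
  shows "L2norm S g \<le> ennreal (sqrt C)"
proof -
  let ?I = "\<integral>\<^sup>+x\<in>S. ennreal ((norm (g x))\<^sup>2) \<partial>lborel"
  have "?I \<noteq> \<infinity>" using assms(1) by (metis ennreal_less_top infinity_ennreal_def leD)
  moreover have "enn2real ?I \<le> C" using assms by (simp add: enn2real_leI)
  ultimately show ?thesis by (simp add: L2norm_def Let_def ennreal_leI)
qed

lemma L2_on_iff:
  fixes g :: "'a::euclidean_space \<Rightarrow> 'b::euclidean_space"
  assumes "S \<in> sets borel"
  shows "L2_on S g \<longleftrightarrow> (\<lambda>x. indicat_real S x *\<^sub>R g x) \<in> borel_measurable lborel \<and>
    integrable lborel (\<lambda>x. (norm (indicat_real S x *\<^sub>R g x))\<^sup>2)"
proof -
  let ?h = "\<lambda>x. indicat_real S x *\<^sub>R g x"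
  have eq: "(\<integral>\<^sup>+x\<in>S. ennreal ((norm (g x))\<^sup>2) \<partial>lborel) = (\<integral>\<^sup>+x. ennreal (norm ((norm (?h x))\<^sup>2)) \<partial>lborel)"
    by (intro nn_integral_cong) (auto simp: indicator_def)
  have "(\<lambda>x. (norm (?h x))\<^sup>2) \<in> borel_measurable lborel" if "?h \<in> borel_measurable lborel"
    by (rule borel_measurable_power[OF measurable_compose[OF that borel_measurable_continuous_onI[OF continuous_on_norm[OF continuous_on_id]]]])
  then show ?thesis
    unfolding L2_on_def L2norm_finite_iff eq set_borel_measurable_def integrable_iff_bounded by blast
qed

lemma L2_on_real_iff:
  assumes "S \<in> sets borel"
  shows "L2_on S g \<longleftrightarrow> square_integrable (\<lambda>x. indicat_real S x * g x)"
  using L2_on_iff[OF assms, of g] by (simp add: square_integrable_def)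

text \<open>Componentwise reduction, so that gradients can be handled as pairs of real
  square-integrable functions.\<close>

lemma L2_on_pair_iff:
  fixes g :: "'a::euclidean_space \<Rightarrow> real \<times> real"
  assumes "S \<in> sets borel"
  shows "L2_on S g \<longleftrightarrow> square_integrable (\<lambda>x. indicat_real S x * fst (g x)) \<and> square_integrable (\<lambda>x. indicat_real S x * snd (g x))"
proof -
  let ?h = "\<lambda>x. indicat_real S x *\<^sub>R g x"
  have m: "?h \<in> borel_measurable lborel \<longleftrightarrow> (\<lambda>x. fst (?h x)) \<in> borel_measurable lborel \<and> (\<lambda>x. snd (?h x)) \<in> borel_measurable lborel"
  proof
    assume h: "?h \<in> borel_measurable lborel"
    show "(\<lambda>x. fst (?h x)) \<in> borel_measurable lborel \<and> (\<lambda>x. snd (?h x)) \<in> borel_measurable lborel"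
      using measurable_compose[OF h, of fst borel] measurable_compose[OF h, of snd borel]
      by (simp add: borel_measurable_continuous_onI continuous_on_fst continuous_on_snd)
  next
    assume "(\<lambda>x. fst (?h x)) \<in> borel_measurable lborel \<and> (\<lambda>x. snd (?h x)) \<in> borel_measurable lborel"
    then have "(\<lambda>x. (fst (?h x), snd (?h x))) \<in> borel_measurable lborel"
      by (intro borel_measurable_Pair) auto
    then show "?h \<in> borel_measurable lborel" by (simp only: prod.collapse)
  qed
  have n: "(norm (?h x))\<^sup>2 = (fst (?h x))\<^sup>2 + (snd (?h x))\<^sup>2" for x
    by (simp add: norm_prod_def)
  show ?thesis
  proof
    assume "L2_on S g"
    then have h: "(\<lambda>x. fst (?h x)) \<in> borel_measurable lborel" "(\<lambda>x. snd (?h x)) \<in> borel_measurable lborel"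
      "integrable lborel (\<lambda>x. (norm (?h x))\<^sup>2)"
      using L2_on_iff[OF assms] m by auto
    have "integrable lborel (\<lambda>x. (fst (?h x))\<^sup>2)"
    proof (rule Bochner_Integration.integrable_bound[OF h(3)])
      show "(\<lambda>x. (fst (?h x))\<^sup>2) \<in> borel_measurable lborel" by (intro borel_measurable_power h(1))
      show "AE x in lborel. norm ((fst (?h x))\<^sup>2) \<le> norm ((norm (?h x))\<^sup>2)"
        by (rule AE_I2) (unfold n, simp)
    qed
    moreover have "integrable lborel (\<lambda>x. (snd (?h x))\<^sup>2)"
    proof (rule Bochner_Integration.integrable_bound[OF h(3)])
      show "(\<lambda>x. (snd (?h x))\<^sup>2) \<in> borel_measurable lborel" by (intro borel_measurable_power h(2))
      show "AE x in lborel. norm ((snd (?h x))\<^sup>2) \<le> norm ((norm (?h x))\<^sup>2)"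
        by (rule AE_I2) (unfold n, simp)
    qed
    ultimately show "square_integrable (\<lambda>x. indicat_real S x * fst (g x)) \<and> square_integrable (\<lambda>x. indicat_real S x * snd (g x))"
      using h by (simp add: square_integrable_def)
  next
    assume "square_integrable (\<lambda>x. indicat_real S x * fst (g x)) \<and> square_integrable (\<lambda>x. indicat_real S x * snd (g x))"
    then have "(\<lambda>x. fst (?h x)) \<in> borel_measurable lborel" "(\<lambda>x. snd (?h x)) \<in> borel_measurable lborel"
      "integrable lborel (\<lambda>x. (fst (?h x))\<^sup>2)" "integrable lborel (\<lambda>x. (snd (?h x))\<^sup>2)"
      by (simp_all add: square_integrable_def)
    then show "L2_on S g"
      unfolding L2_on_iff[OF assms] m n by simp
  qed
qed

lemma Omega_props:
  "Omega l h \<in> sets borel" "open (Omega l h)" "bounded (Omega l h)" "Omega l h = box (-l, 0) (l, h)"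
proof -
  show eq: "Omega l h = box (-l, 0) (l, h)" by (simp add: Omega_def box_Pair)
  show "open (Omega l h)" "bounded (Omega l h)" unfolding eq by auto
  then show "Omega l h \<in> sets borel" by auto
qed

lemma square_integrable_bounded_supp:
  assumes "integrable lborel f" "\<And>x. \<bar>f x\<bar> \<le> B"
  shows "square_integrable f"
proof -
  have "integrable lborel (\<lambda>x. (f x)\<^sup>2)"
  proof (rule Bochner_Integration.integrable_bound)
    show "integrable lborel (\<lambda>x. B * f x)" using assms(1) by simp
    show "(\<lambda>x. (f x)\<^sup>2) \<in> borel_measurable lborel" using assms(1) by (auto dest: borel_measurable_integrable)
    have "(f x)\<^sup>2 \<le> \<bar>B\<bar> * \<bar>f x\<bar>" for x
      using mult_right_mono[OF assms(2)[of x], of "\<bar>f x\<bar>"] assms(2)[of x] by (simp add: power2_eq_square)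
    then show "AE x in lborel. norm ((f x)\<^sup>2) \<le> norm (B * f x)" by (simp add: abs_mult)
  qed
  then show ?thesis using assms(1) by (simp add: square_integrable_def borel_measurable_integrable del: measurable_lborel1)
qed

lemma square_integrable_continuous_compact_supp:
  assumes "continuous_on UNIV f" "compact (supp f)"
  shows "square_integrable f"
  using square_integrable_bounded_supp[OF continuous_compact_supp_integrable[OF assms]]
    continuous_compact_supp_bound[OF assms] by blast

lemma integrable_of_square_integrable_bounded:
  assumes "square_integrable (\<lambda>x. indicat_real S x * f x)" "S \<in> sets borel" "bounded S"
  shows "integrable lborel (\<lambda>x. indicat_real S x * f x)"
proof -
  have i: "integrable lborel (indicat_real S)"
    using emeasure_bounded_finite[OF assms(3)] assms(2) by (simp add: integrable_indicator_iff)
  have "square_integrable (indicat_real S)" by (rule square_integrable_bounded_supp[OF i, of 1]) simp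
  from square_integrable_mult[OF this assms(1)] show ?thesis
    by (rule Bochner_Integration.integrable_cong[THEN iffD1, rotated -1]) (auto simp: indicator_def)
qed

section \<open>Classical gradients and integration by parts\<close>

definition grad2 :: "(real \<times> real \<Rightarrow> real) \<Rightarrow> real \<times> real \<Rightarrow> real \<times> real" where
  "grad2 v x = (frechet_derivative v (at x) (1, 0), frechet_derivative v (at x) (0, 1))"

lemma Basis_real2: "b \<in> (Basis :: (real \<times> real) set) \<longleftrightarrow> b = (1, 0) \<or> b = (0, 1)"
  by (auto simp: Basis_prod_def)

lemma frechet_derivative_mult:
  fixes f g :: "'a::euclidean_space \<Rightarrow> real"
  assumes "Ck 1 UNIV f" "Ck 1 UNIV g"
  shows "frechet_derivative (\<lambda>x. f x * g x) (at x) b = f x * frechet_derivative g (at x) b + frechet_derivative f (at x) b * g x"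
  using frechet_derivative_eqI[OF has_derivative_mult[OF Ck_Suc_has_derivative[of 0 UNIV f x] Ck_Suc_has_derivative[of 0 UNIV g x]]]
    assms by simp

text \<open>The product has compact support even if only \<open>g\<close> does, so the integral of
  its partial derivative is 0.\<close>

lemma integral_by_parts_compact:
  fixes f g :: "'a::euclidean_space \<Rightarrow> real"
  assumes f: "Ck 1 UNIV f" and g: "Ck 1 UNIV g" and s: "compact (supp g)" and b: "b \<in> Basis"
  shows "(LINT x|lborel. f x * frechet_derivative g (at x) b) = - (LINT x|lborel. frechet_derivative f (at x) b * g x)"
proof -
  have fc: "continuous_on UNIV f" "continuous_on UNIV g" using f g Ck_SucD[of 0 UNIV] by auto
  have dc: "continuous_on UNIV (\<lambda>x. frechet_derivative f (at x) b)" "continuous_on UNIV (\<lambda>x. frechet_derivative g (at x) b)"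
    using f g b by auto
  have c1: "compact (supp (\<lambda>x. f x * g x))"
    by (rule compact_suppI[OF s]) (use supp_superset[of g] in auto)
  have c2: "compact (supp (\<lambda>x. f x * frechet_derivative g (at x) b))"
    by (rule compact_suppI[OF s]) (use frechet_derivative_outside_supp[of _ g] in fastforce)
  have c3: "compact (supp (\<lambda>x. frechet_derivative f (at x) b * g x))"
    by (rule compact_suppI[OF s]) (use supp_superset[of g] in auto)
  have "0 = (LINT x|lborel. frechet_derivative (\<lambda>x. f x * g x) (at x) b)"
    using integral_partial_derivative_zero[OF Ck_mult[OF open_UNIV f g] c1 b] by simp
  also have "\<dots> = (LINT x|lborel. f x * frechet_derivative g (at x) b + frechet_derivative f (at x) b * g x)"
    unfolding frechet_derivative_mult[OF f g] ..
  also have "\<dots> = (LINT x|lborel. f x * frechet_derivative g (at x) b) + (LINT x|lborel. frechet_derivative f (at x) b * g x)"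
    by (intro Bochner_Integration.integral_add continuous_compact_supp_integrable c2 c3 continuous_on_mult fc dc)
  finally show ?thesis by simp
qed

lemma Ck_compact_UNIV_props:
  assumes "Ck_compact k S f" "open S"
  shows "Ck k UNIV f" "compact (supp f)" "supp f \<subseteq> S" "continuous_on UNIV f" "\<And>x. x \<notin> S \<Longrightarrow> f x = 0"
proof -
  show C: "Ck k UNIV f" using Ck_compact_UNIV[OF assms(2,1)] .
  show "compact (supp f)" "supp f \<subseteq> S" using assms(1) by (auto simp: Ck_compact_def)
  then show "\<And>x. x \<notin> S \<Longrightarrow> f x = 0" using supp_superset[of f] by auto
  show "continuous_on UNIV f" using Ck_le[OF C, of 0] by simp
qed

text \<open>The support of \<open>v\<close> is a compact subset of the open rectangle; integration
  by parts against a periodic function therefore produces no boundary terms.\<close>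

lemma has_periodic_gradient_Ck_compact:
  assumes v: "Ck_compact 1 (Omega l h) v"
  shows "has_periodic_gradient l h v (grad2 v)"
proof -
  note O = Omega_props[of l h]
  note vp = Ck_compact_UNIV_props[OF v O(2)]
  have d: "Ck_compact 0 (Omega l h) (\<lambda>x. frechet_derivative v (at x) b)" if "b \<in> Basis" for b
    using Ck_compact_SucD[of 0 "Omega l h" v b] v that by simp
  note dp = Ck_compact_UNIV_props[OF d O(2)]
  have ind: "(\<lambda>x. indicat_real (Omega l h) x * f x) = f" if "\<And>x. x \<notin> Omega l h \<Longrightarrow> f x = 0" for f
    using that by (auto simp: indicator_def fun_eq_iff)
  have "L2_on (Omega l h) v"
  proof -
    have "(\<lambda>x. indicat_real (Omega l h) x * v x) = v" by (rule ind[OF vp(5)])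
    then show ?thesis
      unfolding L2_on_real_iff[OF O(1)] using square_integrable_continuous_compact_supp[OF vp(4,2)] by simp
  qed
  moreover have "L2_on (Omega l h) (grad2 v)"
    unfolding L2_on_pair_iff[OF O(1)] grad2_def fst_conv snd_conv
    using dp(5) dp(4,2) Basis_real2 by (simp add: ind square_integrable_continuous_compact_supp)
  moreover have "(LINT x:Omega l h|lborel. v x * frechet_derivative \<psi> (at x) b) = - (LINT x:Omega l h|lborel. (grad2 v x \<bullet> b) * \<psi> x)"
    if psi: "\<psi> \<in> smooth_periodic l h" and b: "b \<in> Basis" for \<psi> b
  proof -
    have p: "Ck 1 UNIV \<psi>" using psi by (simp add: smooth_periodic_def)
    have g: "grad2 v x \<bullet> b = frechet_derivative v (at x) b" for x
      using b by (auto simp: Basis_real2 grad2_def)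
    have "(LINT x:Omega l h|lborel. v x * frechet_derivative \<psi> (at x) b) = (LINT x|lborel. frechet_derivative \<psi> (at x) b * v x)"
      unfolding set_lebesgue_integral_def
      by (intro Bochner_Integration.integral_cong refl) (use vp(5) in \<open>auto simp: indicator_def\<close>)
    also have "\<dots> = - (LINT x|lborel. \<psi> x * frechet_derivative v (at x) b)"
      using integral_by_parts_compact[OF p vp(1,2) b] by simp
    also have "(LINT x|lborel. \<psi> x * frechet_derivative v (at x) b) = (LINT x:Omega l h|lborel. (grad2 v x \<bullet> b) * \<psi> x)"
      unfolding set_lebesgue_integral_def g
      by (intro Bochner_Integration.integral_cong refl) (use dp(5)[OF b] in \<open>auto simp: indicator_def\<close>)
    finally show ?thesis .
  qed
  ultimately show ?thesis unfolding has_periodic_gradient_def by blast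
qed

section \<open>A periodic smoothing kernel\<close>

lemma Ck_cos_sin: "Ck k UNIV (cos :: real \<Rightarrow> real)" "Ck k UNIV (sin :: real \<Rightarrow> real)"
proof -
  have "Ck k UNIV (cos :: real \<Rightarrow> real) \<and> Ck k UNIV (sin :: real \<Rightarrow> real)"
  proof (induction k)
    case (Suc k)
    then have "Ck k UNIV (\<lambda>x. (-1) * sin x :: real)" by (intro Ck_mult Ck_const) auto
    then have "Ck (Suc k) UNIV (cos :: real \<Rightarrow> real)"
      by (intro Ck_real_Suc[of cos "\<lambda>x. (-1) * sin x"]) (auto intro!: derivative_eq_intros)
    moreover have "Ck (Suc k) UNIV (sin :: real \<Rightarrow> real)"
      by (rule Ck_real_Suc[of sin cos]) (use Suc in \<open>auto intro!: derivative_eq_intros\<close>)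
    ultimately show ?case by blast
  qed (auto intro: continuous_intros)
  then show "Ck k UNIV (cos :: real \<Rightarrow> real)" "Ck k UNIV (sin :: real \<Rightarrow> real)" by auto
qed

text \<open>Periodic with period \<open>2 * L\<close> in \<open>s\<close>, and concentrated at the multiples of the period as \<open>n\<close> grows.\<close>

definition periodic_bump :: "nat \<Rightarrow> real \<Rightarrow> real \<Rightarrow> real" where
  "periodic_bump n L s = flat (cos (pi * s / L) - 1 + 1 / (real n + 1))"

text \<open>The bump is nonzero exactly where the cosine exceeds 1 - 1/(n + 1), that is, near
  multiples of the period; the bound 2 L - d keeps s away from the multiples other than 0.\<close>

lemma periodic_bump_concentrates:
  assumes L: "0 < L" and d: "0 < d" and \<sigma>: "0 < \<sigma>"
  shows "\<exists>N. \<forall>n\<ge>N. \<forall>s. \<bar>s\<bar> \<le> 2 * L - d \<longrightarrow> periodic_bump n L s \<noteq> 0 \<longrightarrow> \<bar>s\<bar> < \<sigma>"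
proof -
  define \<sigma>' where "\<sigma>' = min \<sigma> (min d L)"
  have s': "0 < \<sigma>'" "\<sigma>' \<le> \<sigma>" "\<sigma>' \<le> d" "\<sigma>' \<le> L" using assms by (auto simp: \<sigma>'_def)
  have p: "0 < pi * \<sigma>' / L" "pi * \<sigma>' / L \<le> pi" using s' L by (auto simp: field_simps)
  have "cos (pi * \<sigma>' / L) < 1" using cos_monotone_0_pi[of 0 "pi * \<sigma>' / L"] p by simp
  then obtain N where N: "1 / (real N + 1) < 1 - cos (pi * \<sigma>' / L)"
    using reals_Archimedean[of "1 - cos (pi * \<sigma>' / L)"] by (auto simp: inverse_eq_divide add.commute)
  have "\<bar>s\<bar> < \<sigma>" if n: "n \<ge> N" and s: "\<bar>s\<bar> \<le> 2 * L - d" "periodic_bump n L s \<noteq> 0" for n s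
  proof (rule ccontr)
    assume "\<not> \<bar>s\<bar> < \<sigma>"
    then have s1: "\<sigma>' \<le> \<bar>s\<bar>" "\<bar>s\<bar> \<le> 2 * L - \<sigma>'" using s' s by auto
    have "cos (pi * \<bar>s\<bar> / L) \<le> cos (pi * \<sigma>' / L)"
    proof (cases "\<bar>s\<bar> \<le> L")
      case True
      have "pi * \<sigma>' / L \<le> pi * \<bar>s\<bar> / L" "pi * \<bar>s\<bar> / L \<le> pi" using s1 True L by (auto simp: field_simps)
      then show ?thesis using p by (intro cos_monotone_0_pi_le) auto
    next
      \<comment> \<open>Beyond L the cosine increases again; reflection at L brings the argument
        back to the interval from 0 to pi.\<close>
      case False
      have "pi * \<sigma>' / L \<le> 2 * pi - pi * \<bar>s\<bar> / L"
      proof -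
        have "pi * \<sigma>' / L \<le> pi * (2 * L - \<bar>s\<bar>) / L" using s1 L by (intro divide_right_mono mult_left_mono) auto
        then show ?thesis using L by (simp add: field_simps)
      qed
      moreover have "2 * pi - pi * \<bar>s\<bar> / L \<le> pi"
        using False L by (simp add: field_simps)
      ultimately have "cos (2 * pi - pi * \<bar>s\<bar> / L) \<le> cos (pi * \<sigma>' / L)" using p by (intro cos_monotone_0_pi_le) auto
      then show ?thesis by (simp add: cos_diff)
    qed
    moreover have "cos (pi * \<bar>s\<bar> / L) = cos (pi * s / L)" by (cases "0 \<le> s") auto
    moreover have "1 - 1 / (real n + 1) < cos (pi * s / L)"
      using s(2) by (simp add: periodic_bump_def flat_bounds not_le)
    moreover have "1 / (real n + 1) \<le> 1 / (real N + 1)" using n by (auto intro!: divide_left_mono)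
    ultimately show False using N by linarith
  qed
  then show ?thesis by blast
qed

lemma periodic_bump_simps:
  "periodic_bump n L (- s) = periodic_bump n L s" "0 \<le> periodic_bump n L s" "periodic_bump n L s \<le> 1"
  "0 < periodic_bump n L 0"
proof -
  show "periodic_bump n L (- s) = periodic_bump n L s" by (simp add: periodic_bump_def)
  show "0 \<le> periodic_bump n L s" "periodic_bump n L s \<le> 1" by (auto simp: periodic_bump_def flat_bounds)
  show "0 < periodic_bump n L 0" by (simp add: periodic_bump_def flat_def)
qed

lemma periodic_bump_period: "0 < L \<Longrightarrow> periodic_bump n L (s + 2 * L) = periodic_bump n L s"
proof -
  assume "0 < L"
  then have "pi * (s + 2 * L) / L = pi * s / L + 2 * pi" by (simp add: field_simps)
  then show ?thesis by (simp only: periodic_bump_def cos_periodic)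
qed

lemma Ck_periodic_bump: "Ck k UNIV (periodic_bump n L)"
proof -
  have e: "periodic_bump n L = (\<lambda>s. flat (cos (pi / L * s) - (1 - 1 / (real n + 1))))"
    by (simp add: periodic_bump_def fun_eq_iff algebra_simps)
  show ?thesis
    unfolding e
    by (intro Ck_compose[OF open_UNIV Ck_flat] Ck_diff Ck_const open_UNIV Ck_compose[OF open_UNIV Ck_cos_sin(1)]
      Ck_bounded_linear bounded_linear_mult_right)
qed

text \<open>The periods are 2 l and h. The second factor takes h/2 because
  \<open>periodic_bump n L\<close> has period 2 L.\<close>

definition torus_bump :: "real \<Rightarrow> real \<Rightarrow> nat \<Rightarrow> real \<times> real \<Rightarrow> real" where
  "torus_bump l h n z = periodic_bump n l (fst z) * periodic_bump n (h / 2) (snd z)"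

lemma Ck_torus_bump_translate: "Ck k UNIV (\<lambda>x. torus_bump l h n (x - y))"
proof -
  have "Ck k UNIV (\<lambda>x :: real \<times> real. fst x)" "Ck k UNIV (\<lambda>x :: real \<times> real. snd x)"
    by (intro Ck_bounded_linear bounded_linear_fst bounded_linear_snd)+
  then show ?thesis
    unfolding torus_bump_def fst_diff snd_diff
    by (intro Ck_mult open_UNIV Ck_compose[OF open_UNIV Ck_periodic_bump] Ck_diff Ck_const)
qed

lemma torus_bump_sym: "torus_bump l h n (y - x) = torus_bump l h n (x - y)"
  unfolding torus_bump_def fst_diff snd_diff
  using periodic_bump_simps(1)[of n l "fst x - fst y"] periodic_bump_simps(1)[of n "h/2" "snd x - snd y"] by simp

lemma torus_bump_smooth_periodic:
  assumes "0 < l" "0 < h"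
  shows "(\<lambda>x. torus_bump l h n (x - y)) \<in> smooth_periodic l h"
proof -
  have "torus_bump l h n ((x1 + 2 * l, x2) - y) = torus_bump l h n ((x1, x2) - y)"
    "torus_bump l h n ((x1, x2 + h) - y) = torus_bump l h n ((x1, x2) - y)" for x1 x2
    using periodic_bump_period[of l n "x1 - fst y"] periodic_bump_period[of "h/2" n "x2 - snd y"] assms
    unfolding torus_bump_def by (simp_all add: algebra_simps)
  then show ?thesis unfolding smooth_periodic_def using Ck_torus_bump_translate by blast
qed

lemma torus_bump_concentrates:
  assumes "0 < l" "0 < h" "0 < d" "0 < \<sigma>"
  shows "\<exists>N. \<forall>n\<ge>N. \<forall>z. \<bar>fst z\<bar> \<le> 2 * l - d \<longrightarrow> \<bar>snd z\<bar> \<le> h - d \<longrightarrow> torus_bump l h n z \<noteq> 0 \<longrightarrow> \<bar>fst z\<bar> < \<sigma> \<and> \<bar>snd z\<bar> < \<sigma>"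
proof -
  obtain N1 where N1: "\<And>n s. n \<ge> N1 \<Longrightarrow> \<bar>s\<bar> \<le> 2 * l - d \<Longrightarrow> periodic_bump n l s \<noteq> 0 \<Longrightarrow> \<bar>s\<bar> < \<sigma>"
    using periodic_bump_concentrates[of l d \<sigma>] assms by auto
  obtain N2 where N2: "\<And>n s. n \<ge> N2 \<Longrightarrow> \<bar>s\<bar> \<le> h - d \<Longrightarrow> periodic_bump n (h/2) s \<noteq> 0 \<Longrightarrow> \<bar>s\<bar> < \<sigma>"
    using periodic_bump_concentrates[of "h/2" d \<sigma>] assms by auto
  show ?thesis
    by (rule exI[of _ "max N1 N2"]) (auto simp: torus_bump_def intro: N1 N2)
qed

lemma torus_bump_bounds: "0 \<le> torus_bump l h n z" "torus_bump l h n z \<le> 1" "0 < torus_bump l h n 0"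
  using periodic_bump_simps by (auto simp: torus_bump_def intro!: mult_le_one mult_pos_pos)

lemma torus_bump_continuous: "continuous_on UNIV (torus_bump l h n)"
  using Ck_torus_bump_translate[of 0 l h n 0] by simp

text \<open>Approximate identity on the torus, normalised by the mass \<open>c n\<close> of the
  kernel in one period cell \<open>W\<close> around 0. The differences y - x fill a rectangle larger
  than one cell, but for y in the compact support of \<open>\<xi>\<close> they keep a fixed distance
  from the other periods, so that for large n only the central peak contributes.\<close>

lemma torus_bump_averages:
  fixes \<xi> :: "real \<times> real \<Rightarrow> real"
  assumes l: "0 < l" and h: "0 < h" and xi: "Ck_compact 0 (Omega l h) \<xi>"
  defines "W \<equiv> box (-l, -(h/2)) (l, h/2)"
  defines "c \<equiv> \<lambda>n. LINT z|lborel. indicator W z * torus_bump l h n z"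
  shows "0 < c n"
    and "\<exists>B N. (\<forall>n\<ge>N. \<forall>x\<in>Omega l h. \<bar>(LINT y|lborel. torus_bump l h n (y - x) * \<xi> y) / c n\<bar> \<le> B)"
    and "\<And>x. x \<in> Omega l h \<Longrightarrow> (\<lambda>n. (LINT y|lborel. torus_bump l h n (y - x) * \<xi> y) / c n) \<longlonglongrightarrow> \<xi> x"
proof -
  note x = Ck_compact_UNIV_props[OF xi Omega_props(2)]
  let ?K = "\<lambda>n z. indicator W z * torus_bump l h n z"
  have Wb: "W \<in> sets borel" "bounded W" "open W" by (auto simp: W_def)
  have Wz: "z \<in> W \<longleftrightarrow> \<bar>fst z\<bar> < l \<and> \<bar>snd z\<bar> < h/2" for z by (cases z) (auto simp: W_def box_Pair)
  have iW: "integrable lborel (indicat_real W)" unfolding W_def by (rule indicator_box_integrable)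
  have tm: "torus_bump l h n \<in> borel_measurable lborel" for n
    using borel_measurable_continuous_onI[OF torus_bump_continuous] by simp
  have Ki: "integrable lborel (?K n)" for n
    using integrable_bounded_mult[OF iW tm, where B=1] torus_bump_bounds[of l h n] by (simp add: mult.commute)
  show cpos: "0 < c n" for n
  proof -
    have "open (W \<inter> torus_bump l h n -` {torus_bump l h n 0 / 2 <..})"
      using Wb(3) open_vimage[OF _ torus_bump_continuous, of "{torus_bump l h n 0 / 2 <..}"]
      by (intro open_Int) auto
    moreover have "0 \<in> W \<inter> torus_bump l h n -` {torus_bump l h n 0 / 2 <..}"
      using l h torus_bump_bounds(3)[of l h n] by (simp add: Wz)
    ultimately obtain r where r: "0 < r" "ball 0 r \<subseteq> W \<inter> torus_bump l h n -` {torus_bump l h n 0 / 2 <..}"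
      using open_contains_ball by meson
    have ib: "integrable lborel (indicat_real (ball (0::real\<times>real) r))"
      using emeasure_bounded_finite[OF bounded_ball[of 0 r]] by (simp add: integrable_indicator_iff)
    have "0 < torus_bump l h n 0 / 2 * measure lborel (ball (0::real\<times>real) r)"
      using torus_bump_bounds(3)[of l h n] content_ball_pos[OF r(1), of "0::real\<times>real"] by simp
    also have "\<dots> = (LINT z|lborel. torus_bump l h n 0 / 2 * indicator (ball (0::real\<times>real) r) z)" by simp
    also have "\<dots> \<le> c n"
      unfolding c_def
    proof (rule integral_mono[OF _ Ki])
      show "torus_bump l h n 0 / 2 * indicator (ball 0 r) z \<le> indicator W z * torus_bump l h n z" for z
        using r(2) torus_bump_bounds(1)[of l h n z] by (auto simp: indicator_def less_imp_le)
    qed (use ib in simp)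
    finally show ?thesis .
  qed
  obtain B where B: "0 \<le> B" "\<And>x. \<bar>\<xi> x\<bar> \<le> B"
    using continuous_compact_supp_bound[OF x(4,2)] by blast
  have Ktr: "integrable lborel (\<lambda>y. ?K n (y - x))" "(LINT y|lborel. ?K n (y - x)) = c n" for n x
    using integrable_translate[OF Ki[of n], of "- x"] integral_translate[OF borel_measurable_integrable[OF Ki[of n]], of "- x"]
    by (simp_all add: c_def)
  have xm: "\<xi> \<in> borel_measurable lborel" using borel_measurable_continuous_onI[OF x(4)] by simp
  have Kxi: "integrable lborel (\<lambda>y. ?K n (y - x) * \<xi> y)" for n x
    using integrable_bounded_mult[OF Ktr(1) xm B(2)] by (simp add: mult.commute)
  \<comment> \<open>The margin comes from the distance between the compact support and the
    complement of the rectangle: moving y by half of it in a coordinate direction stays inside,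
    which improves the trivial bounds 2 l and h for the coordinates of y - x by this half.\<close>
  obtain d where d: "0 < d" "\<And>x y. x \<in> Omega l h \<Longrightarrow> y \<in> supp \<xi> \<Longrightarrow> \<bar>fst (y - x)\<bar> \<le> 2 * l - d \<and> \<bar>snd (y - x)\<bar> \<le> h - d"
  proof (cases "supp \<xi> = {}")
    case True
    then show ?thesis using that[of 1] by simp
  next
    case False
    obtain d where d: "0 < d" "\<And>y w. y \<in> supp \<xi> \<Longrightarrow> w \<in> - Omega l h \<Longrightarrow> d \<le> dist y w"
    proof -
      have "closed (- Omega l h)" "supp \<xi> \<inter> - Omega l h = {}" using Omega_props(2) x(3) by (auto simp: closed_def)
      from separate_compact_closed[OF x(2) this] show thesis using that by blast
    qed
    show ?thesis
    proof (rule that[of "d/2"])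
      show "0 < d/2" using d by simp
      fix x y assume xy: "x \<in> Omega l h" "y \<in> supp \<xi>"
      obtain y1 y2 where y: "y = (y1, y2)" by (cases y)
      obtain x1 x2 where xx: "x = (x1, x2)" by (cases x)
      have yO: "y \<in> Omega l h" using xy(2) x(3) by auto
      have bnd: "w \<in> Omega l h" if "dist y w < d" for w using d(2)[OF xy(2), of w] that by fastforce
      have "dist y (y1 + d/2, y2) < d" "dist y (y1 - d/2, y2) < d" "dist y (y1, y2 + d/2) < d" "dist y (y1, y2 - d/2) < d"
        using d(1) by (auto simp: y dist_Pair_Pair dist_real_def)
      then have "(y1 + d/2, y2) \<in> Omega l h" "(y1 - d/2, y2) \<in> Omega l h" "(y1, y2 + d/2) \<in> Omega l h" "(y1, y2 - d/2) \<in> Omega l h"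
        using bnd by auto
      then show "\<bar>fst (y - x)\<bar> \<le> 2 * l - d/2 \<and> \<bar>snd (y - x)\<bar> \<le> h - d/2"
        using xy(1) by (auto simp: y xx Omega_def abs_le_iff)
    qed
  qed
  have "0 < min l (h/2)" using l h by simp
  from torus_bump_concentrates[OF l h d(1) this] obtain N where
    N0: "\<forall>n\<ge>N. \<forall>z. \<bar>fst z\<bar> \<le> 2 * l - d \<longrightarrow> \<bar>snd z\<bar> \<le> h - d \<longrightarrow> torus_bump l h n z \<noteq> 0 \<longrightarrow>
      \<bar>fst z\<bar> < min l (h / 2) \<and> \<bar>snd z\<bar> < min l (h / 2)" by blast
  have N: "z \<in> W" if "n \<ge> N" "\<bar>fst z\<bar> \<le> 2 * l - d" "\<bar>snd z\<bar> \<le> h - d" "torus_bump l h n z \<noteq> 0" for n z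
    using N0[rule_format, OF that] unfolding Wz by auto
  have eq: "(LINT y|lborel. torus_bump l h n (y - x) * \<xi> y) = (LINT y|lborel. ?K n (y - x) * \<xi> y)"
    if "n \<ge> N" "x \<in> Omega l h" for n x
  proof (intro Bochner_Integration.integral_cong refl)
    fix y
    show "torus_bump l h n (y - x) * \<xi> y = ?K n (y - x) * \<xi> y"
      using supp_superset[of \<xi> y] d(2)[OF that(2), of y] N[OF that(1), of "y - x"]
      by (cases "\<xi> y = 0"; cases "torus_bump l h n (y - x) = 0") auto
  qed
  have K0: "0 \<le> ?K n z" for n z using torus_bump_bounds(1)[of l h n z] by (auto simp: indicator_def)
  have "\<bar>(LINT y|lborel. torus_bump l h n (y - x) * \<xi> y) / c n\<bar> \<le> B" if "n \<ge> N" "x \<in> Omega l h" for n x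
  proof -
    have "\<bar>LINT y|lborel. ?K n (y - x) * \<xi> y\<bar> \<le> (LINT y|lborel. \<bar>?K n (y - x) * \<xi> y\<bar>)" by (rule integral_abs_bound)
    also have "\<dots> \<le> (LINT y|lborel. ?K n (y - x) * B)"
    proof (rule integral_mono)
      show "\<bar>?K n (y - x) * \<xi> y\<bar> \<le> ?K n (y - x) * B" for y
        unfolding abs_mult[of "?K n (y - x)" "\<xi> y"] abs_of_nonneg[OF K0] by (rule mult_left_mono[OF B(2) K0])
    qed (use Kxi[where n=n and x=x] Ktr(1)[where n=n and x=x] in auto)
    also have "\<dots> = c n * B" using Ktr(2)[where n=n and x=x] by simp
    finally show ?thesis
      unfolding eq[OF that] using cpos[of n] by (simp add: abs_divide field_simps)
  qed
  then show "\<exists>B N. (\<forall>n\<ge>N. \<forall>x\<in>Omega l h. \<bar>(LINT y|lborel. torus_bump l h n (y - x) * \<xi> y) / c n\<bar> \<le> B)" by blast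
  fix x assume xO: "x \<in> Omega l h"
  show "(\<lambda>n. (LINT y|lborel. torus_bump l h n (y - x) * \<xi> y) / c n) \<longlonglongrightarrow> \<xi> x"
  proof (rule LIMSEQ_I)
    fix e :: real assume e: "0 < e"
    have "isCont \<xi> x" using x(4) continuous_on_eq_continuous_at[OF open_UNIV, of \<xi>] by blast
    then have "\<exists>r>0. \<forall>y. dist y x < r \<longrightarrow> dist (\<xi> y) (\<xi> x) < e/2"
      using e half_gt_zero[OF e] unfolding continuous_at_eps_delta by blast
    then obtain r where r: "0 < r" "\<And>y. dist y x < r \<Longrightarrow> \<bar>\<xi> y - \<xi> x\<bar> < e/2"
      unfolding dist_real_def by blast
    have m: "0 < min (r/2) 1" "0 < min l (h/2)" using r l h by auto
    \<comment> \<open>Inside \<open>W\<close> the coordinates are below l and h/2, so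
      \<open>min l (h/2)\<close> is a valid distance from the other periods.\<close>
    obtain N' where N': "\<And>n z. n \<ge> N' \<Longrightarrow> \<bar>fst z\<bar> \<le> 2 * l - min l (h/2) \<Longrightarrow> \<bar>snd z\<bar> \<le> h - min l (h/2) \<Longrightarrow> torus_bump l h n z \<noteq> 0 \<Longrightarrow> \<bar>fst z\<bar> < r/2 \<and> \<bar>snd z\<bar> < r/2"
    proof -
      have "0 < r/2" using r by simp
      from torus_bump_concentrates[OF l h m(2) this] show thesis using that by blast
    qed
    have "\<bar>(LINT y|lborel. torus_bump l h n (y - x) * \<xi> y) / c n - \<xi> x\<bar> < e" if n: "n \<ge> max N N'" for n
    proof -
      \<comment> \<open>Where the kernel does not vanish, both coordinates of y - x are below r/2,
        so y is within r of x and the continuity of \<open>\<xi>\<close> applies.\<close>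
      have small: "\<bar>\<xi> y - \<xi> x\<bar> \<le> e/2" if "?K n (y - x) \<noteq> 0" for y
      proof -
        have "y - x \<in> W" using that by (auto simp: indicator_def)
        then have "\<bar>fst (y - x)\<bar> \<le> 2 * l - min l (h/2)" "\<bar>snd (y - x)\<bar> \<le> h - min l (h/2)"
          unfolding Wz using l h by (auto simp: min_def)
        then have "\<bar>fst (y - x)\<bar> < r/2 \<and> \<bar>snd (y - x)\<bar> < r/2" using N'[of n "y - x"] n that by auto
        moreover have "dist y x \<le> \<bar>fst (y - x)\<bar> + \<bar>snd (y - x)\<bar>"
          unfolding dist_norm using norm_Pair_le[of "fst (y - x)" "snd (y - x)"] by (simp only: prod.collapse real_norm_def)
        ultimately show ?thesis using r(2)[of y] by fastforce
      qed
      have "\<bar>(LINT y|lborel. ?K n (y - x) * \<xi> y) - c n * \<xi> x\<bar> = \<bar>LINT y|lborel. ?K n (y - x) * \<xi> y - ?K n (y - x) * \<xi> x\<bar>"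
        using Kxi[where n=n and x=x] Ktr[where n=n and x=x] by simp
      also have "\<dots> \<le> (LINT y|lborel. \<bar>?K n (y - x) * \<xi> y - ?K n (y - x) * \<xi> x\<bar>)" by (rule integral_abs_bound)
      also have "\<dots> \<le> (LINT y|lborel. ?K n (y - x) * (e/2))"
      proof (rule integral_mono)
        fix y
        have "\<bar>?K n (y - x) * \<xi> y - ?K n (y - x) * \<xi> x\<bar> = ?K n (y - x) * \<bar>\<xi> y - \<xi> x\<bar>"
          by (simp only: right_diff_distrib[symmetric] abs_mult[of "?K n (y - x)"] abs_of_nonneg[OF K0])
        also have "\<dots> \<le> ?K n (y - x) * (e/2)"
        proof (cases "?K n (y - x) = 0")
          case False
          show ?thesis by (rule mult_left_mono[OF small[OF False] K0])
        next
          case True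
          show ?thesis by (simp only: True mult_zero_left order_refl)
        qed
        finally show "\<bar>?K n (y - x) * \<xi> y - ?K n (y - x) * \<xi> x\<bar> \<le> ?K n (y - x) * (e/2)" .
      next
        show "integrable lborel (\<lambda>y. \<bar>?K n (y - x) * \<xi> y - ?K n (y - x) * \<xi> x\<bar>)"
          by (intro integrable_abs Bochner_Integration.integrable_diff Kxi integrable_mult_left Ktr(1))
        show "integrable lborel (\<lambda>y. ?K n (y - x) * (e/2))" by (intro integrable_mult_left Ktr(1))
      qed
      also have "\<dots> = c n * (e/2)" using Ktr(2)[where n=n and x=x] by simp
      finally have "\<bar>(LINT y|lborel. ?K n (y - x) * \<xi> y) - c n * \<xi> x\<bar> / c n \<le> e/2"
        using cpos[of n] by (simp add: field_simps)
      moreover have "\<bar>(LINT y|lborel. ?K n (y - x) * \<xi> y) - c n * \<xi> x\<bar> / c n = \<bar>(LINT y|lborel. ?K n (y - x) * \<xi> y) / c n - \<xi> x\<bar>"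
      proof -
        have "(LINT y|lborel. ?K n (y - x) * \<xi> y) / c n - \<xi> x = ((LINT y|lborel. ?K n (y - x) * \<xi> y) - c n * \<xi> x) / c n"
          using cpos[of n] by (simp add: field_simps)
        then show ?thesis using cpos[of n] by (simp only: abs_divide abs_of_pos)
      qed
      ultimately show ?thesis using eq[of n x] n xO e by auto
    qed
    then show "\<exists>no. \<forall>n\<ge>no. norm ((LINT y|lborel. torus_bump l h n (y - x) * \<xi> y) / c n - \<xi> x) < e" 
      by (intro exI[of _ "max N N'"]) simp
  qed
qed

text \<open>The defining identity of a periodic weak gradient, extended from smooth periodic functions to
  \<open>C\<^sup>1\<close> functions with compact support by averaging over translates of a periodic kernel.\<close>

lemma has_periodic_gradient_by_parts:
  assumes l: "0 < l" and h: "0 < h" and g: "has_periodic_gradient l h g G"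
    and psi: "Ck_compact 1 (Omega l h) \<psi>" and b: "b \<in> Basis"
  shows "(LINT x:Omega l h|lborel. g x * frechet_derivative \<psi> (at x) b) = - (LINT x:Omega l h|lborel. (G x \<bullet> b) * \<psi> x)"
proof -
  note O = Omega_props[of l h]
  note p = Ck_compact_UNIV_props[OF psi O(2)]
  have p0: "Ck_compact 0 (Omega l h) \<psi>" using psi Ck_le[of 1 "Omega l h" \<psi> 0] by (simp add: Ck_compact_def)
  have d0: "Ck_compact 0 (Omega l h) (\<lambda>x. frechet_derivative \<psi> (at x) b)"
    using Ck_compact_SucD[of 0 "Omega l h" \<psi> b] psi b by simp
  note d = Ck_compact_UNIV_props[OF d0 O(2)]
  let ?g = "\<lambda>x. indicat_real (Omega l h) x * g x" and ?G = "\<lambda>x. indicat_real (Omega l h) x * (G x \<bullet> b)"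
  have "square_integrable ?g" "square_integrable ?G"
    using g b unfolding has_periodic_gradient_def L2_on_real_iff[OF O(1)] L2_on_pair_iff[OF O(1)]
    by (auto simp: Basis_real2 inner_prod_def)
  then have gi: "integrable lborel ?g" and Gi: "integrable lborel ?G"
    by (auto intro: integrable_of_square_integrable_bounded O)
  let ?K = "torus_bump l h"
  let ?D = "\<lambda>n z. frechet_derivative (?K n) (at z) b"
  have KC: "Ck k UNIV (?K n)" for k n using Ck_torus_bump_translate[of k l h n 0] by simp
  have Dc: "continuous_on UNIV (?D n)" for n using KC[of 1 n] b by simp
  have Dtr: "frechet_derivative (\<lambda>x. ?K n (x - y)) (at x) b = ?D n (x - y)" for n x y
  proof -
    have "((\<lambda>x. ?K n (x - y)) has_derivative frechet_derivative (?K n) (at (x - y))) (at x)"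
    proof -
      have d: "((\<lambda>x. x - y) has_derivative (\<lambda>h. h)) (at x)" by (auto intro!: derivative_eq_intros)
      show ?thesis
        using diff_chain_at[OF d Ck_Suc_has_derivative[OF KC[of "Suc 0" n] UNIV_I]] by (simp add: o_def)
    qed
    from frechet_derivative_eqI[OF this] show ?thesis .
  qed
  \<comment> \<open>The kernel is even, hence its partial derivatives are odd; this exchanges
    derivatives in x and in y up to sign.\<close>
  have sym: "?D n (y - x) = - ?D n (x - y)" for n x y
  proof -
    have A: "(?K n has_derivative frechet_derivative (?K n) (at z)) (at z)" for z
      using Ck_Suc_has_derivative[of 0 UNIV "?K n" z] KC[of "Suc 0" n] by simp
    have "((\<lambda>z. ?K n (- z)) has_derivative (\<lambda>h. frechet_derivative (?K n) (at (- (y - x))) (- h))) (at (y - x))"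
      using diff_chain_at[OF has_derivative_minus[OF has_derivative_ident] A[of "- (y - x)"]] by (simp add: o_def)
    moreover have "(\<lambda>z. ?K n (- z)) = ?K n" using torus_bump_sym[of l h n _ 0] by (simp add: fun_eq_iff)
    ultimately have "?D n (y - x) = frechet_derivative (?K n) (at (x - y)) (- b)"
      using frechet_derivative_eqI[of "?K n" "\<lambda>h. frechet_derivative (?K n) (at (- (y - x))) (- h)" "y - x" b] by simp
    then show ?thesis using linear_neg[OF has_derivative_linear[OF A[of "x - y"]], of b] by simp
  qed
  \<comment> \<open>For fixed y the translated kernel is a smooth periodic test function of x.
    Fubini together with an integration by parts in y moves the derivative from the kernel to
    \<open>\<psi>\<close>.\<close>
  have main: "(LINT x|lborel. ?g x * (LINT y|lborel. ?K n (y - x) * frechet_derivative \<psi> (at y) b))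
     = - (LINT x|lborel. ?G x * (LINT y|lborel. ?K n (y - x) * \<psi> y))" for n
  proof -
    have int: "integrable lborel (\<lambda>z. q (fst z - snd z) * (f (fst z) * \<psi> (snd z)))"
      if q: "continuous_on UNIV q" and f: "integrable lborel f" "\<And>x. x \<notin> Omega l h \<Longrightarrow> f x = 0" for q f
    proof -
      have "bounded ((\<lambda>z. fst z - snd z) ` (Omega l h \<times> supp \<psi>))"
        using bounded_minus[OF O(3) compact_imp_bounded[OF p(2)]]
        by (simp add: case_prod_beta')
      then obtain R where R: "\<And>z. z \<in> Omega l h \<times> supp \<psi> \<Longrightarrow> norm (fst z - snd z) \<le> R" unfolding bounded_iff by blast
      have "bounded (q ` cball 0 R)"
        using q by (intro compact_imp_bounded compact_continuous_image) (auto intro: continuous_on_subset)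
      then obtain B where B0: "\<forall>w\<in>q ` cball 0 R. norm w \<le> B" unfolding bounded_iff by blast
      have B: "\<bar>q z\<bar> \<le> B" if "norm z \<le> R" for z
        using bspec[OF B0 imageI[of z "cball 0 R" q]] that by simp
      have qm: "(\<lambda>z. q (fst z - snd z)) \<in> borel_measurable lborel"
      proof -
        have c: "continuous_on UNIV (\<lambda>z :: (real \<times> real) \<times> real \<times> real. fst z - snd z)" by (intro continuous_intros)
        have "continuous_on UNIV (\<lambda>z :: (real \<times> real) \<times> real \<times> real. q (fst z - snd z))"
          by (rule continuous_on_compose2[OF q c]) simp
        then show ?thesis by (simp add: borel_measurable_continuous_onI)
      qed
      have ip: "integrable lborel (\<lambda>z. f (fst z) * \<psi> (snd z))"
        by (rule integrable_product[OF f(1) continuous_compact_supp_integrable[OF p(4,2)]])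
      show ?thesis
      proof (rule Bochner_Integration.integrable_bound)
        show "integrable lborel (\<lambda>z. B * (f (fst z) * \<psi> (snd z)))" using ip by simp
        show "(\<lambda>z. q (fst z - snd z) * (f (fst z) * \<psi> (snd z))) \<in> borel_measurable lborel"
          by (intro borel_measurable_times[OF qm borel_measurable_integrable[OF ip]])
        show "AE z in lborel. norm (q (fst z - snd z) * (f (fst z) * \<psi> (snd z))) \<le> norm (B * (f (fst z) * \<psi> (snd z)))"
        proof (rule AE_I2)
          fix z :: "(real \<times> real) \<times> real \<times> real"
          show "norm (q (fst z - snd z) * (f (fst z) * \<psi> (snd z))) \<le> norm (B * (f (fst z) * \<psi> (snd z)))"
          proof (cases "f (fst z) = 0 \<or> \<psi> (snd z) = 0")
            case False
            then have "z \<in> Omega l h \<times> supp \<psi>" using f(2)[of "fst z"] supp_superset[of \<psi> "snd z"] by (auto simp: mem_Times_iff)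
            then have "\<bar>q (fst z - snd z)\<bar> \<le> \<bar>B\<bar>" using B[OF R, of z] by simp
            then show ?thesis unfolding real_norm_def abs_mult[of "q _"] abs_mult[of B] by (intro mult_right_mono) auto
          qed auto
        qed
      qed
    qed
    have i1: "integrable lborel (\<lambda>z. ?D n (fst z - snd z) * (?g (fst z) * \<psi> (snd z)))"
      by (rule int[OF Dc gi]) simp
    have i2: "integrable lborel (\<lambda>z. ?K n (fst z - snd z) * (?G (fst z) * \<psi> (snd z)))"
      by (rule int[OF torus_bump_continuous Gi]) simp
    have inner1: "(LINT y|lborel. ?D n (x - y) * \<psi> y) = (LINT y|lborel. ?K n (y - x) * frechet_derivative \<psi> (at y) b)" for x
    proof -
      have "(LINT y|lborel. ?K n (y - x) * frechet_derivative \<psi> (at y) b) = - (LINT y|lborel. ?D n (y - x) * \<psi> y)"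
        using integral_by_parts_compact[OF Ck_torus_bump_translate[of 1 l h n x] p(1,2) b] unfolding Dtr .
      also have "\<dots> = (LINT y|lborel. ?D n (x - y) * \<psi> y)" unfolding sym[of n _ x] by simp
      finally show ?thesis ..
    qed
    have "(LINT x|lborel. ?g x * (LINT y|lborel. ?K n (y - x) * frechet_derivative \<psi> (at y) b))
      = (LINT x|lborel. LINT y|lborel. ?D n (x - y) * (?g x * \<psi> y))"
      unfolding inner1[symmetric] by (intro Bochner_Integration.integral_cong refl) (simp add: mult.left_commute)
    also have "\<dots> = (LINT y|lborel. LINT x|lborel. ?D n (x - y) * (?g x * \<psi> y))"
      using lborel_pair_integral(1,2)[OF i1] by simp
    also have "\<dots> = (LINT y|lborel. - (LINT x|lborel. ?K n (x - y) * (?G x * \<psi> y)))"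
    proof (intro Bochner_Integration.integral_cong refl)
      fix y
      have "(LINT x:Omega l h|lborel. g x * ?D n (x - y)) = - (LINT x:Omega l h|lborel. (G x \<bullet> b) * ?K n (x - y))"
        using g b torus_bump_smooth_periodic[OF l h, of n y] unfolding has_periodic_gradient_def Dtr[symmetric] by blast
      then have e: "(LINT x|lborel. ?g x * ?D n (x - y)) = - (LINT x|lborel. ?G x * ?K n (x - y))"
        unfolding set_lebesgue_integral_def by (simp add: mult.assoc)
      have "(LINT x|lborel. ?D n (x - y) * (?g x * \<psi> y)) = (LINT x|lborel. (?g x * ?D n (x - y)) * \<psi> y)"
        by (intro Bochner_Integration.integral_cong refl) simp
      also have "\<dots> = - (LINT x|lborel. (?G x * ?K n (x - y)) * \<psi> y)"
        unfolding integral_mult_left_zero e by simp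
      also have "(LINT x|lborel. (?G x * ?K n (x - y)) * \<psi> y) = (LINT x|lborel. ?K n (x - y) * (?G x * \<psi> y))"
        by (intro Bochner_Integration.integral_cong refl) simp
      finally show "(LINT x|lborel. ?D n (x - y) * (?g x * \<psi> y)) = - (LINT x|lborel. ?K n (x - y) * (?G x * \<psi> y))" .
    qed
    also have "\<dots> = - (LINT x|lborel. LINT y|lborel. ?K n (x - y) * (?G x * \<psi> y))"
      using lborel_pair_integral(1,2)[OF i2] by simp
    also have "(LINT x|lborel. LINT y|lborel. ?K n (x - y) * (?G x * \<psi> y)) = (LINT x|lborel. ?G x * (LINT y|lborel. ?K n (y - x) * \<psi> y))"
      unfolding torus_bump_sym[of l h n]
      by (simp only: mult.left_commute[of _ "indicat_real (Omega l h) _ * _"] integral_mult_right_zero)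
    finally show ?thesis .
  qed
  let ?W = "box (-l, -(h/2)) (l, h/2)"
  define c where "c n = (LINT z|lborel. indicator ?W z * ?K n z)" for n
  \<comment> \<open>Division by \<open>c n\<close> turns the kernel integrals into averages that
    converge boundedly on the rectangle to the averaged function.\<close>
  have lim: "(\<lambda>n. LINT x|lborel. f x * ((LINT y|lborel. ?K n (y - x) * \<xi> y) / c n)) \<longlonglongrightarrow> (LINT x|lborel. f x * \<xi> x)"
    if f: "integrable lborel f" "\<And>x. x \<notin> Omega l h \<Longrightarrow> f x = 0" and xi: "Ck_compact 0 (Omega l h) \<xi>" for f \<xi>
  proof -
    note x = Ck_compact_UNIV_props[OF xi O(2)]
    obtain B N where B: "\<And>n x. n \<ge> N \<Longrightarrow> x \<in> Omega l h \<Longrightarrow> \<bar>(LINT y|lborel. ?K n (y - x) * \<xi> y) / c n\<bar> \<le> B"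
      using torus_bump_averages(2)[OF l h xi] unfolding c_def by blast
    have xm: "\<xi> \<in> borel_measurable borel" using borel_measurable_continuous_onI[OF x(4)] by simp
    have Km: "(\<lambda>p. ?K n (snd p - fst p) * \<xi> (snd p)) \<in> borel_measurable (lborel \<Otimes>\<^sub>M lborel)" for n
    proof -
      have "(\<lambda>p :: (real\<times>real)\<times>real\<times>real. ?K n (snd p - fst p) * \<xi> (snd p)) \<in> borel_measurable borel"
      proof (intro borel_measurable_continuous_onI continuous_on_mult)
        show "continuous_on UNIV (\<lambda>p :: (real\<times>real)\<times>real\<times>real. ?K n (snd p - fst p))"
          by (rule continuous_on_compose2[OF torus_bump_continuous]) (intro continuous_intros, simp)
        show "continuous_on UNIV (\<lambda>p :: (real\<times>real)\<times>real\<times>real. \<xi> (snd p))"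
          by (rule continuous_on_compose2[OF x(4)]) (auto intro: continuous_intros)
      qed
      then show ?thesis by (simp only: lborel_prod) simp
    qed
    have m: "(\<lambda>x. LINT y|lborel. ?K n (y - x) * \<xi> y) \<in> borel_measurable lborel" for n
      using lborel.borel_measurable_lebesgue_integral[of "\<lambda>x y. ?K n (y - x) * \<xi> y" lborel] Km[of n] by (simp add: case_prod_beta)
    \<comment> \<open>The uniform bound of the averages starts at \<open>N\<close>, hence the
      shifted sequence.\<close>
    have "(\<lambda>n. LINT x|lborel. f x * ((LINT y|lborel. ?K (n + N) (y - x) * \<xi> y) / c (n + N))) \<longlonglongrightarrow> (LINT x|lborel. f x * \<xi> x)"
    proof (rule integral_dominated_convergence[where w="\<lambda>x. \<bar>f x\<bar> * B"])
      show "(\<lambda>x. f x * \<xi> x) \<in> borel_measurable lborel" using f(1) xm by (auto dest: borel_measurable_integrable)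
      show "(\<lambda>x. f x * ((LINT y|lborel. ?K (n + N) (y - x) * \<xi> y) / c (n + N))) \<in> borel_measurable lborel" for n
        by (intro borel_measurable_times borel_measurable_divide borel_measurable_const m borel_measurable_integrable[OF f(1)])
      show "integrable lborel (\<lambda>x. \<bar>f x\<bar> * B)" using f(1) by simp
      show "AE x in lborel. (\<lambda>n. f x * ((LINT y|lborel. ?K (n + N) (y - x) * \<xi> y) / c (n + N))) \<longlonglongrightarrow> f x * \<xi> x"
      proof (rule AE_I2)
        fix x :: "real \<times> real"
        show "(\<lambda>n. f x * ((LINT y|lborel. ?K (n + N) (y - x) * \<xi> y) / c (n + N))) \<longlonglongrightarrow> f x * \<xi> x"
        proof (cases "x \<in> Omega l h")
          case True
          show ?thesis
            unfolding c_def
            by (rule tendsto_mult_left[OF LIMSEQ_ignore_initial_segment[OF torus_bump_averages(3)[OF l h xi True], of N]])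
        qed (simp add: f(2))
      qed
      show "AE x in lborel. norm (f x * ((LINT y|lborel. ?K (n + N) (y - x) * \<xi> y) / c (n + N))) \<le> \<bar>f x\<bar> * B" for n
      proof (rule AE_I2)
        fix x
        show "norm (f x * ((LINT y|lborel. ?K (n + N) (y - x) * \<xi> y) / c (n + N))) \<le> \<bar>f x\<bar> * B"
        proof (cases "x \<in> Omega l h")
          case True
          then show ?thesis using B[of "n + N" x] unfolding real_norm_def abs_mult[of "f x"] by (intro mult_left_mono) auto
        qed (simp add: f(2))
      qed
    qed
    then show ?thesis by (rule LIMSEQ_offset)
  qed
  have e: "(\<lambda>n. LINT x|lborel. ?g x * ((LINT y|lborel. ?K n (y - x) * frechet_derivative \<psi> (at y) b) / c n))
     = (\<lambda>n. - (LINT x|lborel. ?G x * ((LINT y|lborel. ?K n (y - x) * \<psi> y) / c n)))"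
    unfolding times_divide_eq_right using main by (simp add: fun_eq_iff)
  have l1: "(\<lambda>n. LINT x|lborel. ?g x * ((LINT y|lborel. ?K n (y - x) * frechet_derivative \<psi> (at y) b) / c n)) \<longlonglongrightarrow>
      (LINT x|lborel. ?g x * frechet_derivative \<psi> (at x) b)"
    by (rule lim[OF gi _ d0]) simp
  have l2: "(\<lambda>n. - (LINT x|lborel. ?G x * ((LINT y|lborel. ?K n (y - x) * \<psi> y) / c n))) \<longlonglongrightarrow> - (LINT x|lborel. ?G x * \<psi> x)"
    by (rule tendsto_minus[OF lim[OF Gi _ p0]]) simp
  have "(LINT x|lborel. ?g x * frechet_derivative \<psi> (at x) b) = - (LINT x|lborel. ?G x * \<psi> x)"
    by (rule LIMSEQ_unique[OF l1[unfolded e] l2])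
  then show ?thesis unfolding set_lebesgue_integral_def by (simp add: mult.assoc)
qed

section \<open>Oscillating coefficients\<close>

text \<open>A nonempty open set contains a ball of positive measure. This is the device for picking
  good points and good times.\<close>

lemma AE_meets_open:
  fixes U :: "'a::euclidean_space set"
  assumes "AE x in lborel. P x" "open U" "U \<noteq> {}"
  shows "\<exists>x\<in>U. P x"
proof (rule ccontr)
  assume n: "\<not> (\<exists>x\<in>U. P x)"
  obtain x r where r: "0 < r" "ball x r \<subseteq> U" using assms(2,3) open_contains_ball by blast
  have "AE x in lborel. x \<notin> ball x0 r" if "x0 = x" for x0
    using assms(1) by eventually_elim (use n r that in auto)
  then have "AE y in lborel. y \<notin> ball x r" by simp
  then have "ball x r \<in> null_sets lborel" by (subst AE_iff_null_sets) auto
  then have "measure lborel (ball x r) = 0" by (simp add: measure_def null_sets_def)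
  then show False using content_ball_pos[OF r(1), of x] by simp
qed

lemma set_integral_eq_indicator:
  "(LINT x:S|M. f x) = (LINT x|M. indicat_real S x * f x)"
  by (simp add: set_lebesgue_integral_def)

lemma AE_bounded_on_integrable:
  fixes g :: "'a::euclidean_space \<Rightarrow> real"
  assumes "Linf_on S g" "S \<in> sets borel" "bounded S"
  shows "integrable lborel (\<lambda>x. indicat_real S x * g x)"
proof -
  obtain B where B: "AE x\<in>S in lborel. \<bar>g x\<bar> \<le> B" and m: "(\<lambda>x. indicat_real S x * g x) \<in> borel_measurable lborel"
    using assms(1) by (auto simp: Linf_on_def set_borel_measurable_def)
  have "integrable lborel (indicat_real S)"
    using emeasure_bounded_finite[OF assms(3)] assms(2) by (simp add: integrable_indicator_iff)
  then have i: "integrable lborel (\<lambda>x. B * indicat_real S x)" by simp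
  show ?thesis
  proof (rule Bochner_Integration.integrable_bound[OF i m])
    show "AE x in lborel. norm (indicat_real S x * g x) \<le> norm (B * indicat_real S x)"
      using B by eventually_elim (auto simp: indicator_def)
  qed
qed

section \<open>Lipschitz continuity in time\<close>

lemma primitive0_Lipschitz:
  assumes "integrable lborel (\<lambda>s. g (s, q))" "AE s in lborel. \<bar>g (s, q)\<bar> \<le> B" "0 \<le> s" "s \<le> t"
  shows "\<bar>primitive0 g (t, q) - primitive0 g (s, q)\<bar> \<le> B * (t - s)"
proof -
  have i: "integrable lborel (\<lambda>r. indicat_real {0<..<a} r * g (r, q))" for a
    using integrable_mult_indicator[OF _ assms(1), of "{0<..<a}"] by simp
  have "primitive0 g (t, q) - primitive0 g (s, q) = (LINT r|lborel. indicat_real {0<..<t} r * g (r, q) - indicat_real {0<..<s} r * g (r, q))"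
    unfolding primitive0_def using i by simp
  also have "\<bar>\<dots>\<bar> \<le> (LINT r|lborel. \<bar>indicat_real {0<..<t} r * g (r, q) - indicat_real {0<..<s} r * g (r, q)\<bar>)"
    by (rule integral_abs_bound)
  also have "\<dots> \<le> (LINT r|lborel. B * indicat_real {s..t} r)"
  proof (rule integral_mono_AE)
    show "integrable lborel (\<lambda>r. \<bar>indicat_real {0<..<t} r * g (r, q) - indicat_real {0<..<s} r * g (r, q)\<bar>)"
      by (rule integrable_abs[OF Bochner_Integration.integrable_diff[OF i i]])
    show "AE r in lborel. \<bar>indicat_real {0<..<t} r * g (r, q) - indicat_real {0<..<s} r * g (r, q)\<bar> \<le> B * indicat_real {s..t} r"
      using assms(2) by eventually_elim (use assms(3,4) in \<open>auto simp: indicator_def\<close>)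
    have "integrable lborel (indicat_real {s..t})"
      using emeasure_bounded_finite[of "{s..t}"] by (simp add: integrable_indicator_iff)
    then show "integrable lborel (\<lambda>r. B * indicat_real {s..t} r)" by simp
  qed
  also have "\<dots> = B * (t - s)" using assms(4) by simp
  finally show ?thesis .
qed

lemma weak_derivative_restrict:
  fixes f g :: "real \<times> 'b::euclidean_space \<Rightarrow> real"
  assumes "has_weak_pderiv S (1, 0) f g" "\<theta> \<in> test_functions S"
  shows "(LINT z|lborel. (indicat_real S z * f z) * frechet_derivative \<theta> (at z) (1, 0)) = - (LINT z|lborel. (indicat_real S z * g z) * \<theta> z)"
proof -
  have "(LINT z:S|lborel. f z * frechet_derivative \<theta> (at z) (1, 0)) = - (LINT z:S|lborel. g z * \<theta> z)"
    using assms by (simp add: has_weak_pderiv_def)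
  then show ?thesis by (simp add: set_integral_eq_indicator mult.assoc)
qed

text \<open>On almost every line in time the coefficient is a constant plus the primitive of its
  bounded weak time derivative, which gives the Lipschitz bound at almost all points; continuity
  carries it over to all points.\<close>

lemma W1inf_Lipschitz_time:
  fixes c :: "real \<times> 'b::euclidean_space \<Rightarrow> real"
  assumes T: "0 < T" and W: "W1inf_on ({0<..<T} \<times> box a b) c" and cc: "continuous_on ({0<..<T} \<times> box a b) c"
  shows "\<exists>K\<ge>0. \<forall>s\<in>{0<..<T}. \<forall>t\<in>{0<..<T}. \<forall>q\<in>box a b. \<bar>c (t, q) - c (s, q)\<bar> \<le> K * \<bar>t - s\<bar>"
proof -
  let ?S = "{0<..<T} \<times> box a b"
  have Sb: "?S = box (0, a) (T, b)" by (simp add: box_Pair)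
  have So: "open ?S" "bounded ?S" "?S \<in> sets borel" unfolding Sb by auto
  have e1: "(1, 0) \<in> (Basis :: (real \<times> 'b) set)" by (auto simp: Basis_prod_def)
  obtain g where g: "Linf_on ?S g" "has_weak_pderiv ?S (1, 0) c g"
    using W e1 unfolding W1inf_on_def by blast
  obtain B where B: "AE z\<in>?S in lborel. \<bar>g z\<bar> \<le> B" using g(1) by (auto simp: Linf_on_def)
  let ?g = "\<lambda>z. indicat_real ?S z * g z"
  have gi: "integrable lborel ?g" by (rule AE_bounded_on_integrable[OF g(1) So(3,2)])
  have ci: "integrable lborel (\<lambda>z. indicat_real ?S z * c z)"
    using W by (intro AE_bounded_on_integrable So) (simp add: W1inf_on_def)
  obtain p where p: "AE z in lborel. z \<in> ?S \<longrightarrow> indicat_real ?S z * c z = p (snd z) + primitive0 ?g z"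
  proof -
    have "\<exists>p. p \<in> borel_measurable lborel \<and> (AE z in lborel. z \<in> ?S \<longrightarrow> indicat_real ?S z * c z = p (snd z) + primitive0 ?g z)"
      by (rule weak_time_derivative_primitive[OF T refl ci gi]) (simp, simp, rule weak_derivative_restrict[OF g(2)])
    then show thesis using that by blast
  qed
  define K where "K = \<bar>B\<bar>"
  have gB: "AE z in lborel. \<bar>?g z\<bar> \<le> K"
    using B by eventually_elim (auto simp: K_def indicator_def)
  \<comment> \<open>The quantifiers are nested as almost every q, then t, then s, because the
    representation is available on almost every line and there at almost every time.\<close>
  have good: "AE q in lborel. q \<in> box a b \<longrightarrow> (AE t in lborel. AE s in lborel. s \<in> {0<..<T} \<longrightarrow> t \<in> {0<..<T} \<longrightarrow>
      \<bar>c (t, q) - c (s, q)\<bar> \<le> K * \<bar>t - s\<bar>)"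
    using AE_lborel_pair(2)[OF p] AE_lborel_pair(2)[OF gB] lborel_pair_integral(4)[OF gi]
  proof eventually_elim
    case (elim q)
    have lip: "\<bar>c (t, q) - c (s, q)\<bar> \<le> K * \<bar>t - s\<bar>"
      if "q \<in> box a b" "s \<in> {0<..<T}" "t \<in> {0<..<T}"
        "(t, q) \<in> ?S \<longrightarrow> indicat_real ?S (t, q) * c (t, q) = p (snd (t, q)) + primitive0 ?g (t, q)"
        "(s, q) \<in> ?S \<longrightarrow> indicat_real ?S (s, q) * c (s, q) = p (snd (s, q)) + primitive0 ?g (s, q)" for s t
    proof -
      have eq: "c (t, q) - c (s, q) = primitive0 ?g (t, q) - primitive0 ?g (s, q)" using that by simp
      show ?thesis
      proof (cases "s \<le> t")
        case True
        then show ?thesis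
          unfolding eq using primitive0_Lipschitz[of ?g q K s t] elim(2,3) that(2) by auto
      next
        case False
        then show ?thesis
          unfolding eq using primitive0_Lipschitz[of ?g q K t s] elim(2,3) that(3) by (auto simp: abs_minus_commute)
      qed
    qed
    show ?case
    proof
      assume q: "q \<in> box a b"
      show "AE t in lborel. AE s in lborel. s \<in> {0<..<T} \<longrightarrow> t \<in> {0<..<T} \<longrightarrow> \<bar>c (t, q) - c (s, q)\<bar> \<le> K * \<bar>t - s\<bar>"
        using elim(1)
      proof eventually_elim
        case (elim t)
        note et = elim
        show ?case using \<open>AE x in lborel. (x, q) \<in> ?S \<longrightarrow> indicat_real ?S (x, q) * c (x, q) = p (snd (x, q)) + primitive0 ?g (x, q)\<close>
        proof eventually_elim
          case (elim s)
          show ?case using lip[OF q _ _ et elim] by blast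
        qed
      qed
    qed
  qed
  have "\<bar>c (t, q) - c (s, q)\<bar> \<le> K * \<bar>t - s\<bar>" if st: "s \<in> {0<..<T}" "t \<in> {0<..<T}" "q \<in> box a b" for s t q
  proof (rule ccontr)
    assume n: "\<not> ?thesis"
    \<comment> \<open>A violation by \<open>gap\<close> would persist, with half its size, near (t,
      q) and (s, q). Good points q', t', s', chosen in this order in small balls, contradict
      it.\<close>
    define gap where "gap = \<bar>c (t, q) - c (s, q)\<bar> - K * \<bar>t - s\<bar>"
    have gap: "0 < gap" using n by (simp add: gap_def)
    have near: "\<exists>r>0. \<forall>z. dist z (t', q) < r \<longrightarrow> z \<in> ?S \<and> \<bar>c z - c (t', q)\<bar> < gap / 4" if "t' \<in> {0<..<T}" for t'
    proof -
      have z: "(t', q) \<in> ?S" using that st by auto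
      obtain r1 where r1: "0 < r1" "\<And>z. dist z (t', q) < r1 \<Longrightarrow> z \<in> ?S"
        using So(1) z unfolding open_dist by blast
      have "isCont c (t', q)" using cc z continuous_on_eq_continuous_at[OF So(1)] by blast
      then obtain r2 where r2: "0 < r2" "\<And>z. dist z (t', q) < r2 \<Longrightarrow> dist (c z) (c (t', q)) < gap / 4"
        using gap unfolding continuous_at_eps_delta by (meson divide_pos_pos zero_less_numeral)
      show ?thesis using r1 r2 by (intro exI[of _ "min r1 r2"]) (auto simp: dist_real_def)
    qed
    obtain rt where rt: "0 < rt" "\<And>z. dist z (t, q) < rt \<Longrightarrow> z \<in> ?S \<and> \<bar>c z - c (t, q)\<bar> < gap / 4" using near[OF st(2)] by blast
    obtain rs where rs: "0 < rs" "\<And>z. dist z (s, q) < rs \<Longrightarrow> z \<in> ?S \<and> \<bar>c z - c (s, q)\<bar> < gap / 4" using near[OF st(1)] by blast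
    \<comment> \<open>2 r stays within both continuity radii, and the last entry of the minimum
      makes the excess \<open>K * (2 * r)\<close> smaller than \<open>gap / 2\<close>.\<close>
    define r where "r = min (min rt rs / 2) (gap / (4 * (K + 1)))"
    have K0: "0 \<le> K" by (simp add: K_def)
    have r: "0 < r" "2 * r \<le> rt" "2 * r \<le> rs" "r \<le> gap / (4 * (K + 1))"
      using rt rs gap K0 by (auto simp: r_def)
    have dd: "dist (t', q') (t'', q) < 2 * r" if "dist t' t'' < r" "dist q' q < r" for t' t'' :: real and q'
      using that norm_Pair_le[of "t' - t''" "q' - q"] by (simp add: dist_norm)
    have bne: "ball x r \<noteq> {}" for x :: 'b using r(1) by simp
    have bner: "ball x r \<noteq> {}" for x :: real using r(1) by simp
    obtain q' where q': "q' \<in> ball q r" "q' \<in> box a b \<longrightarrow> (AE t in lborel. AE s in lborel. s \<in> {0<..<T} \<longrightarrow> t \<in> {0<..<T} \<longrightarrow>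
      \<bar>c (t, q') - c (s, q')\<bar> \<le> K * \<bar>t - s\<bar>)" using AE_meets_open[OF good open_ball bne[of q]] by blast
    have "(t, q') \<in> ?S" using rt(2)[of "(t, q')"] dd[of t t q'] q'(1) r by (simp add: dist_commute)
    then have "q' \<in> box a b" by simp
    then have gq: "AE t in lborel. AE s in lborel. s \<in> {0<..<T} \<longrightarrow> t \<in> {0<..<T} \<longrightarrow> \<bar>c (t, q') - c (s, q')\<bar> \<le> K * \<bar>t - s\<bar>"
      using q'(2) by blast
    obtain t' where t': "t' \<in> ball t r" "AE s in lborel. s \<in> {0<..<T} \<longrightarrow> t' \<in> {0<..<T} \<longrightarrow> \<bar>c (t', q') - c (s, q')\<bar> \<le> K * \<bar>t' - s\<bar>"
      using AE_meets_open[OF gq open_ball bner[of t]] by blast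
    obtain s' where s': "s' \<in> ball s r" "s' \<in> {0<..<T} \<longrightarrow> t' \<in> {0<..<T} \<longrightarrow> \<bar>c (t', q') - c (s', q')\<bar> \<le> K * \<bar>t' - s'\<bar>"
      using AE_meets_open[OF t'(2) open_ball bner[of s]] by blast
    have a: "(t', q') \<in> ?S \<and> \<bar>c (t', q') - c (t, q)\<bar> < gap / 4"
      using rt(2)[of "(t', q')"] dd[of t' t q'] t'(1) q'(1) r by (simp add: dist_commute)
    have b: "(s', q') \<in> ?S \<and> \<bar>c (s', q') - c (s, q)\<bar> < gap / 4"
      using rs(2)[of "(s', q')"] dd[of s' s q'] s'(1) q'(1) r by (simp add: dist_commute)
    have l: "\<bar>c (t', q') - c (s', q')\<bar> \<le> K * \<bar>t' - s'\<bar>" using s'(2) a b by auto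
    have "\<bar>t' - s'\<bar> \<le> \<bar>t - s\<bar> + 2 * r" using t'(1) s'(1) by (auto simp: dist_real_def)
    then have "K * \<bar>t' - s'\<bar> \<le> K * \<bar>t - s\<bar> + K * (2 * r)" using K0 by (metis distrib_left mult_left_mono)
    moreover have tri: "\<bar>a' - b'\<bar> \<le> X + g / 2" if "\<bar>p - a'\<bar> < g / 4" "\<bar>r - b'\<bar> < g / 4" "\<bar>p - r\<bar> \<le> X" for a' b' p r g X :: real
      using that by linarith
    have "\<bar>c (t, q) - c (s, q)\<bar> \<le> K * \<bar>t' - s'\<bar> + gap / 2"
      by (rule tri[OF conjunct2[OF a] conjunct2[OF b] l])
    ultimately have "\<bar>c (t, q) - c (s, q)\<bar> \<le> K * \<bar>t - s\<bar> + K * (2 * r) + gap / 2" by linarith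
    moreover have "\<bar>c (t, q) - c (s, q)\<bar> = gap + K * \<bar>t - s\<bar>" by (simp add: gap_def)
    moreover obtain X where X: "X = K * \<bar>t - s\<bar>" by blast
    ultimately have "gap \<le> K * (2 * r) + gap / 2" unfolding X[symmetric] by linarith
    moreover have "K * (2 * r) < gap / 2"
    proof -
      have "4 * (K + 1) * r \<le> gap" using r(4) K0 by (simp add: field_simps)
      moreover have "2 * (K * (2 * r)) < 4 * (K + 1) * r" using r(1) by (simp add: algebra_simps)
      ultimately show ?thesis by linarith
    qed
    ultimately show False by linarith
  qed
  then show ?thesis by (intro exI[of _ K]) (auto simp: K_def)
qed

lemma periodic_int_shift:
  fixes f :: "real \<Rightarrow> real"
  assumes "\<And>y. f (y + 1) = f y"
  shows "f (y + of_int k) = f y"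
proof (induction k rule: int_induct[where k=0])
  case (step1 i)
  then show ?case using assms[of "y + of_int i"] by (simp add: add.assoc)
next
  case (step2 i)
  then show ?case using assms[of "y + of_int (i - 1)"] by simp
qed simp

lemma periodic_frac:
  fixes f :: "real \<Rightarrow> real"
  assumes "\<And>y. f (y + 1) = f y"
  shows "f y = f (frac y)"
  using periodic_int_shift[of f "frac y" "\<lfloor>y\<rfloor>", OF assms] by (simp add: frac_def)

text \<open>The two fast times \<open>\<tau>\<close> and \<open>\<tau>'\<close> may differ, since in
  the oscillating coefficient the fast time t/\<epsilon> moves along with t. That the coefficient
  does not depend on it keeps \<open>K\<close> free of \<epsilon>; periodicity extends the bound
  from the cell to all y2 and z.\<close>

lemma coefficient_Lipschitz_time:
  assumes T: "0 < T" and c: "W1inf_periodic_coeff h T c" and B1: "no_fast_time h T c"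
  shows "\<exists>K\<ge>0. \<forall>s t x2 \<tau> \<tau>' y z. (s, x2, \<tau>, y, z) \<in> coeff_domain h T \<longrightarrow> (t, x2, \<tau>', y, z) \<in> coeff_domain h T \<longrightarrow>
    \<bar>c (t, x2, \<tau>', y, z) - c (s, x2, \<tau>, y, z)\<bar> \<le> K * \<bar>t - s\<bar>"
proof -
  let ?a = "(0, 0, (-1/2, 0), 0) :: real \<times> real \<times> (real \<times> real) \<times> real"
  let ?b = "(h, 1, (1/2, 1), 1) :: real \<times> real \<times> (real \<times> real) \<times> real"
  have cell: "coeff_cell h T = {0<..<T} \<times> box ?a ?b" by (simp add: coeff_cell_def box_Pair)
  have dom: "open (coeff_domain h T)" unfolding coeff_domain_def by (intro open_Times) auto
  have cc: "continuous_on (coeff_domain h T) c" and per: "coeff_periodic h T c" and W: "W1inf_on (coeff_cell h T) c"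
    using c by (auto simp: W1inf_periodic_coeff_def)
  have "coeff_cell h T \<subseteq> coeff_domain h T" by (auto simp: coeff_cell_def coeff_domain_def)
  then have "continuous_on (coeff_cell h T) c" using cc continuous_on_subset by blast
  then obtain K where K: "0 \<le> K" "\<And>s t q. s \<in> {0<..<T} \<Longrightarrow> t \<in> {0<..<T} \<Longrightarrow> q \<in> box ?a ?b \<Longrightarrow> \<bar>c (t, q) - c (s, q)\<bar> \<le> K * \<bar>t - s\<bar>"
    using W1inf_Lipschitz_time[OF T W[unfolded cell]] unfolding cell by blast
  \<comment> \<open>The fast time is frozen at 1/2, an interior point of the unit interval.\<close>
  have tau: "c (t, x2, \<tau>, y, z) = c (t, x2, 1/2, y, z)" if "(t, x2, \<tau>, y, z) \<in> coeff_domain h T" for t x2 \<tau> y z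
    using B1 that unfolding no_fast_time_def by blast
  have fr: "c (t, x2, 1/2, (y1, y2), z) = c (t, x2, 1/2, (y1, frac y2), frac z)"
    if "t \<in> {0<..<T}" "x2 \<in> {0<..<h}" "y1 \<in> {-1/2<..<1/2}" for t x2 y1 y2 z
  proof -
    have d: "(t, x2, 1/2, (y1, y), z) \<in> coeff_domain h T" for y z using that by (auto simp: coeff_domain_def)
    have "c (t, x2, 1/2, (y1, y2), z) = c (t, x2, 1/2, (y1, frac y2), z)"
      by (rule periodic_frac[of "\<lambda>y. c (t, x2, 1/2, (y1, y), z)"]) (use per d in \<open>simp add: coeff_periodic_def\<close>)
    also have "\<dots> = c (t, x2, 1/2, (y1, frac y2), frac z)"
      by (rule periodic_frac[of "\<lambda>z. c (t, x2, 1/2, (y1, frac y2), z)"]) (use per d in \<open>simp add: coeff_periodic_def\<close>)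
    finally show ?thesis .
  qed
  have main: "\<bar>c (t, x2, 1/2, (y1, y2), z) - c (s, x2, 1/2, (y1, y2), z)\<bar> \<le> K * \<bar>t - s\<bar>"
    if st: "s \<in> {0<..<T}" "t \<in> {0<..<T}" and x: "x2 \<in> {0<..<h}" and y: "y1 \<in> {-1/2<..<1/2}" for s t x2 y1 y2 z
  proof -
    \<comment> \<open>A fractional part may be 0, which lies outside the open cell. The shift
      \<open>e n\<close> is positive and smaller than the distance of both fractional parts from 1,
      so the shifted ones lie inside; continuity then lets the shift tend to 0.\<close>
    define e where "e n = (1 - max (frac y2) (frac z)) / (real n + 2)" for n
    have f1: "0 < 1 - max (frac y2) (frac z)" using frac_lt_1[of y2] frac_lt_1[of z] by simp
    have e: "0 < e n" "e n < 1 - max (frac y2) (frac z)" for n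
      using f1 mult_strict_left_mono[of 1 "real n + 2" "1 - max (frac y2) (frac z)"]
      unfolding e_def by (simp_all add: divide_less_eq)
    have e0: "e \<longlonglongrightarrow> 0"
    proof -
      have "filterlim (\<lambda>n. real n + 2) at_top sequentially"
        by (rule filterlim_tendsto_add_at_top[OF tendsto_const filterlim_real_sequentially, of 2, simplified add.commute])
      then show ?thesis unfolding e_def by (rule real_tendsto_divide_at_top[OF tendsto_const])
    qed
    have fra: "frac (r + e n) = frac r + e n" "0 < frac r + e n" "frac r + e n < 1" if "frac r \<le> max (frac y2) (frac z)" for r n
    proof -
      show b: "0 < frac r + e n" "frac r + e n < 1" using e[of n] that frac_ge_0[of r] by linarith+
      show "frac (r + e n) = frac r + e n"
        using b unfolding frac_unique_iff by (simp add: frac_def)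
    qed
    have lim: "(\<lambda>n. c (t', x2, 1/2, (y1, y2 + e n), z + e n)) \<longlonglongrightarrow> c (t', x2, 1/2, (y1, y2), z)" if "t' \<in> {0<..<T}" for t'
    proof -
      have "(t', x2, 1/2, (y1, y2), z) \<in> coeff_domain h T" using that x y by (auto simp: coeff_domain_def)
      then have "isCont c (t', x2, 1/2, (y1, y2), z)" using cc continuous_on_eq_continuous_at[OF dom] by blast
      moreover have "(\<lambda>n. y2 + e n) \<longlonglongrightarrow> y2" "(\<lambda>n. z + e n) \<longlonglongrightarrow> z"
        using tendsto_add[OF tendsto_const e0, of y2] tendsto_add[OF tendsto_const e0, of z] by simp_all
      then have "(\<lambda>n. (t', x2, 1/2 :: real, (y1, y2 + e n), z + e n)) \<longlonglongrightarrow> (t', x2, 1/2, (y1, y2), z)"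
        by (intro tendsto_Pair tendsto_const)
      ultimately show ?thesis by (rule isCont_tendsto_compose)
    qed
    have "\<bar>c (t, x2, 1/2, (y1, y2 + e n), z + e n) - c (s, x2, 1/2, (y1, y2 + e n), z + e n)\<bar> \<le> K * \<bar>t - s\<bar>" for n
    proof -
      have "(x2, 1/2, (y1, frac (y2 + e n)), frac (z + e n)) \<in> box ?a ?b"
        using x y fra[of y2 n] fra[of z n] by (auto simp: box_Pair)
      from K(2)[OF st this] show ?thesis unfolding fr[OF st(2) x y, of "y2 + e n"] fr[OF st(1) x y, of "y2 + e n"] .
    qed
    moreover have "(\<lambda>n. \<bar>c (t, x2, 1/2, (y1, y2 + e n), z + e n) - c (s, x2, 1/2, (y1, y2 + e n), z + e n)\<bar>) \<longlonglongrightarrow>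
      \<bar>c (t, x2, 1/2, (y1, y2), z) - c (s, x2, 1/2, (y1, y2), z)\<bar>"
      by (intro tendsto_rabs tendsto_diff lim st)
    ultimately show ?thesis by (intro tendsto_upperbound[OF _ _ sequentially_bot]) auto
  qed
  have "\<bar>c (t, x2, \<tau>', y, z) - c (s, x2, \<tau>, y, z)\<bar> \<le> K * \<bar>t - s\<bar>"
    if "(s, x2, \<tau>, y, z) \<in> coeff_domain h T" "(t, x2, \<tau>', y, z) \<in> coeff_domain h T" for s t x2 \<tau> \<tau>' y z
  proof -
    obtain y1 y2 where y: "y = (y1, y2)" by (cases y)
    show ?thesis
      unfolding tau[OF that(1)] tau[OF that(2)] unfolding y
      by (rule main) (use that y in \<open>auto simp: coeff_domain_def\<close>)
  qed
  then show ?thesis using K(1) by blast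
qed

text \<open>The last statement bounds the increment relative to \<open>m\<close> itself. In the
  layer both sides carry the factor 1/\<epsilon>, and the lower bound \<open>cmin\<close> converts
  the absolute Lipschitz bound into the relative constant \<open>K / cmin\<close>, which is free of
  \<epsilon>; outside the layer the coefficient is constant in time.\<close>

lemma micro_coeff_props:
  fixes cM :: coefficient
  assumes \<epsilon>: "0 < \<epsilon>" "\<epsilon> < 2 * l" and pos: "0 < cL" "0 < cR" "0 < cmin"
    and cont: "continuous_on (coeff_domain h T) cM"
    and bnd: "\<forall>t\<in>{0<..<T}. \<forall>x\<in>Omega_M h \<epsilon>. cmin \<le> osc \<epsilon> cM t x \<and> osc \<epsilon> cM t x \<le> cmax"
    and K: "0 \<le> K" "\<forall>s t x2 \<tau> \<tau>' y z. (s, x2, \<tau>, y, z) \<in> coeff_domain h T \<longrightarrow> (t, x2, \<tau>', y, z) \<in> coeff_domain h T \<longrightarrow>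
      \<bar>cM (t, x2, \<tau>', y, z) - cM (s, x2, \<tau>, y, z)\<bar> \<le> K * \<bar>t - s\<bar>"
  defines "m \<equiv> \<lambda>z. indicat_real ({0<..<T} \<times> Omega l h) z * micro_coeff \<epsilon> cL cM cR (fst z) (snd z)"
  shows "m \<in> borel_measurable lborel" "0 \<le> m z" "\<exists>M. \<forall>z. m z \<le> M" "t \<notin> {0<..<T} \<Longrightarrow> m (t, x) = 0"
    "0 < t \<Longrightarrow> 0 < s \<Longrightarrow> t + s < T \<Longrightarrow> \<bar>m (t + s, x) - m (t, x)\<bar> \<le> K / cmin * s * m (t, x)"
proof -
  \<comment> \<open>In the layer the bound \<epsilon>/2 for \<bar>x1\<bar> becomes 1/2 for
    \<bar>y1\<bar>, so the composed arguments stay in the periodically extended domain.\<close>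
  have dom: "(t, snd x, t / \<epsilon>, x /\<^sub>R \<epsilon>, snd x / \<epsilon>\<^sup>2) \<in> coeff_domain h T" if "t \<in> {0<..<T}" "x \<in> Omega_M h \<epsilon>" for t and x :: "real \<times> real"
  proof -
    obtain x1 x2 where x: "x = (x1, x2)" by (cases x)
    have "- 1 / 2 < x1 / \<epsilon>" "x1 / \<epsilon> < 1 / 2" using that(2) \<epsilon> by (auto simp: x Omega_M_def field_simps)
    then show ?thesis using that by (auto simp: x coeff_domain_def Omega_M_def inverse_eq_divide)
  qed
  have mid: "x \<in> Omega_M h \<epsilon>" if "x \<in> Omega l h" "\<not> fst x \<le> - \<epsilon> / 2" "fst x < \<epsilon> / 2" for x
    using that by (cases x) (auto simp: Omega_def Omega_M_def)
  have micro: "0 \<le> micro_coeff \<epsilon> cL cM cR t x \<and> micro_coeff \<epsilon> cL cM cR t x \<le> \<bar>cL\<bar> + \<bar>cR\<bar> + \<bar>cmax\<bar> / \<epsilon>"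
    if "t \<in> {0<..<T}" "x \<in> Omega l h" for t x
  proof (cases "\<not> fst x \<le> - \<epsilon> / 2 \<and> fst x < \<epsilon> / 2")
    case True
    then have b: "cmin \<le> osc \<epsilon> cM t x \<and> osc \<epsilon> cM t x \<le> cmax" using bnd[rule_format, OF that(1)] mid[OF that(2)] by blast
    then have "osc \<epsilon> cM t x / \<epsilon> \<le> \<bar>cmax\<bar> / \<epsilon>" "0 \<le> osc \<epsilon> cM t x / \<epsilon>"
      using \<epsilon>(1) pos(3) by (auto intro!: divide_right_mono divide_nonneg_pos)
    then show ?thesis using True by (simp add: micro_coeff_def)
  next
    case False
    have "0 \<le> \<bar>cmax\<bar> / \<epsilon>" using \<epsilon> by simp
    then show ?thesis using False pos by (auto simp: micro_coeff_def)
  qed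
  show "0 \<le> m z" using micro[of "fst z" "snd z"] by (auto simp: m_def indicator_def mem_Times_iff)
  have "m z \<le> \<bar>cL\<bar> + \<bar>cR\<bar> + \<bar>cmax\<bar> / \<epsilon>" for z
  proof -
    have "0 \<le> \<bar>cmax\<bar> / \<epsilon>" using \<epsilon> by simp
    then show ?thesis using micro[of "fst z" "snd z"] by (auto simp: m_def indicator_def mem_Times_iff)
  qed
  then show "\<exists>M. \<forall>z. m z \<le> M" by blast
  show "t \<notin> {0<..<T} \<Longrightarrow> m (t, x) = 0" by (auto simp: m_def)
  show "\<bar>m (t + s, x) - m (t, x)\<bar> \<le> K / cmin * s * m (t, x)" if ts: "0 < t" "0 < s" "t + s < T"
  proof (cases "x \<in> Omega l h \<and> \<not> fst x \<le> - \<epsilon> / 2 \<and> fst x < \<epsilon> / 2")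
    case True
    have tt: "t \<in> {0<..<T}" "t + s \<in> {0<..<T}" using ts by auto
    have xM: "x \<in> Omega_M h \<epsilon>" using True mid by blast
    have mm: "m (t', x) = osc \<epsilon> cM t' x / \<epsilon>" if "t' \<in> {0<..<T}" for t' using True that by (simp add: m_def micro_coeff_def)
    have "\<bar>osc \<epsilon> cM (t + s) x - osc \<epsilon> cM t x\<bar> \<le> K * \<bar>t + s - t\<bar>"
      unfolding osc_def by (rule K(2)[rule_format, OF dom[OF tt(1) xM] dom[OF tt(2) xM]])
    then have a: "\<bar>osc \<epsilon> cM (t + s) x - osc \<epsilon> cM t x\<bar> \<le> K * s" using ts by simp
    have "cmin \<le> osc \<epsilon> cM t x" using bnd[rule_format, OF tt(1) xM] by blast
    then have "K * s * 1 \<le> K * s * (osc \<epsilon> cM t x / cmin)" using K(1) ts pos(3) by (intro mult_left_mono) auto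
    with a have "\<bar>osc \<epsilon> cM (t + s) x - osc \<epsilon> cM t x\<bar> / \<epsilon> \<le> K * s * (osc \<epsilon> cM t x / cmin) / \<epsilon>"
      using \<epsilon>(1) by (intro divide_right_mono) auto
    moreover have "\<bar>m (t + s, x) - m (t, x)\<bar> = \<bar>osc \<epsilon> cM (t + s) x - osc \<epsilon> cM t x\<bar> / \<epsilon>"
      unfolding mm[OF tt(1)] mm[OF tt(2)] diff_divide_distrib[symmetric] abs_divide using \<epsilon>(1) by simp
    ultimately show ?thesis unfolding mm[OF tt(1)] by simp
  next
    case False
    have "m (t + s, x) = m (t, x)" using False ts by (auto simp: m_def micro_coeff_def indicator_def)
    moreover have "0 \<le> m (t, x)" using micro[of t x] by (auto simp: m_def indicator_def)
    ultimately show ?thesis using K(1) ts pos(3) by simp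
  qed
  show "m \<in> borel_measurable lborel"
  proof -
    let ?E = "{0<..<T} \<times> Omega_M h \<epsilon>"
    have E: "?E \<in> sets borel" unfolding Omega_M_def by (intro borel_open open_Times) auto
    have Q: "{0<..<T} \<times> Omega l h \<in> sets borel" using Omega_props by (intro borel_open open_Times) auto
    have A: "{0<..<T} \<times> Omega l h \<inter> {z. fst (snd z) \<le> - \<epsilon> / 2} \<in> sets borel" "{0<..<T} \<times> Omega l h \<inter> {z. \<epsilon> / 2 \<le> fst (snd z)} \<in> sets borel"
    proof -
      have "closed {z :: real \<times> real \<times> real. fst (snd z) \<le> - \<epsilon> / 2}" "closed {z :: real \<times> real \<times> real. \<epsilon> / 2 \<le> fst (snd z)}"
        by (intro closed_Collect_le continuous_intros)+
      then show "{0<..<T} \<times> Omega l h \<inter> {z. fst (snd z) \<le> - \<epsilon> / 2} \<in> sets borel" "{0<..<T} \<times> Omega l h \<inter> {z. \<epsilon> / 2 \<le> fst (snd z)} \<in> sets borel"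
        using sets.Int[OF Q borel_closed] by auto
    qed
    \<comment> \<open>Over the open layer all arguments of \<open>cM\<close> stay inside
      \<open>coeff_domain\<close>, where it is continuous; this is the source of
      measurability.\<close>
    have cE: "continuous_on ?E (\<lambda>z. osc \<epsilon> cM (fst z) (snd z))"
      unfolding osc_def
      by (rule continuous_on_compose2[OF cont]) (use \<epsilon>(1) dom in \<open>auto intro!: continuous_intros\<close>)
    have 1: "(\<lambda>z. indicat_real ?E z * osc \<epsilon> cM (fst z) (snd z)) \<in> borel_measurable borel"
      using borel_measurable_continuous_on_indicator[OF E cE] by simp
    have eq: "m = (\<lambda>z. indicat_real ({0<..<T} \<times> Omega l h \<inter> {z. fst (snd z) \<le> - \<epsilon> / 2}) z * cL
      + indicat_real ({0<..<T} \<times> Omega l h \<inter> {z. \<epsilon> / 2 \<le> fst (snd z)}) z * cR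
      + (indicat_real ?E z * osc \<epsilon> cM (fst z) (snd z)) / \<epsilon>)"
    proof
      fix z :: "real \<times> real \<times> real"
      have "z \<in> ?E \<longleftrightarrow> z \<in> {0<..<T} \<times> Omega l h \<and> - \<epsilon> / 2 < fst (snd z) \<and> fst (snd z) < \<epsilon> / 2"
        using \<epsilon> by (cases z) (auto simp: Omega_def Omega_M_def)
      then show "m z = indicat_real ({0<..<T} \<times> Omega l h \<inter> {z. fst (snd z) \<le> - \<epsilon> / 2}) z * cL
      + indicat_real ({0<..<T} \<times> Omega l h \<inter> {z. \<epsilon> / 2 \<le> fst (snd z)}) z * cR
      + (indicat_real ?E z * osc \<epsilon> cM (fst z) (snd z)) / \<epsilon>"
        using \<epsilon>(1) by (auto simp: m_def micro_coeff_def indicator_def)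
    qed
    show ?thesis unfolding eq
      using 1 A by simp
  qed
qed

section \<open>The initial value of a function with a time derivative\<close>

lemma L2norm_square:
  fixes a :: "'a::euclidean_space \<Rightarrow> real"
  assumes "square_integrable (\<lambda>x. indicat_real S x * a x)"
  shows "L2norm S a = ennreal (sqrt (LINT x|lborel. (indicat_real S x * a x)\<^sup>2))"
proof -
  have "(\<integral>\<^sup>+x\<in>S. ennreal ((norm (a x))\<^sup>2) \<partial>lborel) = (\<integral>\<^sup>+x. ennreal ((indicat_real S x * a x)\<^sup>2) \<partial>lborel)"
    by (intro nn_integral_cong) (auto simp: indicator_def)
  also have "\<dots> = ennreal (LINT x|lborel. (indicat_real S x * a x)\<^sup>2)"
    by (rule nn_integral_eq_integral[OF square_integrableD(3)[OF assms]]) simp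
  finally show ?thesis by (simp add: L2norm_def Let_def)
qed

text \<open>The representation by a primitive yields u = p + primitive with some function p of
  space. It equals \<open>v1\<close> because along good times tending to 0 the continuous
  representative \<open>v\<close> converges to \<open>v1\<close> in L2, while the primitive tends to
  0 in L1.\<close>

lemma has_time_derivative_primitive:
  fixes u ut :: "real \<Rightarrow> real \<times> real \<Rightarrow> real"
  assumes T: "0 < T" and u: "L2_L2 T (Omega l h) u" and ut: "has_time_derivative T (Omega l h) u ut"
    and tr: "has_time_trace T (Omega l h) u 0 v1"
  defines "Q \<equiv> {0<..<T} \<times> Omega l h"
  shows "AE z in lborel. z \<in> Q \<longrightarrow> u (fst z) (snd z) = v1 (snd z) + primitive0 (\<lambda>z. indicat_real Q z * ut (fst z) (snd z)) z"
proof -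
  let ?O = "Omega l h"
  note O = Omega_props[of l h]
  have Qb: "Q = box (0, (-l, 0)) (T, (l, h))" by (simp add: Q_def O(4) box_Pair)
  have Qs: "Q \<in> sets borel" "bounded Q" unfolding Qb by auto
  let ?f = "\<lambda>z. indicat_real Q z * u (fst z) (snd z)" and ?g = "\<lambda>z. indicat_real Q z * ut (fst z) (snd z)"
  have f2: "square_integrable ?f" and g2: "square_integrable ?g"
    using u ut L2_on_real_iff[OF Qs(1)] by (auto simp: L2_L2_def has_time_derivative_def Q_def case_prod_beta')
  note fi = integrable_of_square_integrable_bounded[OF f2 Qs] and gi = integrable_of_square_integrable_bounded[OF g2 Qs]
  have "\<exists>p. p \<in> borel_measurable lborel \<and> (AE z in lborel. z \<in> Q \<longrightarrow> ?f z = p (snd z) + primitive0 ?g z)"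
  proof (rule weak_time_derivative_primitive[OF T _ fi gi])
    show "Q = {0<..<T} \<times> box (-l, 0) (l, h)" by (simp add: Q_def O(4))
    have w: "has_weak_pderiv Q (1, 0) (\<lambda>z. u (fst z) (snd z)) (\<lambda>z. ut (fst z) (snd z))"
      using ut by (simp add: has_time_derivative_def Q_def case_prod_beta')
    show "(LINT z|lborel. ?f z * frechet_derivative \<theta> (at z) (1, 0)) = - (LINT z|lborel. ?g z * \<theta> z)"
      if "\<theta> \<in> test_functions Q" for \<theta> by (rule weak_derivative_restrict[OF w that])
  qed auto
  then obtain p where pm: "p \<in> borel_measurable lborel"
    and p: "AE z in lborel. z \<in> Q \<longrightarrow> ?f z = p (snd z) + primitive0 ?g z" by blast
  obtain v where v: "AE t\<in>{0<..<T} in lborel. AE x\<in>?O in lborel. v t x = u t x" "\<forall>t\<in>{0..T}. L2_on ?O (v t)"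
    "\<forall>t\<in>{0..T}. ((\<lambda>r. L2norm ?O (\<lambda>x. v r x - v t x)) \<longlongrightarrow> 0) (at t within {0..T})" "AE x\<in>?O in lborel. v 0 x = v1 x"
    using tr unfolding has_time_trace_def by blast
  have v1: "L2_on ?O v1" using tr by (simp add: has_time_trace_def)
  \<comment> \<open>The continuous representative agrees with \<open>u\<close> at almost every time,
    so the representation passes to \<open>v\<close> there.\<close>
  have good: "AE t in lborel. t \<in> {0<..<T} \<longrightarrow> (AE x in lborel. x \<in> ?O \<longrightarrow> v t x = p x + primitive0 ?g (t, x))"
    using AE_lborel_pair(1)[OF p] v(1)
  proof eventually_elim
    case (elim t)
    show ?case
    proof
      assume t: "t \<in> {0<..<T}"
      show "AE x in lborel. x \<in> ?O \<longrightarrow> v t x = p x + primitive0 ?g (t, x)"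
        using elim(1) elim(2)[rule_format, OF t] by eventually_elim (use t in \<open>auto simp: Q_def\<close>)
    qed
  qed
  \<comment> \<open>Good times have full measure, hence meet every interval next to 0; a null
    sequence of them is selected.\<close>
  have "\<exists>t. t \<in> {0<..<min T (1 / (real n + 1))} \<and> (AE x in lborel. x \<in> ?O \<longrightarrow> v t x = p x + primitive0 ?g (t, x))" for n
  proof -
    have ne: "{0<..<min T (1 / (real n + 1))} \<noteq> {}" using T by (simp add: min_def)
    from AE_meets_open[OF good open_greaterThanLessThan this] show ?thesis by auto
  qed
  from choice[OF allI[OF this]] obtain t where tt: "\<forall>n. t n \<in> {0<..<min T (1 / (real n + 1))} \<and>
    (AE x in lborel. x \<in> ?O \<longrightarrow> v (t n) x = p x + primitive0 ?g (t n, x))" by (rule exE)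
  have t: "t n \<in> {0<..<min T (1 / (real n + 1))}"
    "AE x in lborel. x \<in> ?O \<longrightarrow> v (t n) x = p x + primitive0 ?g (t n, x)" for n
    using tt by auto
  have t0: "t \<longlonglongrightarrow> 0"
  proof (rule tendsto_0_of_abs_le)
    show "\<bar>t n\<bar> \<le> 1 / real (Suc n)" for n using t(1)[of n] by (auto simp: add.commute)
    show "(\<lambda>n. 1 / real (Suc n)) \<longlonglongrightarrow> 0" using LIMSEQ_inverse_real_of_nat by (simp add: inverse_eq_divide)
  qed
  define a where "a n x = indicat_real ?O x * (v (t n) x - v 0 x)" for n x
  have vs: "square_integrable (\<lambda>x. indicat_real ?O x * v s x)" if "s \<in> {0..T}" for s
    using v(2) that L2_on_real_iff[OF O(1)] by blast
  have tT: "t n \<in> {0..T}" "t n \<noteq> 0" for n using t(1)[of n] by auto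
  have as: "square_integrable (a n)" for n
    unfolding a_def[abs_def] using square_integrable_diff[OF vs[OF tT(1)[of n]] vs[of 0]] T by (simp add: right_diff_distrib)
  have a0: "(\<lambda>n. LINT x|lborel. (a n x)\<^sup>2) \<longlonglongrightarrow> 0"
  proof -
    have fl: "filterlim t (at 0 within {0..T}) sequentially"
      using t0 tT by (auto simp: filterlim_at intro!: always_eventually)
    have "(\<lambda>n. L2norm ?O (\<lambda>x. v (t n) x - v 0 x)) \<longlonglongrightarrow> 0"
      using filterlim_compose[OF v(3)[rule_format, of 0] fl] T by simp
    moreover have "L2norm ?O (\<lambda>x. v (t n) x - v 0 x) = ennreal (sqrt (LINT x|lborel. (a n x)\<^sup>2))" for n
      unfolding a_def by (rule L2norm_square) (use as[of n] in \<open>simp only: a_def[abs_def]\<close>)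
    ultimately have "(\<lambda>n. sqrt (LINT x|lborel. (a n x)\<^sup>2)) \<longlonglongrightarrow> 0"
      by (simp add: tendsto_ennreal_iff[of _ _ 0, simplified])
    from tendsto_power[OF this, of 2] show ?thesis by simp
  qed
  have iO: "integrable lborel (indicat_real ?O)"
    using emeasure_bounded_finite[OF O(3)] O(1) by (simp add: integrable_indicator_iff)
  have sO: "square_integrable (indicat_real ?O)" by (rule square_integrable_bounded_supp[OF iO, of 1]) simp
  \<comment> \<open>On the bounded rectangle convergence in L2 implies convergence in L1.\<close>
  have a1: "(\<lambda>n. LINT x|lborel. \<bar>a n x * indicat_real ?O x\<bar>) \<longlonglongrightarrow> 0"
    by (rule L2_convergence_mult_fixed[OF as a0 sO order_refl])
  define b where "b n x = (LINT s|lborel. indicator {0<..<t n} s * \<bar>?g (s, x)\<bar>)" for n x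
  have gs: "integrable lborel (\<lambda>z. indicator {0<..<t n} (fst z) * \<bar>?g z\<bar>)" for n
    by (rule integrable_bounded_mult[OF integrable_abs[OF gi] borel_measurable_indicator_fst, where B=1]) auto
  have bi: "integrable lborel (b n)" for n
    unfolding b_def[abs_def] using lborel_pair_integral(6)[OF gs[of n]] by simp
  have b0: "(\<lambda>n. LINT x|lborel. b n x) \<longlonglongrightarrow> 0"
    using thin_slab_integral_tendsto_0[OF gi t0] lborel_pair_integral(2)[OF gs] by (simp add: b_def)
  define D where "D x = indicat_real ?O x * (p x - v1 x)" for x
  have D1: "AE x in lborel. \<bar>D x\<bar> \<le> \<bar>a n x * indicat_real ?O x\<bar> + b n x" for n
    using t(2)[of n] v(4)
  proof eventually_elim
    case (elim x)
    have pb: "\<bar>primitive0 ?g (t n, x)\<bar> \<le> b n x"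
    proof -
      have "\<bar>primitive0 ?g (t n, x)\<bar> \<le> (LINT s|lborel. \<bar>indicator {0<..<t n} s * ?g (s, x)\<bar>)"
        unfolding primitive0_def fst_conv snd_conv by (rule integral_abs_bound)
      then show ?thesis by (simp add: b_def abs_mult)
    qed
    show ?case
    proof (cases "x \<in> ?O")
      case True
      then have "p x - v1 x = (v (t n) x - v 0 x) - primitive0 ?g (t n, x)" using elim by auto
      then have "\<bar>p x - v1 x\<bar> \<le> \<bar>v (t n) x - v 0 x\<bar> + b n x" using pb by linarith
      then show ?thesis using True by (simp add: D_def a_def)
    next
      case False
      then show ?thesis using pb by (simp add: D_def)
    qed
  qed
  have Dm: "D \<in> borel_measurable lborel"
  proof -
    have "(\<lambda>x. indicat_real ?O x * v1 x) \<in> borel_measurable lborel"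
      using v1 L2_on_real_iff[OF O(1)] square_integrableD(1) by blast
    moreover have "(\<lambda>x. indicat_real ?O x * p x) \<in> borel_measurable lborel"
      using pm O(1) by (intro borel_measurable_times) auto
    ultimately show ?thesis unfolding D_def[abs_def] right_diff_distrib by (rule borel_measurable_diff[rotated])
  qed
  have ai: "integrable lborel (\<lambda>x. \<bar>a n x * indicat_real ?O x\<bar>)" for n
    by (rule integrable_abs[OF square_integrable_mult[OF as sO]])
  have Di: "integrable lborel D"
  proof (rule Bochner_Integration.integrable_bound[OF Bochner_Integration.integrable_add[OF ai[of 0] bi[of 0]] Dm])
    show "AE x in lborel. norm (D x) \<le> norm (\<bar>a 0 x * indicat_real ?O x\<bar> + b 0 x)"
      using D1[of 0] by eventually_elim simp
  qed
  have "(LINT x|lborel. \<bar>D x\<bar>) \<le> (LINT x|lborel. \<bar>a n x * indicat_real ?O x\<bar>) + (LINT x|lborel. b n x)" for n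
  proof -
    have "(LINT x|lborel. \<bar>D x\<bar>) \<le> (LINT x|lborel. \<bar>a n x * indicat_real ?O x\<bar> + b n x)"
      by (rule integral_mono_AE[OF integrable_abs[OF Di] Bochner_Integration.integrable_add[OF ai bi] D1])
    then show ?thesis using ai[of n] bi[of n] by simp
  qed
  then have "(LINT x|lborel. \<bar>D x\<bar>) \<le> 0 + 0"
    by (intro tendsto_lowerbound[OF tendsto_add[OF a1 b0] always_eventually sequentially_bot] allI)
  then have "(LINT x|lborel. \<bar>D x\<bar>) \<le> 0" by simp
  then have "(LINT x|lborel. \<bar>D x\<bar>) = 0" by (intro antisym) auto
  then have "AE x in lborel. \<bar>D x\<bar> = 0"
    using integral_nonneg_eq_0_iff_AE[OF integrable_abs[OF Di]] by simp
  from AE_lborel_snd[OF this, where 'a=real] p show ?thesis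
    by eventually_elim (auto simp: D_def Q_def)
qed

section \<open>Centred difference quotients and time averages\<close>

lemma L2_bounded_sequence:
  fixes f :: "nat \<Rightarrow> 'a::euclidean_space \<Rightarrow> real"
  assumes "square_integrable F" "\<delta> \<longlonglongrightarrow> 0"
  shows "(\<lambda>n. LINT x|lborel. (F (x + \<delta> n *\<^sub>R e) - F x)\<^sup>2) \<longlonglongrightarrow> 0"
proof -
  have "(\<lambda>n. \<delta> n *\<^sub>R e) \<longlonglongrightarrow> 0" using tendsto_scaleR[OF assms(2) tendsto_const[of e]] by simp
  then show ?thesis
    using translation_continuous_L2[of F "\<lambda>n. \<delta> n *\<^sub>R e"] assms(1) by (simp add: square_integrable_def)
qed

text \<open>The centred difference quotient \<open>(f (t + d) - f (t - d)) / (2 d)\<close> is tested against \<open>\<zeta> m f\<close>.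
  After a shift of the time variable in the second term only the increment of \<open>\<zeta> m\<close> survives, which
  in the limit gives \<open>- (1/2) \<integral> \<zeta>' m f\<^sup>2\<close> up to the contribution of the Lipschitz coefficient \<open>m\<close>.\<close>

lemma centred_difference_limit:
  fixes f m :: "real \<times> 'b::euclidean_space \<Rightarrow> real"
  assumes f: "square_integrable f"
    and mm: "m \<in> borel_measurable lborel" and m0: "\<And>z. 0 \<le> m z" "\<And>z. m z \<le> M"
    and mT: "\<And>t x. t \<notin> {0<..<T} \<Longrightarrow> m (t, x) = 0"
    and mL: "\<And>s t x. 0 < t \<Longrightarrow> 0 < s \<Longrightarrow> t + s < T \<Longrightarrow> \<bar>m (t + s, x) - m (t, x)\<bar> \<le> K * s * m (t, x)"
    and K0: "0 \<le> K"
    and z: "\<And>t. (\<zeta> has_real_derivative \<zeta>' t) (at t)" "continuous_on UNIV \<zeta>'" "\<And>t. 0 \<le> \<zeta> t" "\<And>t. \<zeta> t \<le> Z"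
      "\<And>t. \<bar>\<zeta>' t\<bar> \<le> Z'" "\<And>t. T - \<eta> \<le> t \<Longrightarrow> \<zeta> t = 0"
    and d: "\<And>n. 0 < \<delta> n" "\<And>n. \<delta> n < \<eta>" "\<delta> \<longlonglongrightarrow> 0"
  shows "\<exists>P S. P \<longlonglongrightarrow> 1 / 2 * (LINT z|lborel. \<zeta>' (fst z) * m z * (f z)\<^sup>2) \<and>
     S \<longlonglongrightarrow> K / 2 * (LINT z|lborel. \<zeta> (fst z) * m z * (f z)\<^sup>2) \<and>
     (\<forall>n. abs (1 / (2 * \<delta> n) * ((LINT z|lborel. \<zeta> (fst z) * m z * (f z * (f (z + (\<delta> n, 0)) - f (z - (\<delta> n, 0)))))
        + (LINT z|lborel. indicator {0<..<\<delta> n} (fst z) * (\<zeta> (fst z) * m z * (f z * f (z - (\<delta> n, 0)))))) + P n) \<le> S n)"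
proof -
  let ?s = "\<lambda>n. (\<delta> n, 0 :: 'b)"
  have fm: "f \<in> borel_measurable lborel" using f by (simp add: square_integrable_def)
  have zc: "continuous_on UNIV \<zeta>" using z(1) by (auto intro!: continuous_at_imp_continuous_on DERIV_isCont)
  have z_m: "(\<lambda>z :: real \<times> 'b. h (fst z + c)) \<in> borel_measurable lborel" if "continuous_on UNIV h" for h :: "real \<Rightarrow> real" and c
  proof -
    have "continuous_on UNIV (\<lambda>t. h (t + c))"
      by (rule continuous_on_compose2[OF that]) (intro continuous_intros, simp)
    from measurable_compose[OF borel_measurable_fst_snd(1) borel_measurable_continuous_onI[OF this]]
    show ?thesis by simp
  qed
  have z_m0: "(\<lambda>z :: real \<times> 'b. h (fst z)) \<in> borel_measurable lborel" if "continuous_on UNIV h" for h :: "real \<Rightarrow> real"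
    using z_m[OF that, of 0] by simp
  have M0: "0 \<le> M" using m0[of undefined] by linarith
  have Z0: "0 \<le> Z" using z(3,4)[of 0] by linarith
  have fs: "square_integrable (\<lambda>z. f (z + c))" for c using square_integrable_translate[OF f] .
  have fs': "square_integrable (\<lambda>z. f (z - c))" for c using square_integrable_translate[OF f, of "- c"] by simp
  have mtr: "(\<lambda>z. h (z + c)) \<in> borel_measurable lborel" if "h \<in> borel_measurable lborel" for h :: "real \<times> 'b \<Rightarrow> real" and c
    using that by simp
  have intq: "integrable lborel (\<lambda>z. q z * (f1 z * f2 z))"
    if "square_integrable f1" "square_integrable f2" "q \<in> borel_measurable lborel" "\<And>z. \<bar>q z\<bar> \<le> B" for q f1 f2 :: "real \<times> 'b \<Rightarrow> real" and B
    by (rule integrable_bounded_mult[OF square_integrable_mult[OF that(1,2)] that(3,4)])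
  define w where "w z = \<zeta> (fst z) * m z" for z
  have wm: "w \<in> borel_measurable lborel" unfolding w_def by (intro borel_measurable_times z_m0 zc mm)
  have wb: "\<bar>w z\<bar> \<le> Z * M" for z
    unfolding w_def using z(3,4)[of "fst z"] m0[of z] Z0 by (auto simp: abs_mult intro!: mult_mono)
  \<comment> \<open>\<open>D\<close> carries the increment of \<open>\<zeta>\<close> with
    \<open>m\<close> held fixed; the increment of \<open>m\<close> goes into \<open>S\<close>, with
    \<open>\<zeta>\<close> taken at the later time.\<close>
  define D where "D n z = 1 / (2 * \<delta> n) * ((\<zeta> (fst z + \<delta> n) - \<zeta> (fst z)) * m z)" for n z
  define P where "P n = (LINT z|lborel. D n z * (f z * f (z + ?s n)))" for n
  define S where "S n = (LINT z|lborel. (K / 2 * (\<zeta> (fst z + \<delta> n) * m z)) * (\<bar>f z\<bar> * \<bar>f (z + ?s n)\<bar>))" for n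
  have lim2: "(\<lambda>n. LINT z|lborel. (f (z + ?s n) - f z)\<^sup>2) \<longlonglongrightarrow> 0"
    using L2_bounded_sequence[OF f d(3), of "(1, 0)"] by simp
  have mvt: "\<exists>x. t < x \<and> x < t + \<delta> n \<and> \<zeta> (t + \<delta> n) - \<zeta> t = \<delta> n * \<zeta>' x" for n t
    using MVT2[of t "t + \<delta> n" \<zeta> \<zeta>'] d(1)[of n] z(1) by auto
  have Db: "\<bar>D n z\<bar> \<le> Z' / 2 * M" for n z
  proof -
    obtain x where "\<zeta> (fst z + \<delta> n) - \<zeta> (fst z) = \<delta> n * \<zeta>' x" using mvt[of "fst z" n] by auto
    then have "D n z = \<zeta>' x / 2 * m z" using d(1)[of n] by (simp add: D_def)
    moreover have "\<bar>\<zeta>' x / 2\<bar> * \<bar>m z\<bar> \<le> Z' / 2 * M" using z(5)[of x] m0[of z] by (intro mult_mono) auto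
    ultimately show ?thesis by (simp only: abs_mult)
  qed
  have Dm: "D n \<in> borel_measurable lborel" for n
    unfolding D_def by (intro borel_measurable_times borel_measurable_diff borel_measurable_const z_m zc z_m0 mm)
  have Dlim: "(\<lambda>n. D n z) \<longlonglongrightarrow> \<zeta>' (fst z) / 2 * m z" for z
  proof -
    have fl: "filterlim \<delta> (at 0) sequentially"
      using d(1,3) by (auto simp: filterlim_at less_imp_neq[THEN not_sym] intro!: always_eventually)
    have "(\<lambda>n. (\<zeta> (fst z + \<delta> n) - \<zeta> (fst z)) / \<delta> n) \<longlonglongrightarrow> \<zeta>' (fst z)"
      by (rule filterlim_compose[OF z(1)[of "fst z", unfolded DERIV_def] fl])
    from tendsto_mult_right[OF tendsto_divide[OF this tendsto_const[of 2]], of "m z"] show ?thesis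
      by (simp add: D_def mult.commute)
  qed
  have Plim: "P \<longlonglongrightarrow> 1 / 2 * (LINT z|lborel. \<zeta>' (fst z) * m z * (f z)\<^sup>2)"
  proof -
    have "P \<longlonglongrightarrow> (LINT z|lborel. (\<zeta>' (fst z) / 2 * m z) * (f z * f z))"
      unfolding P_def
    proof (rule L2_convergence_product[where B="Z' / 2 * M"])
      show "(\<lambda>z. \<zeta>' (fst z) / 2 * m z) \<in> borel_measurable lborel"
        by (intro borel_measurable_times borel_measurable_divide borel_measurable_const z_m0 z(2) mm)
    qed (use f fs lim2 Dm Db Dlim in auto)
    also have "(LINT z|lborel. (\<zeta>' (fst z) / 2 * m z) * (f z * f z)) = (LINT z|lborel. 1 / 2 * (\<zeta>' (fst z) * m z * (f z)\<^sup>2))"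
      by (intro Bochner_Integration.integral_cong refl) (simp add: power2_eq_square)
    finally show ?thesis by simp
  qed
  have fa: "square_integrable (\<lambda>z. \<bar>f z\<bar>)" "square_integrable (\<lambda>z. \<bar>f (z + c)\<bar>)" for c
    using square_integrable_bound[OF f, of "\<lambda>z. \<bar>f z\<bar>"] square_integrable_bound[OF fs[of c], of "\<lambda>z. \<bar>f (z + c)\<bar>"] fm fs[of c]
    by (auto simp: square_integrable_def)
  have Slim: "S \<longlonglongrightarrow> K / 2 * (LINT z|lborel. \<zeta> (fst z) * m z * (f z)\<^sup>2)"
  proof -
    have "S \<longlonglongrightarrow> (LINT z|lborel. (K / 2 * (\<zeta> (fst z) * m z)) * (\<bar>f z\<bar> * \<bar>f z\<bar>))"
      unfolding S_def
    proof (rule L2_convergence_product[where B="K / 2 * (Z * M)"])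
      \<comment> \<open>The absolute value is a contraction, so the convergence is inherited from
        \<open>f\<close>.\<close>
      show "(\<lambda>n. LINT z|lborel. (\<bar>f (z + ?s n)\<bar> - \<bar>f z\<bar>)\<^sup>2) \<longlonglongrightarrow> 0"
      proof (rule tendsto_0_of_abs_le[OF _ lim2])
        fix n
        have le: "(\<bar>a\<bar> - \<bar>b\<bar>)\<^sup>2 \<le> (a - b)\<^sup>2" for a b :: real
          by (simp only: abs_le_square_iff[symmetric] abs_triangle_ineq3)
        have "(LINT z|lborel. (\<bar>f (z + ?s n)\<bar> - \<bar>f z\<bar>)\<^sup>2) \<le> (LINT z|lborel. (f (z + ?s n) - f z)\<^sup>2)"
          by (rule integral_mono[OF square_integrableD(3)[OF square_integrable_diff[OF fa(2,1)]] square_integrableD(3)[OF square_integrable_diff[OF fs f]] le])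
        then show "\<bar>LINT z|lborel. (\<bar>f (z + ?s n)\<bar> - \<bar>f z\<bar>)\<^sup>2\<bar> \<le> (LINT z|lborel. (f (z + ?s n) - f z)\<^sup>2)" by simp
      qed
      show "(\<lambda>z. K / 2 * (\<zeta> (fst z + \<delta> n) * m z)) \<in> borel_measurable lborel" for n
        by (intro borel_measurable_times borel_measurable_const z_m zc mm)
      show "(\<lambda>z. K / 2 * (\<zeta> (fst z) * m z)) \<in> borel_measurable lborel"
        by (intro borel_measurable_times borel_measurable_const z_m0 zc mm)
      show "\<bar>K / 2 * (\<zeta> (fst z + \<delta> n) * m z)\<bar> \<le> K / 2 * (Z * M)" for n z
        using K0 z(3,4)[of "fst z + \<delta> n"] m0[of z] Z0 by (auto simp: abs_mult intro!: mult_mono)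
      show "(\<lambda>n. K / 2 * (\<zeta> (fst z + \<delta> n) * m z)) \<longlonglongrightarrow> K / 2 * (\<zeta> (fst z) * m z)" for z
      proof -
        have "(\<lambda>n. fst z + \<delta> n) \<longlonglongrightarrow> fst z" using tendsto_add[OF tendsto_const d(3), of "fst z"] by simp
        then have "(\<lambda>n. \<zeta> (fst z + \<delta> n)) \<longlonglongrightarrow> \<zeta> (fst z)"
          using isCont_tendsto_compose[OF DERIV_isCont[OF z(1)]] by blast
        then show ?thesis by (intro tendsto_mult_left tendsto_mult_right)
      qed
      show "(\<lambda>n. LINT z|lborel. (\<bar>f z\<bar> - \<bar>f z\<bar>)\<^sup>2) \<longlonglongrightarrow> 0" by simp
    qed (use fa in auto)
    also have "(LINT z|lborel. (K / 2 * (\<zeta> (fst z) * m z)) * (\<bar>f z\<bar> * \<bar>f z\<bar>)) = (LINT z|lborel. K / 2 * (\<zeta> (fst z) * m z * (f z)\<^sup>2))"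
      by (intro Bochner_Integration.integral_cong refl) (simp add: power2_eq_square)
    finally show ?thesis by simp
  qed
  have bound: "abs (1 / (2 * \<delta> n) * ((LINT z|lborel. \<zeta> (fst z) * m z * (f z * (f (z + ?s n) - f (z - ?s n))))
        + (LINT z|lborel. indicator {0<..<\<delta> n} (fst z) * (\<zeta> (fst z) * m z * (f z * f (z - ?s n))))) + P n) \<le> S n" for n
  proof -
    let ?c = "1 / (2 * \<delta> n)"
    have indm: "(\<lambda>z :: real \<times> 'b. indicat_real {0<..<\<delta> n} (fst z)) \<in> borel_measurable lborel"
      "(\<lambda>z :: real \<times> 'b. indicat_real {0..} (fst z)) \<in> borel_measurable lborel"
      "(\<lambda>z :: real \<times> 'b. indicat_real {\<delta> n..} (fst z)) \<in> borel_measurable lborel"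
      by (rule borel_measurable_indicator_fst, simp)+
    have iw: "integrable lborel (\<lambda>z. w z * (f z * f (z + ?s n)))" "integrable lborel (\<lambda>z. w z * (f z * f (z - ?s n)))"
      by (rule intq[OF f fs wm wb] intq[OF f fs' wm wb])+
    have iwi: "integrable lborel (\<lambda>z. indicator {0<..<\<delta> n} (fst z) * (w z * (f z * f (z - ?s n))))"
      "integrable lborel (\<lambda>z. indicator {\<delta> n..} (fst z) * (w z * (f z * f (z - ?s n))))"
      by (rule integrable_bounded_mult[OF iw(2) indm(1), where B=1] integrable_bounded_mult[OF iw(2) indm(3), where B=1], simp)+
    have wsm: "(\<lambda>z. indicat_real {0..} (fst z) * w (z + ?s n)) \<in> borel_measurable lborel"
      by (intro borel_measurable_times indm mtr wm)
    have wsb: "\<bar>indicat_real {0..} (fst z) * w (z + ?s n)\<bar> \<le> Z * M" for z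
      using wb[of "z + ?s n"] Z0 M0 by (auto simp: indicator_def)
    have iws: "integrable lborel (\<lambda>z. (indicat_real {0..} (fst z) * w (z + ?s n)) * (f z * f (z + ?s n)))"
      by (rule intq[OF f fs wsm wsb])
    have "(LINT z|lborel. w z * (f z * (f (z + ?s n) - f (z - ?s n)))) + (LINT z|lborel. indicator {0<..<\<delta> n} (fst z) * (w z * (f z * f (z - ?s n))))
      = (LINT z|lborel. w z * (f z * f (z + ?s n))) - ((LINT z|lborel. w z * (f z * f (z - ?s n)))
         - (LINT z|lborel. indicator {0<..<\<delta> n} (fst z) * (w z * (f z * f (z - ?s n)))))"
      using iw by (simp add: right_diff_distrib)
    \<comment> \<open>The part of the second integral over times in (0, \<delta>) would be shifted
      to negative times; it is kept apart as the boundary term of the statement.\<close>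
    also have "(LINT z|lborel. w z * (f z * f (z - ?s n))) - (LINT z|lborel. indicator {0<..<\<delta> n} (fst z) * (w z * (f z * f (z - ?s n))))
       = (LINT z|lborel. w z * (f z * f (z - ?s n)) - indicator {0<..<\<delta> n} (fst z) * (w z * (f z * f (z - ?s n))))"
      using iw(2) iwi(1) by simp
    also have "\<dots> = (LINT z|lborel. indicator {\<delta> n..} (fst z) * (w z * (f z * f (z - ?s n))))"
    proof (intro Bochner_Integration.integral_cong refl)
      fix z :: "real \<times> 'b"
      have "w z = 0" if "fst z \<le> 0" using mT[of "fst z" "snd z"] that by (simp add: w_def)
      then show "w z * (f z * f (z - ?s n)) - indicator {0<..<\<delta> n} (fst z) * (w z * (f z * f (z - ?s n)))
        = indicator {\<delta> n..} (fst z) * (w z * (f z * f (z - ?s n)))"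
        using d(1)[of n] by (cases "fst z \<le> 0") (auto simp: indicator_def)
    qed
    \<comment> \<open>After the shift by \<delta> both integrals contain the product
      \<open>f z * f (z + ?s n)\<close>, and only their weights are subtracted.\<close>
    also have "\<dots> = (LINT z|lborel. indicator {\<delta> n..} (fst (z + ?s n)) * (w (z + ?s n) * (f (z + ?s n) * f (z + ?s n - ?s n))))"
      using integral_translate[OF borel_measurable_integrable[OF iwi(2)], of "?s n"] by simp
    also have "\<dots> = (LINT z|lborel. (indicat_real {0..} (fst z) * w (z + ?s n)) * (f z * f (z + ?s n)))"
      by (intro Bochner_Integration.integral_cong refl) (auto simp: indicator_def mult.commute)
    also have "(LINT z|lborel. w z * (f z * f (z + ?s n))) - \<dots>
      = (LINT z|lborel. (w z - indicat_real {0..} (fst z) * w (z + ?s n)) * (f z * f (z + ?s n)))"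
      using iw(1) iws by (simp add: left_diff_distrib)
    finally have e1: "(LINT z|lborel. w z * (f z * (f (z + ?s n) - f (z - ?s n)))) + (LINT z|lborel. indicator {0<..<\<delta> n} (fst z) * (w z * (f z * f (z - ?s n))))
      = (LINT z|lborel. (w z - indicat_real {0..} (fst z) * w (z + ?s n)) * (f z * f (z + ?s n)))" .
    have iE: "integrable lborel (\<lambda>z. (w z - indicat_real {0..} (fst z) * w (z + ?s n)) * (f z * f (z + ?s n)))"
      using iw(1) iws by (simp add: left_diff_distrib)
    have iD: "integrable lborel (\<lambda>z. D n z * (f z * f (z + ?s n)))" by (rule intq[OF f fs Dm Db])
    have iS: "integrable lborel (\<lambda>z. (K / 2 * (\<zeta> (fst z + \<delta> n) * m z)) * (\<bar>f z\<bar> * \<bar>f (z + ?s n)\<bar>))"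
    proof (rule intq[OF fa(1) fa(2), where B="K / 2 * (Z * M)"])
      show "(\<lambda>z. K / 2 * (\<zeta> (fst z + \<delta> n) * m z)) \<in> borel_measurable lborel"
        by (intro borel_measurable_times borel_measurable_const z_m zc mm)
      show "\<bar>K / 2 * (\<zeta> (fst z + \<delta> n) * m z)\<bar> \<le> K / 2 * (Z * M)" for z
        using K0 z(3,4)[of "fst z + \<delta> n"] m0[of z] Z0 by (auto simp: abs_mult intro!: mult_mono)
    qed
    define V where "V z = w z - indicat_real {0..} (fst z) * w (z + ?s n)" for z
    define R where "R z = ?c * (V z * (f z * f (z + ?s n))) + D n z * (f z * f (z + ?s n))" for z
    define Y where "Y z = (K / 2 * (\<zeta> (fst z + \<delta> n) * m z)) * (\<bar>f z\<bar> * \<bar>f (z + ?s n)\<bar>)" for z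
    have iV: "integrable lborel (\<lambda>z. V z * (f z * f (z + ?s n)))" using iE unfolding V_def .
    have iR: "integrable lborel R"
      unfolding R_def by (rule Bochner_Integration.integrable_add[OF integrable_mult_right[OF iV] iD])
    have iY: "integrable lborel Y" using iS unfolding Y_def .
    \<comment> \<open>At time 0 itself the indicator lets \<open>w (z + ?s n)\<close> through
      although \<open>m z\<close> is 0; this null set is excluded. When t + \<delta> reaches T, the
      inequality \<delta> < \<eta> forces \<open>\<zeta>\<close> to vanish at both times.\<close>
    have key: "abs (?c * V z + D n z) \<le> K / 2 * (\<zeta> (fst z + \<delta> n) * m z)" if "fst z \<noteq> 0" for z
    proof -
      obtain t x where zz: "z = (t, x)" by (cases z)
      show ?thesis
      proof (cases "0 < t \<and> t + \<delta> n < T")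
        case True
        then have V: "V z = \<zeta> t * m (t, x) - \<zeta> (t + \<delta> n) * m (t + \<delta> n, x)" by (simp add: V_def w_def zz)
        have "V z + (\<zeta> (t + \<delta> n) - \<zeta> t) * m z = \<zeta> (t + \<delta> n) * (m (t, x) - m (t + \<delta> n, x))"
          using V by (simp add: zz algebra_simps)
        moreover have "fst z = t" by (simp add: zz)
        ultimately have "?c * V z + D n z = ?c * (\<zeta> (t + \<delta> n) * (m (t, x) - m (t + \<delta> n, x)))"
          by (simp only: D_def distrib_left[symmetric])
        then have "abs (?c * V z + D n z) = ?c * (\<zeta> (t + \<delta> n) * \<bar>m (t + \<delta> n, x) - m (t, x)\<bar>)"
          using z(3)[of "t + \<delta> n"] d(1)[of n] by (simp add: abs_mult abs_minus_commute)
        also have "\<dots> \<le> ?c * (\<zeta> (t + \<delta> n) * (K * \<delta> n * m (t, x)))"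
          using mL[of t "\<delta> n" x] True d(1)[of n] z(3)[of "t + \<delta> n"] by (intro mult_left_mono) auto
        also have "\<dots> = K / 2 * (\<zeta> (fst z + \<delta> n) * m z)" using d(1)[of n] by (simp add: zz)
        finally show ?thesis .
      next
        case False
        then have "t < 0 \<or> (0 < t \<and> T \<le> t + \<delta> n)" using that zz by auto
        then show ?thesis
        proof
          assume "t < 0"
          then show ?thesis using mT[of t x] by (simp add: V_def w_def D_def zz)
        next
          assume a: "0 < t \<and> T \<le> t + \<delta> n"
          have "\<zeta> t = 0" "\<zeta> (t + \<delta> n) = 0" using a z(6)[of t] z(6)[of "t + \<delta> n"] d(1,2)[of n] by auto
          then show ?thesis by (simp add: V_def w_def D_def zz)
        qed
      qed
    qed
    have RY: "abs (R z) \<le> Y z" if "fst z \<noteq> 0" for z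
    proof -
      have "R z = (?c * V z + D n z) * (f z * f (z + ?s n))" by (simp only: R_def distrib_right mult.assoc)
      then have "abs (R z) = abs (?c * V z + D n z) * (\<bar>f z\<bar> * \<bar>f (z + ?s n)\<bar>)" by (simp only: abs_mult)
      also have "\<dots> \<le> Y z" unfolding Y_def by (intro mult_right_mono key that) simp
      finally show ?thesis .
    qed
    have ae: "AE z in lborel. abs (R z) \<le> Y z"
    proof -
      have "AE z in (lborel :: (real \<times> 'b) measure). fst z \<noteq> 0"
        by (rule AE_lborel_fst[of "\<lambda>t. t \<noteq> 0"]) (rule AE_lborel_singleton)
      then show ?thesis by eventually_elim (rule RY)
    qed
    have "?c * (LINT z|lborel. V z * (f z * f (z + ?s n))) + P n = (LINT z|lborel. R z)"
      unfolding P_def R_def using iV iD by simp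
    then have "abs (?c * (LINT z|lborel. V z * (f z * f (z + ?s n))) + P n) \<le> (LINT z|lborel. abs (R z))"
      by (metis integral_abs_bound)
    also have "\<dots> \<le> (LINT z|lborel. Y z)"
      by (rule integral_mono_AE[OF integrable_abs[OF iR] iY ae])
    also have "\<dots> = S n" by (simp add: S_def Y_def)
    finally show ?thesis using e1 unfolding w_def V_def by simp
  qed
  show ?thesis using Plim Slim bound by blast
qed

text \<open>If \<open>W\<close> is the time derivative of a function, this is the centred difference
  quotient of that function with step \<open>d\<close>.\<close>

definition time_average :: "real \<Rightarrow> (real \<times> 'b::euclidean_space \<Rightarrow> real) \<Rightarrow> real \<times> 'b \<Rightarrow> real" where
  "time_average d W z = 1 / (2 * d) * (LINT s|lborel. indicator {-d<..<d} s * W (fst z + s, snd z))"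

text \<open>Fubini in the shift s; translations preserve the L2 norm, so the inner integrals are
  bounded uniformly in s.\<close>

lemma time_average_pairing:
  fixes h W :: "real \<times> 'b::euclidean_space \<Rightarrow> real"
  assumes h: "square_integrable h" and W: "square_integrable W" and d: "0 < d"
  shows "integrable lborel (\<lambda>z. h z * time_average d W z)"
    and "(LINT z|lborel. h z * time_average d W z) = 1 / (2 * d) * (LINT s|lborel. indicator {-d<..<d} s * (LINT z|lborel. h z * W (z + (s, 0))))"
    and "integrable lborel (\<lambda>s. indicator {-d<..<d} s * (LINT z|lborel. h z * W (z + (s, 0))))"
proof -
  let ?F = "\<lambda>p :: real \<times> real \<times> 'b. indicator {-d<..<d} (fst p) * (h (snd p) * W (snd p + (fst p, 0)))"
  let ?C = "(LINT z|lborel. (h z)\<^sup>2) + (LINT z|lborel. (W z)\<^sup>2)"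
  have Wt: "square_integrable (\<lambda>z. W (z + (s, 0)))" for s by (rule square_integrable_translate[OF W])
  have hm: "h \<in> borel_measurable borel" "W \<in> borel_measurable borel" using h W by (auto simp: square_integrable_def)
  have Fm: "?F \<in> borel_measurable lborel"
  proof (intro borel_measurable_times)
    show "(\<lambda>p :: real \<times> real \<times> 'b. indicat_real {-d<..<d} (fst p)) \<in> borel_measurable lborel"
      by (rule borel_measurable_indicator_fst) simp
    show "(\<lambda>p :: real \<times> real \<times> 'b. h (snd p)) \<in> borel_measurable lborel"
      by (rule measurable_compose[OF borel_measurable_fst_snd(2) hm(1)])
    have c: "continuous_on UNIV (\<lambda>p :: real \<times> real \<times> 'b. snd p + (fst p, 0))"
      by (intro continuous_intros)
    have "(\<lambda>p :: real \<times> real \<times> 'b. snd p + (fst p, 0)) \<in> borel_measurable lborel"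
      using borel_measurable_continuous_onI[OF c] by simp
    then show "(\<lambda>p :: real \<times> real \<times> 'b. W (snd p + (fst p, 0))) \<in> borel_measurable lborel"
      by (rule measurable_compose[OF _ hm(2)])
  qed
  have ptw: "\<bar>a * b\<bar> \<le> a\<^sup>2 + b\<^sup>2" for a b :: real
    using sum_squares_bound[of "\<bar>a\<bar>" "\<bar>b\<bar>"] zero_le_power2[of a] zero_le_power2[of b] mult_nonneg_nonneg[of "\<bar>a\<bar>" "\<bar>b\<bar>"]
    by (simp only: abs_mult power2_abs)
  have bound: "(LINT z|lborel. \<bar>h z * W (z + (s, 0))\<bar>) \<le> ?C" for s
  proof -
    have "(LINT z|lborel. \<bar>h z * W (z + (s, 0))\<bar>) \<le> (LINT z|lborel. (h z)\<^sup>2 + (W (z + (s, 0)))\<^sup>2)"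
      by (rule integral_mono[OF integrable_abs[OF square_integrable_mult[OF h Wt]]
         Bochner_Integration.integrable_add[OF square_integrableD(3)[OF h] square_integrableD(3)[OF Wt]] ptw])
    also have "\<dots> = (LINT z|lborel. (h z)\<^sup>2) + (LINT z|lborel. (W (z + (s, 0)))\<^sup>2)"
      by (rule Bochner_Integration.integral_add[OF square_integrableD(3)[OF h] square_integrableD(3)[OF Wt]])
    also have "(LINT z|lborel. (W (z + (s, 0)))\<^sup>2) = (LINT z|lborel. (W z)\<^sup>2)" by (rule integral_square_translate[OF W])
    finally show ?thesis .
  qed
  have C0: "0 \<le> ?C" by (intro add_nonneg_nonneg) auto
  have i: "integrable lborel ?F"
  proof -
    have Fm': "?F \<in> borel_measurable (lborel \<Otimes>\<^sub>M lborel)" using Fm by (simp only: lborel_prod)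
    have "integrable (lborel \<Otimes>\<^sub>M lborel) ?F"
    proof (rule lborel_pair.Fubini_integrable[OF Fm'])
      have ind: "integrable lborel (indicat_real {-d<..<d})" using indicator_box_integrable[of "-d" d] by simp
      show "integrable lborel (\<lambda>x. LINT y|lborel. norm (?F (x, y)))"
      proof (rule Bochner_Integration.integrable_bound)
        show "integrable lborel (\<lambda>s. ?C * indicat_real {-d<..<d} s)" by (rule integrable_mult_right[OF ind])
        have "(\<lambda>p. norm (?F p)) \<in> borel_measurable (lborel \<Otimes>\<^sub>M lborel)" by (rule measurable_compose[OF Fm' borel_measurable_norm])
        then show "(\<lambda>x. LINT y|lborel. norm (?F (x, y))) \<in> borel_measurable lborel"
          using lborel.borel_measurable_lebesgue_integral[of "\<lambda>x y. norm (?F (x, y))" lborel] by (simp add: case_prod_beta')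
        show "AE x in lborel. norm (LINT y|lborel. norm (?F (x, y))) \<le> norm (?C * indicat_real {-d<..<d} x)"
        proof (rule AE_I2)
          fix s :: real
          have "(LINT y|lborel. norm (?F (s, y))) = indicator {-d<..<d} s * (LINT z|lborel. \<bar>h z * W (z + (s, 0))\<bar>)"
            by (simp add: abs_mult)
          also have "norm \<dots> \<le> norm (?C * indicat_real {-d<..<d} s)"
            using bound[of s] C0 by (simp add: indicator_def)
          finally show "norm (LINT y|lborel. norm (?F (s, y))) \<le> norm (?C * indicat_real {-d<..<d} s)" .
        qed
      qed
      show "AE x in lborel. integrable lborel (\<lambda>y. ?F (x, y))"
        using square_integrable_mult[OF h Wt] by simp
    qed
    then show ?thesis by (simp only: lborel_prod)
  qed
  have e: "h z * time_average d W z = 1 / (2 * d) * (LINT s|lborel. ?F (s, z))" for z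
  proof -
    have "z + (s, 0) = (fst z + s, snd z)" for s by (cases z) simp
    then have "(LINT s|lborel. ?F (s, z)) = (LINT s|lborel. h z * (indicator {-d<..<d} s * W (fst z + s, snd z)))"
      by (intro Bochner_Integration.integral_cong refl) simp
    then show ?thesis by (simp add: time_average_def)
  qed
  show "integrable lborel (\<lambda>z. h z * time_average d W z)"
    unfolding e by (rule integrable_mult_right[OF lborel_pair_integral(6)[OF i]])
  have "(LINT z|lborel. h z * time_average d W z) = 1 / (2 * d) * (LINT z|lborel. LINT s|lborel. ?F (s, z))"
    unfolding e by simp
  also have "(LINT z|lborel. LINT s|lborel. ?F (s, z)) = (LINT s|lborel. LINT z|lborel. ?F (s, z))"
    using lborel_pair_integral(1,2)[OF i] by simp
  finally show "(LINT z|lborel. h z * time_average d W z) = 1 / (2 * d) * (LINT s|lborel. indicator {-d<..<d} s * (LINT z|lborel. h z * W (z + (s, 0))))"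
    by simp
  show "integrable lborel (\<lambda>s. indicator {-d<..<d} s * (LINT z|lborel. h z * W (z + (s, 0))))"
    using lborel_pair_integral(5)[OF i] by simp
qed

text \<open>By translation continuity in L2 the pairing with a translate depends continuously on the
  shift, and the left side is its mean over shifts in (-\<delta>, \<delta>). It is this weak
  convergence of the averages that enters the energy identity.\<close>

lemma time_average_tendsto:
  fixes h W :: "real \<times> 'b::euclidean_space \<Rightarrow> real"
  assumes h: "square_integrable h" and W: "square_integrable W" and d: "\<And>n. 0 < \<delta> n" "\<delta> \<longlonglongrightarrow> 0"
  shows "(\<lambda>n. LINT z|lborel. h z * time_average (\<delta> n) W z) \<longlonglongrightarrow> (LINT z|lborel. h z * W z)"
proof -
  define P where "P s = (LINT z|lborel. h z * W (z + (s, 0)))" for s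
  have Wt: "square_integrable (\<lambda>z. W (z + (s, 0)))" for s by (rule square_integrable_translate[OF W])
  have P0: "P 0 = (LINT z|lborel. h z * W z)" by (simp add: P_def zero_prod_def[symmetric])
  have "(P \<longlongrightarrow> P 0) (at 0)"
    unfolding tendsto_at_iff_sequentially
  proof (intro allI impI)
    fix X :: "nat \<Rightarrow> real" assume X: "X \<longlonglongrightarrow> 0"
    then have "(\<lambda>n. (X n, 0 :: 'b)) \<longlonglongrightarrow> (0, 0)" by (intro tendsto_Pair tendsto_const)
    then have X0: "(\<lambda>n. (X n, 0 :: 'b)) \<longlonglongrightarrow> 0" by (simp add: zero_prod_def)
    have dW: "square_integrable (\<lambda>z. W (z + (X n, 0)) - W z)" for n by (rule square_integrable_diff[OF Wt W])
    have l0: "(\<lambda>n. LINT z|lborel. \<bar>(W (z + (X n, 0)) - W z) * h z\<bar>) \<longlonglongrightarrow> 0"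
      by (rule L2_convergence_mult_fixed[OF dW translation_continuous_L2[OF square_integrableD(1,3)[OF W] X0] h order_refl])
    have le: "\<bar>P (X n) - P 0\<bar> \<le> (LINT z|lborel. \<bar>(W (z + (X n, 0)) - W z) * h z\<bar>)" for n
    proof -
      have "P (X n) - P 0 = (LINT z|lborel. h z * W (z + (X n, 0)) - h z * W z)"
        unfolding P0 unfolding P_def using square_integrable_mult[OF h Wt] square_integrable_mult[OF h W] by simp
      also have "\<dots> = (LINT z|lborel. (W (z + (X n, 0)) - W z) * h z)" by (simp add: algebra_simps)
      finally show ?thesis by (metis integral_abs_bound)
    qed
    have "(\<lambda>n. P (X n) - P 0) \<longlonglongrightarrow> 0" by (rule tendsto_0_of_abs_le[OF le l0])
    then show "(P \<circ> X) \<longlonglongrightarrow> P 0" unfolding o_def by (rule LIM_zero_cancel)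
  qed
  then have near: "\<exists>r>0. \<forall>s. \<bar>s\<bar> < r \<longrightarrow> \<bar>P s - P 0\<bar> \<le> e" if "0 < e" for e
  proof -
    obtain r where r: "0 < r" "\<And>s. s \<noteq> 0 \<Longrightarrow> \<bar>s\<bar> < r \<Longrightarrow> \<bar>P s - P 0\<bar> < e"
      using \<open>(P \<longlongrightarrow> P 0) (at 0)\<close> \<open>0 < e\<close> unfolding LIM_eq by auto
    have "\<bar>P s - P 0\<bar> \<le> e" if "\<bar>s\<bar> < r" for s
      using r(2)[of s] that \<open>0 < e\<close> by (cases "s = 0") auto
    then show ?thesis using r(1) by blast
  qed
  have "(\<lambda>n. LINT z|lborel. h z * time_average (\<delta> n) W z) \<longlonglongrightarrow> P 0"
  proof (rule LIMSEQ_I)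
    fix e :: real assume e: "0 < e"
    obtain r where r: "0 < r" "\<And>s. \<bar>s\<bar> < r \<Longrightarrow> \<bar>P s - P 0\<bar> \<le> e/2" using near[of "e/2"] e by auto
    obtain N where N: "\<And>n. n \<ge> N \<Longrightarrow> \<delta> n < r" using order_tendstoD(2)[OF d(2) r(1)] unfolding eventually_sequentially by blast
    have "norm ((LINT z|lborel. h z * time_average (\<delta> n) W z) - P 0) < e" if "n \<ge> N" for n
    proof -
      let ?i = "indicat_real {- \<delta> n<..<\<delta> n}"
      have ii: "integrable lborel ?i" using indicator_box_integrable[of "- \<delta> n" "\<delta> n"] by simp
      have iv: "(LINT s|lborel. ?i s) = 2 * \<delta> n" using d(1)[of n] by simp
      have iP: "integrable lborel (\<lambda>s. ?i s * P s)" unfolding P_def by (rule time_average_pairing(3)[OF h W d(1)])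
      have "(LINT z|lborel. h z * time_average (\<delta> n) W z) - P 0 = 1 / (2 * \<delta> n) * ((LINT s|lborel. ?i s * P s) - (LINT s|lborel. ?i s * P 0))"
        unfolding time_average_pairing(2)[OF h W d(1)] P_def[symmetric] using iv d(1)[of n] by (simp add: field_simps)
      also have "(LINT s|lborel. ?i s * P s) - (LINT s|lborel. ?i s * P 0) = (LINT s|lborel. ?i s * (P s - P 0))"
        using iP ii by (simp add: right_diff_distrib)
      finally have eq: "(LINT z|lborel. h z * time_average (\<delta> n) W z) - P 0 = 1 / (2 * \<delta> n) * (LINT s|lborel. ?i s * (P s - P 0))" .
      have iD: "integrable lborel (\<lambda>s. ?i s * (P s - P 0))" using iP ii by (simp add: right_diff_distrib)
      have "\<bar>LINT s|lborel. ?i s * (P s - P 0)\<bar> \<le> (LINT s|lborel. \<bar>?i s * (P s - P 0)\<bar>)" by (rule integral_abs_bound)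
      also have "\<dots> \<le> (LINT s|lborel. ?i s * (e/2))"
      proof (rule integral_mono[OF integrable_abs[OF iD] integrable_mult_left[OF ii]])
        fix s show "\<bar>?i s * (P s - P 0)\<bar> \<le> ?i s * (e/2)"
          using r(2)[of s] N[OF that] by (auto simp: indicator_def)
      qed
      also have "\<dots> = \<delta> n * e" using iv by simp
      finally have "1 / (2 * \<delta> n) * \<bar>LINT s|lborel. ?i s * (P s - P 0)\<bar> \<le> e / 2" using d(1)[of n] by (simp add: field_simps)
      then show ?thesis unfolding eq real_norm_def abs_mult using d(1)[of n] e by simp
    qed
    then show "\<exists>N. \<forall>n\<ge>N. norm ((LINT z|lborel. h z * time_average (\<delta> n) W z) - P 0) < e" by blast
  qed
  then show ?thesis unfolding P0 .
qed

lemma integrable_on_bounded_interval: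
  fixes g :: "real \<Rightarrow> real"
  assumes "square_integrable g"
  shows "integrable lborel (\<lambda>s. indicator {a<..<b} s * g s)"
proof -
  have i: "integrable lborel (indicat_real {a<..<b})" using indicator_box_integrable[of a b] by simp
  have "square_integrable (indicat_real {a<..<b})" by (rule square_integrable_bounded_supp[OF i, of 1]) simp
  then show ?thesis using square_integrable_mult assms by blast
qed

text \<open>A fundamental theorem of calculus for moving averages: their slope is a difference
  quotient of \<open>W\<close>, so no derivative of \<open>W\<close> is involved.\<close>

lemma time_average_primitive:
  fixes W :: "real \<times> 'b::euclidean_space \<Rightarrow> real"
  assumes g: "square_integrable (\<lambda>s. W (s, x))" and d: "0 < d" and t: "0 \<le> t" "t \<le> T"
    and G: "\<And>s. s \<in> {0<..<T} \<Longrightarrow> G (s, x) = (W (s + d, x) - W (s - d, x)) / (2 * d)"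
  shows "time_average d W (t, x) = time_average d W (0, x) + primitive0 G (t, x)"
proof -
  let ?g = "\<lambda>s. W (s, x)"
  let ?I = "\<lambda>a b. LINT s|lborel. indicator {a<..<b} s * ?g s"
  have i: "integrable lborel (\<lambda>s. indicator {a<..<b} s * ?g s)" for a b
    by (rule integrable_on_bounded_interval[OF g])
  have tr: "(LINT s|lborel. indicator {a<..<b} s * ?g (s + c)) = ?I (a + c) (b + c)"
    "integrable lborel (\<lambda>s. indicator {a<..<b} s * ?g (s + c))" for a b c
  proof -
    have e: "(\<lambda>s. indicator {a<..<b} s * ?g (s + c)) = (\<lambda>s. indicator {a + c<..<b + c} (s + c) * ?g (s + c))"
      by (auto simp: indicator_def fun_eq_iff)
    show "(LINT s|lborel. indicator {a<..<b} s * ?g (s + c)) = ?I (a + c) (b + c)"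
      unfolding e by (rule integral_translate[OF borel_measurable_integrable[OF i]])
    show "integrable lborel (\<lambda>s. indicator {a<..<b} s * ?g (s + c))"
      unfolding e by (rule integrable_translate[OF i])
  qed
  have ta: "time_average d W (r, x) = 1 / (2 * d) * ?I (r - d) (r + d)" for r
    unfolding time_average_def fst_conv snd_conv using tr(1)[of "-d" d r] by (simp add: add.commute)
  have "primitive0 G (t, x) = (LINT s|lborel. 1 / (2 * d) * (indicator {0<..<t} s * ?g (s + d) - indicator {0<..<t} s * ?g (s + - d)))"
    unfolding primitive0_def fst_conv snd_conv
    by (intro Bochner_Integration.integral_cong refl) (use G t in \<open>auto simp: indicator_def\<close>)
  also have "\<dots> = 1 / (2 * d) * ((LINT s|lborel. indicator {0<..<t} s * ?g (s + d)) - (LINT s|lborel. indicator {0<..<t} s * ?g (s + - d)))"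
    using tr(2)[of 0 t d] tr(2)[of 0 t "-d"] by simp
  also have "\<dots> = 1 / (2 * d) * (?I d (t + d) - ?I (-d) (t - d))"
    using tr(1)[of 0 t d] tr(1)[of 0 t "-d"] by simp
  finally have pr: "primitive0 G (t, x) = 1 / (2 * d) * (?I d (t + d) - ?I (-d) (t - d))" .
  \<comment> \<open>Sums on both sides avoid reversed intervals: for t \<ge> 0 each pair tiles (-d,
    t + d) up to endpoints, also when t < 2 d.\<close>
  have "?I (t - d) (t + d) + ?I (-d) (t - d) = ?I (-d) d + ?I d (t + d)"
  proof -
    have "?I (t - d) (t + d) + ?I (-d) (t - d) = (LINT s|lborel. indicator {t - d<..<t + d} s * ?g s + indicator {-d<..<t - d} s * ?g s)"
      using i by simp
    also have "\<dots> = (LINT s|lborel. indicator {-d<..<d} s * ?g s + indicator {d<..<t + d} s * ?g s)"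
    proof (rule integral_cong_AE)
      show "AE s in lborel. indicator {t - d<..<t + d} s * ?g s + indicator {-d<..<t - d} s * ?g s
         = indicator {-d<..<d} s * ?g s + indicator {d<..<t + d} s * ?g s"
        using AE_lborel_singleton[of d] AE_lborel_singleton[of "t - d"]
        by eventually_elim (use d t in \<open>auto simp: indicator_def\<close>)
    qed (use i in \<open>auto intro!: borel_measurable_add dest: borel_measurable_integrable simp del: measurable_lborel1\<close>)
    also have "\<dots> = ?I (-d) d + ?I d (t + d)" using i by simp
    finally show ?thesis .
  qed
  then have sum: "?I (t - d) (t + d) = ?I (-d) d + (?I d (t + d) - ?I (-d) (t - d))" by simp
  show ?thesis unfolding ta pr sum by (simp add: distrib_left)
qed

text \<open>Cauchy-Schwarz on the interval from s to t; the factor t - s is what later yields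
  continuity in time with values in L2.\<close>

lemma primitive0_difference_square:
  fixes G :: "real \<times> 'b::euclidean_space \<Rightarrow> real"
  assumes g: "square_integrable (\<lambda>s. G (s, x))" and st: "0 \<le> s" "s \<le> t"
  shows "(primitive0 G (t, x) - primitive0 G (s, x))\<^sup>2 \<le> (t - s) * (LINT r|lborel. (G (r, x))\<^sup>2)"
proof -
  let ?i = "\<lambda>r. indicat_real {0<..<t} r - indicat_real {0<..<s} r"
  have ind: "integrable lborel (indicat_real {0<..<a})" for a :: real using indicator_box_integrable[of 0 a] by simp
  have ii: "integrable lborel ?i" by (rule Bochner_Integration.integrable_diff[OF ind ind])
  have isq: "square_integrable ?i" by (rule square_integrable_bounded_supp[OF ii, of 1]) (simp add: indicator_def)
  have sq: "(LINT r|lborel. (?i r)\<^sup>2) = t - s"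
  proof -
    have "(LINT r|lborel. (?i r)\<^sup>2) = (LINT r|lborel. ?i r)"
      by (intro Bochner_Integration.integral_cong refl) (use st in \<open>auto simp: indicator_def\<close>)
    also have "\<dots> = (LINT r|lborel. indicat_real {0<..<t} r) - (LINT r|lborel. indicat_real {0<..<s} r)"
      by (rule Bochner_Integration.integral_diff[OF ind ind])
    finally show ?thesis using st by simp
  qed
  have "primitive0 G (t, x) - primitive0 G (s, x) = (LINT r|lborel. ?i r * G (r, x))"
    unfolding primitive0_def fst_conv snd_conv
    using integrable_on_bounded_interval[OF g, of 0 t] integrable_on_bounded_interval[OF g, of 0 s]
    by (simp add: left_diff_distrib)
  then have "\<bar>primitive0 G (t, x) - primitive0 G (s, x)\<bar> \<le> (LINT r|lborel. \<bar>?i r * G (r, x)\<bar>)"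
    by (simp only: integral_abs_bound)
  then have "\<bar>primitive0 G (t, x) - primitive0 G (s, x)\<bar>\<^sup>2 \<le> (LINT r|lborel. \<bar>?i r * G (r, x)\<bar>)\<^sup>2"
    by (rule power_mono) simp
  also have "\<dots> \<le> (LINT r|lborel. (?i r)\<^sup>2) * (LINT r|lborel. (G (r, x))\<^sup>2)"
    by (rule Cauchy_Schwarz_integral[OF isq g])
  finally show ?thesis by (simp only: sq power2_abs)
qed

lemma primitive0_at_0: "primitive0 G (0, x) = 0"
  by (simp add: primitive0_def)

section \<open>Admissible test functions\<close>

lemma square_integrable_slices:
  fixes G :: "real \<times> 'b::euclidean_space \<Rightarrow> real"
  assumes "square_integrable G"
  shows "AE x in lborel. square_integrable (\<lambda>s. G (s, x))"
  using lborel_pair_integral(4)[OF square_integrableD(3)[OF assms]]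
proof eventually_elim
  case (elim x)
  have "(\<lambda>s. G (s, x)) \<in> borel_measurable lborel"
    by (rule borel_measurable_prod_comp[OF square_integrableD(1)[OF assms]]) auto
  then show ?case using elim by (simp add: square_integrable_def)
qed

text \<open>Supplies test functions for the weak formulation: an L2 function of space plus the
  primitive of an L2 function, times a C1 weight. The traces in time are then the values of the
  explicit formula.\<close>

lemma test_function_in_time:
  fixes q :: "real \<times> real \<Rightarrow> real" and G :: "real \<times> real \<times> real \<Rightarrow> real"
  assumes T: "0 < T" and q: "square_integrable q" "\<And>x. x \<notin> Omega l h \<Longrightarrow> q x = 0"
    and G: "square_integrable G" "\<And>z. z \<notin> {0<..<T} \<times> Omega l h \<Longrightarrow> G z = 0"
    and z: "\<And>t. (\<zeta> has_real_derivative \<zeta>' t) (at t)" "continuous_on UNIV \<zeta>'" "\<And>t. \<bar>\<zeta> t\<bar> \<le> Z" "\<And>t. \<bar>\<zeta>' t\<bar> \<le> Z'"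
  defines "\<phi> \<equiv> \<lambda>t x. \<zeta> t * (q x + primitive0 G (t, x))"
    and "\<phi>t \<equiv> \<lambda>t x. \<zeta>' t * (q x + primitive0 G (t, x)) + \<zeta> t * G (t, x)"
  shows "L2_L2 T (Omega l h) \<phi>" and "has_time_derivative T (Omega l h) \<phi> \<phi>t"
    and "\<And>s. s \<in> {0..T} \<Longrightarrow> has_time_trace T (Omega l h) \<phi> s (\<phi> s)"
proof -
  let ?O = "Omega l h" and ?Q = "{0<..<T} \<times> Omega l h"
  note O = Omega_props[of l h]
  have Qb: "?Q = box (0, (-l, 0)) (T, (l, h))" by (simp add: O(4) box_Pair)
  have Qs: "?Q \<in> sets borel" "bounded ?Q" unfolding Qb by auto
  have zc: "continuous_on UNIV \<zeta>" using z(1) by (auto intro!: continuous_at_imp_continuous_on DERIV_isCont)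
  have zm: "(\<lambda>z :: real \<times> real \<times> real. k (fst z)) \<in> borel_measurable lborel" if "continuous_on UNIV k" for k :: "real \<Rightarrow> real"
    using measurable_compose[OF borel_measurable_fst_snd(1) borel_measurable_continuous_onI[OF that]] .
  have QG: "indicat_real ?Q z * G z = G z" for z using G(2)[of z] by (auto simp: indicator_def)
  have Gi: "integrable lborel G"
    using integrable_of_square_integrable_bounded[of ?Q G] Qs G(1) unfolding QG by blast
  note Gm = square_integrableD(1)[OF G(1)] and qm = square_integrableD(1)[OF q(1)]
  have pm: "primitive0 G \<in> borel_measurable lborel" by (rule primitive0_measurable[OF Gm])
  \<comment> \<open>The squared L2 norm of \<open>G\<close> on the line over x controls the squares
    of the primitive and of its increments, uniformly in time.\<close>
  define \<gamma> where "\<gamma> x = (LINT s|lborel. (G (s, x))\<^sup>2)" for x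
  have gi: "integrable lborel \<gamma>" unfolding \<gamma>_def by (rule lborel_pair_integral(6)[OF square_integrableD(3)[OF G(1)]])
  have g0: "0 \<le> \<gamma> x" for x by (simp add: \<gamma>_def)
  note sl = square_integrable_slices[OF G(1)]
  have psq: "(primitive0 G (t, x))\<^sup>2 \<le> T * \<gamma> x" if "square_integrable (\<lambda>s. G (s, x))" "t \<in> {0..T}" for t x
  proof -
    have "(primitive0 G (t, x))\<^sup>2 \<le> t * \<gamma> x"
      using primitive0_difference_square[OF that(1), of 0 t] that(2) by (simp add: primitive0_at_0 \<gamma>_def)
    also have "\<dots> \<le> T * \<gamma> x" using that(2) g0[of x] by (intro mult_right_mono) auto
    finally show ?thesis .
  qed
  have p0: "primitive0 G (t, x) = 0" if "x \<notin> ?O" for t x using G(2) that by (simp add: primitive0_def)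
  have sum_sq: "(a + b)\<^sup>2 \<le> 2 * a\<^sup>2 + 2 * b\<^sup>2" for a b :: real
    using sum_squares_bound[of a b] by (simp add: power2_sum)
  have sumsq: "(q x + primitive0 G (t, x))\<^sup>2 \<le> 2 * (q x)\<^sup>2 + 2 * T * \<gamma> x" if "square_integrable (\<lambda>s. G (s, x))" "t \<in> {0..T}" for t x
    using sum_sq[of "q x" "primitive0 G (t, x)"] psq[OF that] by simp
  have q2: "integrable lborel (\<lambda>x. 2 * (q x)\<^sup>2 + 2 * T * \<gamma> x)" using square_integrableD(3)[OF q(1)] gi by simp
  have indT: "integrable lborel (indicat_real {0<..<T})" using indicator_box_integrable[of 0 T] by simp
  \<comment> \<open>The test function without its weight; as the weights are bounded, integrability
    is settled once for \<open>R\<close>.\<close>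
  define R where "R z = indicat_real {0<..<T} (fst z) * (q (snd z) + primitive0 G z)" for z
  have qsm: "(\<lambda>z :: real \<times> real \<times> real. q (snd z)) \<in> borel_measurable lborel"
    using measurable_compose[OF borel_measurable_fst_snd(2), of q borel] qm by simp
  have Rm: "R \<in> borel_measurable lborel"
    unfolding R_def by (intro borel_measurable_times borel_measurable_add borel_measurable_indicator_fst qsm pm) simp
  have R2: "square_integrable R"
  proof -
    have "integrable lborel (\<lambda>z. (R z)\<^sup>2)"
    proof (rule Bochner_Integration.integrable_bound[OF integrable_product[OF indT q2]])
      show "(\<lambda>z. (R z)\<^sup>2) \<in> borel_measurable lborel" by (rule borel_measurable_power[OF Rm])
      show "AE z in lborel. norm ((R z)\<^sup>2) \<le> norm (indicat_real {0<..<T} (fst z) * (2 * (q (snd z))\<^sup>2 + 2 * T * \<gamma> (snd z)))"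
        using AE_lborel_snd[OF sl, where 'a=real]
      proof eventually_elim
        case (elim z)
        have nn: "0 \<le> 2 * (q (snd z))\<^sup>2 + 2 * T * \<gamma> (snd z)" using g0[of "snd z"] T by simp
        then show ?case using sumsq[OF elim, of "fst z"] by (auto simp: R_def indicator_def)
      qed
    qed
    then show ?thesis using Rm by (simp add: square_integrable_def)
  qed
  have QF: "indicat_real ?Q z * \<phi> (fst z) (snd z) = \<zeta> (fst z) * R z" for z
    using q(2)[of "snd z"] p0[of "snd z" "fst z"] by (auto simp: \<phi>_def R_def indicator_def mem_Times_iff)
  have QFt: "indicat_real ?Q z * \<phi>t (fst z) (snd z) = \<zeta>' (fst z) * R z + \<zeta> (fst z) * G z" for z
    using q(2)[of "snd z"] p0[of "snd z" "fst z"] G(2)[of z] by (auto simp: \<phi>t_def R_def indicator_def mem_Times_iff)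
  have F2: "square_integrable (\<lambda>z. indicat_real ?Q z * \<phi> (fst z) (snd z))"
    unfolding QF by (rule square_integrable_bounded_mult[OF R2 zm[OF zc] z(3)])
  have Ft2: "square_integrable (\<lambda>z. indicat_real ?Q z * \<phi>t (fst z) (snd z))"
    unfolding QFt by (rule square_integrable_add[OF square_integrable_bounded_mult[OF R2 zm[OF z(2)] z(4)]
       square_integrable_bounded_mult[OF G(1) zm[OF zc] z(3)]])
  show "L2_L2 T ?O \<phi>"
    using F2 L2_on_real_iff[OF Qs(1)] by (simp add: L2_L2_def case_prod_beta')
  note Fi = integrable_of_square_integrable_bounded[OF F2 Qs] and Fti = integrable_of_square_integrable_bounded[OF Ft2 Qs]
  have loc: "locally_integrable_on ?Q f" if "integrable lborel (\<lambda>z. indicat_real ?Q z * f z)" for f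
    unfolding locally_integrable_on_def
  proof (intro allI impI, elim conjE)
    fix K assume K: "compact K" "K \<subseteq> ?Q"
    have "integrable lborel (\<lambda>z. indicat_real K z * (indicat_real ?Q z * f z))"
      using integrable_mult_indicator[OF _ that, of K] K(1) by (simp add: borel_compact)
    moreover have "indicat_real K z * (indicat_real ?Q z * f z) = indicat_real K z * f z" for z using K(2) by (auto simp: indicator_def)
    ultimately show "set_integrable lborel K f" by (simp add: set_integrable_def)
  qed
  have Ri: "integrable lborel R"
  proof -
    have e: "indicat_real ?Q z * R z = R z" for z
      using q(2)[of "snd z"] p0[of "snd z" "fst z"] by (auto simp: R_def indicator_def mem_Times_iff)
    show ?thesis using integrable_of_square_integrable_bounded[of ?Q R] Qs R2 unfolding e by blast
  qed
  have test: "(LINT z:?Q|lborel. \<phi> (fst z) (snd z) * frechet_derivative \<theta> (at z) (1, 0)) = - (LINT z:?Q|lborel. \<phi>t (fst z) (snd z) * \<theta> z)"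
    if th: "\<theta> \<in> test_functions ?Q" for \<theta>
  proof -
    have Qo: "open ?Q" unfolding Qb by (rule open_box)
    have th1: "Ck_compact (Suc 0) ?Q \<theta>" using th by (simp add: test_functions_def)
    note tp = Ck_compact_UNIV_props[OF th1 Qo]
    let ?D = "\<lambda>z. frechet_derivative \<theta> (at z) (1, 0)"
    have e1: "(1, 0) \<in> (Basis :: (real \<times> real \<times> real) set)" by (auto simp: Basis_prod_def)
    have d0: "Ck_compact 0 ?Q ?D" by (rule Ck_compact_SucD[OF th1 e1])
    note dp = Ck_compact_UNIV_props[OF d0 Qo]
    obtain B where B: "\<And>z. \<bar>\<theta> z\<bar> \<le> B" using continuous_compact_supp_bound[OF tp(4,2)] by blast
    obtain B' where B': "\<And>z. \<bar>?D z\<bar> \<le> B'" using continuous_compact_supp_bound[OF dp(4,2)] by blast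
    have thme: "\<theta> \<in> borel_measurable lborel" and Dm: "?D \<in> borel_measurable lborel"
      using borel_measurable_continuous_onI[OF tp(4)] borel_measurable_continuous_onI[OF dp(4)] by simp_all
    \<comment> \<open>The weight is merged into the test function: \<open>\<kappa>\<close> is
      \<open>\<zeta>\<close> times \<open>\<theta>\<close> and \<open>\<kappa>'\<close> its time
      derivative, so that one integration by parts along lines covers both terms of the product
      rule.\<close>
    define \<kappa> where "\<kappa> z = \<zeta> (fst z) * \<theta> z" for z
    define \<kappa>' where "\<kappa>' z = \<zeta>' (fst z) * \<theta> z + \<zeta> (fst z) * ?D z" for z
    have zf: "continuous_on UNIV (\<lambda>z :: real \<times> real \<times> real. k (fst z))" if "continuous_on UNIV k" for k :: "real \<Rightarrow> real"
      by (rule continuous_on_compose2[OF that]) (intro continuous_intros, simp)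
    have kc: "continuous_on UNIV \<kappa>" "continuous_on UNIV \<kappa>'"
      unfolding \<kappa>_def[abs_def] \<kappa>'_def[abs_def] by (intro continuous_on_mult continuous_on_add zf zc z(2) tp(4) dp(4))+
    have ks: "compact (supp \<kappa>)" "compact (supp \<kappa>')"
    proof -
      have "z \<in> supp \<theta>" if "\<kappa> z \<noteq> 0" for z using that supp_superset[of \<theta> z] by (auto simp: \<kappa>_def)
      then show "compact (supp \<kappa>)" by (rule compact_suppI[OF tp(2)])
      have "z \<in> supp \<theta>" if "\<kappa>' z \<noteq> 0" for z
        using that supp_superset[of \<theta> z] frechet_derivative_outside_supp[of z \<theta> "(1, 0)"]
        by (cases "z \<in> supp \<theta>") (auto simp: \<kappa>'_def)
      then show "compact (supp \<kappa>')" by (rule compact_suppI[OF tp(2)])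
    qed
    obtain C where C: "\<And>z. \<bar>\<kappa> z\<bar> \<le> C" using continuous_compact_supp_bound[OF kc(1) ks(1)] by blast
    obtain C' where C': "\<And>z. \<bar>\<kappa>' z\<bar> \<le> C'" using continuous_compact_supp_bound[OF kc(2) ks(2)] by blast
    have km: "\<kappa> \<in> borel_measurable lborel" "\<kappa>' \<in> borel_measurable lborel"
      using borel_measurable_continuous_onI[OF kc(1)] borel_measurable_continuous_onI[OF kc(2)] by simp_all
    have iR: "integrable lborel (\<lambda>z. \<kappa>' z * R z)" by (rule integrable_bounded_mult[OF Ri km(2) C'])
    have iG: "integrable lborel (\<lambda>z. \<kappa> z * G z)" by (rule integrable_bounded_mult[OF Gi km(1) C])
    have kd: "((\<lambda>t. \<kappa> (t, x)) has_real_derivative \<kappa>' (t, x)) (at t)" for t x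
    proof -
      have th': "(\<theta> has_derivative frechet_derivative \<theta> (at (t, x))) (at (t, x))"
        by (rule Ck_Suc_has_derivative[OF tp(1)]) simp
      have "((\<lambda>t. (t, x)) has_derivative (\<lambda>h. (h, 0))) (at t)" by (auto intro!: derivative_eq_intros)
      from diff_chain_at[OF this th'] have "((\<lambda>t. \<theta> (t, x)) has_derivative (\<lambda>h. frechet_derivative \<theta> (at (t, x)) (h, 0))) (at t)"
        by (simp add: o_def)
      moreover have "(\<lambda>h. frechet_derivative \<theta> (at (t, x)) (h, 0)) = (*) (?D (t, x))"
      proof
        fix k show "frechet_derivative \<theta> (at (t, x)) (k, 0) = ?D (t, x) * k"
          using linear_scale[OF has_derivative_linear[OF th'], of k "(1, 0)"] by simp
      qed
      ultimately have "((\<lambda>t. \<theta> (t, x)) has_real_derivative ?D (t, x)) (at t)" by (simp only: has_field_derivative_def)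
      from DERIV_mult[OF z(1)[of t] this] show ?thesis
        unfolding \<kappa>_def \<kappa>'_def by (simp add: algebra_simps)
    qed
    have kx: "continuous_on UNIV (\<lambda>t. \<kappa>' (t, x))" for x
      by (rule continuous_on_compose2[OF kc(2)]) (intro continuous_intros, simp)
    have k0: "\<kappa> (0, x) = 0" "\<kappa> (T, x) = 0" for x using tp(5)[of "(0, x)"] tp(5)[of "(T, x)"] by (auto simp: \<kappa>_def)
    have "(LINT z|lborel. \<kappa>' z * R z + \<kappa> z * G z) = (LINT x|lborel. LINT t|lborel. \<kappa>' (t, x) * R (t, x) + \<kappa> (t, x) * G (t, x))"
      by (rule lborel_pair_integral(2)[OF Bochner_Integration.integrable_add[OF iR iG]])
    also have "\<dots> = (LINT x|(lborel :: (real \<times> real) measure). 0)"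
    proof (rule integral_cong_AE)
      show "(\<lambda>x. LINT t|lborel. \<kappa>' (t, x) * R (t, x) + \<kappa> (t, x) * G (t, x)) \<in> borel_measurable lborel"
        by (rule borel_measurable_integrable[OF lborel_pair_integral(6)[OF Bochner_Integration.integrable_add[OF iR iG]]])
      show "AE x in lborel. (LINT t|lborel. \<kappa>' (t, x) * R (t, x) + \<kappa> (t, x) * G (t, x)) = 0"
        using lborel_pair_integral(4)[OF iR] lborel_pair_integral(4)[OF iG] lborel_pair_integral(4)[OF Gi]
      proof eventually_elim
        case (elim x)
        have FTC: "(LINT t|lborel. \<kappa>' (t, x) * indicator {0..T} t) = 0"
          using integral_FTC_Icc_real[of 0 T "\<lambda>t. \<kappa> (t, x)" "\<lambda>t. \<kappa>' (t, x)"] T kd[of x] kx[of x] k0[of x]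
          by (simp add: continuous_on_eq_continuous_at)
        have iI: "integrable lborel (\<lambda>t. indicator {0..T} t * \<kappa>' (t, x))"
          using borel_integrable_compact[of "{0..T}" "\<lambda>t. \<kappa>' (t, x)"] continuous_on_subset[OF kx[of x]] by simp
        have iq: "integrable lborel (\<lambda>t. q x * (\<kappa>' (t, x) * indicator {0..T} t))" using iI by (simp add: mult.commute)
        have ae: "AE t in lborel. \<kappa>' (t, x) * R (t, x) - q x * (\<kappa>' (t, x) * indicator {0..T} t)
           = indicator {0<..<T} t * (\<kappa>' (t, x) * (LINT s|lborel. indicator {0<..<t} s * G (s, x)))"
          using AE_lborel_singleton[of 0] AE_lborel_singleton[of T]
          by eventually_elim (auto simp: R_def primitive0_def indicator_def algebra_simps)
        \<comment> \<open>The constant \<open>q x\<close> integrates to 0 against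
          \<open>\<kappa>'\<close>, as \<open>\<kappa>\<close> vanishes at 0 and T; what remains is
          the case of a pure primitive.\<close>
        have "(LINT t|lborel. \<kappa>' (t, x) * R (t, x)) = (LINT t|lborel. \<kappa>' (t, x) * R (t, x) - q x * (\<kappa>' (t, x) * indicator {0..T} t))"
          using elim(1) iq FTC by simp
        also have "\<dots> = (LINT t|lborel. indicator {0<..<T} t * (\<kappa>' (t, x) * (LINT s|lborel. indicator {0<..<t} s * G (s, x))))"
        proof (rule integral_cong_AE[OF _ _ ae])
          show m: "(\<lambda>t. \<kappa>' (t, x) * R (t, x) - q x * (\<kappa>' (t, x) * indicator {0..T} t)) \<in> borel_measurable lborel"
            by (rule borel_measurable_integrable[OF Bochner_Integration.integrable_diff[OF elim(1) iq]])
          have pmx: "(\<lambda>t. primitive0 G (t, x)) \<in> borel_measurable lborel"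
            by (rule borel_measurable_prod_comp[OF pm]) auto
          have kmx: "(\<lambda>t. \<kappa>' (t, x)) \<in> borel_measurable lborel"
            by (rule borel_measurable_prod_comp[OF km(2)]) auto
          have "(\<lambda>t. indicat_real {0<..<T} t * (\<kappa>' (t, x) * primitive0 G (t, x))) \<in> borel_measurable lborel"
            by (intro borel_measurable_times pmx kmx) simp
          then show "(\<lambda>t. indicator {0<..<T} t * (\<kappa>' (t, x) * (LINT s|lborel. indicator {0<..<t} s * G (s, x)))) \<in> borel_measurable lborel"
            by (simp add: primitive0_def)
        qed
        also have "\<dots> = (LINT s|lborel. indicator {0<..<T} s * (G (s, x) * (\<kappa> (T, x) - \<kappa> (s, x))))"
          by (rule integral_primitive_mult[OF elim(3) less_imp_le[OF T] kd kx])
        also have "\<dots> = (LINT s|lborel. - (\<kappa> (s, x) * G (s, x)))"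
        proof (intro Bochner_Integration.integral_cong refl)
          fix s show "indicator {0<..<T} s * (G (s, x) * (\<kappa> (T, x) - \<kappa> (s, x))) = - (\<kappa> (s, x) * G (s, x))"
            using G(2)[of "(s, x)"] k0(2)[of x] by (cases "s \<in> {0<..<T}") auto
        qed
        finally show ?case using elim(1,2) by simp
      qed
    qed simp
    finally have "(LINT z|lborel. \<kappa>' z * R z + \<kappa> z * G z) = 0" by simp
    moreover have "\<kappa>' z * R z + \<kappa> z * G z = (indicat_real ?Q z * \<phi> (fst z) (snd z)) * ?D z + (indicat_real ?Q z * \<phi>t (fst z) (snd z)) * \<theta> z" for z
      unfolding QF QFt by (simp add: \<kappa>_def \<kappa>'_def algebra_simps)
    ultimately have "(LINT z|lborel. (indicat_real ?Q z * \<phi> (fst z) (snd z)) * ?D z + (indicat_real ?Q z * \<phi>t (fst z) (snd z)) * \<theta> z) = 0"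
      by simp
    moreover have "integrable lborel (\<lambda>z. (indicat_real ?Q z * \<phi> (fst z) (snd z)) * ?D z)"
      using integrable_bounded_mult[OF Fi Dm B'] by (simp add: mult.commute)
    moreover have "integrable lborel (\<lambda>z. (indicat_real ?Q z * \<phi>t (fst z) (snd z)) * \<theta> z)"
      using integrable_bounded_mult[OF Fti thme B] by (simp add: mult.commute)
    ultimately have "(LINT z|lborel. (indicat_real ?Q z * \<phi> (fst z) (snd z)) * ?D z) = - (LINT z|lborel. (indicat_real ?Q z * \<phi>t (fst z) (snd z)) * \<theta> z)"
      by simp
    then show ?thesis by (simp add: set_lebesgue_integral_def mult.assoc)
  qed
  show "has_time_derivative T ?O \<phi> \<phi>t"
    unfolding has_time_derivative_def has_weak_pderiv_def case_prod_beta'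
    using Ft2 L2_on_real_iff[OF Qs(1)] loc[OF Fi] loc[OF Fti] test by (simp add: L2_L2_def case_prod_beta')
  have pmt: "(\<lambda>x. primitive0 G (t, x)) \<in> borel_measurable lborel" for t
    by (rule borel_measurable_prod_comp[OF pm]) auto
  have slice2: "square_integrable (\<lambda>x. q x + primitive0 G (t, x))" if "t \<in> {0..T}" for t
  proof -
    have m: "(\<lambda>x. q x + primitive0 G (t, x)) \<in> borel_measurable lborel" by (rule borel_measurable_add[OF qm pmt])
    have "integrable lborel (\<lambda>x. (q x + primitive0 G (t, x))\<^sup>2)"
    proof (rule Bochner_Integration.integrable_bound[OF q2 borel_measurable_power[OF m]])
      show "AE x in lborel. norm ((q x + primitive0 G (t, x))\<^sup>2) \<le> norm (2 * (q x)\<^sup>2 + 2 * T * \<gamma> x)"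
        using sl
      proof eventually_elim
        case (elim x)
        have "0 \<le> 2 * (q x)\<^sup>2 + 2 * T * \<gamma> x" using g0[of x] T by simp
        then show ?case using sumsq[OF elim that] by simp
      qed
    qed
    then show ?thesis using m by (simp add: square_integrable_def)
  qed
  have phis: "square_integrable (\<phi> t)" if "t \<in> {0..T}" for t
    unfolding \<phi>_def by (rule square_integrable_cmult[OF slice2[OF that]])
  have phi0: "\<phi> t x = 0" if "x \<notin> ?O" for t x using that q(2) p0 by (simp add: \<phi>_def)
  have indphi: "(\<lambda>x. indicat_real ?O x * \<phi> t x) = \<phi> t" for t using phi0 by (auto simp: indicator_def fun_eq_iff)
  have L2phi: "L2_on ?O (\<phi> t)" if "t \<in> {0..T}" for t
    using L2_on_real_iff[OF O(1), of "\<phi> t"] phis[OF that] unfolding indphi by simp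
  have cont: "((\<lambda>r. L2norm ?O (\<lambda>x. \<phi> r x - \<phi> t x)) \<longlongrightarrow> 0) (at t within {0..T})" if t: "t \<in> {0..T}" for t
  proof -
    define C1 where "C1 = (LINT x|lborel. 2 * (q x)\<^sup>2 + 2 * T * \<gamma> x)"
    define C2 where "C2 = (LINT x|lborel. \<gamma> x)"
    \<comment> \<open>A modulus of continuity at t for the squared L2 norm: the first part accounts
      for the change of the weight, the second for the increment of the primitive.\<close>
    define e where "e r = 2 * (\<zeta> r - \<zeta> t)\<^sup>2 * C1 + 2 * (\<zeta> t)\<^sup>2 * \<bar>r - t\<bar> * C2" for r
    have C: "0 \<le> C1" "0 \<le> C2" unfolding C1_def C2_def using g0 T by (auto intro!: integral_nonneg_AE)
    have le: "L2norm ?O (\<lambda>x. \<phi> r x - \<phi> t x) \<le> ennreal (sqrt (e r))" if r: "r \<in> {0..T}" for r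
    proof (rule L2norm_le)
      show "0 \<le> e r" using C by (simp add: e_def)
      let ?B = "\<lambda>x. 2 * (\<zeta> r - \<zeta> t)\<^sup>2 * (2 * (q x)\<^sup>2 + 2 * T * \<gamma> x) + 2 * (\<zeta> t)\<^sup>2 * \<bar>r - t\<bar> * \<gamma> x"
      have Bi: "integrable lborel ?B" by (intro Bochner_Integration.integrable_add integrable_mult_right q2 gi)
      have B0: "0 \<le> ?B x" for x using g0[of x] T by simp
      have "(\<integral>\<^sup>+x\<in>?O. ennreal ((norm (\<phi> r x - \<phi> t x))\<^sup>2) \<partial>lborel) \<le> (\<integral>\<^sup>+x. ennreal (?B x) \<partial>lborel)"
      proof (rule nn_integral_mono_AE)
        show "AE x in lborel. ennreal ((norm (\<phi> r x - \<phi> t x))\<^sup>2) * indicator ?O x \<le> ennreal (?B x)"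
          using sl
        proof eventually_elim
          case (elim x)
          have dsq: "(primitive0 G (r, x) - primitive0 G (t, x))\<^sup>2 \<le> \<bar>r - t\<bar> * \<gamma> x"
          proof (cases "t \<le> r")
            case True
            then show ?thesis using primitive0_difference_square[OF elim, of t r] t by (simp add: \<gamma>_def)
          next
            case False
            then show ?thesis using primitive0_difference_square[OF elim, of r t] r by (simp add: \<gamma>_def power2_commute)
          qed
          have "\<phi> r x - \<phi> t x = (\<zeta> r - \<zeta> t) * (q x + primitive0 G (r, x)) + \<zeta> t * (primitive0 G (r, x) - primitive0 G (t, x))"
            by (simp add: \<phi>_def algebra_simps)
          then have "(\<phi> r x - \<phi> t x)\<^sup>2 \<le> 2 * ((\<zeta> r - \<zeta> t)\<^sup>2 * (q x + primitive0 G (r, x))\<^sup>2) + 2 * ((\<zeta> t)\<^sup>2 * (primitive0 G (r, x) - primitive0 G (t, x))\<^sup>2)"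
            using sum_sq[of "(\<zeta> r - \<zeta> t) * (q x + primitive0 G (r, x))" "\<zeta> t * (primitive0 G (r, x) - primitive0 G (t, x))"]
            by (simp only: power_mult_distrib)
          also have "\<dots> \<le> 2 * ((\<zeta> r - \<zeta> t)\<^sup>2 * (2 * (q x)\<^sup>2 + 2 * T * \<gamma> x)) + 2 * ((\<zeta> t)\<^sup>2 * (\<bar>r - t\<bar> * \<gamma> x))"
            by (intro add_mono mult_left_mono sumsq[OF elim r] dsq) auto
          finally have "(\<phi> r x - \<phi> t x)\<^sup>2 \<le> ?B x" by (simp only: mult.assoc)
          then show ?case using B0[of x] by (auto simp: indicator_def intro!: ennreal_leI)
        qed
      qed
      also have "\<dots> = ennreal (LINT x|lborel. ?B x)" by (rule nn_integral_eq_integral[OF Bi]) (use B0 in simp)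
      also have "(LINT x|lborel. ?B x) = e r" using q2 gi by (simp add: e_def C1_def C2_def)
      finally show "(\<integral>\<^sup>+x\<in>?O. ennreal ((norm (\<phi> r x - \<phi> t x))\<^sup>2) \<partial>lborel) \<le> ennreal (e r)" .
    qed
    have "(e \<longlongrightarrow> 2 * (\<zeta> t - \<zeta> t)\<^sup>2 * C1 + 2 * (\<zeta> t)\<^sup>2 * \<bar>t - t\<bar> * C2) (at t within {0..T})"
      unfolding e_def
      by (intro tendsto_intros tendsto_within_subset[OF DERIV_isCont[OF z(1), unfolded isCont_def] subset_UNIV])
    then have "((\<lambda>r. sqrt (e r)) \<longlongrightarrow> sqrt 0) (at t within {0..T})" by (intro tendsto_real_sqrt) simp
    then have "((\<lambda>r. ennreal (sqrt (e r))) \<longlongrightarrow> ennreal 0) (at t within {0..T})" by (intro tendsto_ennrealI) simp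
    then have lim: "((\<lambda>r. ennreal (sqrt (e r))) \<longlongrightarrow> 0) (at t within {0..T})" by simp
    show ?thesis
      by (rule tendsto_sandwich[OF _ _ tendsto_const lim]) (use le in \<open>auto simp: eventually_at_filter\<close>)
  qed
  show "has_time_trace T ?O \<phi> s (\<phi> s)" if "s \<in> {0..T}" for s
    unfolding has_time_trace_def using L2phi[OF that] L2phi cont by (intro conjI exI[of _ \<phi>]) auto
qed

lemma has_periodic_gradient_cong_AE:
  assumes g: "has_periodic_gradient l h g G" and m: "square_integrable (\<lambda>x. indicat_real (Omega l h) x * g' x)"
    and eq: "AE x in lborel. x \<in> Omega l h \<longrightarrow> g x = g' x"
  shows "has_periodic_gradient l h g' G"
proof -
  note O = Omega_props[of l h]
  have gm: "square_integrable (\<lambda>x. indicat_real (Omega l h) x * g x)"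
    using g L2_on_real_iff[OF O(1)] by (simp add: has_periodic_gradient_def)
  have "(LINT x:Omega l h|lborel. g x * frechet_derivative \<psi> (at x) b) = (LINT x:Omega l h|lborel. g' x * frechet_derivative \<psi> (at x) b)"
    if psi: "\<psi> \<in> smooth_periodic l h" and b: "b \<in> Basis" for \<psi> b
  proof -
    have "Ck 1 UNIV \<psi>" using psi by (simp add: smooth_periodic_def)
    then have dm: "(\<lambda>x. frechet_derivative \<psi> (at x) b) \<in> borel_measurable lborel"
      using b borel_measurable_continuous_onI[of "\<lambda>x. frechet_derivative \<psi> (at x) b"] by simp
    have "(LINT x|lborel. (indicat_real (Omega l h) x * g x) * frechet_derivative \<psi> (at x) b) = (LINT x|lborel. (indicat_real (Omega l h) x * g' x) * frechet_derivative \<psi> (at x) b)"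
    proof (rule integral_cong_AE)
      show "AE x in lborel. (indicat_real (Omega l h) x * g x) * frechet_derivative \<psi> (at x) b = (indicat_real (Omega l h) x * g' x) * frechet_derivative \<psi> (at x) b"
        using eq by eventually_elim (auto simp: indicator_def)
    qed (intro borel_measurable_times[OF square_integrableD(1)[OF gm] dm] borel_measurable_times[OF square_integrableD(1)[OF m] dm])+
    then show ?thesis by (simp add: set_lebesgue_integral_def mult.assoc)
  qed
  then show ?thesis
    using g m L2_on_real_iff[OF O(1)] by (simp add: has_periodic_gradient_def)
qed

lemma has_periodic_gradient_lincomb:
  assumes g: "has_periodic_gradient l h g G" and g': "has_periodic_gradient l h g' G'"
  shows "has_periodic_gradient l h (\<lambda>x. a * g x + b * g' x) (\<lambda>x. a *\<^sub>R G x + b *\<^sub>R G' x)"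
proof -
  note O = Omega_props[of l h]
  let ?i = "indicat_real (Omega l h)"
  have s: "square_integrable (\<lambda>x. ?i x * g x)" "square_integrable (\<lambda>x. ?i x * g' x)"
    "square_integrable (\<lambda>x. ?i x * fst (G x))" "square_integrable (\<lambda>x. ?i x * snd (G x))"
    "square_integrable (\<lambda>x. ?i x * fst (G' x))" "square_integrable (\<lambda>x. ?i x * snd (G' x))"
    using g g' L2_on_real_iff[OF O(1)] L2_on_pair_iff[OF O(1)] by (auto simp: has_periodic_gradient_def)
  have comb: "square_integrable (\<lambda>x. ?i x * (a * u x + b * u' x))" if "square_integrable (\<lambda>x. ?i x * u x)" "square_integrable (\<lambda>x. ?i x * u' x)" for u u'
    using square_integrable_add[OF square_integrable_cmult[OF that(1), of a] square_integrable_cmult[OF that(2), of b]]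
    by (simp add: algebra_simps)
  have L: "L2_on (Omega l h) (\<lambda>x. a * g x + b * g' x)" "L2_on (Omega l h) (\<lambda>x. a *\<^sub>R G x + b *\<^sub>R G' x)"
    using comb s L2_on_real_iff[OF O(1)] L2_on_pair_iff[OF O(1)] by auto
  have "(LINT x:Omega l h|lborel. (a * g x + b * g' x) * frechet_derivative \<psi> (at x) e) =
        - (LINT x:Omega l h|lborel. ((a *\<^sub>R G x + b *\<^sub>R G' x) \<bullet> e) * \<psi> x)"
    if psi: "\<psi> \<in> smooth_periodic l h" and e: "e \<in> Basis" for \<psi> e
  proof -
    have C1: "Ck 1 UNIV \<psi>" using psi by (simp add: smooth_periodic_def)
    have c: "continuous_on UNIV \<psi>" "continuous_on UNIV (\<lambda>x. frechet_derivative \<psi> (at x) e)"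
      using C1 e Ck_SucD[of 0 UNIV \<psi>] by auto
    \<comment> \<open>Continuous functions are bounded on the closure of the rectangle; this makes
      all products integrable and the integrals linear.\<close>
    have mul: "integrable lborel (\<lambda>x. (?i x * u x) * k x)" if u: "square_integrable (\<lambda>x. ?i x * u x)" and k: "continuous_on UNIV k" for u and k :: "real \<times> real \<Rightarrow> real"
    proof -
      have "compact (closure (Omega l h))" using O(3) by simp
      then have "bounded (k ` closure (Omega l h))"
        using k by (intro compact_imp_bounded compact_continuous_image) (auto intro: continuous_on_subset)
      then obtain B where B: "\<forall>y\<in>k ` closure (Omega l h). norm y \<le> B" unfolding bounded_iff by blast
      have Bx: "\<bar>k x\<bar> \<le> \<bar>B\<bar>" if "x \<in> Omega l h" for x
        using bspec[OF B imageI[of x]] that closure_subset[of "Omega l h"] by auto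
      have i: "integrable lborel (\<lambda>x. ?i x * u x)" by (rule integrable_of_square_integrable_bounded[OF u O(1,3)])
      have km: "k \<in> borel_measurable lborel" using borel_measurable_continuous_onI[OF k] by simp
      show ?thesis
      proof (rule Bochner_Integration.integrable_bound)
        show "integrable lborel (\<lambda>x. B * (?i x * u x))" using i by simp
        show "(\<lambda>x. ?i x * u x * k x) \<in> borel_measurable lborel" by (intro borel_measurable_times[OF borel_measurable_integrable[OF i] km])
        show "AE x in lborel. norm (?i x * u x * k x) \<le> norm (B * (?i x * u x))"
        proof (rule AE_I2)
          fix x show "norm (?i x * u x * k x) \<le> norm (B * (?i x * u x))"
            using Bx[of x] by (cases "x \<in> Omega l h") (simp_all add: abs_mult mult.commute mult_right_mono)
        qed
      qed
    qed
    have Ge: "square_integrable (\<lambda>x. ?i x * (G x \<bullet> e))" "square_integrable (\<lambda>x. ?i x * (G' x \<bullet> e))"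
      using e s by (auto simp: Basis_real2 inner_prod_def)
    have A: "(LINT x|lborel. (?i x * g x) * frechet_derivative \<psi> (at x) e) = - (LINT x|lborel. (?i x * (G x \<bullet> e)) * \<psi> x)"
      "(LINT x|lborel. (?i x * g' x) * frechet_derivative \<psi> (at x) e) = - (LINT x|lborel. (?i x * (G' x \<bullet> e)) * \<psi> x)"
      using g g' psi e by (simp_all add: has_periodic_gradient_def set_lebesgue_integral_def mult.assoc)
    have "(LINT x:Omega l h|lborel. (a * g x + b * g' x) * frechet_derivative \<psi> (at x) e) =
      (LINT x|lborel. a * ((?i x * g x) * frechet_derivative \<psi> (at x) e) + b * ((?i x * g' x) * frechet_derivative \<psi> (at x) e))"
      unfolding set_lebesgue_integral_def by (intro Bochner_Integration.integral_cong refl) (simp add: algebra_simps)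
    also have "\<dots> = a * (LINT x|lborel. (?i x * g x) * frechet_derivative \<psi> (at x) e) + b * (LINT x|lborel. (?i x * g' x) * frechet_derivative \<psi> (at x) e)"
      using mul[OF s(1) c(2)] mul[OF s(2) c(2)] by simp
    also have "\<dots> = - (a * (LINT x|lborel. (?i x * (G x \<bullet> e)) * \<psi> x) + b * (LINT x|lborel. (?i x * (G' x \<bullet> e)) * \<psi> x))"
      unfolding A by simp
    also have "\<dots> = - (LINT x|lborel. a * ((?i x * (G x \<bullet> e)) * \<psi> x) + b * ((?i x * (G' x \<bullet> e)) * \<psi> x))"
      using mul[OF Ge(1) c(1)] mul[OF Ge(2) c(1)] by simp
    also have "(LINT x|lborel. a * ((?i x * (G x \<bullet> e)) * \<psi> x) + b * ((?i x * (G' x \<bullet> e)) * \<psi> x)) = (LINT x:Omega l h|lborel. ((a *\<^sub>R G x + b *\<^sub>R G' x) \<bullet> e) * \<psi> x)"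
      unfolding set_lebesgue_integral_def
      by (intro Bochner_Integration.integral_cong refl) (simp add: inner_add_left algebra_simps)
    finally show ?thesis .
  qed
  then show ?thesis using L by (simp add: has_periodic_gradient_def)
qed

section \<open>Weights in time\<close>

lemma iterated_set_integral:
  fixes f :: "real \<Rightarrow> 'b::euclidean_space \<Rightarrow> real"
  assumes "integrable lborel (\<lambda>z. indicat_real (I \<times> S) z * f (fst z) (snd z))"
  shows "(LINT t:I|lborel. LINT x:S|lborel. f t x) = (LINT z|lborel. indicat_real (I \<times> S) z * f (fst z) (snd z))"
  unfolding lborel_pair_integral(1)[OF assms] set_lebesgue_integral_def
  by (intro Bochner_Integration.integral_cong refl) (simp add: indicator_times mult.assoc)

text \<open>The factor \<open>exp (- k arctan t)\<close> plays the role of the Gronwall factor \<open>exp (- B t)\<close>, but is bounded on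
  the whole line.\<close>

lemma decreasing_weight_exists:
  fixes g :: "real \<Rightarrow> real"
  assumes T: "0 < T" and B: "0 \<le> B" and g: "continuous_on UNIV g" "\<And>t. 0 \<le> g t" "\<And>t. g t \<le> 1"
    and \<eta>: "0 < \<eta>" "\<eta> < T" and g0: "\<And>t. t \<le> 0 \<Longrightarrow> g t = 0" and gT: "\<And>t. T - \<eta> \<le> t \<Longrightarrow> g t = 0"
  shows "\<exists>\<zeta> \<zeta>' Z Z'. (\<forall>t. (\<zeta> has_real_derivative \<zeta>' t) (at t)) \<and> continuous_on UNIV \<zeta>' \<and> (\<forall>t. 0 \<le> \<zeta> t) \<and> (\<forall>t. \<zeta> t \<le> Z) \<and>
    (\<forall>t. \<bar>\<zeta>' t\<bar> \<le> Z') \<and> (\<forall>t. T - \<eta> \<le> t \<longrightarrow> \<zeta> t = 0) \<and> \<zeta> 0 = (LINT t|lborel. g t) \<and> (\<forall>t\<ge>0. \<zeta> t \<le> \<zeta> 0) \<and>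
    (\<forall>t\<in>{0<..<T}. exp (- (B * (1 + T\<^sup>2) * (pi / 2))) * g t \<le> - \<zeta>' t - B * \<zeta> t)"
proof -
  obtain F where F: "\<And>t. (F has_real_derivative g t) (at t)" using continuous_primitive_exists[OF g(1)] by blast
  have Fmono: "F s \<le> F t" if "s \<le> t" for s t
    by (rule DERIV_nonneg_imp_nondecreasing[OF that]) (use F g(2) in blast)
  have F0: "F t = F 0" if "t \<le> 0" for t
  proof (rule antisym)
    show "F t \<le> F 0" by (rule Fmono[OF that])
    show "F 0 \<le> F t" by (rule DERIV_nonpos_imp_nonincreasing[OF that]) (use F g0 in \<open>metis order_refl\<close>)
  qed
  have FT: "F t = F T" if t: "T - \<eta> \<le> t" for t
  proof -
    have "F (T - \<eta>) = F s" if "T - \<eta> \<le> s" for s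
    proof (rule antisym)
      show "F (T - \<eta>) \<le> F s" by (rule Fmono[OF that])
      show "F s \<le> F (T - \<eta>)" by (rule DERIV_nonpos_imp_nonincreasing[OF that]) (use F gT in \<open>metis order_refl\<close>)
    qed
    from this[OF t] this[of T] \<eta> show ?thesis by simp
  qed
  \<comment> \<open>The integral of \<open>g\<close> from t to T: nonincreasing, with derivative -
    g, and 0 near T.\<close>
  define \<gamma> where "\<gamma> t = F T - F t" for t
  have gam0: "0 \<le> \<gamma> t" for t
    using Fmono[of t T] FT[of t] \<eta> by (cases "t \<le> T") (auto simp: \<gamma>_def)
  have gam1: "\<gamma> t \<le> \<gamma> 0" for t
    using Fmono[of 0 t] F0[of t] by (cases "0 \<le> t") (auto simp: \<gamma>_def)
  have gami: "\<gamma> 0 = (LINT t|lborel. g t)"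
  proof -
    have "(LINT t|lborel. g t * indicator {0..T} t) = F T - F 0"
      using T F g(1) by (intro integral_FTC_Icc_real) (auto simp: continuous_on_eq_continuous_at)
    moreover have "(LINT t|lborel. g t * indicator {0..T} t) = (LINT t|lborel. g t)"
    proof (intro Bochner_Integration.integral_cong refl)
      fix t show "g t * indicator {0..T} t = g t" using g0[of t] gT[of t] \<eta> by (cases "t \<in> {0..T}") auto
    qed
    ultimately show ?thesis by (simp add: \<gamma>_def)
  qed
  \<comment> \<open>The derivative 1 / (1 + t^2) of arctan is at least 1 / (1 + T^2) on (0, T), so
    with this \<open>k\<close> the logarithmic derivative of \<open>\<psi>\<close> is at most - B
    there; \<bar>arctan t\<bar> < pi / 2 gives the lower bound exp (- k pi / 2) of
    \<open>\<psi>\<close>.\<close>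
  define k where "k = B * (1 + T\<^sup>2)"
  have k0: "0 \<le> k" using B by (simp add: k_def)
  define \<psi> where "\<psi> t = exp (- (k * arctan t))" for t
  have psi: "0 < \<psi> t" "\<psi> t \<le> exp (k * (pi / 2))" "exp (- (k * (pi / 2))) \<le> \<psi> t" for t
  proof -
    have "k * arctan t \<le> k * (pi/2)" "k * (- (pi/2)) \<le> k * arctan t"
      using arctan_bounded[of t] by (auto intro!: mult_left_mono[OF _ k0] simp only: less_imp_le)
    then show "0 < \<psi> t" "\<psi> t \<le> exp (k * (pi / 2))" "exp (- (k * (pi / 2))) \<le> \<psi> t" by (auto simp: \<psi>_def)
  qed
  have psi1: "\<psi> t \<le> 1" if "0 \<le> t" for t using that k0 by (simp add: \<psi>_def)
  define \<zeta> where "\<zeta> t = \<psi> t * \<gamma> t" for t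
  define \<zeta>' where "\<zeta>' t = - (k / (1 + t\<^sup>2)) * \<psi> t * \<gamma> t - \<psi> t * g t" for t
  have pos: "0 < 1 + t\<^sup>2" for t :: real by (simp add: add_pos_nonneg)
  have dpsi: "(\<psi> has_real_derivative (- (k / (1 + t\<^sup>2)) * \<psi> t)) (at t)" for t
  proof -
    have "((\<lambda>t. - (k * arctan t)) has_real_derivative - (k * inverse (1 + t\<^sup>2))) (at t)"
      by (intro DERIV_minus DERIV_cmult DERIV_arctan)
    from DERIV_chain2[OF DERIV_exp this] show ?thesis
      unfolding \<psi>_def[abs_def] by (rule DERIV_cong) (simp add: divide_inverse)
  qed
  have dgam: "(\<gamma> has_real_derivative (- g t)) (at t)" for t
    unfolding \<gamma>_def[abs_def] using DERIV_diff[OF DERIV_const F[of t], of "F T"] by simp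
  have dz: "(\<zeta> has_real_derivative \<zeta>' t) (at t)" for t
    unfolding \<zeta>_def[abs_def] by (rule DERIV_cong[OF DERIV_mult[OF dpsi dgam]]) (simp add: \<zeta>'_def)
  have cont: "continuous_on UNIV \<psi>" "continuous_on UNIV \<gamma>"
    using dpsi dgam by (auto intro!: continuous_at_imp_continuous_on DERIV_isCont)
  have cz: "continuous_on UNIV \<zeta>'"
    unfolding \<zeta>'_def by (intro continuous_intros cont g(1)) (use pos in \<open>auto simp: less_imp_neq[THEN not_sym]\<close>)
  let ?P = "exp (k * (pi / 2))"
  have z0: "0 \<le> \<zeta> t" for t using psi(1)[of t] gam0[of t] by (simp add: \<zeta>_def)
  have zZ: "\<zeta> t \<le> ?P * \<gamma> 0" for t
    unfolding \<zeta>_def using psi[of t] gam0[of t] gam1[of t] by (intro mult_mono) auto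
  have zZ': "\<bar>\<zeta>' t\<bar> \<le> k * (?P * \<gamma> 0) + ?P" for t
  proof -
    have a: "0 \<le> k / (1 + t\<^sup>2)" "k / (1 + t\<^sup>2) \<le> k"
      using k0 pos[of t] mult_left_mono[of 1 "1 + t\<^sup>2" k] by (auto simp: divide_le_eq)
    have "k / (1 + t\<^sup>2) * \<zeta> t \<le> k * (?P * \<gamma> 0)" using a zZ[of t] z0[of t] k0 by (intro mult_mono) auto
    moreover have "\<psi> t * g t \<le> ?P * 1" using psi[of t] g(2,3)[of t] by (intro mult_mono) auto
    moreover have "0 \<le> k / (1 + t\<^sup>2) * \<zeta> t" "0 \<le> \<psi> t * g t" using a z0[of t] psi(1)[of t] g(2)[of t] by auto
    moreover have "\<zeta>' t = - (k / (1 + t\<^sup>2) * \<zeta> t) - \<psi> t * g t" by (simp add: \<zeta>'_def \<zeta>_def)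
    ultimately show ?thesis by linarith
  qed
  have zT: "\<zeta> t = 0" if "T - \<eta> \<le> t" for t using FT[OF that] by (simp add: \<zeta>_def \<gamma>_def)
  have zi: "\<zeta> 0 = (LINT t|lborel. g t)" using gami by (simp add: \<zeta>_def \<psi>_def)
  have zle: "\<zeta> t \<le> \<zeta> 0" if "0 \<le> t" for t
  proof -
    have "\<psi> t * \<gamma> t \<le> 1 * \<gamma> 0" using psi1[OF that] psi(1)[of t] gam0[of t] gam1[of t] by (intro mult_mono) auto
    then show ?thesis by (simp add: \<zeta>_def \<psi>_def)
  qed
  have main: "exp (- (B * (1 + T\<^sup>2) * (pi / 2))) * g t \<le> - \<zeta>' t - B * \<zeta> t" if t: "t \<in> {0<..<T}" for t
  proof -
    have "t\<^sup>2 \<le> T\<^sup>2" using t by (intro power_mono) auto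
    then have "B * (1 + t\<^sup>2) \<le> B * (1 + T\<^sup>2)" using B by (intro mult_left_mono) auto
    then have "B \<le> k / (1 + t\<^sup>2)" using pos[of t] by (simp add: k_def le_divide_eq)
    then have "B * \<zeta> t \<le> k / (1 + t\<^sup>2) * \<zeta> t" by (rule mult_right_mono[OF _ z0])
    moreover have "exp (- (k * (pi / 2))) * g t \<le> \<psi> t * g t" by (rule mult_right_mono[OF psi(3) g(2)])
    moreover have "\<zeta>' t = - (k / (1 + t\<^sup>2) * \<zeta> t) - \<psi> t * g t" by (simp add: \<zeta>'_def \<zeta>_def)
    ultimately show ?thesis unfolding k_def by linarith
  qed
  show ?thesis
    by (intro exI[of _ \<zeta>] exI[of _ \<zeta>'] exI[of _ "?P * \<gamma> 0"] exI[of _ "k * (?P * \<gamma> 0) + ?P"] conjI allI impI ballI dz cz z0 zZ zZ' zT zi zle main)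
qed

text \<open>The weights approach the indicator of the set \<open>A\<close> where \<open>E\<close>
  exceeds \<open>C\<close>. In the limit the hypothesis says that E - C has integral at most 0 over
  \<open>A\<close>, but it is positive there, so \<open>A\<close> is a null set.\<close>

lemma AE_le_of_weighted_integrals:
  fixes E :: "real \<Rightarrow> real"
  assumes T: "0 < T" and E: "integrable lborel E"
    and H: "\<And>g \<eta>. continuous_on UNIV g \<Longrightarrow> (\<And>t. 0 \<le> g t) \<Longrightarrow> (\<And>t. g t \<le> 1) \<Longrightarrow> 0 < \<eta> \<Longrightarrow> \<eta> < T \<Longrightarrow>
      (\<And>t. t \<le> 0 \<Longrightarrow> g t = 0) \<Longrightarrow> (\<And>t. T - \<eta> \<le> t \<Longrightarrow> g t = 0) \<Longrightarrow>
      (LINT t|lborel. g t * E t) \<le> C * (LINT t|lborel. g t)"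
  shows "AE t in lborel. t \<in> {0<..<T} \<longrightarrow> E t \<le> C"
proof -
  define A where "A = {t. 0 < t \<and> t < T \<and> C < E t}"
  have Em: "E \<in> borel_measurable borel" using borel_measurable_integrable[OF E] by simp
  then have A: "A \<in> sets borel" unfolding A_def by measurable
  \<comment> \<open>\<open>measurable_on\<close> supplies continuous functions that converge to the
    indicator outside a negligible set.\<close>
  have "indicat_real A measurable_on UNIV"
    by (rule lebesgue_measurable_imp_measurable_on) (use A in \<open>auto intro: measurable_completion\<close>)
  then obtain N g where N: "negligible N" and gc: "\<And>n. continuous_on UNIV (g n)"
    and gl: "\<And>x. x \<notin> N \<Longrightarrow> (\<lambda>n. g n x) \<longlonglongrightarrow> indicat_real A x"
    unfolding measurable_on_def by auto
  have AEN: "AE x in lborel. x \<notin> N"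
  proof -
    have "AE x in lebesgue. x \<notin> N" using N by (simp add: negligible_iff_null_sets AE_not_in)
    then show ?thesis by (simp add: AE_completion_iff)
  qed
  \<comment> \<open>Cut-offs at both ends: the second factor vanishes from T - 1/n on, which makes
    \<eta> = 1/n admissible for large n, and both factors tend to 1 inside (0, T).\<close>
  define \<kappa> where "\<kappa> n t = max 0 (min 1 (real n * t)) * max 0 (min 1 (real n * (T - t) - 1))" for n t
  define f where "f n t = max 0 (min 1 (g n t)) * \<kappa> n t" for n t
  have k01: "0 \<le> \<kappa> n t" "\<kappa> n t \<le> 1" for n t
    unfolding \<kappa>_def by (auto intro!: mult_nonneg_nonneg mult_le_one)
  have f01: "0 \<le> f n t" "f n t \<le> 1" for n t
    unfolding f_def using k01[of n t] by (auto intro!: mult_nonneg_nonneg mult_le_one)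
  have fc: "continuous_on UNIV (f n)" for n
    unfolding f_def[abs_def] \<kappa>_def by (intro continuous_intros gc)
  have f0: "f n t = 0" if "t \<le> 0" for n t
  proof -
    have "real n * t \<le> 0" using that by (simp add: mult_nonneg_nonpos)
    then show ?thesis by (simp add: f_def \<kappa>_def)
  qed
  have fT: "f n t = 0" if "T - 1 / real n \<le> t" "0 < n" for n t
  proof -
    have "real n * (T - t) \<le> 1" using that by (simp add: field_simps)
    then show ?thesis by (simp add: f_def \<kappa>_def)
  qed
  have fT': "f n t = 0" if "T \<le> t" for n t
  proof -
    have "real n * (T - t) \<le> 0" using that by (simp add: mult_nonneg_nonpos)
    then show ?thesis by (simp add: f_def \<kappa>_def)
  qed
  have k1: "(\<lambda>n. \<kappa> n t) \<longlonglongrightarrow> 1" if t: "0 < t" "t < T" for t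
  proof (rule tendsto_eventually)
    have "\<forall>\<^sub>F n in sequentially. 1 / t \<le> real n" "\<forall>\<^sub>F n in sequentially. 2 / (T - t) \<le> real n"
      by (rule filterlim_at_top[THEN iffD1, OF filterlim_real_sequentially, rule_format])+
    then show "\<forall>\<^sub>F n in sequentially. \<kappa> n t = 1"
    proof eventually_elim
      case (elim n)
      then have "1 \<le> real n * t" "2 \<le> real n * (T - t)" using t by (simp_all add: field_simps)
      then show ?case by (simp add: \<kappa>_def)
    qed
  qed
  have fl: "(\<lambda>n. f n t) \<longlonglongrightarrow> indicat_real A t" if "t \<notin> N" for t
  proof (cases "0 < t \<and> t < T")
    case True
    have "(\<lambda>n. max 0 (min 1 (g n t)) * \<kappa> n t) \<longlonglongrightarrow> max 0 (min 1 (indicat_real A t)) * 1"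
      using True by (intro tendsto_mult tendsto_max tendsto_min tendsto_const gl[OF that] k1) auto
    then show ?thesis by (simp add: f_def indicator_def)
  next
    case False
    then have "f n t = 0" for n using f0[of t n] fT'[of t n] by auto
    moreover have "t \<notin> A" using False by (auto simp: A_def)
    ultimately show ?thesis by simp
  qed
  have fm: "f n \<in> borel_measurable lborel" for n using borel_measurable_continuous_onI[OF fc[of n]] by simp
  have ii: "integrable lborel (indicat_real {0<..<T})" using indicator_box_integrable[of 0 T] by simp
  have fi: "f n t \<le> indicat_real {0<..<T} t" for n t using f01(2)[of n t] f0[of t n] fT'[of t n] by (auto simp: indicator_def)
  have l1: "(\<lambda>n. LINT t|lborel. f n t * E t) \<longlonglongrightarrow> (LINT t|lborel. indicat_real A t * E t)"
  proof (rule integral_dominated_convergence[where w="\<lambda>t. \<bar>E t\<bar>"])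
    show "AE t in lborel. (\<lambda>n. f n t * E t) \<longlonglongrightarrow> indicat_real A t * E t"
      using AEN by eventually_elim (intro tendsto_mult_right fl)
    show "AE t in lborel. norm (f n t * E t) \<le> \<bar>E t\<bar>" for n
      using f01[of n] by (auto simp: abs_mult mult_left_le_one_le)
    show "(\<lambda>t. f n t * E t) \<in> borel_measurable lborel" for n by (intro borel_measurable_times fm borel_measurable_integrable[OF E])
    show "(\<lambda>t. indicat_real A t * E t) \<in> borel_measurable lborel" using A Em by simp
  qed (use E in simp)
  have l2: "(\<lambda>n. LINT t|lborel. f n t) \<longlonglongrightarrow> (LINT t|lborel. indicat_real A t)"
  proof (rule integral_dominated_convergence[OF _ fm ii])
    show "AE t in lborel. (\<lambda>n. f n t) \<longlonglongrightarrow> indicat_real A t" using AEN by eventually_elim (rule fl)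
    show "AE t in lborel. norm (f n t) \<le> indicat_real {0<..<T} t" for n using f01[of n] fi[of n] by simp
    show "indicat_real A \<in> borel_measurable lborel" using A by simp
  qed
  have "(LINT t|lborel. indicat_real A t * E t) \<le> C * (LINT t|lborel. indicat_real A t)"
  proof (rule tendsto_le[OF sequentially_bot tendsto_mult_left[OF l2] l1])
    have "\<forall>\<^sub>F n in sequentially. 1 / T < real n"
      by (rule filterlim_at_top_dense[THEN iffD1, OF filterlim_real_sequentially, rule_format])
    then show "\<forall>\<^sub>F n in sequentially. (LINT t|lborel. f n t * E t) \<le> C * (LINT t|lborel. f n t)"
      using eventually_gt_at_top[of 0]
    proof eventually_elim
      case (elim n)
      then have "1 / real n < T" using T by (simp add: field_simps)
      then show ?case using elim f01 f0 fT by (intro H[OF fc, where \<eta>="1 / real n"]) auto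
    qed
  qed
  moreover have iA: "integrable lborel (indicat_real A)"
    by (rule Bochner_Integration.integrable_bound[OF ii]) (use A in \<open>auto simp: A_def indicator_def\<close>)
  moreover have iAE: "integrable lborel (\<lambda>t. indicat_real A t * E t)"
    using integrable_mult_indicator[OF _ E, of A] A by simp
  ultimately have le: "(LINT t|lborel. indicat_real A t * E t - C * indicat_real A t) \<le> 0" by simp
  have nn: "0 \<le> indicat_real A t * E t - C * indicat_real A t" for t by (auto simp: A_def indicator_def)
  have i3: "integrable lborel (\<lambda>t. indicat_real A t * E t - C * indicat_real A t)" using iA iAE by simp
  have "(LINT t|lborel. indicat_real A t * E t - C * indicat_real A t) = 0"
    using le integral_nonneg_AE[of "\<lambda>t. indicat_real A t * E t - C * indicat_real A t" lborel] nn by (intro antisym) auto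
  then have "AE t in lborel. indicat_real A t * E t - C * indicat_real A t = 0"
    using integral_nonneg_eq_0_iff_AE[OF i3] nn by simp
  then show ?thesis by eventually_elim (auto simp: A_def indicator_def split: if_splits)
qed

section \<open>The energy estimate\<close>

lemma has_periodic_gradient_cong_gradient:
  assumes "has_periodic_gradient l h g G" "\<And>x. x \<in> Omega l h \<Longrightarrow> G x = G' x"
  shows "has_periodic_gradient l h g G'"
proof -
  have e: "indicat_real (Omega l h) x *\<^sub>R G x = indicat_real (Omega l h) x *\<^sub>R G' x" for x
    using assms(2)[of x] by (auto simp: indicator_def)
  have L: "L2_on (Omega l h) G'"
    using assms(1) unfolding has_periodic_gradient_def L2_on_iff[OF Omega_props(1)] e by blast
  have "(LINT x:Omega l h|lborel. (G x \<bullet> b) * \<psi> x) = (LINT x:Omega l h|lborel. (G' x \<bullet> b) * \<psi> x)" for \<psi> b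
    by (rule set_lebesgue_integral_cong) (use assms(2) Omega_props(1) in auto)
  then show ?thesis using assms(1) L by (simp add: has_periodic_gradient_def)
qed

lemma has_periodic_gradient_zero:
  assumes "has_periodic_gradient l h g G"
  shows "has_periodic_gradient l h (\<lambda>x. 0) (\<lambda>x. 0)"
  using has_periodic_gradient_lincomb[OF assms assms, of 0 0] by simp

text \<open>The situation for one fixed \<epsilon>; \<open>m\<close> and \<open>a\<close> are the
  coefficients cut off outside the space-time cylinder. The upper bounds \<open>Mm\<close> and
  \<open>Ma\<close>, which depend on \<epsilon>, enter integrability and passages to the limit; the
  final constants are built from \<open>T\<close>, \<open>\<rho>L\<close>, \<open>DL\<close>,
  \<open>K\<close> and the data.\<close>

locale wave_solution =
  fixes l h T \<epsilon> \<rho>L DL K Mm Ma :: real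
    and cm ca :: "real \<Rightarrow> real \<times> real \<Rightarrow> real" and m a :: "real \<times> real \<times> real \<Rightarrow> real"
    and v1 v2 :: "real \<times> real \<Rightarrow> real" and fL :: "real \<times> real \<times> real \<Rightarrow> real"
    and u ut :: "real \<Rightarrow> real \<times> real \<Rightarrow> real" and Gu :: "real \<Rightarrow> real \<times> real \<Rightarrow> real \<times> real"
  assumes l: "0 < l" and h: "0 < h" and T: "0 < T" and \<epsilon>: "0 < \<epsilon>" and \<rho>L: "0 < \<rho>L" and DL: "0 < DL" and K0: "0 \<le> K"
    and m_def: "\<And>z. m z = indicat_real ({0<..<T} \<times> Omega l h) z * cm (fst z) (snd z)"
    and a_def: "\<And>z. a z = indicat_real ({0<..<T} \<times> Omega l h) z * ca (fst z) (snd z)"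
    and mm: "m \<in> borel_measurable lborel" and am: "a \<in> borel_measurable lborel"
    and m0: "\<And>z. 0 \<le> m z" "\<And>z. m z \<le> Mm" and a0: "\<And>z. 0 \<le> a z" "\<And>z. a z \<le> Ma"
    and mL: "\<And>s t x. 0 < t \<Longrightarrow> 0 < s \<Longrightarrow> t + s < T \<Longrightarrow> \<bar>m (t + s, x) - m (t, x)\<bar> \<le> K * s * m (t, x)"
    and aL: "\<And>s t x. 0 < t \<Longrightarrow> 0 < s \<Longrightarrow> t + s < T \<Longrightarrow> \<bar>a (t + s, x) - a (t, x)\<bar> \<le> K * s * a (t, x)"
    and m_left: "\<And>t x. t \<in> {0<..<T} \<Longrightarrow> x \<in> Omega_L l h \<epsilon> \<Longrightarrow> m (t, x) = \<rho>L"
    and a_left: "\<And>t x. t \<in> {0<..<T} \<Longrightarrow> x \<in> Omega_L l h \<epsilon> \<Longrightarrow> a (t, x) = DL"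
    and v1: "Ck_compact 2 (Omega l h) v1" and v1s: "supp v1 \<subseteq> Omega_L l h \<epsilon>"
    and v2: "Ck_compact 1 (Omega l h) v2" and v2s: "supp v2 \<subseteq> Omega_L l h \<epsilon>"
    and fL: "Ck_compact 0 ({0<..<T} \<times> Omega l h) fL" and fLs: "supp fL \<subseteq> {0<..<T} \<times> Omega_L l h \<epsilon>"
    and uH1: "L2_H1_periodic l h T u Gu" and ut: "has_time_derivative T (Omega l h) u ut"
    and u0: "has_time_trace T (Omega l h) u 0 v1"
    and weak: "\<And>\<phi> \<phi>t G\<phi> \<phi>0. L2_H1_periodic l h T \<phi> G\<phi> \<Longrightarrow> has_time_derivative T (Omega l h) \<phi> \<phi>t \<Longrightarrow>
        has_time_trace T (Omega l h) \<phi> T (\<lambda>x. 0) \<Longrightarrow> has_time_trace T (Omega l h) \<phi> 0 \<phi>0 \<Longrightarrow>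
        - (LINT t:{0<..<T}|lborel. LINT x:Omega l h|lborel. cm t x * ut t x * \<phi>t t x)
        + (LINT t:{0<..<T}|lborel. LINT x:Omega l h|lborel. ca t x * (Gu t x \<bullet> G\<phi> t x))
        = (LINT t:{0<..<T}|lborel. LINT x:Omega l h|lborel. fL (t, x) * \<phi> t x)
        + (LINT x:Omega l h|lborel. \<rho>L * v2 x * \<phi>0 x)"
begin

abbreviation "Q \<equiv> {0<..<T} \<times> Omega l h"
definition "pd b f x = frechet_derivative f (at x) b" for f :: "real \<times> real \<Rightarrow> real" and b
abbreviation "e1 \<equiv> (1, 0) :: real \<times> real"
abbreviation "e2 \<equiv> (0, 1) :: real \<times> real"
definition "w z = indicat_real Q z * ut (fst z) (snd z)"

text \<open>The solution is continued to negative times by \<open>v1 + t v2\<close>; \<open>W\<close> and \<open>Gr\<close> are the continued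
  time derivative and the components of the continued gradient.\<close>

definition "past z = indicat_real {-T<..0} (fst z)" for z :: "real \<times> real \<times> real"
definition "W z = w z + past z * v2 (snd z)"
definition "Gr b z = indicat_real Q z * (Gu (fst z) (snd z) \<bullet> b) + past z * (pd b v1 (snd z) + fst z * pd b v2 (snd z))"
text \<open>The continued solution. At positive times it is defined through the primitive of
  \<open>w\<close> instead of \<open>u\<close>, which fixes its value at every time and makes its
  difference quotients exact averages of \<open>W\<close>.\<close>

definition "V s x = v1 x + (if 0 < s then primitive0 w (s, x) else s * v2 x)"

section \<open>Regularity of the data and of the continuation\<close>

lemma basis [simp]: "e1 \<in> Basis" "e2 \<in> Basis"
  by (auto simp: Basis_real2)

lemma Q_props: "Q \<in> sets borel" "bounded Q" "open Q"
proof -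
  have Qb: "Q = box (0, (-l, 0)) (T, (l, h))" by (simp add: Omega_props(4) box_Pair)
  show "Q \<in> sets borel" "bounded Q" "open Q" unfolding Qb by auto
qed

lemmas O = Omega_props[of l h]

lemma v1C1: "Ck_compact 1 (Omega l h) v1"
  using v1 Ck_le[of 2 "Omega l h" v1 1] by (simp add: Ck_compact_def)

lemma pd_props:
  assumes "Ck_compact (Suc k) (Omega l h) f" "b \<in> Basis"
  shows "Ck_compact k (Omega l h) (pd b f)"
  using Ck_compact_SucD[OF assms] unfolding pd_def[abs_def] .

lemma pd_v: "b \<in> Basis \<Longrightarrow> Ck_compact 1 (Omega l h) (pd b v1)" "b \<in> Basis \<Longrightarrow> Ck_compact 0 (Omega l h) (pd b v2)"
  using pd_props[of 1 v1 b] pd_props[of 0 v2 b] v1 v2 by (simp_all add: numeral_2_eq_2)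

lemma pd2_v1: "b \<in> Basis \<Longrightarrow> Ck_compact 0 (Omega l h) (pd b (pd b v1))"
  using pd_props[of 0 "pd b v1" b] pd_v(1) by simp

lemma pd_outside: "x \<notin> supp f \<Longrightarrow> pd b f x = 0"
  unfolding pd_def by (rule frechet_derivative_outside_supp)

lemma compact_C: "Ck_compact k (Omega l h) f \<Longrightarrow> square_integrable f \<and> f \<in> borel_measurable borel \<and> integrable lborel f \<and> (\<exists>B\<ge>0. \<forall>x. \<bar>f x\<bar> \<le> B) \<and> (\<forall>x. x \<notin> Omega l h \<longrightarrow> f x = 0)"
  using Ck_compact_UNIV_props[of k "Omega l h" f] O(2) square_integrable_continuous_compact_supp[of f] continuous_compact_supp_bound[of f]
    continuous_compact_supp_integrable[of f] borel_measurable_continuous_onI[of f] by blast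

lemma past_measurable: "past \<in> borel_measurable lborel"
  unfolding past_def[abs_def] by (rule borel_measurable_indicator_fst) simp

lemma square_integrable_past:
  assumes "square_integrable f"
  shows "square_integrable (\<lambda>z. past z * f (snd z))" "square_integrable (\<lambda>z. past z * (fst z * f (snd z)))"
proof -
  have fm: "(\<lambda>z :: real \<times> real \<times> real. f (snd z)) \<in> borel_measurable lborel"
    using measurable_compose[OF borel_measurable_fst_snd(2), of f borel] square_integrableD(2)[OF assms] by simp
  have ii: "integrable lborel (indicat_real {-T<..0})" using emeasure_bounded_finite[of "{-T<..0}"]
    by (auto simp: integrable_indicator_iff intro: bounded_subset[OF bounded_closed_interval[of "-T" 0]])
  have "integrable lborel (\<lambda>z. indicat_real {-T<..0} (fst z) * (f (snd z))\<^sup>2)"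
    by (rule integrable_product[OF ii square_integrableD(3)[OF assms]])
  moreover have "(past z * f (snd z))\<^sup>2 = indicat_real {-T<..0} (fst z) * (f (snd z))\<^sup>2" for z
    by (simp add: past_def indicator_def)
  ultimately show s: "square_integrable (\<lambda>z. past z * f (snd z))"
    unfolding square_integrable_def using borel_measurable_times[OF past_measurable fm] by simp
  show "square_integrable (\<lambda>z. past z * (fst z * f (snd z)))"
  proof (rule square_integrable_bound[OF square_integrable_cmult[OF s, of T]])
    show "(\<lambda>z. past z * (fst z * f (snd z))) \<in> borel_measurable lborel"
      by (intro borel_measurable_times past_measurable borel_measurable_fst_snd(1) fm)
    show "\<bar>past z * (fst z * f (snd z))\<bar> \<le> \<bar>T * (past z * f (snd z))\<bar>" for z
    proof -
      have "\<bar>past z\<bar> * (\<bar>fst z\<bar> * \<bar>f (snd z)\<bar>) \<le> \<bar>past z\<bar> * (T * \<bar>f (snd z)\<bar>)"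
      proof (cases "past z = 0")
        case False
        then have "\<bar>fst z\<bar> \<le> T" by (auto simp: past_def indicator_def split: if_splits)
        then show ?thesis by (intro mult_left_mono mult_right_mono) auto
      qed simp
      then show ?thesis using T by (simp add: abs_mult mult.left_commute)
    qed
  qed
qed

lemma w_L2: "square_integrable w"
  using ut L2_on_real_iff[OF Q_props(1)] unfolding w_def[abs_def] by (simp add: has_time_derivative_def L2_L2_def case_prod_beta')

lemma Gu_L2: "b \<in> Basis \<Longrightarrow> square_integrable (\<lambda>z. indicat_real Q z * (Gu (fst z) (snd z) \<bullet> b))"
  using uH1 L2_on_pair_iff[OF Q_props(1)] by (auto simp: L2_H1_periodic_def L2_L2_def case_prod_beta' Basis_real2 inner_prod_def)

lemma W_L2: "square_integrable W"
  unfolding W_def[abs_def] using square_integrable_add[OF w_L2 square_integrable_past(1)[of v2]] compact_C[OF v2] by blast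

lemma Gr_L2: "b \<in> Basis \<Longrightarrow> square_integrable (Gr b)"
  unfolding Gr_def[abs_def] distrib_left
  using compact_C[OF pd_v(1)[of b]] compact_C[OF pd_v(2)[of b]]
  by (intro square_integrable_add Gu_L2 square_integrable_past) auto

lemma W_outside: "x \<notin> Omega l h \<Longrightarrow> W (t, x) = 0"
  using Ck_compact_UNIV_props(5)[OF v2 O(2), of x] by (simp add: W_def w_def)

lemma w_outside: "z \<notin> Q \<Longrightarrow> w z = 0"
  by (simp add: w_def)

lemma W_on_Q: "z \<in> Q \<Longrightarrow> W z = ut (fst z) (snd z)" "z \<in> Q \<Longrightarrow> Gr b z = Gu (fst z) (snd z) \<bullet> b"
  by (auto simp: W_def w_def Gr_def past_def)

lemma W_past: "-T < t \<Longrightarrow> t \<le> 0 \<Longrightarrow> W (t, x) = v2 x" "-T < t \<Longrightarrow> t \<le> 0 \<Longrightarrow> Gr b (t, x) = pd b v1 x + t * pd b v2 x"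
  by (auto simp: W_def w_def Gr_def past_def)

lemma bounded_time_integrable:
  assumes "square_integrable f" "\<And>t x. x \<notin> Omega l h \<Longrightarrow> f (t, x) = 0" "\<And>t x. t \<notin> {-T<..<T} \<Longrightarrow> f (t, x) = 0"
  shows "integrable lborel (f :: real \<times> real \<times> real \<Rightarrow> real)"
proof -
  let ?S = "{-T<..<T} \<times> Omega l h"
  have Sb: "?S = box (-T, (-l, 0)) (T, (l, h))" by (simp add: O(4) box_Pair)
  have S: "?S \<in> sets borel" "bounded ?S" unfolding Sb by auto
  have e: "indicat_real ?S z * f z = f z" for z
    using assms(2)[of "snd z" "fst z"] assms(3)[of "fst z" "snd z"] by (auto simp: indicator_def mem_Times_iff)
  show ?thesis using integrable_of_square_integrable_bounded[of ?S f] S assms(1) unfolding e by blast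
qed

lemma W_integrable: "integrable lborel W"
proof (rule bounded_time_integrable[OF W_L2 W_outside])
  show "W (t, x) = 0" if "t \<notin> {-T<..<T}" for t x using that T by (auto simp: W_def w_def past_def indicator_def)
qed

text \<open>Read off from the time trace of the test function with the constant weight 1.\<close>

lemma time_slice_L2: "s \<in> {0..T} \<Longrightarrow> square_integrable (\<lambda>x. indicat_real (Omega l h) x * (v1 x + primitive0 w (s, x)))"
proof -
  assume s: "s \<in> {0..T}"
  have v1p: "square_integrable v1" "\<And>x. x \<notin> Omega l h \<Longrightarrow> v1 x = 0" using compact_C[OF v1] by auto
  have "has_time_trace T (Omega l h) (\<lambda>t x. 1 * (v1 x + primitive0 w (t, x))) s ((\<lambda>t x. 1 * (v1 x + primitive0 w (t, x))) s)"
    by (rule test_function_in_time(3)[OF T v1p w_L2 w_outside, where \<zeta>="\<lambda>t. 1" and \<zeta>'="\<lambda>t. 0" and Z=1 and Z'=0]) (use s in auto)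
  then show ?thesis using L2_on_real_iff[OF O(1)] by (simp add: has_time_trace_def)
qed

text \<open>At almost every positive time \<open>V s\<close> agrees with \<open>u s\<close> almost
  everywhere and inherits the gradient \<open>Gu s\<close>; at nonpositive times it is an explicit
  C1 function with compact support.\<close>

lemma V_gradient: "AE s in lborel. s \<in> {-T<..<T} \<longrightarrow> has_periodic_gradient l h (V s) (\<lambda>x. (Gr e1 (s, x), Gr e2 (s, x)))"
proof -
  have uV: "AE z in lborel. z \<in> Q \<longrightarrow> u (fst z) (snd z) = v1 (snd z) + primitive0 w z"
    using has_time_derivative_primitive[OF T _ ut u0] uH1 unfolding w_def[abs_def] by (simp add: L2_H1_periodic_def)
  have gu: "AE t in lborel. t \<in> {0<..<T} \<longrightarrow> has_periodic_gradient l h (u t) (Gu t)"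
    using uH1 by (simp add: L2_H1_periodic_def)
  show ?thesis
    using AE_lborel_pair(1)[OF uV] gu
  proof eventually_elim
    case (elim s)
    show ?case
    proof
      assume s: "s \<in> {-T<..<T}"
      show "has_periodic_gradient l h (V s) (\<lambda>x. (Gr e1 (s, x), Gr e2 (s, x)))"
      proof (cases "0 < s")
        case True
        have "has_periodic_gradient l h (V s) (Gu s)"
        proof (rule has_periodic_gradient_cong_AE)
          show "has_periodic_gradient l h (u s) (Gu s)" using elim(2) s True by simp
          show "square_integrable (\<lambda>x. indicat_real (Omega l h) x * V s x)"
            using time_slice_L2[of s] s True by (simp add: V_def)
          show "AE x in lborel. x \<in> Omega l h \<longrightarrow> u s x = V s x"
            using elim(1) by eventually_elim (use s True in \<open>auto simp: V_def\<close>)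
        qed
        then show ?thesis
          by (rule has_periodic_gradient_cong_gradient) (use s True in \<open>auto simp: W_on_Q prod_eq_iff inner_prod_def\<close>)
      next
        case False
        have "has_periodic_gradient l h (\<lambda>x. 1 * v1 x + s * v2 x) (\<lambda>x. 1 *\<^sub>R grad2 v1 x + s *\<^sub>R grad2 v2 x)"
          by (rule has_periodic_gradient_lincomb[OF has_periodic_gradient_Ck_compact[OF v1C1] has_periodic_gradient_Ck_compact[OF v2]])
        moreover have "(\<lambda>x. 1 * v1 x + s * v2 x) = V s" using False by (auto simp: V_def)
        ultimately have "has_periodic_gradient l h (V s) (\<lambda>x. 1 *\<^sub>R grad2 v1 x + s *\<^sub>R grad2 v2 x)" by simp
        then show ?thesis
          by (rule has_periodic_gradient_cong_gradient) (use s False in \<open>auto simp: W_past grad2_def pd_def\<close>)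
      qed
    qed
  qed
qed

text \<open>\<open>test_initial\<close> is the average of \<open>W\<close> around time 0 and
  \<open>test_slope\<close> the slope of the moving average. This splitting puts the test function
  into the form that \<open>test_function_in_time\<close> accepts.\<close>

definition "test_initial d x = 1 / (2 * d) * (LINT s|lborel. indicat_real {-d<..<d} s * W (s, x))" for d
definition "test_slope d z = indicat_real Q z * ((W (z + (d, 0)) - W (z - (d, 0))) / (2 * d))"

lemma square_integrable_shift: "square_integrable f \<Longrightarrow> square_integrable (\<lambda>z. f (z - c))"
  using square_integrable_translate[of f "- c"] by simp

lemma test_slope_L2: "square_integrable (test_slope d)"
proof -
  have "square_integrable (\<lambda>z. (1 / (2 * d)) * (W (z + (d, 0)) - W (z - (d, 0))))"
    by (intro square_integrable_cmult square_integrable_diff square_integrable_translate square_integrable_shift W_L2)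
  then have "square_integrable (\<lambda>z. indicat_real Q z * ((1 / (2 * d)) * (W (z + (d, 0)) - W (z - (d, 0)))))"
    by (rule square_integrable_bounded_mult[where B=1]) (use Q_props(1) in auto)
  then show ?thesis unfolding test_slope_def[abs_def] by simp
qed

text \<open>The square of a mean is at most the mean of the square, by Cauchy-Schwarz on (-d, d), so
  the average inherits integrability from \<open>W\<close>.\<close>

lemma test_initial_props:
  assumes d: "0 < d"
  shows "square_integrable (test_initial d)" "\<And>x. x \<notin> Omega l h \<Longrightarrow> test_initial d x = 0"
proof -
  have i: "integrable lborel (\<lambda>z. indicat_real {-d<..<d} (fst z) * W z)"
    by (rule integrable_bounded_mult[OF W_integrable borel_measurable_indicator_fst, where B=1]) auto
  have mq: "test_initial d \<in> borel_measurable lborel"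
    unfolding test_initial_def[abs_def]
    using borel_measurable_integrable[OF lborel_pair_integral(6)[OF i]] by simp
  have ind: "integrable lborel (indicat_real {-d<..<d})" using indicator_box_integrable[of "-d" d] by simp
  have ind2: "square_integrable (indicat_real {-d<..<d})" by (rule square_integrable_bounded_supp[OF ind, of 1]) simp
  have iW: "integrable lborel (\<lambda>x. 1 / (2 * d) * (LINT s|lborel. (W (s, x))\<^sup>2))"
    using lborel_pair_integral(6)[OF square_integrableD(3)[OF W_L2]] by simp
  have "integrable lborel (\<lambda>x. (test_initial d x)\<^sup>2)"
  proof (rule Bochner_Integration.integrable_bound[OF iW borel_measurable_power[OF mq]])
    show "AE x in lborel. norm ((test_initial d x)\<^sup>2) \<le> norm (1 / (2 * d) * (LINT s|lborel. (W (s, x))\<^sup>2))"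
      using square_integrable_slices[OF W_L2]
    proof eventually_elim
      case (elim x)
      have "\<bar>LINT s|lborel. indicat_real {-d<..<d} s * W (s, x)\<bar>\<^sup>2 \<le> (LINT s|lborel. \<bar>indicat_real {-d<..<d} s * W (s, x)\<bar>)\<^sup>2"
        by (intro power_mono integral_abs_bound) simp
      also have "\<dots> \<le> (LINT s|lborel. (indicat_real {-d<..<d} s)\<^sup>2) * (LINT s|lborel. (W (s, x))\<^sup>2)"
        by (rule Cauchy_Schwarz_integral[OF ind2 elim])
      also have "(LINT s|lborel. (indicat_real {-d<..<d} s)\<^sup>2) = (LINT s|lborel. indicat_real {-d<..<d} s)"
        by (intro Bochner_Integration.integral_cong refl) (simp add: indicator_def)
      also have "\<dots> = 2 * d" using d by simp
      finally have "(LINT s|lborel. indicat_real {-d<..<d} s * W (s, x))\<^sup>2 \<le> 2 * d * (LINT s|lborel. (W (s, x))\<^sup>2)" by simp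
      then have "(1 / (2 * d))\<^sup>2 * (LINT s|lborel. indicat_real {-d<..<d} s * W (s, x))\<^sup>2 \<le> (1 / (2 * d))\<^sup>2 * (2 * d * (LINT s|lborel. (W (s, x))\<^sup>2))"
        by (rule mult_left_mono) simp
      also have "\<dots> = 1 / (2 * d) * (LINT s|lborel. (W (s, x))\<^sup>2)" using d by (simp add: power2_eq_square)
      finally have "(test_initial d x)\<^sup>2 \<le> 1 / (2 * d) * (LINT s|lborel. (W (s, x))\<^sup>2)"
        unfolding test_initial_def power_mult_distrib .
      moreover have "0 \<le> 1 / (2 * d) * (LINT s|lborel. (W (s, x))\<^sup>2)" using d by simp
      ultimately show ?case using d by simp
    qed
  qed
  then show "square_integrable (test_initial d)" using mq by (simp add: square_integrable_def)
  show "\<And>x. x \<notin> Omega l h \<Longrightarrow> test_initial d x = 0" by (simp add: test_initial_def W_outside)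
qed

lemma test_value:
  assumes d: "0 < d"
  shows "AE x in lborel. \<forall>t\<in>{0..T}. x \<in> Omega l h \<longrightarrow> test_initial d x + primitive0 (test_slope d) (t, x) = time_average d W (t, x)"
  using square_integrable_slices[OF W_L2]
proof eventually_elim
  case (elim x)
  show ?case
  proof (intro ballI impI)
    fix t assume t: "t \<in> {0..T}" and x: "x \<in> Omega l h"
    have "time_average d W (t, x) = time_average d W (0, x) + primitive0 (test_slope d) (t, x)"
      by (rule time_average_primitive[OF elim d, of t T]) (use t x in \<open>auto simp: test_slope_def\<close>)
    then show "test_initial d x + primitive0 (test_slope d) (t, x) = time_average d W (t, x)"
      by (simp add: test_initial_def time_average_def)
  qed
qed

text \<open>Links two descriptions of the test function: as an average of \<open>W\<close> it has
  time traces and a time derivative, as a difference quotient of \<open>V\<close> it has a spatial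
  gradient. If t - d is not positive, the averaging interval meets the past and collects
  \<open>v2\<close> as well as \<open>w\<close>.\<close>

lemma time_average_V:
  assumes d: "0 < d" "d < T"
  shows "AE x in lborel. \<forall>t. 0 < t \<longrightarrow> t + d < T \<longrightarrow> time_average d W (t, x) = 1 / (2 * d) * V (t + d) x - 1 / (2 * d) * V (t - d) x"
  using square_integrable_slices[OF W_L2] square_integrable_slices[OF w_L2]
proof eventually_elim
  case (elim x)
  show ?case
  proof (intro allI impI)
    fix t assume t: "0 < t" "t + d < T"
    let ?I = "\<lambda>f a b. LINT s|lborel. indicat_real {a<..<b} s * f (s, x)"
    have i: "integrable lborel (\<lambda>s. indicat_real {a<..<b} s * W (s, x))" for a b
      by (rule integrable_on_bounded_interval[OF elim(1)])
    have iw: "integrable lborel (\<lambda>s. indicat_real {a<..<b} s * w (s, x))" for a b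
      by (rule integrable_on_bounded_interval[OF elim(2)])
    have pw: "primitive0 w (s, x) = ?I w 0 s" for s by (simp add: primitive0_def)
    have Ww: "?I W a b = ?I w a b" if "0 \<le> a" for a b
      by (intro Bochner_Integration.integral_cong refl) (use that in \<open>auto simp: W_def past_def indicator_def\<close>)
    have ta: "time_average d W (t, x) = 1 / (2 * d) * ?I W (t - d) (t + d)"
    proof -
      have e: "(\<lambda>s. indicat_real {-d<..<d} s * W (t + s, x)) = (\<lambda>s. indicat_real {t - d<..<t + d} (s + t) * W (s + t, x))"
        by (auto simp: indicator_def fun_eq_iff add.commute)
      have "(LINT s|lborel. indicat_real {-d<..<d} s * W (t + s, x)) = ?I W (t - d) (t + d)"
        unfolding e by (rule integral_translate[OF borel_measurable_integrable[OF i]])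
      then show ?thesis by (simp add: time_average_def)
    qed
    have "?I W (t - d) (t + d) = V (t + d) x - V (t - d) x"
    proof (cases "0 < t - d")
      case True
      have "?I w (t - d) (t + d) + ?I w 0 (t - d) = (LINT s|lborel. indicat_real {t - d<..<t + d} s * w (s, x) + indicat_real {0<..<t - d} s * w (s, x))"
        using iw by simp
      also have "\<dots> = ?I w 0 (t + d)"
      proof (rule integral_cong_AE)
        show "AE s in lborel. indicat_real {t - d<..<t + d} s * w (s, x) + indicat_real {0<..<t - d} s * w (s, x) = indicat_real {0<..<t + d} s * w (s, x)"
          using AE_lborel_singleton[of "t - d"] by eventually_elim (use True d in \<open>auto simp: indicator_def\<close>)
        show "(\<lambda>s. indicat_real {t - d<..<t + d} s * w (s, x) + indicat_real {0<..<t - d} s * w (s, x)) \<in> borel_measurable lborel"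
          by (intro borel_measurable_add borel_measurable_integrable[OF iw])
        show "(\<lambda>s. indicat_real {0<..<t + d} s * w (s, x)) \<in> borel_measurable lborel" by (rule borel_measurable_integrable[OF iw])
      qed
      finally show ?thesis using True t d by (simp add: Ww V_def pw)
    next
      case False
      have "?I W (t - d) (t + d) = (LINT s|lborel. indicat_real {t - d<..<0} s * v2 x + indicat_real {0<..<t + d} s * w (s, x))"
      proof (rule integral_cong_AE)
        show "AE s in lborel. indicat_real {t - d<..<t + d} s * W (s, x) = indicat_real {t - d<..<0} s * v2 x + indicat_real {0<..<t + d} s * w (s, x)"
          using AE_lborel_singleton[of 0]
        proof eventually_elim
          case (elim s)
          then show ?case
            using False t d W_past(1)[of s x] by (cases "s < 0") (auto simp: indicator_def W_def past_def)
        qed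
        show "(\<lambda>s. indicat_real {t - d<..<t + d} s * W (s, x)) \<in> borel_measurable lborel" by (rule borel_measurable_integrable[OF i])
        show "(\<lambda>s. indicat_real {t - d<..<0} s * v2 x + indicat_real {0<..<t + d} s * w (s, x)) \<in> borel_measurable lborel"
          by (intro borel_measurable_add borel_measurable_integrable[OF iw]) simp
      qed
      also have "\<dots> = (LINT s|lborel. indicat_real {t - d<..<0} s * v2 x) + ?I w 0 (t + d)"
      proof (rule Bochner_Integration.integral_add[OF _ iw])
        show "integrable lborel (\<lambda>s. indicat_real {t - d<..<0} s * v2 x)"
          using indicator_box_integrable[of "t - d" 0] by simp
      qed
      also have "(LINT s|lborel. indicat_real {t - d<..<0} s * v2 x) = - (t - d) * v2 x"
        using False by simp
      finally show ?thesis using False t d by (simp add: V_def pw algebra_simps)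
    qed
    then show "time_average d W (t, x) = 1 / (2 * d) * V (t + d) x - 1 / (2 * d) * V (t - d) x"
      unfolding ta by (simp add: right_diff_distrib)
  qed
qed

section \<open>The weak formulation tested with the averaged velocity\<close>

definition "centred f k \<zeta> d = 1 / (2 * d) * (LINT z|lborel. \<zeta> (fst z) * k z * (f z * (f (z + (d, 0)) - f (z - (d, 0)))))"
  for f k :: "real \<times> real \<times> real \<Rightarrow> real" and \<zeta> :: "real \<Rightarrow> real" and d :: real

lemma measurable_of_time:
  "continuous_on UNIV k \<Longrightarrow> (\<lambda>z :: real \<times> real \<times> real. k (fst z)) \<in> borel_measurable lborel" for k :: "real \<Rightarrow> real"
  by (rule measurable_compose[OF borel_measurable_fst_snd(1) borel_measurable_continuous_onI])

lemma measurable_of_space: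
  "k \<in> borel_measurable borel \<Longrightarrow> (\<lambda>z :: real \<times> real \<times> real. k (snd z)) \<in> borel_measurable lborel" for k :: "real \<times> real \<Rightarrow> real"
  by (rule measurable_compose[OF borel_measurable_fst_snd(2)])

lemma fL_props: "square_integrable fL" "fL \<in> borel_measurable lborel" "integrable lborel fL" "\<And>z. z \<notin> Q \<Longrightarrow> fL z = 0"
proof -
  note p = Ck_compact_UNIV_props[OF fL Q_props(3)]
  show "square_integrable fL" by (rule square_integrable_continuous_compact_supp[OF p(4,2)])
  show "integrable lborel fL" by (rule continuous_compact_supp_integrable[OF p(4,2)])
  then show "fL \<in> borel_measurable lborel" by (rule borel_measurable_integrable)
  show "\<And>z. z \<notin> Q \<Longrightarrow> fL z = 0" by (rule p(5))
qed

lemma m_outside: "z \<notin> Q \<Longrightarrow> m z = 0" "z \<notin> Q \<Longrightarrow> a z = 0"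
  by (simp_all add: m_def a_def)

lemma m_abs: "\<bar>m z\<bar> \<le> Mm" "\<bar>a z\<bar> \<le> Ma"
  using m0[of z] a0[of z] by auto

text \<open>The test function is \<open>\<zeta>\<close> times the average of \<open>W\<close>. The
  slope of the average in the inertia term and the gradient of the difference quotient in the
  elliptic term both lead to \<open>centred\<close> terms of the same symmetric shape; the terms
  with \<open>\<zeta>'\<close>, the source and the initial velocity retain the average.\<close>

lemma discrete_identity:
  assumes z: "\<And>t. (\<zeta> has_real_derivative \<zeta>' t) (at t)" "continuous_on UNIV \<zeta>'" "\<And>t. \<bar>\<zeta> t\<bar> \<le> Z" "\<And>t. \<bar>\<zeta>' t\<bar> \<le> Z'"
      "\<And>t. T - \<eta> \<le> t \<Longrightarrow> \<zeta> t = 0"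
    and d: "0 < d" "d < \<eta>" "\<eta> < T"
  shows "- ((LINT z|lborel. (\<zeta>' (fst z) * m z * W z) * time_average d W z) + centred W m \<zeta> d)
     + (centred (Gr e1) a \<zeta> d + centred (Gr e2) a \<zeta> d)
   = (LINT z|lborel. (\<zeta> (fst z) * fL z) * time_average d W z)
     + \<rho>L * \<zeta> 0 * (1 / (2 * d)) * (LINT z|lborel. indicator {-d<..<d} (fst z) * (v2 (snd z) * W z))"
proof -
  let ?O = "Omega l h"
  have zc: "continuous_on UNIV \<zeta>" using z(1) by (auto intro!: continuous_at_imp_continuous_on DERIV_isCont)
  note zm = measurable_of_time[OF zc] and zm' = measurable_of_time[OF z(2)]
  note q = test_initial_props[OF d(1)]
  have S0: "z \<notin> Q \<Longrightarrow> test_slope d z = 0" for z by (simp add: test_slope_def)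
  define \<phi> where "\<phi> = (\<lambda>t x. \<zeta> t * (test_initial d x + primitive0 (test_slope d) (t, x)))"
  define \<phi>t where "\<phi>t = (\<lambda>t x. \<zeta>' t * (test_initial d x + primitive0 (test_slope d) (t, x)) + \<zeta> t * test_slope d (t, x))"
  note tf = test_function_in_time[where l=l and h=h, OF T q test_slope_L2 S0 z(1-4), folded \<phi>_def \<phi>t_def]
  have tr: "has_time_trace T ?O \<phi> t (\<phi> t)" if "t \<in> {0..T}" for t
    by (rule tf(3)[of t, folded fun_cong[OF fun_cong[OF \<phi>_def]]]) (use that in auto)
  define c where "c t = \<zeta> t / (2 * d)" for t
  define G\<phi> where "G\<phi> t x = (c t * (Gr e1 (t + d, x) - Gr e1 (t - d, x)), c t * (Gr e2 (t + d, x) - Gr e2 (t - d, x)))" for t x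
  have Gd: "square_integrable (\<lambda>z. Gr b (z + (d, 0)) - Gr b (z - (d, 0)))" if "b \<in> Basis" for b
    by (intro square_integrable_diff square_integrable_translate square_integrable_shift Gr_L2 that)
  have cm: "(\<lambda>z :: real \<times> real \<times> real. c (fst z)) \<in> borel_measurable lborel"
    unfolding c_def using zm by simp
  have cb: "\<bar>c t\<bar> \<le> Z / (2 * d)" for t
    unfolding c_def abs_divide using z(3)[of t] d by (simp add: divide_right_mono)
  have Gc: "square_integrable (\<lambda>z. c (fst z) * (Gr b (z + (d, 0)) - Gr b (z - (d, 0))))" if "b \<in> Basis" for b
    by (rule square_integrable_bounded_mult[OF Gd[OF that] cm cb])
  have Gc': "square_integrable (\<lambda>z. indicat_real Q z * (c (fst z) * (Gr b (z + (d, 0)) - Gr b (z - (d, 0)))))" if "b \<in> Basis" for b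
    by (rule square_integrable_bounded_mult[OF Gc[OF that], where B=1]) (use Q_props(1) in auto)
  have zz: "z + (d, 0) = (fst z + d, snd z)" "z - (d, 0) = (fst z - d, snd z)" for z :: "real \<times> real \<times> real" by (auto simp: prod_eq_iff)
  have L2G: "L2_L2 T ?O G\<phi>"
    using Gc'[OF basis(1)] Gc'[OF basis(2)] L2_on_pair_iff[OF Q_props(1)]
    unfolding L2_L2_def case_prod_beta' G\<phi>_def zz by simp
  have grad: "AE t in lborel. t \<in> {0<..<T} \<longrightarrow> has_periodic_gradient l h (\<phi> t) (G\<phi> t)"
  proof -
    have Vp: "AE t in lborel. t + d \<in> {-T<..<T} \<longrightarrow> has_periodic_gradient l h (V (t + d)) (\<lambda>x. (Gr e1 (t + d, x), Gr e2 (t + d, x)))"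
      by (rule AE_translate[OF V_gradient])
    have Vm: "AE t in lborel. t + - d \<in> {-T<..<T} \<longrightarrow> has_periodic_gradient l h (V (t + - d)) (\<lambda>x. (Gr e1 (t + - d, x), Gr e2 (t + - d, x)))"
      by (rule AE_translate[OF V_gradient])
    show ?thesis
      using Vp Vm
    proof eventually_elim
      case (elim t)
      show ?case
      proof
        assume t: "t \<in> {0<..<T}"
        show "has_periodic_gradient l h (\<phi> t) (G\<phi> t)"
        \<comment> \<open>For t + d beyond T the continuation has no gradient to offer; there
          \<open>\<zeta>\<close> vanishes because d < \<eta>.\<close>
        proof (cases "T - \<eta> \<le> t")
          case True
          have "\<phi> t = (\<lambda>x. 0)" "G\<phi> t = (\<lambda>x. 0)" using z(5)[OF True] by (auto simp: \<phi>_def G\<phi>_def c_def fun_eq_iff zero_prod_def)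
          then show ?thesis using has_periodic_gradient_zero[OF has_periodic_gradient_Ck_compact[OF v1C1]] by simp
        next
          case False
          have g1: "has_periodic_gradient l h (V (t + d)) (\<lambda>x. (Gr e1 (t + d, x), Gr e2 (t + d, x)))"
            using elim(1) False t d by auto
          have g2: "has_periodic_gradient l h (V (t - d)) (\<lambda>x. (Gr e1 (t - d, x), Gr e2 (t - d, x)))"
            using elim(2) False t d by auto
          have "has_periodic_gradient l h (\<lambda>x. c t * V (t + d) x + (- c t) * V (t - d) x)
             (\<lambda>x. c t *\<^sub>R (Gr e1 (t + d, x), Gr e2 (t + d, x)) + (- c t) *\<^sub>R (Gr e1 (t - d, x), Gr e2 (t - d, x)))"
            by (rule has_periodic_gradient_lincomb[OF g1 g2])
          then have "has_periodic_gradient l h (\<lambda>x. c t * V (t + d) x + (- c t) * V (t - d) x) (G\<phi> t)"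
            by (rule has_periodic_gradient_cong_gradient) (simp add: G\<phi>_def algebra_simps)
          then show ?thesis
          proof (rule has_periodic_gradient_cong_AE)
            show "square_integrable (\<lambda>x. indicat_real ?O x * \<phi> t x)"
              using tr[of t] t L2_on_real_iff[OF O(1)] by (simp add: has_time_trace_def)
            have dT: "d < T" using d by simp
            show "AE x in lborel. x \<in> ?O \<longrightarrow> c t * V (t + d) x + - c t * V (t - d) x = \<phi> t x"
              using test_value[OF d(1)] time_average_V[OF d(1) dT]
            proof eventually_elim
              case (elim x)
              show ?case
              proof
                assume x: "x \<in> ?O"
                have "\<phi> t x = \<zeta> t * (1 / (2 * d) * V (t + d) x - 1 / (2 * d) * V (t - d) x)"
                  using elim x t False d by (auto simp: \<phi>_def)
                then show "c t * V (t + d) x + - c t * V (t - d) x = \<phi> t x" by (simp add: c_def algebra_simps)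
              qed
            qed
          qed
        qed
      qed
    qed
  qed
  have H1: "L2_H1_periodic l h T \<phi> G\<phi>" using tf(1) L2G grad by (simp add: L2_H1_periodic_def)
  have trT: "has_time_trace T ?O \<phi> T (\<lambda>x. 0)"
  proof -
    have "\<phi> T = (\<lambda>x. 0)" using z(5)[of T] d by (auto simp: \<phi>_def)
    then show ?thesis using tr[of T] T by simp
  qed
  have tr0: "has_time_trace T ?O \<phi> 0 (\<phi> 0)" using tr[of 0] T by simp
  note id = weak[OF H1 tf(2) trT tr0]
  have phi2: "square_integrable (\<lambda>z. indicat_real Q z * \<phi> (fst z) (snd z))"
    using tf(1) L2_on_real_iff[OF Q_props(1)] by (simp add: L2_L2_def case_prod_beta')
  have phit2: "square_integrable (\<lambda>z. indicat_real Q z * \<phi>t (fst z) (snd z))"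
    using tf(2) L2_on_real_iff[OF Q_props(1)] by (simp add: has_time_derivative_def L2_L2_def case_prod_beta')
  have val: "AE z in lborel. z \<in> Q \<longrightarrow> test_initial d (snd z) + primitive0 (test_slope d) z = time_average d W z"
    using AE_lborel_snd[OF test_value[OF d(1)], where 'a=real] by eventually_elim auto
  \<comment> \<open>The product rule for \<open>\<phi>t\<close> splits the inertia term into the
    part with \<open>\<zeta>'\<close> and the centred part.\<close>
  have I1: "(LINT t:{0<..<T}|lborel. LINT x:?O|lborel. cm t x * ut t x * \<phi>t t x)
     = (LINT z|lborel. (\<zeta>' (fst z) * m z * W z) * time_average d W z) + centred W m \<zeta> d"
  proof -
    have e: "indicat_real Q z * (cm (fst z) (snd z) * ut (fst z) (snd z) * \<phi>t (fst z) (snd z)) = m z * (w z * (indicat_real Q z * \<phi>t (fst z) (snd z)))" for z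
      by (auto simp: m_def w_def indicator_def)
    have i: "integrable lborel (\<lambda>z. m z * (w z * (indicat_real Q z * \<phi>t (fst z) (snd z))))"
      by (rule integrable_bounded_mult[OF square_integrable_mult[OF w_L2 phit2] mm m_abs(1)])
    have h1: "square_integrable (\<lambda>z. \<zeta>' (fst z) * m z * W z)"
    proof (rule square_integrable_bounded_mult[OF W_L2])
      show "(\<lambda>z. \<zeta>' (fst z) * m z) \<in> borel_measurable lborel" by (rule borel_measurable_times[OF zm' mm])
      show "\<bar>\<zeta>' (fst z) * m z\<bar> \<le> Z' * Mm" for z
        unfolding abs_mult using z(4)[of "fst z"] m_abs(1)[of z] by (intro mult_mono) auto
    qed
    have i1: "integrable lborel (\<lambda>z. (\<zeta>' (fst z) * m z * W z) * time_average d W z)" by (rule time_average_pairing(1)[OF h1 W_L2 d(1)])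
    have Wd: "square_integrable (\<lambda>z. W (z + (d, 0)) - W (z - (d, 0)))"
      by (intro square_integrable_diff square_integrable_translate square_integrable_shift W_L2)
    have i2: "integrable lborel (\<lambda>z. \<zeta> (fst z) * m z * (W z * (W (z + (d, 0)) - W (z - (d, 0)))))"
    proof (rule integrable_bounded_mult[OF square_integrable_mult[OF W_L2 Wd]])
      show "(\<lambda>z. \<zeta> (fst z) * m z) \<in> borel_measurable lborel" by (rule borel_measurable_times[OF zm mm])
      show "\<bar>\<zeta> (fst z) * m z\<bar> \<le> Z * Mm" for z
        unfolding abs_mult using z(3)[of "fst z"] m_abs(1)[of z] by (intro mult_mono) auto
    qed
    have "(LINT t:{0<..<T}|lborel. LINT x:?O|lborel. cm t x * ut t x * \<phi>t t x)
      = (LINT z|lborel. indicat_real Q z * (cm (fst z) (snd z) * ut (fst z) (snd z) * \<phi>t (fst z) (snd z)))"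
      by (rule iterated_set_integral) (unfold e, rule i)
    also have "\<dots> = (LINT z|lborel. (\<zeta>' (fst z) * m z * W z) * time_average d W z
        + 1 / (2 * d) * (\<zeta> (fst z) * m z * (W z * (W (z + (d, 0)) - W (z - (d, 0))))))"
      unfolding e
    proof (rule integral_cong_AE)
      show "AE z in lborel. m z * (w z * (indicat_real Q z * \<phi>t (fst z) (snd z))) = (\<zeta>' (fst z) * m z * W z) * time_average d W z
        + 1 / (2 * d) * (\<zeta> (fst z) * m z * (W z * (W (z + (d, 0)) - W (z - (d, 0)))))"
        using val
      proof eventually_elim
        case (elim z)
        show ?case
        proof (cases "z \<in> Q")
          case True
          have pt: "\<phi>t (fst z) (snd z) = \<zeta>' (fst z) * time_average d W z + \<zeta> (fst z) * ((W (z + (d, 0)) - W (z - (d, 0))) / (2 * d))"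
            using elim True by (simp add: \<phi>t_def test_slope_def zz)
          have wW: "w z = W z" using True W_on_Q(1)[OF True] by (simp add: w_def)
          show ?thesis unfolding pt wW using True by (simp add: algebra_simps diff_divide_distrib)
        qed (simp add: m_outside)
      qed
      show "(\<lambda>z. m z * (w z * (indicat_real Q z * \<phi>t (fst z) (snd z)))) \<in> borel_measurable lborel" by (rule borel_measurable_integrable[OF i])
      show "(\<lambda>z. (\<zeta>' (fst z) * m z * W z) * time_average d W z
        + 1 / (2 * d) * (\<zeta> (fst z) * m z * (W z * (W (z + (d, 0)) - W (z - (d, 0)))))) \<in> borel_measurable lborel"
        by (rule borel_measurable_integrable[OF Bochner_Integration.integrable_add[OF i1 integrable_mult_right[OF i2]]])
    qed
    also have "\<dots> = (LINT z|lborel. (\<zeta>' (fst z) * m z * W z) * time_average d W z) + centred W m \<zeta> d"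
      unfolding centred_def by (simp only: Bochner_Integration.integral_add[OF i1 integrable_mult_right[OF i2]] integral_mult_right_zero)
    finally show ?thesis .
  qed
  have I2: "(LINT t:{0<..<T}|lborel. LINT x:?O|lborel. ca t x * (Gu t x \<bullet> G\<phi> t x)) = centred (Gr e1) a \<zeta> d + centred (Gr e2) a \<zeta> d"
  proof -
    let ?X = "\<lambda>b z. \<zeta> (fst z) * a z * (Gr b z * (Gr b (z + (d, 0)) - Gr b (z - (d, 0))))"
    have iX: "integrable lborel (?X b)" if "b \<in> Basis" for b
    proof (rule integrable_bounded_mult[OF square_integrable_mult[OF Gr_L2[OF that] Gd[OF that]]])
      show "(\<lambda>z. \<zeta> (fst z) * a z) \<in> borel_measurable lborel" by (rule borel_measurable_times[OF zm am])
      show "\<bar>\<zeta> (fst z) * a z\<bar> \<le> Z * Ma" for z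
        unfolding abs_mult using z(3)[of "fst z"] m_abs(2)[of z] by (intro mult_mono) auto
    qed
    have e: "indicat_real Q z * (ca (fst z) (snd z) * (Gu (fst z) (snd z) \<bullet> G\<phi> (fst z) (snd z))) = 1 / (2 * d) * ?X e1 z + 1 / (2 * d) * ?X e2 z" for z
    proof (cases "z \<in> Q")
      case True
      have G: "Gr e1 z = fst (Gu (fst z) (snd z))" "Gr e2 z = snd (Gu (fst z) (snd z))"
        using W_on_Q(2)[OF True] by (simp_all add: inner_prod_def)
      have az: "a z = ca (fst z) (snd z)" using True by (simp add: a_def)
      show ?thesis using True d by (simp add: inner_prod_def G\<phi>_def c_def G az zz field_simps)
    qed (simp add: m_outside)
    have "(LINT t:{0<..<T}|lborel. LINT x:?O|lborel. ca t x * (Gu t x \<bullet> G\<phi> t x))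
      = (LINT z|lborel. indicat_real Q z * (ca (fst z) (snd z) * (Gu (fst z) (snd z) \<bullet> G\<phi> (fst z) (snd z))))"
      by (rule iterated_set_integral)
        (unfold e, rule Bochner_Integration.integrable_add[OF integrable_mult_right[OF iX[OF basis(1)]] integrable_mult_right[OF iX[OF basis(2)]]])
    also have "\<dots> = centred (Gr e1) a \<zeta> d + centred (Gr e2) a \<zeta> d"
      unfolding e centred_def
      by (simp only: Bochner_Integration.integral_add[OF integrable_mult_right[OF iX[OF basis(1)]] integrable_mult_right[OF iX[OF basis(2)]]] integral_mult_right_zero)
    finally show ?thesis .
  qed
  have I3: "(LINT t:{0<..<T}|lborel. LINT x:?O|lborel. fL (t, x) * \<phi> t x) = (LINT z|lborel. (\<zeta> (fst z) * fL z) * time_average d W z)"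
  proof -
    have e: "indicat_real Q z * (fL (fst z, snd z) * \<phi> (fst z) (snd z)) = fL z * (indicat_real Q z * \<phi> (fst z) (snd z))" for z by simp
    have i: "integrable lborel (\<lambda>z. fL z * (indicat_real Q z * \<phi> (fst z) (snd z)))"
      by (rule square_integrable_mult[OF fL_props(1) phi2])
    have h1: "square_integrable (\<lambda>z. \<zeta> (fst z) * fL z)"
      by (rule square_integrable_bounded_mult[OF fL_props(1) zm z(3)])
    have "(LINT t:{0<..<T}|lborel. LINT x:?O|lborel. fL (t, x) * \<phi> t x) = (LINT z|lborel. indicat_real Q z * (fL (fst z, snd z) * \<phi> (fst z) (snd z)))"
      by (rule iterated_set_integral) (unfold e, rule i)
    also have "\<dots> = (LINT z|lborel. (\<zeta> (fst z) * fL z) * time_average d W z)"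
      unfolding e
    proof (rule integral_cong_AE)
      show "AE z in lborel. fL z * (indicat_real Q z * \<phi> (fst z) (snd z)) = (\<zeta> (fst z) * fL z) * time_average d W z"
        using val
      proof eventually_elim
        case (elim z)
        show ?case
        proof (cases "z \<in> Q")
          case True
          then show ?thesis using elim by (simp add: \<phi>_def)
        qed (simp add: fL_props(4))
      qed
    qed (rule borel_measurable_integrable[OF i], rule borel_measurable_integrable[OF time_average_pairing(1)[OF h1 W_L2 d(1)]])
    finally show ?thesis .
  qed
  \<comment> \<open>\<open>\<phi> 0\<close> is \<open>\<zeta> 0\<close> times the average over (-d,
    d). It is written as a space-time integral so that past and future times can be separated in the
    limit.\<close>
  have I4: "(LINT x:?O|lborel. \<rho>L * v2 x * \<phi> 0 x) = \<rho>L * \<zeta> 0 * (1 / (2 * d)) * (LINT z|lborel. indicator {-d<..<d} (fst z) * (v2 (snd z) * W z))"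
  proof -
    obtain B where B: "\<forall>x. \<bar>v2 x\<bar> \<le> B" using compact_C[OF v2] by blast
    have v2m: "v2 \<in> borel_measurable borel" using compact_C[OF v2] by blast
    have i: "integrable lborel (\<lambda>z. indicat_real {-d<..<d} (fst z) * (v2 (snd z) * W z))"
    proof (rule integrable_bounded_mult[OF _ borel_measurable_indicator_fst, where B=1])
      show "integrable lborel (\<lambda>z. v2 (snd z) * W z)"
        by (rule integrable_bounded_mult[OF W_integrable measurable_of_space[OF v2m]]) (use B in blast)
    qed auto
    have "(LINT x:?O|lborel. \<rho>L * v2 x * \<phi> 0 x) = (LINT x|lborel. \<rho>L * \<zeta> 0 * (1 / (2 * d)) * (LINT s|lborel. indicat_real {-d<..<d} s * (v2 x * W (s, x))))"
      unfolding set_lebesgue_integral_def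
    proof (intro Bochner_Integration.integral_cong refl)
      fix x
      have v2x: "x \<notin> ?O \<Longrightarrow> v2 x = 0" by (rule Ck_compact_UNIV_props(5)[OF v2 O(2)])
      have "(LINT s|lborel. indicat_real {-d<..<d} s * (v2 x * W (s, x))) = (LINT s|lborel. v2 x * (indicat_real {-d<..<d} s * W (s, x)))"
        by (intro Bochner_Integration.integral_cong refl) simp
      also have "\<dots> = v2 x * (LINT s|lborel. indicat_real {-d<..<d} s * W (s, x))" by simp
      finally show "indicat_real ?O x *\<^sub>R (\<rho>L * v2 x * \<phi> 0 x) = \<rho>L * \<zeta> 0 * (1 / (2 * d)) * (LINT s|lborel. indicat_real {-d<..<d} s * (v2 x * W (s, x)))"
        using v2x by (cases "x \<in> ?O") (simp_all add: \<phi>_def primitive0_at_0 test_initial_def)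
    qed
    also have "\<dots> = \<rho>L * \<zeta> 0 * (1 / (2 * d)) * (LINT x|lborel. LINT s|lborel. indicat_real {-d<..<d} s * (v2 x * W (s, x)))" by simp
    also have "(LINT x|lborel. LINT s|lborel. indicat_real {-d<..<d} s * (v2 x * W (s, x))) = (LINT z|lborel. indicator {-d<..<d} (fst z) * (v2 (snd z) * W z))"
      using lborel_pair_integral(2)[OF i] by simp
    finally show ?thesis .
  qed
  show ?thesis using id unfolding I1 I2 I3 I4 .
qed

section \<open>Limits of the initial terms\<close>

lemma lipschitz_weight:
  assumes z: "\<And>t. (\<zeta> has_real_derivative \<zeta>' t) (at t)" "\<And>t. \<bar>\<zeta>' t\<bar> \<le> Z'" and t: "0 < t" "t < d"
  shows "\<bar>\<zeta> t - \<zeta> 0\<bar> \<le> Z' * d"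
proof -
  obtain x where "\<zeta> t - \<zeta> 0 = (t - 0) * \<zeta>' x" using MVT2[OF t(1), of \<zeta> \<zeta>'] z(1) by blast
  then have "\<bar>\<zeta> t - \<zeta> 0\<bar> = t * \<bar>\<zeta>' x\<bar>" using t by (simp add: abs_mult)
  also have "\<dots> \<le> d * Z'" using t z(2)[of x] by (intro mult_mono) auto
  finally show ?thesis by (simp add: mult.commute)
qed

text \<open>Times before 0 contribute the explicit velocity \<open>v2\<close> and account for the
  whole limit, with factor 1/2. Times after 0 contain the unknown velocity, but there the subtracted
  slab term has the same integrand up to the weight, since the earlier value of \<open>W\<close> is
  \<open>v2\<close> and \<open>m\<close> is \<open>\<rho>L\<close> on its support. The weights
  differ by order \<delta>, which compensates the factor 1/\<delta>.\<close>

lemma initial_velocity_limit: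
  assumes z: "\<And>t. (\<zeta> has_real_derivative \<zeta>' t) (at t)" "\<And>t. \<bar>\<zeta> t\<bar> \<le> Z" "\<And>t. \<bar>\<zeta>' t\<bar> \<le> Z'"
    and d: "\<And>n. 0 < \<delta> n" "\<And>n. \<delta> n < T" "\<delta> \<longlonglongrightarrow> 0"
  shows "(\<lambda>n. \<rho>L * \<zeta> 0 * (1 / (2 * \<delta> n)) * (LINT z|lborel. indicator {-\<delta> n<..<\<delta> n} (fst z) * (v2 (snd z) * W z))
     - 1 / (2 * \<delta> n) * (LINT z|lborel. indicator {0<..<\<delta> n} (fst z) * (\<zeta> (fst z) * m z * (W z * W (z - (\<delta> n, 0))))))
     \<longlonglongrightarrow> 1 / 2 * \<rho>L * \<zeta> 0 * (LINT x|lborel. (v2 x)\<^sup>2)"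
proof -
  obtain B where B: "\<forall>x. \<bar>v2 x\<bar> \<le> B" using compact_C[OF v2] by blast
  have v2m: "v2 \<in> borel_measurable borel" and v2sq: "square_integrable v2" using compact_C[OF v2] by auto
  have zc: "continuous_on UNIV \<zeta>" using z(1) by (auto intro!: continuous_at_imp_continuous_on DERIV_isCont)
  let ?F = "\<lambda>z. v2 (snd z) * W z"
  have F: "integrable lborel ?F"
    by (rule integrable_bounded_mult[OF W_integrable measurable_of_space[OF v2m]]) (use B in blast)
  have iF: "integrable lborel (\<lambda>z. indicat_real S (fst z) * ?F z)" if "S \<in> sets borel" for S
    by (rule integrable_bounded_mult[OF F borel_measurable_indicator_fst[OF that], where B=1]) auto
  have iz: "integrable lborel (\<lambda>z. \<zeta> (fst z) * (indicat_real S (fst z) * ?F z))" if "S \<in> sets borel" for S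
    by (rule integrable_bounded_mult[OF iF[OF that] measurable_of_time[OF zc] z(2)])
  \<comment> \<open>What survives the cancellation over (0, \<delta>): the slab integral weighted
    with the difference of \<open>\<zeta> 0\<close> and \<open>\<zeta>\<close> at the current
    time.\<close>
  define R where "R n = (LINT z|lborel. (\<zeta> 0 - \<zeta> (fst z)) * (indicat_real {0<..<\<delta> n} (fst z) * ?F z))" for n
  have eq: "\<rho>L * \<zeta> 0 * (1 / (2 * \<delta> n)) * (LINT z|lborel. indicator {-\<delta> n<..<\<delta> n} (fst z) * ?F z)
     - 1 / (2 * \<delta> n) * (LINT z|lborel. indicator {0<..<\<delta> n} (fst z) * (\<zeta> (fst z) * m z * (W z * W (z - (\<delta> n, 0)))))
     = 1 / 2 * \<rho>L * \<zeta> 0 * (LINT x|lborel. (v2 x)\<^sup>2) + \<rho>L / (2 * \<delta> n) * R n" for n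
  proof -
    have a1: "(LINT z|lborel. indicator {-\<delta> n<..<\<delta> n} (fst z) * ?F z)
      = (LINT z|lborel. indicat_real {-\<delta> n<..0} (fst z) * ?F z) + (LINT z|lborel. indicat_real {0<..<\<delta> n} (fst z) * ?F z)"
    proof -
      have "(LINT z|lborel. indicator {-\<delta> n<..<\<delta> n} (fst z) * ?F z) = (LINT z|lborel. indicat_real {-\<delta> n<..0} (fst z) * ?F z + indicat_real {0<..<\<delta> n} (fst z) * ?F z)"
        by (intro Bochner_Integration.integral_cong refl) (use d(1)[of n] in \<open>auto simp: indicator_def\<close>)
      then show ?thesis using iF by simp
    qed
    have a2: "(LINT z|lborel. indicat_real {-\<delta> n<..0} (fst z) * ?F z) = \<delta> n * (LINT x|lborel. (v2 x)\<^sup>2)"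
    proof -
      have e: "indicat_real {-\<delta> n<..0} (fst z) * ?F z = indicat_real {-\<delta> n<..0} (fst z) * (v2 (snd z))\<^sup>2" for z
        using W_past(1)[of "fst z" "snd z"] d(2)[of n] by (auto simp: indicator_def power2_eq_square)
      have ii: "integrable lborel (indicat_real {-\<delta> n<..0})" using emeasure_bounded_finite[of "{-\<delta> n<..0}"]
        by (auto simp: integrable_indicator_iff intro: bounded_subset[OF bounded_closed_interval[of "-\<delta> n" 0]])
      have "(LINT z|lborel. indicat_real {-\<delta> n<..0} (fst z) * (v2 (snd z))\<^sup>2) = (LINT t|lborel. LINT x|lborel. indicat_real {-\<delta> n<..0} t * (v2 x)\<^sup>2)"
        using lborel_pair_integral(1)[OF integrable_product[OF ii square_integrableD(3)[OF v2sq]]] by simp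
      also have "\<dots> = (LINT t|lborel. indicat_real {-\<delta> n<..0} t) * (LINT x|lborel. (v2 x)\<^sup>2)" by simp
      also have "(LINT t|lborel. indicat_real {-\<delta> n<..0} t) = \<delta> n" using d(1)[of n] by simp
      finally show ?thesis unfolding e .
    qed
    have a3: "(LINT z|lborel. indicator {0<..<\<delta> n} (fst z) * (\<zeta> (fst z) * m z * (W z * W (z - (\<delta> n, 0)))))
      = (LINT z|lborel. \<rho>L * (\<zeta> (fst z) * (indicat_real {0<..<\<delta> n} (fst z) * ?F z)))"
    proof (intro Bochner_Integration.integral_cong refl)
      fix z :: "real \<times> real \<times> real"
      obtain t x where zz: "z = (t, x)" by (cases z)
      show "indicator {0<..<\<delta> n} (fst z) * (\<zeta> (fst z) * m z * (W z * W (z - (\<delta> n, 0)))) = \<rho>L * (\<zeta> (fst z) * (indicat_real {0<..<\<delta> n} (fst z) * ?F z))"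
      proof (cases "0 < t \<and> t < \<delta> n")
        case True
        then have p: "W (t - \<delta> n, x) = v2 x" using d(2)[of n] by (intro W_past) auto
        show ?thesis
        proof (cases "v2 x = 0")
          case True
          then show ?thesis using p by (simp add: zz)
        next
          case False
          then have "x \<in> Omega_L l h \<epsilon>" using v2s supp_superset[of v2 x] by auto
          then have "m (t, x) = \<rho>L" using True d(2)[of n] by (intro m_left) auto
          then show ?thesis using p by (simp add: zz)
        qed
      qed (auto simp: zz)
    qed
    have R: "R n = \<zeta> 0 * (LINT z|lborel. indicat_real {0<..<\<delta> n} (fst z) * ?F z) - (LINT z|lborel. \<zeta> (fst z) * (indicat_real {0<..<\<delta> n} (fst z) * ?F z))"
      unfolding R_def left_diff_distrib using iF[of "{0<..<\<delta> n}"] iz[of "{0<..<\<delta> n}"] by simp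
    show ?thesis unfolding a1 a2 a3 R using d(1)[of n] by (simp add: field_simps)
  qed
  have "(\<lambda>n. \<rho>L / (2 * \<delta> n) * R n) \<longlonglongrightarrow> 0"
  proof (rule tendsto_0_of_abs_le)
    show "(\<lambda>n. \<rho>L / 2 * Z' * (LINT z|lborel. indicator {0<..<\<delta> n} (fst z) * \<bar>?F z\<bar>)) \<longlonglongrightarrow> 0"
      using tendsto_mult_left[OF thin_slab_integral_tendsto_0[OF F d(3)], of "\<rho>L / 2 * Z'"] by simp
    fix n
    have i: "integrable lborel (\<lambda>z. (\<zeta> 0 - \<zeta> (fst z)) * (indicat_real {0<..<\<delta> n} (fst z) * ?F z))"
      unfolding left_diff_distrib using iF[of "{0<..<\<delta> n}"] iz[of "{0<..<\<delta> n}"] by simp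
    have "\<bar>R n\<bar> \<le> (LINT z|lborel. \<bar>(\<zeta> 0 - \<zeta> (fst z)) * (indicat_real {0<..<\<delta> n} (fst z) * ?F z)\<bar>)"
      unfolding R_def by (rule integral_abs_bound)
    also have "\<dots> \<le> (LINT z|lborel. Z' * \<delta> n * (indicat_real {0<..<\<delta> n} (fst z) * \<bar>?F z\<bar>))"
    proof (rule integral_mono[OF integrable_abs[OF i]])
      show "integrable lborel (\<lambda>z. Z' * \<delta> n * (indicat_real {0<..<\<delta> n} (fst z) * \<bar>?F z\<bar>))"
        by (intro integrable_mult_right integrable_bounded_mult[OF integrable_abs[OF F] borel_measurable_indicator_fst, where B=1]) auto
      fix z :: "real \<times> real \<times> real"
      show "\<bar>(\<zeta> 0 - \<zeta> (fst z)) * (indicat_real {0<..<\<delta> n} (fst z) * ?F z)\<bar> \<le> Z' * \<delta> n * (indicat_real {0<..<\<delta> n} (fst z) * \<bar>?F z\<bar>)"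
      proof (cases "0 < fst z \<and> fst z < \<delta> n")
        case True
        then have "\<bar>\<zeta> 0 - \<zeta> (fst z)\<bar> \<le> Z' * \<delta> n" using lipschitz_weight[OF z(1,3), of "fst z" "\<delta> n"] by (simp add: abs_minus_commute)
        then show ?thesis using True mult_right_mono[of "\<bar>\<zeta> 0 - \<zeta> (fst z)\<bar>" "Z' * \<delta> n" "\<bar>?F z\<bar>"] by (simp add: abs_mult)
      qed auto
    qed
    also have "\<dots> = Z' * \<delta> n * (LINT z|lborel. indicat_real {0<..<\<delta> n} (fst z) * \<bar>?F z\<bar>)" by simp
    finally have "\<rho>L / (2 * \<delta> n) * \<bar>R n\<bar> \<le> \<rho>L / (2 * \<delta> n) * (Z' * \<delta> n * (LINT z|lborel. indicat_real {0<..<\<delta> n} (fst z) * \<bar>?F z\<bar>))"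
      using \<rho>L d(1)[of n] by (intro mult_left_mono) auto
    then show "\<bar>\<rho>L / (2 * \<delta> n) * R n\<bar> \<le> \<rho>L / 2 * Z' * (LINT z|lborel. indicator {0<..<\<delta> n} (fst z) * \<bar>?F z\<bar>)"
      using \<rho>L d(1)[of n] by (simp add: abs_mult field_simps)
  qed
  then show ?thesis
    unfolding eq using tendsto_add[OF tendsto_const, of "\<lambda>n. \<rho>L / (2 * \<delta> n) * R n" 0] by simp
qed

text \<open>In the slab the earlier gradient is explicit, \<open>pd b v1\<close> to leading order,
  but the later one has no trace at 0. An integration by parts in space transfers its derivative to
  \<open>pd b v1\<close> and leaves the solution itself, which is \<open>v1\<close> plus a primitive
  that is small on the slab. The limit is the b-th part of the Dirichlet energy of
  \<open>v1\<close>, written with the second derivative, hence the minus sign.\<close>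

lemma initial_gradient_limit:
  assumes z: "\<And>t. (\<zeta> has_real_derivative \<zeta>' t) (at t)" "\<And>t. \<bar>\<zeta> t\<bar> \<le> Z" "\<And>t. \<bar>\<zeta>' t\<bar> \<le> Z'"
    and d: "\<And>n. 0 < \<delta> n" "\<And>n. \<delta> n < T" "\<delta> \<longlonglongrightarrow> 0" and b: "b \<in> Basis"
  shows "(\<lambda>n. 1 / (2 * \<delta> n) * (LINT z|lborel. indicator {0<..<\<delta> n} (fst z) * (\<zeta> (fst z) * a z * (Gr b z * Gr b (z - (\<delta> n, 0))))))
     \<longlonglongrightarrow> - (1 / 2 * DL * \<zeta> 0 * (LINT x|lborel. v1 x * pd b (pd b v1) x))"
proof -
  define p where "p = pd b v1"
  define r where "r = pd b v2"
  define c where "c = pd b p"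
  have pC: "Ck_compact 1 (Omega l h) p" and rC: "Ck_compact 0 (Omega l h) r" and cC: "Ck_compact 0 (Omega l h) c"
    unfolding p_def r_def c_def using pd_v[OF b] pd2_v1[OF b] by auto
  obtain Bp where Bp: "\<forall>x. \<bar>p x\<bar> \<le> Bp" using compact_C[OF pC] by blast
  obtain Br where Br: "\<forall>x. \<bar>r x\<bar> \<le> Br" using compact_C[OF rC] by blast
  obtain Bc where Bc: "\<forall>x. \<bar>c x\<bar> \<le> Bc" using compact_C[OF cC] by blast
  have pm: "p \<in> borel_measurable borel" and rm: "r \<in> borel_measurable borel" and cmm: "c \<in> borel_measurable borel"
    using compact_C[OF pC] compact_C[OF rC] compact_C[OF cC] by auto
  have zc: "continuous_on UNIV \<zeta>" using z(1) by (auto intro!: continuous_at_imp_continuous_on DERIV_isCont)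
  have Gi: "integrable lborel (Gr b)"
  proof (rule bounded_time_integrable[OF Gr_L2[OF b]])
    show "Gr b (t, x) = 0" if "x \<notin> Omega l h" for t x
      using that Ck_compact_UNIV_props(5)[OF pd_v(1)[OF b] O(2), of x] Ck_compact_UNIV_props(5)[OF pd_v(2)[OF b] O(2), of x] by (simp add: Gr_def)
    show "Gr b (t, x) = 0" if "t \<notin> {-T<..<T}" for t x using that T by (auto simp: Gr_def past_def indicator_def)
  qed
  have Fp: "integrable lborel (\<lambda>z. p (snd z) * Gr b z)"
    by (rule integrable_bounded_mult[OF Gi measurable_of_space[OF pm]]) (use Bp in blast)
  have Fr: "integrable lborel (\<lambda>z. r (snd z) * Gr b z)"
    by (rule integrable_bounded_mult[OF Gi measurable_of_space[OF rm]]) (use Br in blast)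
  have w_i: "integrable lborel w" using integrable_of_square_integrable_bounded[of Q "\<lambda>z. ut (fst z) (snd z)"] w_L2 Q_props unfolding w_def[abs_def] by blast
  have Fc: "integrable lborel (\<lambda>z. c (snd z) * w z)"
    by (rule integrable_bounded_mult[OF w_i measurable_of_space[OF cmm]]) (use Bc in blast)
  let ?i = "\<lambda>n z. indicat_real {0<..<\<delta> n} (fst z)"
  have im: "(\<lambda>z :: real \<times> real \<times> real. ?i n z) \<in> borel_measurable lborel" for n by (rule borel_measurable_indicator_fst) simp
  have ib: "integrable lborel (\<lambda>z. ?i n z * F z)" if "integrable lborel F" for F :: "real \<times> real \<times> real \<Rightarrow> real" and n
    by (rule integrable_bounded_mult[OF that im, where B=1]) auto
  define A where "A n = (LINT z|lborel. ?i n z * (p (snd z) * Gr b z))" for n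
  define N where "N n = (LINT z|lborel. ?i n z * (\<zeta> (fst z) * a z * (Gr b z * Gr b (z - (\<delta> n, 0)))))" for n
  \<comment> \<open>Replacing \<open>\<zeta>\<close> by \<open>\<zeta> 0\<close>, and dropping the
    part of the continued gradient that stems from t \<open>v2\<close>, each cost a factor \<delta>
    times a slab integral.\<close>
  have slab: "\<bar>N n - DL * \<zeta> 0 * A n\<bar> \<le> \<delta> n * (DL * Z' * (LINT z|lborel. ?i n z * \<bar>p (snd z) * Gr b z\<bar>) + DL * Z * (LINT z|lborel. ?i n z * \<bar>r (snd z) * Gr b z\<bar>))" for n
  proof -
    let ?Y = "\<lambda>z. ?i n z * ((\<zeta> (fst z) - \<zeta> 0) * (p (snd z) * Gr b z)) + ?i n z * ((\<zeta> (fst z) * (fst z - \<delta> n)) * (r (snd z) * Gr b z))"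
    have e: "?i n z * (\<zeta> (fst z) * a z * (Gr b z * Gr b (z - (\<delta> n, 0)))) = DL * \<zeta> 0 * (?i n z * (p (snd z) * Gr b z)) + DL * ?Y z" for z
    proof -
      obtain t x where zz: "z = (t, x)" by (cases z)
      show ?thesis
      proof (cases "0 < t \<and> t < \<delta> n")
        case True
        then have pst: "Gr b (t - \<delta> n, x) = p x + (t - \<delta> n) * r x"
          unfolding p_def r_def using d(2)[of n] by (intro W_past(2)) auto
        show ?thesis
        \<comment> \<open>Where the earlier gradient is nonzero, x lies in the left part and
          \<open>a\<close> is the constant \<open>DL\<close>; elsewhere both sides vanish.\<close>
        proof (cases "x \<in> supp v1 \<or> x \<in> supp v2")
          case x: True
          then have "x \<in> Omega_L l h \<epsilon>" using v1s v2s by auto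
          then have "a (t, x) = DL" using True d(2)[of n] by (intro a_left) auto
          moreover have "Gr b ((t, x) - (\<delta> n, 0)) = p x + (t - \<delta> n) * r x" using pst by simp
          ultimately show ?thesis unfolding zz fst_conv snd_conv by (simp only:) (simp add: algebra_simps)
        next
          case False
          then have "p x = 0" "r x = 0" unfolding p_def r_def by (auto intro: pd_outside)
          then show ?thesis using pst by (simp add: zz)
        qed
      qed (auto simp: zz)
    qed
    have j1: "integrable lborel (\<lambda>z. ?i n z * ((\<zeta> (fst z) - \<zeta> 0) * (p (snd z) * Gr b z)))"
    proof (rule ib, rule integrable_bounded_mult[OF Fp])
      show "(\<lambda>z :: real \<times> real \<times> real. \<zeta> (fst z) - \<zeta> 0) \<in> borel_measurable lborel"
        by (intro borel_measurable_diff measurable_of_time zc borel_measurable_const)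
      show "\<bar>\<zeta> (fst z) - \<zeta> 0\<bar> \<le> Z + Z" for z :: "real \<times> real \<times> real" using z(2)[of "fst z"] z(2)[of 0] by linarith
    qed
    have j2: "integrable lborel (\<lambda>z. ?i n z * ((\<zeta> (fst z) * (fst z - \<delta> n)) * (r (snd z) * Gr b z)))"
    proof -
      have "integrable lborel (\<lambda>z. (?i n z * (\<zeta> (fst z) * (fst z - \<delta> n))) * (r (snd z) * Gr b z))"
      proof (rule integrable_bounded_mult[OF Fr])
        show "(\<lambda>z :: real \<times> real \<times> real. ?i n z * (\<zeta> (fst z) * (fst z - \<delta> n))) \<in> borel_measurable lborel"
          by (intro borel_measurable_times borel_measurable_diff im measurable_of_time zc borel_measurable_fst_snd(1) borel_measurable_const)
        show "\<bar>?i n z * (\<zeta> (fst z) * (fst z - \<delta> n))\<bar> \<le> Z * \<delta> n" for z :: "real \<times> real \<times> real"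
        proof (cases "0 < fst z \<and> fst z < \<delta> n")
          case True
          then show ?thesis using z(2)[of "fst z"] by (auto simp: abs_mult intro!: mult_mono)
        next
          case False
          moreover have "0 \<le> Z * \<delta> n" using z(2)[of 0] d(1)[of n] by (intro mult_nonneg_nonneg) auto
          ultimately show ?thesis by (auto simp: indicator_def)
        qed
      qed
      then show ?thesis by (simp only: mult.assoc)
    qed
    have "N n = DL * \<zeta> 0 * A n + DL * (LINT z|lborel. ?Y z)"
      unfolding N_def A_def e using ib[OF Fp] Bochner_Integration.integrable_add[OF j1 j2]
      by (simp only: Bochner_Integration.integral_add[OF integrable_mult_right[OF ib[OF Fp]] integrable_mult_right[OF Bochner_Integration.integrable_add[OF j1 j2]]] integral_mult_right_zero)
    then have "\<bar>N n - DL * \<zeta> 0 * A n\<bar> = DL * \<bar>LINT z|lborel. ?Y z\<bar>" using DL by (simp add: abs_mult)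
    also have "\<dots> \<le> DL * (LINT z|lborel. \<bar>?Y z\<bar>)" using DL integral_abs_bound[of lborel ?Y] by simp
    also have "(LINT z|lborel. \<bar>?Y z\<bar>) \<le> (LINT z|lborel. \<delta> n * Z' * (?i n z * \<bar>p (snd z) * Gr b z\<bar>) + \<delta> n * Z * (?i n z * \<bar>r (snd z) * Gr b z\<bar>))"
    proof (rule integral_mono[OF integrable_abs[OF Bochner_Integration.integrable_add[OF j1 j2]]])
      show "integrable lborel (\<lambda>z. \<delta> n * Z' * (?i n z * \<bar>p (snd z) * Gr b z\<bar>) + \<delta> n * Z * (?i n z * \<bar>r (snd z) * Gr b z\<bar>))"
        by (intro Bochner_Integration.integrable_add integrable_mult_right ib integrable_abs Fp Fr)
      fix z :: "real \<times> real \<times> real"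
      show "\<bar>?Y z\<bar> \<le> \<delta> n * Z' * (?i n z * \<bar>p (snd z) * Gr b z\<bar>) + \<delta> n * Z * (?i n z * \<bar>r (snd z) * Gr b z\<bar>)"
      proof (cases "0 < fst z \<and> fst z < \<delta> n")
        case True
        then have i1: "?i n z = 1" by simp
        have "\<bar>\<zeta> (fst z) - \<zeta> 0\<bar> * \<bar>p (snd z) * Gr b z\<bar> \<le> \<delta> n * Z' * \<bar>p (snd z) * Gr b z\<bar>"
          using lipschitz_weight[OF z(1,3), of "fst z" "\<delta> n"] True by (intro mult_right_mono) (auto simp: mult.commute)
        moreover have "\<bar>\<zeta> (fst z) * (fst z - \<delta> n)\<bar> \<le> Z * \<delta> n"
          using z(2)[of "fst z"] True by (auto simp: abs_mult intro!: mult_mono)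
        then have "\<bar>\<zeta> (fst z) * (fst z - \<delta> n)\<bar> * \<bar>r (snd z) * Gr b z\<bar> \<le> \<delta> n * Z * \<bar>r (snd z) * Gr b z\<bar>"
          by (intro mult_right_mono) (auto simp: mult.commute)
        ultimately show ?thesis
          unfolding i1 mult_1 using abs_triangle_ineq[of "(\<zeta> (fst z) - \<zeta> 0) * (p (snd z) * Gr b z)" "(\<zeta> (fst z) * (fst z - \<delta> n)) * (r (snd z) * Gr b z)"]
          unfolding abs_mult[of "\<zeta> (fst z) - \<zeta> 0"] abs_mult[of "\<zeta> (fst z) * (fst z - \<delta> n)"] by linarith
      qed auto
    qed
    also have "\<dots> = \<delta> n * Z' * (LINT z|lborel. ?i n z * \<bar>p (snd z) * Gr b z\<bar>) + \<delta> n * Z * (LINT z|lborel. ?i n z * \<bar>r (snd z) * Gr b z\<bar>)"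
      by (simp only: Bochner_Integration.integral_add[OF integrable_mult_right[OF ib[OF integrable_abs[OF Fp]]] integrable_mult_right[OF ib[OF integrable_abs[OF Fr]]]] integral_mult_right_zero)
    finally show ?thesis using DL by (simp add: algebra_simps)
  qed
  \<comment> \<open>Weak differentiation at almost every time, against the function \<open>p\<close>
    of class C1. The first term carries the full order \<delta>, the second is the error made in
    replacing \<open>V\<close> by \<open>v1\<close>.\<close>
  have A: "A n = - \<delta> n * (LINT x|lborel. v1 x * c x) - (LINT z|lborel. ?i n z * (c (snd z) * primitive0 w z))" for n
  proof -
    have v1i: "integrable lborel (\<lambda>x. v1 x * c x)"
      using square_integrable_mult[of v1 c] compact_C[OF v1] compact_C[OF cC] by blast
    have indi: "integrable lborel (indicat_real {0<..<\<delta> n})" using indicator_box_integrable[of 0 "\<delta> n"] by simp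
    have k1: "integrable lborel (\<lambda>z. ?i n z * (v1 (snd z) * c (snd z)))" by (rule integrable_product[OF indi v1i])
    have k2: "integrable lborel (\<lambda>z. ?i n z * (c (snd z) * primitive0 w z))"
    proof -
      have "integrable lborel (\<lambda>z. c (snd z) * (?i n z * primitive0 w z))"
        by (rule integrable_bounded_mult[OF primitive0_integrable[OF w_i] measurable_of_space[OF cmm]]) (use Bc in blast)
      then show ?thesis by (simp only: mult.left_commute)
    qed
    let ?k = "\<lambda>z. ?i n z * (v1 (snd z) * c (snd z)) + ?i n z * (c (snd z) * primitive0 w z)"
    have kk: "integrable lborel ?k" by (rule Bochner_Integration.integrable_add[OF k1 k2])
    have "A n = (LINT t|lborel. LINT x|lborel. ?i n (t, x) * (p x * Gr b (t, x)))"
      unfolding A_def using lborel_pair_integral(1)[OF ib[OF Fp]] by simp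
    also have "\<dots> = (LINT t|lborel. - (LINT x|lborel. ?k (t, x)))"
    proof (rule integral_cong_AE)
      show "(\<lambda>t. LINT x|lborel. ?i n (t, x) * (p x * Gr b (t, x))) \<in> borel_measurable lborel"
        using borel_measurable_integrable[OF lborel_pair_integral(5)[OF ib[OF Fp]]] by simp
      show "(\<lambda>t. - (LINT x|lborel. ?k (t, x))) \<in> borel_measurable lborel"
        using borel_measurable_integrable[OF lborel_pair_integral(5)[OF kk]] by simp
      show "AE t in lborel. (LINT x|lborel. ?i n (t, x) * (p x * Gr b (t, x))) = - (LINT x|lborel. ?k (t, x))"
        using V_gradient
      proof eventually_elim
        case (elim t)
        show ?case
        proof (cases "0 < t \<and> t < \<delta> n")
          case True
          then have g: "has_periodic_gradient l h (V t) (\<lambda>x. (Gr e1 (t, x), Gr e2 (t, x)))" using elim d(2)[of n] by auto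
          have Gb: "(Gr e1 (t, x), Gr e2 (t, x)) \<bullet> b = Gr b (t, x)" for x using b by (auto simp: Basis_real2)
          have out: "x \<notin> Omega l h \<Longrightarrow> p x = 0" "x \<notin> Omega l h \<Longrightarrow> c x = 0" for x
            using Ck_compact_UNIV_props(5)[OF pC O(2)] Ck_compact_UNIV_props(5)[OF cC O(2)] by auto
          have "(LINT x|lborel. ?i n (t, x) * (p x * Gr b (t, x))) = (LINT x:Omega l h|lborel. ((Gr e1 (t, x), Gr e2 (t, x)) \<bullet> b) * p x)"
            unfolding set_lebesgue_integral_def Gb
            by (intro Bochner_Integration.integral_cong refl) (use True out in \<open>auto simp: indicator_def\<close>)
          also have "\<dots> = - (LINT x:Omega l h|lborel. V t x * c x)"
            using has_periodic_gradient_by_parts[OF l h g pC b] unfolding c_def pd_def by simp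
          also have "(LINT x:Omega l h|lborel. V t x * c x) = (LINT x|lborel. ?k (t, x))"
            unfolding set_lebesgue_integral_def
            by (intro Bochner_Integration.integral_cong refl) (use True out in \<open>auto simp: indicator_def V_def algebra_simps\<close>)
          finally show ?thesis .
        qed auto
      qed
    qed
    also have "\<dots> = - (LINT z|lborel. ?k z)" using lborel_pair_integral(1)[OF kk] by simp
    also have "(LINT z|lborel. ?k z) = (LINT z|lborel. ?i n z * (v1 (snd z) * c (snd z))) + (LINT z|lborel. ?i n z * (c (snd z) * primitive0 w z))"
      by (rule Bochner_Integration.integral_add[OF k1 k2])
    also have "(LINT z|lborel. ?i n z * (v1 (snd z) * c (snd z))) = \<delta> n * (LINT x|lborel. v1 x * c x)"
      using lborel_pair_integral(1)[OF k1] d(1)[of n] by simp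
    finally show ?thesis by simp
  qed
  \<comment> \<open>The primitive is bounded by the mass of the whole slab, and integration over the
    slab then yields the factor \<delta>.\<close>
  have prim: "\<bar>LINT z|lborel. ?i n z * (c (snd z) * primitive0 w z)\<bar> \<le> \<delta> n * (LINT z|lborel. ?i n z * \<bar>c (snd z) * w z\<bar>)" for n
  proof -
    define \<beta> where "\<beta> x = (LINT s|lborel. indicat_real {0<..<\<delta> n} s * \<bar>c x * w (s, x)\<bar>)" for x
    have bi: "integrable lborel \<beta>"
      unfolding \<beta>_def using lborel_pair_integral(6)[OF ib[OF integrable_abs[OF Fc]]] by simp
    have indi: "integrable lborel (indicat_real {0<..<\<delta> n})" using indicator_box_integrable[of 0 "\<delta> n"] by simp
    have k2: "integrable lborel (\<lambda>z. ?i n z * (c (snd z) * primitive0 w z))"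
    proof -
      have "integrable lborel (\<lambda>z. c (snd z) * (?i n z * primitive0 w z))"
        by (rule integrable_bounded_mult[OF primitive0_integrable[OF w_i] measurable_of_space[OF cmm]]) (use Bc in blast)
      then show ?thesis by (simp only: mult.left_commute)
    qed
    have "\<bar>LINT z|lborel. ?i n z * (c (snd z) * primitive0 w z)\<bar> \<le> (LINT z|lborel. \<bar>?i n z * (c (snd z) * primitive0 w z)\<bar>)" by (rule integral_abs_bound)
    also have "\<dots> \<le> (LINT z|lborel. ?i n z * \<beta> (snd z))"
    proof (rule integral_mono_AE[OF integrable_abs[OF k2] integrable_product[OF indi bi]])
      show "AE z in lborel. \<bar>?i n z * (c (snd z) * primitive0 w z)\<bar> \<le> ?i n z * \<beta> (snd z)"
        using AE_lborel_snd[OF square_integrable_slices[OF w_L2], where 'a=real]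
      proof eventually_elim
        case (elim z)
        show ?case
        proof (cases "0 < fst z \<and> fst z < \<delta> n")
          case True
          have iw: "integrable lborel (\<lambda>s. indicator {0<..<t} s * w (s, snd z))" for t by (rule integrable_on_bounded_interval[OF elim])
          have "c (snd z) * primitive0 w z = (LINT s|lborel. c (snd z) * (indicator {0<..<fst z} s * w (s, snd z)))"
            by (simp add: primitive0_def)
          then have "\<bar>c (snd z) * primitive0 w z\<bar> \<le> (LINT s|lborel. \<bar>c (snd z) * (indicator {0<..<fst z} s * w (s, snd z))\<bar>)"
            by (simp only: integral_abs_bound)
          also have "\<dots> \<le> (LINT s|lborel. \<bar>c (snd z) * (indicator {0<..<\<delta> n} s * w (s, snd z))\<bar>)"
            by (rule integral_mono[OF integrable_abs[OF integrable_mult_right[OF iw]] integrable_abs[OF integrable_mult_right[OF iw]]])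
              (use True in \<open>auto simp: indicator_def\<close>)
          also have "\<dots> = \<beta> (snd z)"
            unfolding \<beta>_def by (intro Bochner_Integration.integral_cong refl) (auto simp: indicator_def)
          finally show ?thesis using True by simp
        qed auto
      qed
    qed
    also have "\<dots> = \<delta> n * (LINT x|lborel. \<beta> x)"
      using lborel_pair_integral(1)[OF integrable_product[OF indi bi]] d(1)[of n] by simp
    also have "(LINT x|lborel. \<beta> x) = (LINT z|lborel. ?i n z * \<bar>c (snd z) * w z\<bar>)"
      unfolding \<beta>_def using lborel_pair_integral(2)[OF ib[OF integrable_abs[OF Fc]]] by simp
    finally show ?thesis .
  qed
  \<comment> \<open>All slab integrals that remain after one factor \<delta> has been split off;
    each of them tends to 0.\<close>
  define E where "E n = DL * Z' * (LINT z|lborel. ?i n z * \<bar>p (snd z) * Gr b z\<bar>) + DL * Z * (LINT z|lborel. ?i n z * \<bar>r (snd z) * Gr b z\<bar>)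
     + DL * \<bar>\<zeta> 0\<bar> * (LINT z|lborel. ?i n z * \<bar>c (snd z) * w z\<bar>)" for n
  have E0: "E \<longlonglongrightarrow> DL * Z' * 0 + DL * Z * 0 + DL * \<bar>\<zeta> 0\<bar> * 0"
    unfolding E_def
    by (intro tendsto_add tendsto_mult_left thin_slab_integral_tendsto_0[OF Fp d(3)] thin_slab_integral_tendsto_0[OF Fr d(3)] thin_slab_integral_tendsto_0[OF Fc d(3)])
  have "\<bar>1 / (2 * \<delta> n) * N n - - (1 / 2 * DL * \<zeta> 0 * (LINT x|lborel. v1 x * c x))\<bar> \<le> 1 / 2 * E n" for n
  proof -
    let ?P = "LINT z|lborel. ?i n z * (c (snd z) * primitive0 w z)"
    have "N n + \<delta> n * (DL * \<zeta> 0 * (LINT x|lborel. v1 x * c x)) = (N n - DL * \<zeta> 0 * A n) - DL * \<zeta> 0 * ?P"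
      unfolding A by (simp add: algebra_simps)
    also have "\<bar>\<dots>\<bar> \<le> \<bar>N n - DL * \<zeta> 0 * A n\<bar> + \<bar>DL * \<zeta> 0 * ?P\<bar>" by (rule abs_triangle_ineq4)
    also have "\<bar>DL * \<zeta> 0 * ?P\<bar> \<le> DL * \<bar>\<zeta> 0\<bar> * (\<delta> n * (LINT z|lborel. ?i n z * \<bar>c (snd z) * w z\<bar>))"
      unfolding abs_mult[of _ ?P] using DL by (intro mult_mono prim) (auto simp: abs_mult)
    also note slab[of n]
    finally have le: "\<bar>N n + \<delta> n * (DL * \<zeta> 0 * (LINT x|lborel. v1 x * c x))\<bar> \<le> \<delta> n * E n"
      unfolding E_def by (simp add: algebra_simps)
    have "1 / (2 * \<delta> n) * N n - - (1 / 2 * DL * \<zeta> 0 * (LINT x|lborel. v1 x * c x)) = 1 / (2 * \<delta> n) * (N n + \<delta> n * (DL * \<zeta> 0 * (LINT x|lborel. v1 x * c x)))"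
      using d(1)[of n] by (simp add: field_simps)
    also have "\<bar>\<dots>\<bar> = 1 / (2 * \<delta> n) * \<bar>N n + \<delta> n * (DL * \<zeta> 0 * (LINT x|lborel. v1 x * c x))\<bar>"
      unfolding abs_mult using d(1)[of n] by simp
    also have "\<dots> \<le> 1 / (2 * \<delta> n) * (\<delta> n * E n)" using d(1)[of n] by (intro mult_left_mono le) simp
    also have "\<dots> = 1 / 2 * E n" using d(1)[of n] by simp
    finally show ?thesis .
  qed
  from tendsto_0_of_abs_le[OF this] have "(\<lambda>n. 1 / (2 * \<delta> n) * N n - - (1 / 2 * DL * \<zeta> 0 * (LINT x|lborel. v1 x * c x))) \<longlonglongrightarrow> 0"
    using tendsto_mult_left[OF E0, of "1/2"] by simp
  then show ?thesis unfolding N_def c_def p_def by (rule LIM_zero_cancel)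
qed

section \<open>The energy inequality\<close>

definition "energy z = m z * (W z)\<^sup>2 + (a z * (Gr e1 z)\<^sup>2 + a z * (Gr e2 z)\<^sup>2)"

lemma coefficient_square_integrable:
  assumes "square_integrable f"
  shows "integrable lborel (\<lambda>z. m z * (f z)\<^sup>2)" "integrable lborel (\<lambda>z. a z * (f z)\<^sup>2)"
  by (rule integrable_bounded_mult[OF square_integrableD(3)[OF assms] mm m_abs(1)],
      rule integrable_bounded_mult[OF square_integrableD(3)[OF assms] am m_abs(2)])

lemma energy_props: "integrable lborel energy" "0 \<le> energy z" "z \<notin> Q \<Longrightarrow> energy z = 0"
proof -
  show "integrable lborel energy" unfolding energy_def[abs_def]
    by (intro Bochner_Integration.integrable_add coefficient_square_integrable W_L2 Gr_L2 basis)
  show "0 \<le> energy z" using m0(1)[of z] a0(1)[of z] by (simp add: energy_def)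
  show "z \<notin> Q \<Longrightarrow> energy z = 0" by (simp add: energy_def m_outside)
qed

lemma weighted_energy_integral:
  assumes k: "continuous_on UNIV k" "\<And>t. \<bar>k t\<bar> \<le> B"
  shows "integrable lborel (\<lambda>z. k (fst z) * energy z)"
    and "(LINT z|lborel. k (fst z) * energy z) = (LINT z|lborel. k (fst z) * m z * (W z)\<^sup>2)
      + ((LINT z|lborel. k (fst z) * a z * (Gr e1 z)\<^sup>2) + (LINT z|lborel. k (fst z) * a z * (Gr e2 z)\<^sup>2))"
proof -
  note km = measurable_of_time[OF k(1)]
  show "integrable lborel (\<lambda>z. k (fst z) * energy z)"
    by (rule integrable_bounded_mult[OF energy_props(1) km k(2)])
  have i: "integrable lborel (\<lambda>z. k (fst z) * m z * (W z)\<^sup>2)" "integrable lborel (\<lambda>z. k (fst z) * a z * (Gr e1 z)\<^sup>2)"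
    "integrable lborel (\<lambda>z. k (fst z) * a z * (Gr e2 z)\<^sup>2)"
    unfolding mult.assoc
    by (intro integrable_bounded_mult[OF _ km k(2)] coefficient_square_integrable W_L2 Gr_L2 basis)+
  have e: "k (fst z) * energy z = k (fst z) * m z * (W z)\<^sup>2 + (k (fst z) * a z * (Gr e1 z)\<^sup>2 + k (fst z) * a z * (Gr e2 z)\<^sup>2)" for z
    by (simp add: energy_def algebra_simps)
  show "(LINT z|lborel. k (fst z) * energy z) = (LINT z|lborel. k (fst z) * m z * (W z)\<^sup>2)
      + ((LINT z|lborel. k (fst z) * a z * (Gr e1 z)\<^sup>2) + (LINT z|lborel. k (fst z) * a z * (Gr e2 z)\<^sup>2))"
    unfolding e using i by simp
qed

text \<open>The derivative of the weight contributes -1 times the kinetic integral through the test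
  function and +1/2 through the centred difference. The sum -1/2 matches the gradient terms, and
  multiplication by 2 gives the energy.\<close>

lemma energy_inequality:
  assumes z: "\<And>t. (\<zeta> has_real_derivative \<zeta>' t) (at t)" "continuous_on UNIV \<zeta>'" "\<And>t. 0 \<le> \<zeta> t" "\<And>t. \<zeta> t \<le> Z"
      "\<And>t. \<bar>\<zeta>' t\<bar> \<le> Z'" "\<And>t. T - \<eta> \<le> t \<Longrightarrow> \<zeta> t = 0"
    and \<eta>: "0 < \<eta>" "\<eta> < T"
  shows "- (LINT z|lborel. \<zeta>' (fst z) * energy z) - K * (LINT z|lborel. \<zeta> (fst z) * energy z)
    \<le> 2 * (LINT z|lborel. (\<zeta> (fst z) * fL z) * W z) + \<zeta> 0 * (\<rho>L * (LINT x|lborel. (v2 x)\<^sup>2)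
      - DL * ((LINT x|lborel. v1 x * pd e1 (pd e1 v1) x) + (LINT x|lborel. v1 x * pd e2 (pd e2 v1) x)))"
proof -
  have zc: "continuous_on UNIV \<zeta>" using z(1) by (auto intro!: continuous_at_imp_continuous_on DERIV_isCont)
  have za: "\<bar>\<zeta> t\<bar> \<le> Z" for t using z(3)[of t] z(4)[of t] by simp
  \<comment> \<open>The denominator n + 2 makes every step positive and strictly smaller than
    \<eta>.\<close>
  define \<delta> where "\<delta> n = \<eta> / (real n + 2)" for n
  have d0: "0 < \<delta> n" for n using \<eta> by (simp add: \<delta>_def)
  have d1: "\<delta> n < \<eta>" for n
  proof -
    have "\<eta> * 1 < \<eta> * (real n + 2)" using \<eta> by (intro mult_strict_left_mono) auto
    then show ?thesis using \<eta> by (simp add: \<delta>_def divide_less_eq)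
  qed
  have dT: "\<delta> n < T" for n using d1[of n] \<eta> by simp
  have dl: "\<delta> \<longlonglongrightarrow> 0"
    using LIMSEQ_ignore_initial_segment[OF lim_const_over_n[of \<eta>], of 2] unfolding \<delta>_def[abs_def] by (simp add: add.commute)
  let ?I = "\<lambda>f k n. 1 / (2 * \<delta> n) * (LINT z|lborel. indicator {0<..<\<delta> n} (fst z) * (\<zeta> (fst z) * k z * (f z * f (z - (\<delta> n, 0)))))"
  have mT: "t \<notin> {0<..<T} \<Longrightarrow> m (t, x) = 0" "t \<notin> {0<..<T} \<Longrightarrow> a (t, x) = 0" for t x
    using m_outside[of "(t, x)"] by auto
  note cdm = centred_difference_limit[where T=T and K=K and \<delta>=\<delta> and \<eta>=\<eta>, OF _ mm m0 mT(1) mL K0 z d0 d1 dl]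
  note cda = centred_difference_limit[where T=T and K=K and \<delta>=\<delta> and \<eta>=\<eta>, OF _ am a0 mT(2) aL K0 z d0 d1 dl]
  obtain P0 S0 where P0: "P0 \<longlonglongrightarrow> 1 / 2 * (LINT z|lborel. \<zeta>' (fst z) * m z * (W z)\<^sup>2)"
    and S0: "S0 \<longlonglongrightarrow> K / 2 * (LINT z|lborel. \<zeta> (fst z) * m z * (W z)\<^sup>2)"
    and b0: "\<forall>n. abs (1 / (2 * \<delta> n) * ((LINT z|lborel. \<zeta> (fst z) * m z * (W z * (W (z + (\<delta> n, 0)) - W (z - (\<delta> n, 0)))))
        + (LINT z|lborel. indicator {0<..<\<delta> n} (fst z) * (\<zeta> (fst z) * m z * (W z * W (z - (\<delta> n, 0)))))) + P0 n) \<le> S0 n"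
    using cdm[OF W_L2] by blast
  obtain P1 S1 where P1: "P1 \<longlonglongrightarrow> 1 / 2 * (LINT z|lborel. \<zeta>' (fst z) * a z * (Gr e1 z)\<^sup>2)"
    and S1: "S1 \<longlonglongrightarrow> K / 2 * (LINT z|lborel. \<zeta> (fst z) * a z * (Gr e1 z)\<^sup>2)"
    and b1: "\<forall>n. abs (1 / (2 * \<delta> n) * ((LINT z|lborel. \<zeta> (fst z) * a z * (Gr e1 z * (Gr e1 (z + (\<delta> n, 0)) - Gr e1 (z - (\<delta> n, 0)))))
        + (LINT z|lborel. indicator {0<..<\<delta> n} (fst z) * (\<zeta> (fst z) * a z * (Gr e1 z * Gr e1 (z - (\<delta> n, 0)))))) + P1 n) \<le> S1 n"
    using cda[OF Gr_L2[OF basis(1)]] by blast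
  obtain P2 S2 where P2: "P2 \<longlonglongrightarrow> 1 / 2 * (LINT z|lborel. \<zeta>' (fst z) * a z * (Gr e2 z)\<^sup>2)"
    and S2: "S2 \<longlonglongrightarrow> K / 2 * (LINT z|lborel. \<zeta> (fst z) * a z * (Gr e2 z)\<^sup>2)"
    and b2: "\<forall>n. abs (1 / (2 * \<delta> n) * ((LINT z|lborel. \<zeta> (fst z) * a z * (Gr e2 z * (Gr e2 (z + (\<delta> n, 0)) - Gr e2 (z - (\<delta> n, 0)))))
        + (LINT z|lborel. indicator {0<..<\<delta> n} (fst z) * (\<zeta> (fst z) * a z * (Gr e2 z * Gr e2 (z - (\<delta> n, 0)))))) + P2 n) \<le> S2 n"
    using cda[OF Gr_L2[OF basis(2)]] by blast
  note c0 = b0[unfolded distrib_left, folded centred_def] and c1 = b1[unfolded distrib_left, folded centred_def]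
    and c2 = b2[unfolded distrib_left, folded centred_def]
  define A where "A n = (LINT z|lborel. (\<zeta>' (fst z) * m z * W z) * time_average (\<delta> n) W z)" for n
  define F where "F n = (LINT z|lborel. (\<zeta> (fst z) * fL z) * time_average (\<delta> n) W z)" for n
  \<comment> \<open>The initial term is paired with the kinetic slab term, because it is their
    difference that converges.\<close>
  define D where "D n = \<rho>L * \<zeta> 0 * (1 / (2 * \<delta> n)) * (LINT z|lborel. indicator {-\<delta> n<..<\<delta> n} (fst z) * (v2 (snd z) * W z)) - ?I W m n" for n
  have h1: "square_integrable (\<lambda>z. \<zeta>' (fst z) * m z * W z)"
  proof (rule square_integrable_bounded_mult[OF W_L2])
    show "(\<lambda>z. \<zeta>' (fst z) * m z) \<in> borel_measurable lborel" by (rule borel_measurable_times[OF measurable_of_time[OF z(2)] mm])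
    show "\<bar>\<zeta>' (fst z) * m z\<bar> \<le> Z' * Mm" for z
      unfolding abs_mult using z(5)[of "fst z"] m_abs(1)[of z] by (intro mult_mono) auto
  qed
  have h2: "square_integrable (\<lambda>z. \<zeta> (fst z) * fL z)"
    by (rule square_integrable_bounded_mult[OF fL_props(1) measurable_of_time[OF zc] za])
  have Al: "A \<longlonglongrightarrow> (LINT z|lborel. \<zeta>' (fst z) * m z * (W z)\<^sup>2)"
    unfolding A_def using time_average_tendsto[OF h1 W_L2 d0 dl] by (simp add: power2_eq_square mult.assoc)
  have Fl: "F \<longlonglongrightarrow> (LINT z|lborel. (\<zeta> (fst z) * fL z) * W z)"
    unfolding F_def by (rule time_average_tendsto[OF h2 W_L2 d0 dl])
  have Dl: "D \<longlonglongrightarrow> 1 / 2 * \<rho>L * \<zeta> 0 * (LINT x|lborel. (v2 x)\<^sup>2)"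
    unfolding D_def by (rule initial_velocity_limit[OF z(1) za z(5) d0 dT dl])
  have Il: "?I (Gr b) a \<longlonglongrightarrow> - (1 / 2 * DL * \<zeta> 0 * (LINT x|lborel. v1 x * pd b (pd b v1) x))" if "b \<in> Basis" for b
    by (rule initial_gradient_limit[OF z(1) za z(5) d0 dT dl that])
  \<comment> \<open>The identity combined with one side of each of the three bounds, arranged so
    that X n \<le> 0; the kinetic slab term is contained in \<open>D n\<close>.\<close>
  define X where "X n = - A n + P0 n - P1 n - P2 n - F n - D n - ?I (Gr e1) a n - ?I (Gr e2) a n - (S0 n + S1 n + S2 n)" for n
  have "X n \<le> 0" for n
  proof -
    have id: "- (A n + centred W m \<zeta> (\<delta> n)) + (centred (Gr e1) a \<zeta> (\<delta> n) + centred (Gr e2) a \<zeta> (\<delta> n)) = F n + (D n + ?I W m n)"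
      using discrete_identity[OF z(1,2) za z(5,6) d0 d1 \<eta>(2), of n] unfolding A_def F_def D_def by simp
    show ?thesis
      using id c0[THEN spec, of n] c1[THEN spec, of n] c2[THEN spec, of n] unfolding X_def abs_le_iff by linarith
  qed
  moreover have "X \<longlonglongrightarrow> - (LINT z|lborel. \<zeta>' (fst z) * m z * (W z)\<^sup>2) + 1 / 2 * (LINT z|lborel. \<zeta>' (fst z) * m z * (W z)\<^sup>2)
     - 1 / 2 * (LINT z|lborel. \<zeta>' (fst z) * a z * (Gr e1 z)\<^sup>2) - 1 / 2 * (LINT z|lborel. \<zeta>' (fst z) * a z * (Gr e2 z)\<^sup>2)
     - (LINT z|lborel. (\<zeta> (fst z) * fL z) * W z) - 1 / 2 * \<rho>L * \<zeta> 0 * (LINT x|lborel. (v2 x)\<^sup>2)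
     - - (1 / 2 * DL * \<zeta> 0 * (LINT x|lborel. v1 x * pd e1 (pd e1 v1) x)) - - (1 / 2 * DL * \<zeta> 0 * (LINT x|lborel. v1 x * pd e2 (pd e2 v1) x))
     - (K / 2 * (LINT z|lborel. \<zeta> (fst z) * m z * (W z)\<^sup>2) + K / 2 * (LINT z|lborel. \<zeta> (fst z) * a z * (Gr e1 z)\<^sup>2)
       + K / 2 * (LINT z|lborel. \<zeta> (fst z) * a z * (Gr e2 z)\<^sup>2))" (is "_ \<longlonglongrightarrow> ?L")
    unfolding X_def
    by (intro tendsto_diff tendsto_add tendsto_minus Al Fl Dl P0 P1 P2 S0 S1 S2 Il[OF basis(1)] Il[OF basis(2)])
  ultimately have "?L \<le> 0" by (intro LIMSEQ_le_const2[of X]) auto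
  then show ?thesis
    unfolding weighted_energy_integral(2)[OF z(2,5)] weighted_energy_integral(2)[OF zc za]
    by (simp add: algebra_simps)
qed

text \<open>Built from the data and the constants of the left part, without \<epsilon>: the source
  as it comes out of Young's inequality, the initial kinetic energy, and the initial gradient energy
  with its second-derivative integrals in absolute value.\<close>

definition "data_bound = (LINT z|lborel. (fL z)\<^sup>2) / \<rho>L + \<rho>L * (LINT x|lborel. (v2 x)\<^sup>2)
  + DL * (\<bar>LINT x|lborel. v1 x * pd e1 (pd e1 v1) x\<bar> + \<bar>LINT x|lborel. v1 x * pd e2 (pd e2 v1) x\<bar>)"

text \<open>Since \<open>fL\<close> lives where \<open>m\<close> is \<open>\<rho>L\<close>, Young's
  inequality bounds the source term by \<open>(fL z)\<^sup>2 / \<rho>L\<close> plus the energy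
  itself. This additional energy raises the rate from \<open>K\<close> to \<open>K + 1\<close>, and
  the weight is built for that rate.\<close>

lemma weighted_energy_bound:
  assumes g: "continuous_on UNIV g" "\<And>t. 0 \<le> g t" "\<And>t. g t \<le> 1"
    and \<eta>: "0 < \<eta>" "\<eta> < T" and g0: "\<And>t. t \<le> 0 \<Longrightarrow> g t = 0" and gT: "\<And>t. T - \<eta> \<le> t \<Longrightarrow> g t = 0"
  shows "exp (- ((K + 1) * (1 + T\<^sup>2) * (pi / 2))) * (LINT z|lborel. g (fst z) * energy z) \<le> data_bound * (LINT t|lborel. g t)"
proof -
  let ?c = "exp (- ((K + 1) * (1 + T\<^sup>2) * (pi / 2)))"
  have K1: "0 \<le> K + 1" using K0 by simp
  obtain \<zeta> \<zeta>' Z Z' where ZZ: "\<forall>t. (\<zeta> has_real_derivative \<zeta>' t) (at t)" "continuous_on UNIV \<zeta>'" "\<forall>t. 0 \<le> \<zeta> t" "\<forall>t. \<zeta> t \<le> Z"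
    "\<forall>t. \<bar>\<zeta>' t\<bar> \<le> Z'" "\<forall>t. T - \<eta> \<le> t \<longrightarrow> \<zeta> t = 0" and z0: "\<zeta> 0 = (LINT t|lborel. g t)" and zmax: "\<forall>t\<ge>0. \<zeta> t \<le> \<zeta> 0"
    and dec: "\<forall>t\<in>{0<..<T}. ?c * g t \<le> - \<zeta>' t - (K + 1) * \<zeta> t"
    using decreasing_weight_exists[OF T K1 g \<eta> g0 gT] by blast
  note z = ZZ(1)[THEN spec] ZZ(2) ZZ(3)[THEN spec] ZZ(4)[THEN spec] ZZ(5)[THEN spec] ZZ(6)[THEN spec, THEN mp]
  have zc: "continuous_on UNIV \<zeta>" using z(1) by (auto intro!: continuous_at_imp_continuous_on DERIV_isCont)
  have za: "\<bar>\<zeta> t\<bar> \<le> Z" for t using z(3)[of t] z(4)[of t] by simp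
  have ga: "\<bar>g t\<bar> \<le> 1" for t using g(2,3)[of t] by simp
  note ie = weighted_energy_integral(1)[OF zc za] and ie' = weighted_energy_integral(1)[OF z(2,5)] and ig = weighted_energy_integral(1)[OF g(1) ga]
  have source: "2 * (LINT z|lborel. (\<zeta> (fst z) * fL z) * W z) \<le> \<zeta> 0 / \<rho>L * (LINT z|lborel. (fL z)\<^sup>2) + (LINT z|lborel. \<zeta> (fst z) * energy z)"
  proof -
    have i1: "integrable lborel (\<lambda>z. (\<zeta> (fst z) * fL z) * W z)"
      by (rule square_integrable_mult[OF square_integrable_bounded_mult[OF fL_props(1) measurable_of_time[OF zc] za] W_L2])
    have i2: "integrable lborel (\<lambda>z. (fL z)\<^sup>2)" by (rule square_integrableD(3)[OF fL_props(1)])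
    have "(LINT z|lborel. 2 * ((\<zeta> (fst z) * fL z) * W z)) \<le> (LINT z|lborel. \<zeta> 0 / \<rho>L * (fL z)\<^sup>2 + \<zeta> (fst z) * energy z)"
    proof (rule integral_mono[OF integrable_mult_right[OF i1] Bochner_Integration.integrable_add[OF integrable_mult_right[OF i2] ie]])
      fix z :: "real \<times> real \<times> real"
      obtain t x where zz: "z = (t, x)" by (cases z)
      show "2 * ((\<zeta> (fst z) * fL z) * W z) \<le> \<zeta> 0 / \<rho>L * (fL z)\<^sup>2 + \<zeta> (fst z) * energy z"
      proof (cases "fL z = 0")
        case True
        then show ?thesis using z(3)[of "fst z"] energy_props(2)[of z] by simp
      next
        case False
        then have "z \<in> {0<..<T} \<times> Omega_L l h \<epsilon>" using fLs supp_superset[of fL z] by auto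
        then have t: "0 < t" "t < T" and x: "x \<in> Omega_L l h \<epsilon>" by (auto simp: zz)
        have mz: "m z = \<rho>L" using m_left[of t x] t x by (simp add: zz)
        have "0 \<le> (fL z - \<rho>L * W z)\<^sup>2" by simp
        then have "2 * (fL z * W z) * \<rho>L \<le> (fL z)\<^sup>2 + \<rho>L * (W z)\<^sup>2 * \<rho>L"
          by (simp add: power2_eq_square algebra_simps)
        then have "2 * (fL z * W z) \<le> (fL z)\<^sup>2 / \<rho>L + \<rho>L * (W z)\<^sup>2"
          using \<rho>L by (simp add: field_simps)
        also have "\<rho>L * (W z)\<^sup>2 \<le> energy z" unfolding energy_def mz using a0(1)[of z] by simp
        finally have "2 * (fL z * W z) \<le> (fL z)\<^sup>2 / \<rho>L + energy z" by simp
        from mult_left_mono[OF this z(3)[of t]] have "2 * (\<zeta> t * fL z * W z) \<le> \<zeta> t * ((fL z)\<^sup>2 / \<rho>L) + \<zeta> t * energy z"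
          by (simp add: algebra_simps)
        \<comment> \<open>Passing from \<open>\<zeta> t\<close> to \<open>\<zeta> 0\<close> makes
          all data terms proportional to the integral of \<open>g\<close>.\<close>
        moreover have "\<zeta> t * ((fL z)\<^sup>2 / \<rho>L) \<le> \<zeta> 0 * ((fL z)\<^sup>2 / \<rho>L)"
          using zmax t \<rho>L by (intro mult_right_mono) auto
        ultimately show ?thesis by (simp add: zz)
      qed
    qed
    then show ?thesis using i1 i2 ie by simp
  qed
  have "?c * (LINT z|lborel. g (fst z) * energy z) = (LINT z|lborel. ?c * (g (fst z) * energy z))" by simp
  also have "\<dots> \<le> (LINT z|lborel. - (\<zeta>' (fst z) * energy z) - (K + 1) * (\<zeta> (fst z) * energy z))"
  proof (rule integral_mono)
    show "integrable lborel (\<lambda>z. ?c * (g (fst z) * energy z))" by (rule integrable_mult_right[OF ig])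
    show "integrable lborel (\<lambda>z. - (\<zeta>' (fst z) * energy z) - (K + 1) * (\<zeta> (fst z) * energy z))"
      by (intro Bochner_Integration.integrable_diff Bochner_Integration.integrable_minus integrable_mult_right ie ie')
    fix z :: "real \<times> real \<times> real"
    show "?c * (g (fst z) * energy z) \<le> - (\<zeta>' (fst z) * energy z) - (K + 1) * (\<zeta> (fst z) * energy z)"
    proof (cases "z \<in> Q")
      case True
      then have "?c * g (fst z) \<le> - \<zeta>' (fst z) - (K + 1) * \<zeta> (fst z)" using dec by auto
      from mult_right_mono[OF this energy_props(2)[of z]] show ?thesis by (simp add: algebra_simps)
    qed (simp add: energy_props(3))
  qed
  also have "\<dots> = - (LINT z|lborel. \<zeta>' (fst z) * energy z) - (K + 1) * (LINT z|lborel. \<zeta> (fst z) * energy z)"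
    using ie ie' by simp
  also have "\<dots> \<le> \<zeta> 0 / \<rho>L * (LINT z|lborel. (fL z)\<^sup>2) + \<zeta> 0 * (\<rho>L * (LINT x|lborel. (v2 x)\<^sup>2)
      - DL * ((LINT x|lborel. v1 x * pd e1 (pd e1 v1) x) + (LINT x|lborel. v1 x * pd e2 (pd e2 v1) x)))"
    using energy_inequality[OF z \<eta>] source by (simp add: algebra_simps)
  also have "\<dots> \<le> \<zeta> 0 * data_bound"
  proof -
    have "- (DL * (p + q)) \<le> DL * (\<bar>p\<bar> + \<bar>q\<bar>)" for p q :: real
      using mult_left_mono[of "- (p + q)" "\<bar>p\<bar> + \<bar>q\<bar>" DL] DL by (simp add: algebra_simps)
    note this[of "LINT x|lborel. v1 x * pd e1 (pd e1 v1) x" "LINT x|lborel. v1 x * pd e2 (pd e2 v1) x"]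
    then have "(LINT z|lborel. (fL z)\<^sup>2) / \<rho>L + (\<rho>L * (LINT x|lborel. (v2 x)\<^sup>2)
      - DL * ((LINT x|lborel. v1 x * pd e1 (pd e1 v1) x) + (LINT x|lborel. v1 x * pd e2 (pd e2 v1) x))) \<le> data_bound"
      unfolding data_bound_def by simp
    from mult_left_mono[OF this z(3)[of 0]] show ?thesis by (simp add: algebra_simps)
  qed
  finally show ?thesis unfolding z0 by (simp add: mult.commute)
qed

lemma energy_bound:
  "AE t in lborel. t \<in> {0<..<T} \<longrightarrow> (LINT x|lborel. energy (t, x)) \<le> data_bound / exp (- ((K + 1) * (1 + T\<^sup>2) * (pi / 2)))"
proof (rule AE_le_of_weighted_integrals[OF T lborel_pair_integral(5)[OF energy_props(1)]])
  fix g :: "real \<Rightarrow> real" and \<eta>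
  assume g: "continuous_on UNIV g" "\<And>t. 0 \<le> g t" "\<And>t. g t \<le> 1" "0 < \<eta>" "\<eta> < T"
    "\<And>t. t \<le> 0 \<Longrightarrow> g t = 0" "\<And>t. T - \<eta> \<le> t \<Longrightarrow> g t = 0"
  have ga: "\<bar>g t\<bar> \<le> 1" for t using g(2,3)[of t] by simp
  have "(LINT t|lborel. g t * (LINT x|lborel. energy (t, x))) = (LINT z|lborel. g (fst z) * energy z)"
    using lborel_pair_integral(1)[OF weighted_energy_integral(1)[OF g(1) ga]] by simp
  then show "(LINT t|lborel. g t * (LINT x|lborel. energy (t, x))) \<le> data_bound / exp (- ((K + 1) * (1 + T\<^sup>2) * (pi / 2))) * (LINT t|lborel. g t)"
    using weighted_energy_bound[OF g] by (simp add: field_simps)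
qed

end

section \<open>From the energy to the norms\<close>

text \<open>\<open>esssup_I\<close> asks for measurability in time of the slice norms. It comes from
  Tonelli for the jointly measurable function \<open>F\<close>, which agrees with the squared norm
  of \<open>g\<close> over \<open>S\<close>.\<close>

lemma LinfL2norm_le:
  fixes g :: "real \<Rightarrow> real \<times> real \<Rightarrow> 'b::euclidean_space"
  assumes g: "L2_L2 T S0 g" and Q: "{0<..<T} \<times> S0 \<in> sets borel" and S: "S \<in> sets borel" "S \<subseteq> S0"
    and bound: "AE t in lborel. t \<in> {0<..<T} \<longrightarrow> (LINT x|lborel. indicator S x * (norm (g t x))\<^sup>2) \<le> B" and B: "0 \<le> B"
  shows "LinfL2norm T S g \<le> ennreal (sqrt B)"
proof -
  define F where "F z = indicator S (snd z) * (norm (indicat_real ({0<..<T} \<times> S0) z *\<^sub>R g (fst z) (snd z)))\<^sup>2" for z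
  have Fi: "integrable lborel F"
    unfolding F_def[abs_def]
  proof (rule integrable_bounded_mult[where B=1])
    show "integrable lborel (\<lambda>z. (norm (indicat_real ({0<..<T} \<times> S0) z *\<^sub>R g (fst z) (snd z)))\<^sup>2)"
      using g unfolding L2_L2_def case_prod_beta' L2_on_iff[OF Q] by blast
    show "(\<lambda>z :: real \<times> real \<times> real. indicat_real S (snd z)) \<in> borel_measurable lborel" by (rule borel_measurable_indicator_snd[OF S(1)])
  qed auto
  have Ft: "F (t, x) = indicator S x * (norm (g t x))\<^sup>2" if "t \<in> {0<..<T}" for t x
    using that S(2) by (auto simp: F_def indicator_def)
  define I where "I t = (\<integral>\<^sup>+x. ennreal (F (t, x)) \<partial>lborel)" for t
  have "(\<lambda>z. ennreal (F z)) \<in> borel_measurable (lborel \<Otimes>\<^sub>M lborel)"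
    using borel_measurable_integrable[OF Fi] by (simp add: lborel_prod)
  then have Im: "I \<in> borel_measurable lborel"
    unfolding I_def using lborel.borel_measurable_nn_integral[of "\<lambda>t x. ennreal (F (t, x))" lborel] by simp
  have It: "(\<integral>\<^sup>+x\<in>S. ennreal ((norm (g t x))\<^sup>2) \<partial>lborel) = I t" if "t \<in> {0<..<T}" for t
    unfolding I_def Ft[OF that] by (intro nn_integral_cong) (auto simp: indicator_def)
  show ?thesis
    unfolding LinfL2norm_def
  proof (rule esssup_I)
    have "(\<lambda>t. if I t = \<infinity> then \<infinity> else ennreal (sqrt (enn2real (I t)))) \<in> borel_measurable (restrict_space lborel {0<..<T})"
      by (rule measurable_restrict_space1) (use Im in measurable)
    also have "?this \<longleftrightarrow> (\<lambda>t. L2norm S (g t)) \<in> borel_measurable (restrict_space lborel {0<..<T})"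
      by (rule measurable_cong) (use It in \<open>simp add: space_restrict_space L2norm_def Let_def\<close>)
    finally show "(\<lambda>t. L2norm S (g t)) \<in> borel_measurable (restrict_space lborel {0<..<T})" .
    have "AE t in lborel. t \<in> {0<..<T} \<longrightarrow> L2norm S (g t) \<le> ennreal (sqrt B)"
      using bound lborel_pair_integral(3)[OF Fi]
    proof eventually_elim
      case (elim t)
      show ?case
      proof
        assume t: "t \<in> {0<..<T}"
        show "L2norm S (g t) \<le> ennreal (sqrt B)"
        proof (rule L2norm_le[OF _ B])
          have "I t = ennreal (LINT x|lborel. F (t, x))"
            unfolding I_def by (rule nn_integral_eq_integral[OF elim(2)]) (simp add: F_def)
          also have "\<dots> \<le> ennreal B" using elim(1) t by (intro ennreal_leI) (simp add: Ft)
          finally show "(\<integral>\<^sup>+x\<in>S. ennreal ((norm (g t x))\<^sup>2) \<partial>lborel) \<le> ennreal B" unfolding It[OF t] .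
        qed
      qed
    qed
    then show "AE t in restrict_space lborel {0<..<T}. L2norm S (g t) \<le> ennreal (sqrt B)"
      by (subst AE_restrict_space_iff) auto
  qed
qed

text \<open>In the layer a factor \<epsilon> under the root balances the weight 1 / sqrt
  \<epsilon>.\<close>

lemma scaled_norm_le:
  assumes "0 < \<epsilon>" "0 \<le> A" "0 \<le> B" "0 \<le> D"
    and "LinfL2norm T (Omega_L l h \<epsilon>) g \<le> ennreal A" "LinfL2norm T (Omega_R l h \<epsilon>) g \<le> ennreal B"
    and "LinfL2norm T (Omega_M h \<epsilon>) g \<le> ennreal (sqrt (\<epsilon> * D))"
  shows "scaled_norm l h T \<epsilon> g \<le> ennreal (A + B + sqrt D)"
proof -
  have "ennreal (1 / sqrt \<epsilon>) * LinfL2norm T (Omega_M h \<epsilon>) g \<le> ennreal (1 / sqrt \<epsilon>) * ennreal (sqrt (\<epsilon> * D))"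
    by (intro mult_left_mono assms) simp
  also have "\<dots> = ennreal (sqrt D)"
    using assms(1) by (simp add: ennreal_mult'[symmetric] real_sqrt_mult)
  finally have M: "ennreal (1 / sqrt \<epsilon>) * LinfL2norm T (Omega_M h \<epsilon>) g \<le> ennreal (sqrt D)" .
  have "scaled_norm l h T \<epsilon> g \<le> (ennreal A + ennreal B) + ennreal (sqrt D)"
    unfolding scaled_norm_def by (intro add_mono assms M)
  also have "\<dots> = ennreal (A + B + sqrt D)" using assms by (simp add: ennreal_plus)
  finally show ?thesis .
qed

context wave_solution begin

definition "energy_constant = data_bound / exp (- ((K + 1) * (1 + T\<^sup>2) * (pi / 2)))"

lemma energy_constant_nonneg: "0 \<le> energy_constant"
  unfolding energy_constant_def data_bound_def using \<rho>L DL by simp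

lemma energy_density_integral_le:
  assumes c: "0 < c" and f: "integrable lborel f" "\<And>z. z \<in> Q \<Longrightarrow> c * f z \<le> energy z"
  shows "AE t in lborel. t \<in> {0<..<T} \<longrightarrow> (LINT x|lborel. indicator (Omega l h) x * f (t, x)) \<le> energy_constant / c"
  using energy_bound lborel_pair_integral(3)[OF energy_props(1)] lborel_pair_integral(3)[OF f(1)]
proof eventually_elim
  case (elim t)
  show ?case
  proof
    assume t: "t \<in> {0<..<T}"
    have i: "integrable lborel (\<lambda>x. indicator (Omega l h) x * f (t, x))"
      by (rule integrable_bounded_mult[OF elim(3), where B=1]) (use O(1) in auto)
    have "c * (LINT x|lborel. indicator (Omega l h) x * f (t, x)) = (LINT x|lborel. c * (indicator (Omega l h) x * f (t, x)))" by simp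
    also have "\<dots> \<le> (LINT x|lborel. energy (t, x))"
    proof (rule integral_mono[OF integrable_mult_right[OF i] elim(2)])
      fix x
      show "c * (indicator (Omega l h) x * f (t, x)) \<le> energy (t, x)"
        using f(2)[of "(t, x)"] energy_props(2)[of "(t, x)"] t by (cases "x \<in> Omega l h") auto
    qed
    also have "\<dots> \<le> energy_constant" using elim(1) t by (simp add: energy_constant_def)
    finally show "(LINT x|lborel. indicator (Omega l h) x * f (t, x)) \<le> energy_constant / c"
      using c by (simp add: field_simps)
  qed
qed

text \<open>Applied with a constant \<open>c\<close> on the outer parts and with \<open>c\<close> of
  order 1/\<epsilon> in the layer, where the right side is then of order \<epsilon>.\<close>

lemma velocity_slices:
  assumes S: "S \<in> sets borel" "S \<subseteq> Omega l h" and c: "0 < c" "\<And>t x. t \<in> {0<..<T} \<Longrightarrow> x \<in> S \<Longrightarrow> c \<le> m (t, x)"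
  shows "AE t in lborel. t \<in> {0<..<T} \<longrightarrow> (LINT x|lborel. indicator S x * (w (t, x))\<^sup>2) \<le> energy_constant / c"
proof -
  let ?f = "\<lambda>z. indicator S (snd z) * (w z)\<^sup>2"
  have "integrable lborel ?f"
    by (rule integrable_bounded_mult[OF square_integrableD(3)[OF w_L2] borel_measurable_indicator_snd[OF S(1)], where B=1]) auto
  moreover have "c * ?f z \<le> energy z" if "z \<in> Q" for z
  proof (cases "snd z \<in> S")
    case True
    then have "c \<le> m z" using c(2)[of "fst z" "snd z"] that by auto
    then have "c * (w z)\<^sup>2 \<le> m z * (W z)\<^sup>2"
      using W_on_Q(1)[OF that] that by (simp add: w_def mult_right_mono)
    then show ?thesis using True a0(1)[of z] by (simp add: energy_def add_increasing2)
  qed (simp add: energy_props(2))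
  ultimately have "AE t in lborel. t \<in> {0<..<T} \<longrightarrow> (LINT x|lborel. indicator (Omega l h) x * ?f (t, x)) \<le> energy_constant / c"
    by (rule energy_density_integral_le[OF c(1)])
  moreover have e: "indicator (Omega l h) x * ?f (t, x) = indicator S x * (w (t, x))\<^sup>2" for t x
    using S(2) by (auto simp: indicator_def)
  ultimately show ?thesis by (simp only: e)
qed

lemma velocity_bound:
  assumes S: "S \<in> sets borel" "S \<subseteq> Omega l h" and c: "0 < c" "\<And>t x. t \<in> {0<..<T} \<Longrightarrow> x \<in> S \<Longrightarrow> c \<le> m (t, x)"
  shows "LinfL2norm T S ut \<le> ennreal (sqrt (energy_constant / c))"
proof (rule LinfL2norm_le[OF _ Q_props(1) S])
  have slices: "AE t in lborel. t \<in> {0<..<T} \<longrightarrow> (LINT x|lborel. indicator S x * (w (t, x))\<^sup>2) \<le> energy_constant / c"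
    by (rule velocity_slices[OF assms])
  show "L2_L2 T (Omega l h) ut" using ut by (simp add: has_time_derivative_def)
  show "0 \<le> energy_constant / c" using energy_constant_nonneg c by simp
  have e: "indicator S x * (norm (ut t x))\<^sup>2 = indicator S x * (w (t, x))\<^sup>2" if "t \<in> {0<..<T}" for t x
    using that S(2) by (auto simp: w_def indicator_def)
  show "AE t in lborel. t \<in> {0<..<T} \<longrightarrow> (LINT x|lborel. indicator S x * (norm (ut t x))\<^sup>2) \<le> energy_constant / c"
    using slices by eventually_elim (simp only: e simp_thms cong: imp_cong)
qed

lemma gradient_bound:
  assumes S: "S \<in> sets borel" "S \<subseteq> Omega l h" and c: "0 < c" "\<And>t x. t \<in> {0<..<T} \<Longrightarrow> x \<in> S \<Longrightarrow> c \<le> a (t, x)"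
  shows "LinfL2norm T S Gu \<le> ennreal (sqrt (energy_constant / c))"
proof (rule LinfL2norm_le[OF _ Q_props(1) S])
  show "L2_L2 T (Omega l h) Gu" using uH1 by (simp add: L2_H1_periodic_def)
  show "0 \<le> energy_constant / c" using energy_constant_nonneg c by simp
  let ?f = "\<lambda>z. indicator S (snd z) * ((Gr e1 z)\<^sup>2 + (Gr e2 z)\<^sup>2)"
  have "integrable lborel ?f"
    by (rule integrable_bounded_mult[OF Bochner_Integration.integrable_add[OF square_integrableD(3)[OF Gr_L2] square_integrableD(3)[OF Gr_L2]]
      borel_measurable_indicator_snd[OF S(1)], where B=1]) auto
  moreover have "c * ?f z \<le> energy z" if "z \<in> Q" for z
  proof (cases "snd z \<in> S")
    case True
    then have "c \<le> a z" using c(2)[of "fst z" "snd z"] that by auto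
    then have "c * ((Gr e1 z)\<^sup>2 + (Gr e2 z)\<^sup>2) \<le> a z * ((Gr e1 z)\<^sup>2 + (Gr e2 z)\<^sup>2)" by (intro mult_right_mono) auto
    then show ?thesis using True m0(1)[of z] by (simp add: energy_def add_increasing distrib_left)
  qed (simp add: energy_props(2))
  ultimately have "AE t in lborel. t \<in> {0<..<T} \<longrightarrow> (LINT x|lborel. indicator (Omega l h) x * ?f (t, x)) \<le> energy_constant / c"
    by (rule energy_density_integral_le[OF c(1)])
  moreover have e: "indicator (Omega l h) x * ?f (t, x) = indicator S x * (norm (Gu t x))\<^sup>2" if "t \<in> {0<..<T}" for t x
  proof (cases "x \<in> S")
    case True
    then have q: "(t, x) \<in> Q" using that S(2) by auto
    show ?thesis using True S(2) W_on_Q(2)[OF q, of e1] W_on_Q(2)[OF q, of e2]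
      by (cases "Gu t x") (auto simp: inner_prod_def norm_Pair)
  qed simp
  ultimately show "AE t in lborel. t \<in> {0<..<T} \<longrightarrow> (LINT x|lborel. indicator S x * (norm (Gu t x))\<^sup>2) \<le> energy_constant / c"
    by eventually_elim (simp only: e)
qed

text \<open>The solution is \<open>v1\<close> plus the primitive of \<open>w\<close>. One factor T
  comes from Cauchy-Schwarz in time, the other from integrating the velocity bound over (0, T). The
  integral of \<open>v1\<close> is kept over \<open>S\<close> because it vanishes in the layer,
  where the other term is of order \<epsilon>.\<close>

lemma solution_bound:
  assumes S: "S \<in> sets borel" "S \<subseteq> Omega l h" and c: "0 < c" "\<And>t x. t \<in> {0<..<T} \<Longrightarrow> x \<in> S \<Longrightarrow> c \<le> m (t, x)"
  shows "LinfL2norm T S u \<le> ennreal (sqrt (2 * (LINT x|lborel. indicator S x * (v1 x)\<^sup>2) + 2 * T\<^sup>2 * energy_constant / c))"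
proof (rule LinfL2norm_le[OF _ Q_props(1) S])
  have slices: "AE t in lborel. t \<in> {0<..<T} \<longrightarrow> (LINT x|lborel. indicator S x * (w (t, x))\<^sup>2) \<le> energy_constant / c"
    by (rule velocity_slices[OF assms])
  have v1sq: "integrable lborel (\<lambda>x. (v1 x)\<^sup>2)" using compact_C[OF v1] square_integrableD(3) by blast
  have v1i: "integrable lborel (\<lambda>x. indicator S x * (v1 x)\<^sup>2)"
    by (rule integrable_bounded_mult[OF v1sq, where B=1]) (use S(1) in auto)
  show "L2_L2 T (Omega l h) u" using uH1 by (simp add: L2_H1_periodic_def)
  show "0 \<le> 2 * (LINT x|lborel. indicator S x * (v1 x)\<^sup>2) + 2 * T\<^sup>2 * energy_constant / c"
    using energy_constant_nonneg c by (intro add_nonneg_nonneg mult_nonneg_nonneg divide_nonneg_pos Bochner_Integration.integral_nonneg) auto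
  let ?f = "\<lambda>z. indicator S (snd z) * (w z)\<^sup>2"
  have fi: "integrable lborel ?f"
    by (rule integrable_bounded_mult[OF square_integrableD(3)[OF w_L2] borel_measurable_indicator_snd[OF S(1)], where B=1]) auto
  define R where "R x = (LINT s|lborel. ?f (s, x))" for x
  have R0: "0 \<le> R x" for x unfolding R_def by (intro Bochner_Integration.integral_nonneg) simp
  have Ri: "integrable lborel R" unfolding R_def by (rule lborel_pair_integral(6)[OF fi])
  \<comment> \<open>Exchanging the integrals turns the bound at almost every time into a bound of
    the space integral of \<open>R\<close>; outside (0, T) \<open>w\<close> vanishes.\<close>
  have Rle: "(LINT x|lborel. R x) \<le> T * (energy_constant / c)"
  proof -
    have "(LINT x|lborel. R x) = (LINT t|lborel. LINT x|lborel. ?f (t, x))"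
      unfolding R_def using lborel_pair_integral(1,2)[OF fi] by simp
    also have "\<dots> \<le> (LINT t|lborel. energy_constant / c * indicat_real {0<..<T} t)"
    proof (rule integral_mono_AE[OF lborel_pair_integral(5)[OF fi]])
      show "integrable lborel (\<lambda>t. energy_constant / c * indicat_real {0<..<T} t)"
        using indicator_box_integrable[of 0 T] by simp
      show "AE t in lborel. (LINT x|lborel. ?f (t, x)) \<le> energy_constant / c * indicat_real {0<..<T} t"
        using slices
      proof eventually_elim
        case (elim t)
        show ?case
        proof (cases "t \<in> {0<..<T}")
          case False
          then have "w (t, x) = 0" for x by (intro w_outside) auto
          then show ?thesis using False by simp
        qed (use elim in simp)
      qed
    qed
    also have "\<dots> = T * (energy_constant / c)" using T by simp
    finally show ?thesis .
  qed
  have uV: "AE z in lborel. z \<in> Q \<longrightarrow> u (fst z) (snd z) = v1 (snd z) + primitive0 w z"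
    using has_time_derivative_primitive[OF T _ ut u0] uH1 unfolding w_def[abs_def] by (simp add: L2_H1_periodic_def)
  have "AE t in lborel. AE x in lborel. (t, x) \<in> Q \<longrightarrow> u t x = v1 x + primitive0 w (t, x)"
    using AE_lborel_pair[OF uV] by simp
  then show "AE t in lborel. t \<in> {0<..<T} \<longrightarrow> (LINT x|lborel. indicator S x * (norm (u t x))\<^sup>2)
    \<le> 2 * (LINT x|lborel. indicator S x * (v1 x)\<^sup>2) + 2 * T\<^sup>2 * energy_constant / c"
  proof eventually_elim
    case (elim t)
    show ?case
    proof
      assume t: "t \<in> {0<..<T}"
      have i: "integrable lborel (\<lambda>x. 2 * (indicator S x * (v1 x)\<^sup>2) + 2 * T * R x)"
        by (intro Bochner_Integration.integrable_add integrable_mult_right v1i Ri)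
      have "(LINT x|lborel. indicator S x * (norm (u t x))\<^sup>2) \<le> (LINT x|lborel. 2 * (indicator S x * (v1 x)\<^sup>2) + 2 * T * R x)"
      proof (rule integral_mono_AE'[OF i])
        show "AE x in lborel. indicator S x * (norm (u t x))\<^sup>2 \<le> 2 * (indicator S x * (v1 x)\<^sup>2) + 2 * T * R x"
          using elim square_integrable_slices[OF w_L2]
        proof eventually_elim
          case (elim x)
          show ?case
          proof (cases "x \<in> S")
            case True
            then have ux: "u t x = v1 x + primitive0 w (t, x)" using elim(1) t S(2) by auto
            have "(primitive0 w (t, x))\<^sup>2 \<le> t * (LINT r|lborel. (w (r, x))\<^sup>2)"
              using primitive0_difference_square[OF elim(2), of 0 t] t by (simp add: primitive0_at_0)
            also have "\<dots> \<le> T * (LINT r|lborel. (w (r, x))\<^sup>2)" using t by (intro mult_right_mono) auto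
            finally have p: "(primitive0 w (t, x))\<^sup>2 \<le> T * R x" using True by (simp add: R_def)
            have "(u t x)\<^sup>2 \<le> 2 * (v1 x)\<^sup>2 + 2 * (primitive0 w (t, x))\<^sup>2"
              unfolding ux using sum_squares_bound[of "v1 x" "primitive0 w (t, x)"] by (simp add: power2_sum)
            then show ?thesis using p True by simp
          next
            case False
            then have "R x = 0" by (simp add: R_def)
            then show ?thesis using False by simp
          qed
        qed
      qed (use T R0 in simp)
      also have "\<dots> = 2 * (LINT x|lborel. indicator S x * (v1 x)\<^sup>2) + 2 * T * (LINT x|lborel. R x)"
        using v1i Ri by simp
      also have "\<dots> \<le> 2 * (LINT x|lborel. indicator S x * (v1 x)\<^sup>2) + 2 * T * (T * (energy_constant / c))"
        using T by (intro add_left_mono mult_left_mono Rle) auto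
      finally show "(LINT x|lborel. indicator S x * (norm (u t x))\<^sup>2)
        \<le> 2 * (LINT x|lborel. indicator S x * (v1 x)\<^sup>2) + 2 * T\<^sup>2 * energy_constant / c"
        by (simp add: power2_eq_square mult.assoc)
    qed
  qed
qed

end

section \<open>Independence of \<epsilon>\<close>

lemma Ck_compact_mono:
  assumes "open S" "S \<subseteq> S'" "Ck_compact k S f" "j \<le> k"
  shows "Ck_compact j S' f"
  using Ck_subset[OF Ck_compact_UNIV[OF assms(1,3)], of S'] Ck_le[of k S' f j] assms by (auto simp: Ck_compact_def)

theorem lemma1:
  fixes l h T \<epsilon>0 \<rho>L \<rho>R DL DR :: real
    and \<rho>M DM :: coefficient
    and v1 v2 :: "real \<times> real \<Rightarrow> real"
    and fL :: "real \<times> real \<times> real \<Rightarrow> real"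
  assumes "0 < l" and "0 < h" and "0 < T" and "0 < \<epsilon>0"
    and "assumption_A1 l h T \<epsilon>0 \<rho>L \<rho>R DL DR \<rho>M DM"
    and "assumption_A2 l h T \<epsilon>0 v1 v2 fL"
    and "assumption_B1 h T \<rho>M DM"
  shows "\<exists>C>0. \<forall>\<epsilon>\<in>eps_range l h \<epsilon>0. \<forall>u ut Gu.
    weak_solution l h T \<rho>L \<rho>R DL DR \<rho>M DM v1 v2 fL \<epsilon> u ut Gu \<longrightarrow>
      scaled_norm l h T \<epsilon> u \<le> ennreal C \<and>
      scaled_norm l h T \<epsilon> ut \<le> ennreal C \<and>
      scaled_norm l h T \<epsilon> Gu \<le> ennreal C"
proof -
  have pos: "0 < DL" "0 < DR" "0 < \<rho>L" "0 < \<rho>R" and W: "W1inf_periodic_coeff h T \<rho>M" "W1inf_periodic_coeff h T DM"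
    and ub: "uniformly_bounded_coeff l h T \<epsilon>0 \<rho>M" "uniformly_bounded_coeff l h T \<epsilon>0 DM"
    using assms(5) by (auto simp: assumption_A1_def)
  have nf: "no_fast_time h T \<rho>M" "no_fast_time h T DM" using assms(7) by (auto simp: assumption_B1_def)
  have cont: "continuous_on (coeff_domain h T) \<rho>M" "continuous_on (coeff_domain h T) DM"
    using W by (auto simp: W1inf_periodic_coeff_def)
  obtain r r' where r: "0 < r" "\<forall>\<epsilon>\<in>eps_range l h \<epsilon>0. \<forall>t\<in>{0<..<T}. \<forall>x\<in>Omega_M h \<epsilon>. r \<le> osc \<epsilon> \<rho>M t x \<and> osc \<epsilon> \<rho>M t x \<le> r'"
    using ub(1) unfolding uniformly_bounded_coeff_def by blast
  obtain d d' where d: "0 < d" "\<forall>\<epsilon>\<in>eps_range l h \<epsilon>0. \<forall>t\<in>{0<..<T}. \<forall>x\<in>Omega_M h \<epsilon>. d \<le> osc \<epsilon> DM t x \<and> osc \<epsilon> DM t x \<le> d'"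
    using ub(2) unfolding uniformly_bounded_coeff_def by blast
  obtain K1 where K1: "0 \<le> K1" "\<forall>s t x2 \<tau> \<tau>' y z. (s, x2, \<tau>, y, z) \<in> coeff_domain h T \<longrightarrow> (t, x2, \<tau>', y, z) \<in> coeff_domain h T \<longrightarrow>
      \<bar>\<rho>M (t, x2, \<tau>', y, z) - \<rho>M (s, x2, \<tau>, y, z)\<bar> \<le> K1 * \<bar>t - s\<bar>"
    using coefficient_Lipschitz_time[OF assms(3) W(1) nf(1)] by blast
  obtain K2 where K2: "0 \<le> K2" "\<forall>s t x2 \<tau> \<tau>' y z. (s, x2, \<tau>, y, z) \<in> coeff_domain h T \<longrightarrow> (t, x2, \<tau>', y, z) \<in> coeff_domain h T \<longrightarrow>
      \<bar>DM (t, x2, \<tau>', y, z) - DM (s, x2, \<tau>, y, z)\<bar> \<le> K2 * \<bar>t - s\<bar>"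
    using coefficient_Lipschitz_time[OF assms(3) W(2) nf(2)] by blast
  \<comment> \<open>A common relative Lipschitz constant of both coefficients: \<open>r\<close> and
    \<open>d\<close> bound them from below in the layer for all admissible \<epsilon>, and
    \<open>K1\<close> and \<open>K2\<close> do not refer to \<epsilon>.\<close>
  define K where "K = K1 / r + K2 / d"
  have K: "0 \<le> K" "K1 / r \<le> K" "K2 / d \<le> K" using K1(1) K2(1) r(1) d(1) by (auto simp: K_def)
  \<comment> \<open>Outside the locale \<open>energy_constant\<close> is applied to its actual
    parameters, and \<epsilon> is not among them: this is the uniformity of the estimate.\<close>
  define E where "E = wave_solution.energy_constant T \<rho>L DL K v1 v2 fL"
  define I0 where "I0 = (LINT x|lborel. (v1 x)\<^sup>2)"
  define C1 where "C1 = sqrt (E / \<rho>L) + sqrt (E / \<rho>R) + sqrt (E / r)"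
  define C2 where "C2 = sqrt (E / DL) + sqrt (E / DR) + sqrt (E / d)"
  \<comment> \<open>The last summand, for the layer, contains no \<open>I0\<close>, because
    \<open>v1\<close> vanishes in the layer; an \<open>I0\<close> there would lack the factor
    \<epsilon>.\<close>
  define C3 where "C3 = sqrt (2 * I0 + 2 * T\<^sup>2 * E / \<rho>L) + sqrt (2 * I0 + 2 * T\<^sup>2 * E / \<rho>R) + sqrt (2 * T\<^sup>2 * E / r)"
  define C where "C = max 1 (max C1 (max C2 C3))"
  have A2: "Ck_compact 2 (Omega_L0 l h) v1" "Ck_compact 1 (Omega_L0 l h) v2" "Ck_compact 2 ({0<..<T} \<times> Omega_L0 l h) fL"
    using assms(6) by (auto simp: assumption_A2_def)
  have L0: "open (Omega_L0 l h)" "Omega_L0 l h \<subseteq> Omega l h"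
    using assms(1) by (auto simp: Omega_L0_def Omega_def open_Times)
  have L0T: "open ({0<..<T} \<times> Omega_L0 l h)" "{0<..<T} \<times> Omega_L0 l h \<subseteq> {0<..<T} \<times> Omega l h"
    using L0 by (auto simp: open_Times)
  have "scaled_norm l h T \<epsilon> u \<le> ennreal C \<and> scaled_norm l h T \<epsilon> ut \<le> ennreal C \<and> scaled_norm l h T \<epsilon> Gu \<le> ennreal C"
    if e: "\<epsilon> \<in> eps_range l h \<epsilon>0" and sol: "weak_solution l h T \<rho>L \<rho>R DL DR \<rho>M DM v1 v2 fL \<epsilon> u ut Gu" for \<epsilon> u ut Gu
  proof -
    have \<epsilon>: "0 < \<epsilon>" "\<epsilon> < 2 * l" using e by (auto simp: eps_range_def)
    define m where "m z = indicat_real ({0<..<T} \<times> Omega l h) z * micro_coeff \<epsilon> \<rho>L \<rho>M \<rho>R (fst z) (snd z)" for z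
    define a where "a z = indicat_real ({0<..<T} \<times> Omega l h) z * micro_coeff \<epsilon> DL DM DR (fst z) (snd z)" for z
    note mp = micro_coeff_props[OF \<epsilon> pos(3,4) r(1) cont(1) r(2)[THEN bspec, OF e] K1, folded m_def]
    note ap = micro_coeff_props[OF \<epsilon> pos(1,2) d(1) cont(2) d(2)[THEN bspec, OF e] K2, folded a_def]
    obtain Mm where Mm: "\<And>z. m z \<le> Mm" using mp(3) by blast
    obtain Ma where Ma: "\<And>z. a z \<le> Ma" using ap(3) by blast
    have sub: "Omega_L l h \<epsilon> \<subseteq> Omega l h" "Omega_R l h \<epsilon> \<subseteq> Omega l h" "Omega_M h \<epsilon> \<subseteq> Omega l h"
      using \<epsilon> by (auto simp: Omega_L_def Omega_R_def Omega_M_def Omega_def)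
    have meas: "Omega_L l h \<epsilon> \<in> sets borel" "Omega_R l h \<epsilon> \<in> sets borel" "Omega_M h \<epsilon> \<in> sets borel"
      by (auto simp: Omega_L_def Omega_R_def Omega_M_def open_Times intro!: borel_open)
    have mv: "\<And>t x. t \<in> {0<..<T} \<Longrightarrow> x \<in> Omega_L l h \<epsilon> \<Longrightarrow> m (t, x) = \<rho>L" "\<And>t x. t \<in> {0<..<T} \<Longrightarrow> x \<in> Omega_R l h \<epsilon> \<Longrightarrow> \<rho>R \<le> m (t, x)"
      "\<And>t x. t \<in> {0<..<T} \<Longrightarrow> x \<in> Omega_M h \<epsilon> \<Longrightarrow> r / \<epsilon> \<le> m (t, x)"
      using sub \<epsilon> r(2)[THEN bspec, OF e] by (auto simp: m_def micro_coeff_def Omega_L_def Omega_R_def Omega_M_def divide_right_mono subset_iff)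
    have av: "\<And>t x. t \<in> {0<..<T} \<Longrightarrow> x \<in> Omega_L l h \<epsilon> \<Longrightarrow> a (t, x) = DL" "\<And>t x. t \<in> {0<..<T} \<Longrightarrow> x \<in> Omega_R l h \<epsilon> \<Longrightarrow> DR \<le> a (t, x)"
      "\<And>t x. t \<in> {0<..<T} \<Longrightarrow> x \<in> Omega_M h \<epsilon> \<Longrightarrow> d / \<epsilon> \<le> a (t, x)"
      using sub \<epsilon> d(2)[THEN bspec, OF e] by (auto simp: a_def micro_coeff_def Omega_L_def Omega_R_def Omega_M_def divide_right_mono subset_iff)
    have su: "supp v1 \<subseteq> Omega_L l h \<epsilon>" "supp v2 \<subseteq> Omega_L l h \<epsilon>" "supp fL \<subseteq> {0<..<T} \<times> Omega_L l h \<epsilon>"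
      using assms(6) e by (auto simp: assumption_A2_def)
    interpret wave_solution l h T \<epsilon> \<rho>L DL K Mm Ma "micro_coeff \<epsilon> \<rho>L \<rho>M \<rho>R" "micro_coeff \<epsilon> DL DM DR" m a v1 v2 fL u ut Gu
    proof
      show "\<bar>m (t + s, x) - m (t, x)\<bar> \<le> K * s * m (t, x)" if "0 < t" "0 < s" "t + s < T" for s t x
      proof -
        have "\<bar>m (t + s, x) - m (t, x)\<bar> \<le> K1 / r * s * m (t, x)" by (rule mp(5)[OF that])
        also have "\<dots> \<le> K * s * m (t, x)" using K(2) that mp(2)[of "(t, x)"] by (intro mult_right_mono) auto
        finally show ?thesis .
      qed
      show "\<bar>a (t + s, x) - a (t, x)\<bar> \<le> K * s * a (t, x)" if "0 < t" "0 < s" "t + s < T" for s t x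
      proof -
        have "\<bar>a (t + s, x) - a (t, x)\<bar> \<le> K2 / d * s * a (t, x)" by (rule ap(5)[OF that])
        also have "\<dots> \<le> K * s * a (t, x)" using K(3) that ap(2)[of "(t, x)"] by (intro mult_right_mono) auto
        finally show ?thesis .
      qed
      show "Ck_compact 2 (Omega l h) v1" by (rule Ck_compact_mono[OF L0 A2(1)]) simp
      show "Ck_compact 1 (Omega l h) v2" by (rule Ck_compact_mono[OF L0 A2(2)]) simp
      show "Ck_compact 0 ({0<..<T} \<times> Omega l h) fL" by (rule Ck_compact_mono[OF L0T A2(3)]) simp
      show "L2_H1_periodic l h T u Gu" "has_time_derivative T (Omega l h) u ut" "has_time_trace T (Omega l h) u 0 v1"
        using sol by (auto simp: weak_solution_def)
      show "- (LINT t:{0<..<T}|lborel. LINT x:Omega l h|lborel. micro_coeff \<epsilon> \<rho>L \<rho>M \<rho>R t x * ut t x * \<phi>t t x)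
        + (LINT t:{0<..<T}|lborel. LINT x:Omega l h|lborel. micro_coeff \<epsilon> DL DM DR t x * (Gu t x \<bullet> G\<phi> t x))
        = (LINT t:{0<..<T}|lborel. LINT x:Omega l h|lborel. fL (t, x) * \<phi> t x)
        + (LINT x:Omega l h|lborel. \<rho>L * v2 x * \<phi>0 x)"
        if "L2_H1_periodic l h T \<phi> G\<phi>" "has_time_derivative T (Omega l h) \<phi> \<phi>t" "has_time_trace T (Omega l h) \<phi> T (\<lambda>x. 0)"
          "has_time_trace T (Omega l h) \<phi> 0 \<phi>0" for \<phi> \<phi>t G\<phi> \<phi>0
        using sol that unfolding weak_solution_def by blast
    qed (fact assms(1,2,3) \<epsilon>(1) pos(1,3) K(1) m_def a_def mp(1,2) ap(1,2) Mm Ma mv(1) av(1) su)+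
    have Ec: "energy_constant = E" by (simp add: E_def)
    note E0 = energy_constant_nonneg[unfolded Ec]
    have mL: "\<rho>L \<le> m (t, x)" if "t \<in> {0<..<T}" "x \<in> Omega_L l h \<epsilon>" for t x using mv(1)[OF that] by simp
    have aL: "DL \<le> a (t, x)" if "t \<in> {0<..<T}" "x \<in> Omega_L l h \<epsilon>" for t x using av(1)[OF that] by simp
    have re: "0 < r / \<epsilon>" "0 < d / \<epsilon>" using r(1) d(1) \<epsilon> by auto
    \<comment> \<open>The lower bounds in the layer are \<open>r / \<epsilon>\<close> and
      \<open>d / \<epsilon>\<close>, so the estimates there gain the factor \<epsilon> that
      \<open>scaled_norm_le\<close> expects.\<close>
    have scale: "c / (r / \<epsilon>) = \<epsilon> * (c / r)" "c / (d / \<epsilon>) = \<epsilon> * (c / d)" for c by simp_all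
    have I0: "(LINT x|lborel. indicator S x * (v1 x)\<^sup>2) \<le> I0" for S
      unfolding I0_def
    proof (rule integral_mono_AE')
      show "integrable lborel (\<lambda>x. (v1 x)\<^sup>2)" using compact_C[OF v1] square_integrableD(3) by blast
    qed (auto simp: indicator_def)
    have VM: "(LINT x|lborel. indicator (Omega_M h \<epsilon>) x * (v1 x)\<^sup>2) = 0"
    proof -
      have "v1 x = 0" if "x \<in> Omega_M h \<epsilon>" for x
      proof (rule ccontr)
        assume "v1 x \<noteq> 0"
        then have "x \<in> Omega_L l h \<epsilon>" using su(1) supp_superset[of v1 x] by blast
        then show False using that by (auto simp: Omega_L_def Omega_M_def)
      qed
      then have e: "indicator (Omega_M h \<epsilon>) x * (v1 x)\<^sup>2 = 0" for x by (auto simp: indicator_def)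
      show ?thesis unfolding e by simp
    qed
    have "scaled_norm l h T \<epsilon> ut \<le> ennreal C1"
      unfolding C1_def
    proof (rule scaled_norm_le[OF \<epsilon>(1)])
      show "LinfL2norm T (Omega_L l h \<epsilon>) ut \<le> ennreal (sqrt (E / \<rho>L))" by (rule velocity_bound[OF meas(1) sub(1) pos(3) mL, unfolded Ec])
      show "LinfL2norm T (Omega_R l h \<epsilon>) ut \<le> ennreal (sqrt (E / \<rho>R))" by (rule velocity_bound[OF meas(2) sub(2) pos(4) mv(2), unfolded Ec])
      show "LinfL2norm T (Omega_M h \<epsilon>) ut \<le> ennreal (sqrt (\<epsilon> * (E / r)))" by (rule velocity_bound[OF meas(3) sub(3) re(1) mv(3), unfolded Ec scale])
    qed (use E0 pos r(1) in auto)
    moreover have "scaled_norm l h T \<epsilon> Gu \<le> ennreal C2"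
      unfolding C2_def
    proof (rule scaled_norm_le[OF \<epsilon>(1)])
      show "LinfL2norm T (Omega_L l h \<epsilon>) Gu \<le> ennreal (sqrt (E / DL))" by (rule gradient_bound[OF meas(1) sub(1) pos(1) aL, unfolded Ec])
      show "LinfL2norm T (Omega_R l h \<epsilon>) Gu \<le> ennreal (sqrt (E / DR))" by (rule gradient_bound[OF meas(2) sub(2) pos(2) av(2), unfolded Ec])
      show "LinfL2norm T (Omega_M h \<epsilon>) Gu \<le> ennreal (sqrt (\<epsilon> * (E / d)))" by (rule gradient_bound[OF meas(3) sub(3) re(2) av(3), unfolded Ec scale])
    qed (use E0 pos d(1) in auto)
    moreover have "scaled_norm l h T \<epsilon> u \<le> ennreal C3"
      unfolding C3_def
    proof (rule scaled_norm_le[OF \<epsilon>(1)])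
      note sb = solution_bound[unfolded Ec]
      have mono: "ennreal (sqrt (2 * (LINT x|lborel. indicator S x * (v1 x)\<^sup>2) + c)) \<le> ennreal (sqrt (2 * I0 + c))" for S c
        using I0[of S] by (intro ennreal_leI) simp
      show "LinfL2norm T (Omega_L l h \<epsilon>) u \<le> ennreal (sqrt (2 * I0 + 2 * T\<^sup>2 * E / \<rho>L))"
        by (rule order_trans[OF sb[OF meas(1) sub(1) pos(3) mL] mono])
      show "LinfL2norm T (Omega_R l h \<epsilon>) u \<le> ennreal (sqrt (2 * I0 + 2 * T\<^sup>2 * E / \<rho>R))"
        by (rule order_trans[OF sb[OF meas(2) sub(2) pos(4) mv(2)] mono])
      show "LinfL2norm T (Omega_M h \<epsilon>) u \<le> ennreal (sqrt (\<epsilon> * (2 * T\<^sup>2 * E / r)))"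
        using sb[OF meas(3) sub(3) re(1)] mv(3) unfolding VM scale by simp
    qed (use E0 pos r(1) I0_def in auto)
    moreover have "ennreal C1 \<le> ennreal C" "ennreal C2 \<le> ennreal C" "ennreal C3 \<le> ennreal C"
      unfolding C_def by (auto intro!: ennreal_leI)
    ultimately show ?thesis by (meson order_trans)
  qed
  moreover have "0 < C" unfolding C_def by simp
  ultimately show ?thesis by blast
qed

end
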